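(* Let $(M,g)$ be a connected quaternionic-Kähler manifold of dimension $4n\geq 8$, with reduced scalar curvature $\nu$ and quaternionic-Weyl tensor $W^{Q}$. Define a connection $\mathcal D$ on the vector bundle $S^{2}H\oplus S^{2}E\oplus TM$ by \begin{align*} \mathcal D_{Z}(\psi,X)^{S^{2}E\oplus S^{2}H} &=\nabla_{Z}\psi-\frac{1}{4n-1}\Big( X\wedge Z+\sum_{i=1}^{3}J_{i}X\wedge J_{i}Z-\sum_{i=1}^{3}\omega_{i}(X,Z)\,\omega_{i}\Big),\\ \mathcal D_{Z}(\psi,X)^{TM} &=\nabla_{Z}X-\frac{4n-1}{4}\, i_{Z}\Big(\nu\,\psi^{S^{2}E}-2\nu\,\psi^{S^{2}H}+\frac{1}{n+1}W^{Q}(\psi)\Big), \end{align*} where $\{J_{1},J_{2},J_{3}\}$ is a local admissible basis of the quaternionic bundle $Q$, with Kähler forms $\omega_{1},\omega_{2},\omega_{3}$, $\psi$ is a section of $S^{2}H\oplus S^{2}E$ and $X,Z$ are vector fields on $M$. Then $\mathcal D$ is a prolongation of the conformal-Killing operator acting on compatible $2$-forms. Moreover, $\mathcal D$ is flat if and only if $W^{Q}=0$.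
   Context: A quaternionic-Kähler manifold is a Riemannian manifold $(M,g)$ of dimension $4n\geq 8$ with holonomy group included in $\mathrm{Sp}(1)\mathrm{Sp}(n)$; equivalently, there is a rank three sub-bundle $Q\subset \mathrm{End}(TM)$, preserved by the Levi-Civita connection $\nabla$ of $g$, locally generated by three anti-commuting $g$-orthogonal almost complex structures $J_1,J_2,J_3$ with $J_3=J_1J_2$ (a local admissible basis of $Q$), with Kähler forms $\omega_i:=g(J_i\cdot,\cdot)$. Tangent vectors are identified with $1$-forms using $g$, and a $2$-form $\psi$ is identified with the skew endomorphism $Y\mapsto \psi(Y)=i_Y\psi$ of $TM$; so $(X\wedge Y)(Z)=g(X,Z)Y-g(Y,Z)X$ and $\omega_i$ corresponds to $J_i$. Forms $i_Z\psi$ are regarded as vectors. $g$ is Einstein; its reduced scalar curvature is $\nu:=\frac{k}{4n(n+2)}$, where $k$ is the scalar curvature. With $R^g_{X,Y}=[\nabla_X,\nabla_Y]-\nabla_{[X,Y]}$, the curvature has the form $$R^{g}_{X,Y}=-\frac{\nu}{4}\Big( X\wedge Y+\sum_{i=1}^{3}J_{i}X\wedge J_{i}Y+2\sum_{i=1}^{3}\omega_{i}(X,Y)\omega_{i}\Big)+W^{Q}_{X,Y},$$ which defines the quaternionic-Weyl tensor $W^Q$. It satisfies $W^Q_{J_iX,J_iY}=W^Q_{X,Y}$, is trace-free (Ricci-flat), and is viewed also as the symmetric endomorphism of $\Lambda^2(M)$ determined by $W^Q(X\wedge Y)=W^Q_{X,Y}$, i.e. $W^Q(\psi)=\frac12\sum_k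 W^Q_{e_k,\psi(e_k)}$ for a local orthonormal frame $\{e_k\}$. As real bundles, $S^2H\subset\Lambda^2(M)$ is the bundle spanned locally by $\omega_1,\omega_2,\omega_3$ (i.e. $Q$), and $S^2E\subset\Lambda^2(M)$ is the bundle of $2$-forms $\psi$ with $\psi(J_i\cdot,J_i\cdot)=\psi$ for $i=1,2,3$. The projections of $\psi$ are $\psi^{S^2H}=\frac1{4n}\sum_{i,k}\psi(e_k,J_ie_k)\omega_i$ and $\psi^{S^2E}=\frac14\big(\psi+\sum_{i=1}^3\psi(J_i\cdot,J_i\cdot)\big)$. A $2$-form is compatible if it is a section of $S^2H\oplus S^2E$. A $2$-form $\psi$ on $(M,g)$ is conformal-Killing if $\nabla_Y\psi=\frac13 i_Yd\psi-\frac{1}{4n-1}Y\wedge\delta\psi$ for all $Y\in TM$, where $\delta\psi=-\sum_k i_{e_k}\nabla_{e_k}\psi$ is the codifferential. The conformal-Killing operator is the first order differential operator whose kernel is given by this equation; $\mathcal C_2(M)$ denotes the vector space of compatible conformal-Killing $2$-forms. A prolongation of a linear differential operator $D$ is a connection on a vector bundle whose space of parallel sections is isomorphic to the kernel of $D$ (here, to $\mathcal C_2(M)$). *)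

theory Defs
  imports "HOL-Analysis.Analysis"
begin

section \<open>Smooth functions on open subsets of a Euclidean space\<close>

fun Ck_on :: "nat \<Rightarrow> 'e::euclidean_space set \<Rightarrow> ('e \<Rightarrow> 'b::real_normed_vector) \<Rightarrow> bool" where
  "Ck_on 0 S f \<longleftrightarrow> continuous_on S f"
| "Ck_on (Suc k) S f \<longleftrightarrow> (\<forall>x\<in>S. f differentiable (at x))
     \<and> (\<forall>v. Ck_on k S (\<lambda>x. frechet_derivative f (at x) v))"

definition Cinf_on :: "'e::euclidean_space set \<Rightarrow> ('e \<Rightarrow> 'b::real_normed_vector) \<Rightarrow> bool" where
  "Cinf_on S f \<longleftrightarrow> (\<forall>k. Ck_on k S f)"


section \<open>Smooth manifolds and tensor fields\<close>

text \<open>The manifold is a whole topological type; a chart is a domain together with a coordinate map.\<close>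

type_synonym ('a, 'e) chart = "'a set \<times> ('a \<Rightarrow> 'e)"

definition chart_inv :: "('a, 'e) chart \<Rightarrow> 'e \<Rightarrow> 'a" where
  "chart_inv c = inv_into (fst c) (snd c)"

definition smooth_atlas ::
  "('a::{t2_space,second_countable_topology}, 'e::euclidean_space) chart set \<Rightarrow> bool" where
  "smooth_atlas A \<longleftrightarrow>
     (\<Union>c\<in>A. fst c) = UNIV
   \<and> (\<forall>c\<in>A. open (fst c) \<and> open (snd c ` fst c)
        \<and> homeomorphism (fst c) (snd c ` fst c) (snd c) (chart_inv c))
   \<and> (\<forall>c\<in>A. \<forall>d\<in>A. Cinf_on (snd c ` (fst c \<inter> fst d)) (\<lambda>x. snd d (chart_inv c x)))"

text \<open>The tangent space at \<open>p\<close> is the model space \<open>'e\<close>, a tangent vector being given by its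
  components in one fixed chart around \<open>p\<close>, the base chart of \<open>p\<close>. Thus a vector field is a
  function \<open>'a \<Rightarrow> 'e\<close>, a 2-tensor field a function \<open>'a \<Rightarrow> 'e \<Rightarrow> 'e \<Rightarrow> real\<close>, and a field of
  endomorphisms a function \<open>'a \<Rightarrow> 'e \<Rightarrow> 'e\<close>. The base chart may jump from point to point, so
  smoothness and derivatives always refer to the components in one and the same chart, which are
  obtained with the differentials of the coordinate changes.\<close>

definition base_chart :: "('a, 'e) chart set \<Rightarrow> 'a \<Rightarrow> ('a, 'e) chart" where
  "base_chart A p = (SOME c. c \<in> A \<and> p \<in> fst c)"

definition base_pt :: "('a, 'e) chart set \<Rightarrow> 'a \<Rightarrow> 'e" where
  "base_pt A p = snd (base_chart A p) p"

definition to_chart ::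
  "('a, 'e::euclidean_space) chart set \<Rightarrow> ('a, 'e) chart \<Rightarrow> 'a \<Rightarrow> 'e \<Rightarrow> 'e" where
  "to_chart A c p = frechet_derivative (\<lambda>x. snd c (chart_inv (base_chart A p) x)) (at (base_pt A p))"

definition from_chart ::
  "('a, 'e::euclidean_space) chart set \<Rightarrow> ('a, 'e) chart \<Rightarrow> 'a \<Rightarrow> 'e \<Rightarrow> 'e" where
  "from_chart A c p = frechet_derivative (\<lambda>x. snd (base_chart A p) (chart_inv c x)) (at (snd c p))"

definition fun_rep :: "('a, 'e) chart \<Rightarrow> ('a \<Rightarrow> real) \<Rightarrow> 'e \<Rightarrow> real" where
  "fun_rep c f x = f (chart_inv c x)"

definition vec_rep ::
  "('a, 'e::euclidean_space) chart set \<Rightarrow> ('a, 'e) chart \<Rightarrow> ('a \<Rightarrow> 'e) \<Rightarrow> 'e \<Rightarrow> 'e" where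
  "vec_rep A c X x = (let p = chart_inv c x in to_chart A c p (X p))"

definition end_rep ::
  "('a, 'e::euclidean_space) chart set \<Rightarrow> ('a, 'e) chart \<Rightarrow> ('a \<Rightarrow> 'e \<Rightarrow> 'e) \<Rightarrow> 'e \<Rightarrow> 'e \<Rightarrow> 'e" where
  "end_rep A c J u x = (let p = chart_inv c x in to_chart A c p (J p (from_chart A c p u)))"

definition form_rep ::
  "('a, 'e::euclidean_space) chart set \<Rightarrow> ('a, 'e) chart \<Rightarrow> ('a \<Rightarrow> 'e \<Rightarrow> 'e \<Rightarrow> real)
     \<Rightarrow> 'e \<Rightarrow> 'e \<Rightarrow> 'e \<Rightarrow> real" where
  "form_rep A c \<psi> u v x =
     (let p = chart_inv c x in \<psi> p (from_chart A c p u) (from_chart A c p v))"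

definition smooth_fun ::
  "('a, 'e::euclidean_space) chart set \<Rightarrow> 'a set \<Rightarrow> ('a \<Rightarrow> real) \<Rightarrow> bool" where
  "smooth_fun A U f \<longleftrightarrow> (\<forall>c\<in>A. Cinf_on (snd c ` (fst c \<inter> U)) (fun_rep c f))"

definition smooth_vec ::
  "('a, 'e::euclidean_space) chart set \<Rightarrow> 'a set \<Rightarrow> ('a \<Rightarrow> 'e) \<Rightarrow> bool" where
  "smooth_vec A U X \<longleftrightarrow> (\<forall>c\<in>A. Cinf_on (snd c ` (fst c \<inter> U)) (vec_rep A c X))"

definition smooth_end ::
  "('a, 'e::euclidean_space) chart set \<Rightarrow> 'a set \<Rightarrow> ('a \<Rightarrow> 'e \<Rightarrow> 'e) \<Rightarrow> bool" where
  "smooth_end A U J \<longleftrightarrow> (\<forall>c\<in>A. \<forall>u. Cinf_on (snd c ` (fst c \<inter> U)) (end_rep A c J u))"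

definition smooth_form ::
  "('a, 'e::euclidean_space) chart set \<Rightarrow> 'a set \<Rightarrow> ('a \<Rightarrow> 'e \<Rightarrow> 'e \<Rightarrow> real) \<Rightarrow> bool" where
  "smooth_form A U \<psi> \<longleftrightarrow> (\<forall>c\<in>A. \<forall>u v. Cinf_on (snd c ` (fst c \<inter> U)) (form_rep A c \<psi> u v))"

text \<open>Derivatives at \<open>p\<close> of components in the base chart of \<open>p\<close>; there \<open>to_chart\<close> and \<open>from_chart\<close>
  are the identity at \<open>p\<close> itself.\<close>

definition d_fun :: "('a, 'e::euclidean_space) chart set \<Rightarrow> 'a \<Rightarrow> 'e \<Rightarrow> ('a \<Rightarrow> real) \<Rightarrow> real" where
  "d_fun A p w f = frechet_derivative (fun_rep (base_chart A p) f) (at (base_pt A p)) w"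

definition d_vec :: "('a, 'e::euclidean_space) chart set \<Rightarrow> 'a \<Rightarrow> 'e \<Rightarrow> ('a \<Rightarrow> 'e) \<Rightarrow> 'e" where
  "d_vec A p w X = frechet_derivative (vec_rep A (base_chart A p) X) (at (base_pt A p)) w"

definition d_end :: "('a, 'e::euclidean_space) chart set \<Rightarrow> 'a \<Rightarrow> 'e \<Rightarrow> ('a \<Rightarrow> 'e \<Rightarrow> 'e) \<Rightarrow> 'e \<Rightarrow> 'e" where
  "d_end A p w J u = frechet_derivative (end_rep A (base_chart A p) J u) (at (base_pt A p)) w"

definition d_form ::
  "('a, 'e::euclidean_space) chart set \<Rightarrow> 'a \<Rightarrow> 'e \<Rightarrow> ('a \<Rightarrow> 'e \<Rightarrow> 'e \<Rightarrow> real) \<Rightarrow> 'e \<Rightarrow> 'e \<Rightarrow> real" where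
  "d_form A p w \<psi> u v =
     frechet_derivative (form_rep A (base_chart A p) \<psi> u v) (at (base_pt A p)) w"

definition lie_bracket ::
  "('a, 'e::euclidean_space) chart set \<Rightarrow> ('a \<Rightarrow> 'e) \<Rightarrow> ('a \<Rightarrow> 'e) \<Rightarrow> 'a \<Rightarrow> 'e" where
  "lie_bracket A X Y p = d_vec A p (X p) Y - d_vec A p (Y p) X"

text \<open>Exterior derivative of a 2-form, normalized by
  \<open>d\<psi>(U,V,W) = U(\<psi>(V,W)) - V(\<psi>(U,W)) + W(\<psi>(U,V))\<close> for commuting fields.\<close>

definition ext_deriv ::
  "('a, 'e::euclidean_space) chart set \<Rightarrow> ('a \<Rightarrow> 'e \<Rightarrow> 'e \<Rightarrow> real) \<Rightarrow> 'a \<Rightarrow> 'e \<Rightarrow> 'e \<Rightarrow> 'e \<Rightarrow> real" where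
  "ext_deriv A \<psi> p u v w = d_form A p u \<psi> v w - d_form A p v \<psi> u w + d_form A p w \<psi> u v"


section \<open>Linear algebra in a tangent space with inner product \<open>h\<close>\<close>

definition sharp :: "('e \<Rightarrow> 'e \<Rightarrow> real) \<Rightarrow> ('e \<Rightarrow> real) \<Rightarrow> 'e" where
  "sharp h \<alpha> = (THE w. \<forall>z. h w z = \<alpha> z)"

definition orthonormal_frame :: "('e::euclidean_space \<Rightarrow> 'e \<Rightarrow> real) \<Rightarrow> ('e \<Rightarrow> 'e) \<Rightarrow> bool" where
  "orthonormal_frame h e \<longleftrightarrow>
     (\<forall>a\<in>Basis. \<forall>b\<in>Basis. h (e a) (e b) = (if a = b then 1 else 0))"

definition frame :: "('e::euclidean_space \<Rightarrow> 'e \<Rightarrow> real) \<Rightarrow> 'e \<Rightarrow> 'e" where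
  "frame h = (SOME e. orthonormal_frame h e)"

text \<open>\<open>X \<and> Y\<close> as an endomorphism and as the corresponding 2-form.\<close>

definition wedge_end :: "('e::euclidean_space \<Rightarrow> 'e \<Rightarrow> real) \<Rightarrow> 'e \<Rightarrow> 'e \<Rightarrow> 'e \<Rightarrow> 'e" where
  "wedge_end h X Y Z = h X Z *\<^sub>R Y - h Y Z *\<^sub>R X"

definition wedge :: "('e::euclidean_space \<Rightarrow> 'e \<Rightarrow> real) \<Rightarrow> 'e \<Rightarrow> 'e \<Rightarrow> 'e \<Rightarrow> 'e \<Rightarrow> real" where
  "wedge h X Y u v = h (wedge_end h X Y u) v"

definition kaehler_form :: "('e \<Rightarrow> 'e \<Rightarrow> real) \<Rightarrow> ('e \<Rightarrow> 'e) \<Rightarrow> 'e \<Rightarrow> 'e \<Rightarrow> real" where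
  "kaehler_form h J u v = h (J u) v"

text \<open>\<open>admissible h q J\<close>: the triple \<open>J 1, J 2, J 3\<close> is an admissible basis of the space \<open>q\<close> of
  endomorphisms.\<close>

definition admissible ::
  "('e::euclidean_space \<Rightarrow> 'e \<Rightarrow> real) \<Rightarrow> ('e \<Rightarrow> 'e) set \<Rightarrow> (nat \<Rightarrow> 'e \<Rightarrow> 'e) \<Rightarrow> bool" where
  "admissible h q J \<longleftrightarrow>
     (\<forall>i\<in>{1..3}. linear (J i) \<and> (\<forall>v. J i (J i v) = - v) \<and> (\<forall>u v. h (J i u) (J i v) = h u v))
   \<and> (\<forall>i\<in>{1..3}. \<forall>j\<in>{1..3}. i \<noteq> j \<longrightarrow> (\<forall>v. J i (J j v) = - J j (J i v)))
   \<and> (\<forall>v. J 3 v = J 1 (J 2 v))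
   \<and> q = {(\<lambda>v. \<Sum>i=1..3. a i *\<^sub>R J i v) | a :: nat \<Rightarrow> real. True}"

text \<open>All expressions in which \<open>adm_basis\<close> is used below are tensorial in the admissible basis and
  do not depend on its choice (two such bases differ by an element of \<open>SO(3)\<close>).\<close>

definition adm_basis ::
  "('e::euclidean_space \<Rightarrow> 'e \<Rightarrow> real) \<Rightarrow> ('e \<Rightarrow> 'e) set \<Rightarrow> nat \<Rightarrow> 'e \<Rightarrow> 'e" where
  "adm_basis h q = (SOME J. admissible h q J)"

definition S2H :: "('e::euclidean_space \<Rightarrow> 'e \<Rightarrow> real) \<Rightarrow> ('e \<Rightarrow> 'e) set \<Rightarrow> ('e \<Rightarrow> 'e \<Rightarrow> real) set" where
  "S2H h q = kaehler_form h ` q"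

definition S2E :: "('e::euclidean_space \<Rightarrow> 'e \<Rightarrow> real) \<Rightarrow> ('e \<Rightarrow> 'e) set \<Rightarrow> ('e \<Rightarrow> 'e \<Rightarrow> real) set" where
  "S2E h q = {\<psi>. bilinear \<psi> \<and> (\<forall>u v. \<psi> u v = - \<psi> v u)
     \<and> (\<forall>J. admissible h q J \<longrightarrow> (\<forall>i\<in>{1..3}. \<forall>u v. \<psi> (J i u) (J i v) = \<psi> u v))}"

definition compatible ::
  "('e::euclidean_space \<Rightarrow> 'e \<Rightarrow> real) \<Rightarrow> ('e \<Rightarrow> 'e) set \<Rightarrow> ('e \<Rightarrow> 'e \<Rightarrow> real) set" where
  "compatible h q = {(\<lambda>u v. \<alpha> u v + \<beta> u v) | \<alpha> \<beta>. \<alpha> \<in> S2H h q \<and> \<beta> \<in> S2E h q}"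

definition proj_S2H ::
  "('e::euclidean_space \<Rightarrow> 'e \<Rightarrow> real) \<Rightarrow> ('e \<Rightarrow> 'e) set \<Rightarrow> ('e \<Rightarrow> 'e \<Rightarrow> real) \<Rightarrow> 'e \<Rightarrow> 'e \<Rightarrow> real" where
  "proj_S2H h q \<psi> u v = (let J = adm_basis h q; e = frame h in
     1 / real DIM('e) * (\<Sum>i=1..3. \<Sum>b\<in>Basis. \<psi> (e b) (J i (e b)) * kaehler_form h (J i) u v))"

definition proj_S2E ::
  "('e::euclidean_space \<Rightarrow> 'e \<Rightarrow> real) \<Rightarrow> ('e \<Rightarrow> 'e) set \<Rightarrow> ('e \<Rightarrow> 'e \<Rightarrow> real) \<Rightarrow> 'e \<Rightarrow> 'e \<Rightarrow> real" where
  "proj_S2E h q \<psi> u v = (let J = adm_basis h q in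
     1 / 4 * (\<psi> u v + (\<Sum>i=1..3. \<psi> (J i u) (J i v))))"


section \<open>Riemannian geometry\<close>

definition riemannian_metric ::
  "('a, 'e::euclidean_space) chart set \<Rightarrow> ('a \<Rightarrow> 'e \<Rightarrow> 'e \<Rightarrow> real) \<Rightarrow> bool" where
  "riemannian_metric A g \<longleftrightarrow> smooth_form A UNIV g
     \<and> (\<forall>p. bilinear (g p) \<and> (\<forall>u v. g p u v = g p v u) \<and> (\<forall>v. v \<noteq> 0 \<longrightarrow> g p v v > 0))"

text \<open>Levi-Civita connection. \<open>christoffel A g p u v\<close> is \<open>\<nabla>\<^sub>U V\<close> at \<open>p\<close> for the coordinate fields
  \<open>U, V\<close> (constant components in the base chart of \<open>p\<close>) through \<open>u, v\<close>, as given by the Koszul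
  formula, in which the brackets of coordinate fields vanish.\<close>

definition christoffel ::
  "('a, 'e::euclidean_space) chart set \<Rightarrow> ('a \<Rightarrow> 'e \<Rightarrow> 'e \<Rightarrow> real) \<Rightarrow> 'a \<Rightarrow> 'e \<Rightarrow> 'e \<Rightarrow> 'e" where
  "christoffel A g p u v =
     sharp (g p) (\<lambda>z. 1 / 2 * (d_form A p u g v z + d_form A p v g u z - d_form A p z g u v))"

definition nabla_vec ::
  "('a, 'e::euclidean_space) chart set \<Rightarrow> ('a \<Rightarrow> 'e \<Rightarrow> 'e \<Rightarrow> real) \<Rightarrow> 'a \<Rightarrow> 'e \<Rightarrow> ('a \<Rightarrow> 'e) \<Rightarrow> 'e" where
  "nabla_vec A g p w X = d_vec A p w X + christoffel A g p w (X p)"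

definition nabla_end ::
  "('a, 'e::euclidean_space) chart set \<Rightarrow> ('a \<Rightarrow> 'e \<Rightarrow> 'e \<Rightarrow> real) \<Rightarrow> 'a \<Rightarrow> 'e
     \<Rightarrow> ('a \<Rightarrow> 'e \<Rightarrow> 'e) \<Rightarrow> 'e \<Rightarrow> 'e" where
  "nabla_end A g p w J u =
     d_end A p w J u + christoffel A g p w (J p u) - J p (christoffel A g p w u)"

definition nabla_form ::
  "('a, 'e::euclidean_space) chart set \<Rightarrow> ('a \<Rightarrow> 'e \<Rightarrow> 'e \<Rightarrow> real) \<Rightarrow> 'a \<Rightarrow> 'e
     \<Rightarrow> ('a \<Rightarrow> 'e \<Rightarrow> 'e \<Rightarrow> real) \<Rightarrow> 'e \<Rightarrow> 'e \<Rightarrow> real" where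
  "nabla_form A g p w \<psi> u v =
     d_form A p w \<psi> u v - \<psi> p (christoffel A g p w u) v - \<psi> p u (christoffel A g p w v)"

definition curv_op ::
  "('a, 'e::euclidean_space) chart set \<Rightarrow> ('a \<Rightarrow> 'e \<Rightarrow> 'e \<Rightarrow> real)
     \<Rightarrow> ('a \<Rightarrow> 'e) \<Rightarrow> ('a \<Rightarrow> 'e) \<Rightarrow> ('a \<Rightarrow> 'e) \<Rightarrow> 'a \<Rightarrow> 'e" where
  "curv_op A g X Y Z p =
     nabla_vec A g p (X p) (\<lambda>q. nabla_vec A g q (Y q) Z)
   - nabla_vec A g p (Y p) (\<lambda>q. nabla_vec A g q (X q) Z)
   - nabla_vec A g p (lie_bracket A X Y p) Z"

text \<open>The curvature tensor at \<open>p\<close> is computed with the extensions of the three vectors to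
  coordinate fields.\<close>

definition coord_field ::
  "('a, 'e::euclidean_space) chart set \<Rightarrow> 'a \<Rightarrow> 'e \<Rightarrow> 'a \<Rightarrow> 'e" where
  "coord_field A p u q = from_chart A (base_chart A p) q u"

definition curv ::
  "('a, 'e::euclidean_space) chart set \<Rightarrow> ('a \<Rightarrow> 'e \<Rightarrow> 'e \<Rightarrow> real) \<Rightarrow> 'a \<Rightarrow> 'e \<Rightarrow> 'e \<Rightarrow> 'e \<Rightarrow> 'e" where
  "curv A g p u v w = curv_op A g (coord_field A p u) (coord_field A p v) (coord_field A p w) p"

definition ricci ::
  "('a, 'e::euclidean_space) chart set \<Rightarrow> ('a \<Rightarrow> 'e \<Rightarrow> 'e \<Rightarrow> real) \<Rightarrow> 'a \<Rightarrow> 'e \<Rightarrow> 'e \<Rightarrow> real" where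
  "ricci A g p v w = (let e = frame (g p) in \<Sum>b\<in>Basis. g p (curv A g p (e b) v w) (e b))"

definition scalar_curv ::
  "('a, 'e::euclidean_space) chart set \<Rightarrow> ('a \<Rightarrow> 'e \<Rightarrow> 'e \<Rightarrow> real) \<Rightarrow> 'a \<Rightarrow> real" where
  "scalar_curv A g p = (let e = frame (g p) in \<Sum>b\<in>Basis. ricci A g p (e b) (e b))"

definition codiff ::
  "('a, 'e::euclidean_space) chart set \<Rightarrow> ('a \<Rightarrow> 'e \<Rightarrow> 'e \<Rightarrow> real)
     \<Rightarrow> ('a \<Rightarrow> 'e \<Rightarrow> 'e \<Rightarrow> real) \<Rightarrow> 'a \<Rightarrow> 'e" where
  "codiff A g \<psi> p = (let e = frame (g p) in
     sharp (g p) (\<lambda>v. - (\<Sum>b\<in>Basis. nabla_form A g p (e b) \<psi> (e b) v)))"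

definition conformal_killing ::
  "('a, 'e::euclidean_space) chart set \<Rightarrow> ('a \<Rightarrow> 'e \<Rightarrow> 'e \<Rightarrow> real)
     \<Rightarrow> ('a \<Rightarrow> 'e \<Rightarrow> 'e \<Rightarrow> real) \<Rightarrow> bool" where
  "conformal_killing A g \<psi> \<longleftrightarrow> (\<forall>p Y u v.
     nabla_form A g p Y \<psi> u v =
       1 / 3 * ext_deriv A \<psi> p Y u v - 1 / (real DIM('e) - 1) * wedge (g p) Y (codiff A g \<psi> p) u v)"


section \<open>Quaternionic-Kaehler manifolds\<close>

definition quaternionic_kaehler ::
  "('a::{t2_space,second_countable_topology}, 'e::euclidean_space) chart set
     \<Rightarrow> ('a \<Rightarrow> 'e \<Rightarrow> 'e \<Rightarrow> real) \<Rightarrow> ('a \<Rightarrow> ('e \<Rightarrow> 'e) set) \<Rightarrow> nat \<Rightarrow> bool" where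
  "quaternionic_kaehler A g Q n \<longleftrightarrow>
     smooth_atlas A \<and> n \<ge> 2 \<and> DIM('e) = 4 * n \<and> riemannian_metric A g
   \<and> (\<forall>p. \<exists>U J. open U \<and> p \<in> U \<and> (\<forall>i\<in>{1..3}. smooth_end A U (J i))
        \<and> (\<forall>q\<in>U. admissible (g q) (Q q) (\<lambda>i. J i q)))
   \<and> (\<forall>U B. open U \<and> smooth_end A U B \<and> (\<forall>q\<in>U. B q \<in> Q q) \<longrightarrow>
        (\<forall>q\<in>U. \<forall>w. nabla_end A g q w B \<in> Q q))"

definition reduced_scalar_curv ::
  "('a, 'e::euclidean_space) chart set \<Rightarrow> ('a \<Rightarrow> 'e \<Rightarrow> 'e \<Rightarrow> real) \<Rightarrow> nat \<Rightarrow> 'a \<Rightarrow> real" where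
  "reduced_scalar_curv A g n p = scalar_curv A g p / (4 * real n * (real n + 2))"

definition quat_weyl ::
  "('a, 'e::euclidean_space) chart set \<Rightarrow> ('a \<Rightarrow> 'e \<Rightarrow> 'e \<Rightarrow> real) \<Rightarrow> ('a \<Rightarrow> ('e \<Rightarrow> 'e) set) \<Rightarrow> nat
     \<Rightarrow> 'a \<Rightarrow> 'e \<Rightarrow> 'e \<Rightarrow> 'e \<Rightarrow> 'e" where
  "quat_weyl A g Q n p X Y Z = (let J = adm_basis (g p) (Q p) in
     curv A g p X Y Z + (reduced_scalar_curv A g n p / 4) *\<^sub>R
       (wedge_end (g p) X Y Z + (\<Sum>i=1..3. wedge_end (g p) (J i X) (J i Y) Z)
        + 2 *\<^sub>R (\<Sum>i=1..3. kaehler_form (g p) (J i) X Y *\<^sub>R J i Z)))"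

text \<open>The action \<open>W\<^sup>Q(\<psi>) = 1/2 \<Sum>\<^sub>k W\<^sup>Q(e\<^sub>k, \<psi>(e\<^sub>k))\<close> on 2-forms, with values in 2-forms.\<close>

definition quat_weyl_form ::
  "('a, 'e::euclidean_space) chart set \<Rightarrow> ('a \<Rightarrow> 'e \<Rightarrow> 'e \<Rightarrow> real) \<Rightarrow> ('a \<Rightarrow> ('e \<Rightarrow> 'e) set) \<Rightarrow> nat
     \<Rightarrow> 'a \<Rightarrow> ('e \<Rightarrow> 'e \<Rightarrow> real) \<Rightarrow> 'e \<Rightarrow> 'e \<Rightarrow> real" where
  "quat_weyl_form A g Q n p \<psi> u v = (let e = frame (g p) in
     1 / 2 * (\<Sum>b\<in>Basis. g p (quat_weyl A g Q n p (e b) (sharp (g p) (\<psi> (e b))) u) v))"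

definition compatible_conformal_killing ::
  "('a, 'e::euclidean_space) chart set \<Rightarrow> ('a \<Rightarrow> 'e \<Rightarrow> 'e \<Rightarrow> real) \<Rightarrow> ('a \<Rightarrow> ('e \<Rightarrow> 'e) set)
     \<Rightarrow> ('a \<Rightarrow> 'e \<Rightarrow> 'e \<Rightarrow> real) set" where
  "compatible_conformal_killing A g Q =
     {\<psi>. smooth_form A UNIV \<psi> \<and> (\<forall>p. \<psi> p \<in> compatible (g p) (Q p)) \<and> conformal_killing A g \<psi>}"


section \<open>Connections on bundles of pairs consisting of a 2-form and a vector\<close>

type_synonym ('a, 'e) section_pair = "('a \<Rightarrow> 'e \<Rightarrow> 'e \<Rightarrow> real) \<times> ('a \<Rightarrow> 'e)"

definition sec_zero :: "('a, 'e::euclidean_space) section_pair" where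
  "sec_zero = ((\<lambda>p u v. 0), (\<lambda>p. 0))"

definition sec_add ::
  "('a, 'e::euclidean_space) section_pair \<Rightarrow> ('a, 'e) section_pair \<Rightarrow> ('a, 'e) section_pair" where
  "sec_add s t = ((\<lambda>p u v. fst s p u v + fst t p u v), (\<lambda>p. snd s p + snd t p))"

definition sec_scale ::
  "('a \<Rightarrow> real) \<Rightarrow> ('a, 'e::euclidean_space) section_pair \<Rightarrow> ('a, 'e) section_pair" where
  "sec_scale f s = ((\<lambda>p u v. f p * fst s p u v), (\<lambda>p. f p *\<^sub>R snd s p))"

definition sec_eq_on ::
  "'a set \<Rightarrow> ('a, 'e::euclidean_space) section_pair \<Rightarrow> ('a, 'e) section_pair \<Rightarrow> bool" where
  "sec_eq_on U s t \<longleftrightarrow> (\<forall>p\<in>U. fst s p = fst t p \<and> snd s p = snd t p)"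

text \<open>In the following, \<open>S U\<close> is the space of smooth sections of the bundle over the open set \<open>U\<close>.
  Sections and vector fields over \<open>U\<close> are total functions whose values outside \<open>U\<close> are irrelevant,
  which is what the first clause of \<open>connection\<close> expresses.\<close>

definition connection ::
  "('a::topological_space, 'e::euclidean_space) chart set \<Rightarrow> ('a set \<Rightarrow> ('a, 'e) section_pair set)
     \<Rightarrow> (('a \<Rightarrow> 'e) \<Rightarrow> ('a, 'e) section_pair \<Rightarrow> ('a, 'e) section_pair) \<Rightarrow> bool" where
  "connection A S D \<longleftrightarrow> (\<forall>U. open U \<longrightarrow>
     (\<forall>Y Z. \<forall>s\<in>S U. \<forall>t\<in>S U. smooth_vec A U Y \<longrightarrow> smooth_vec A U Z
        \<longrightarrow> (\<forall>p\<in>U. Y p = Z p) \<longrightarrow> sec_eq_on U s t \<longrightarrow> sec_eq_on U (D Y s) (D Z t))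
   \<and> (\<forall>Z. \<forall>s\<in>S U. smooth_vec A U Z \<longrightarrow> D Z s \<in> S U)
   \<and> (\<forall>Y Z f. \<forall>s\<in>S U. smooth_vec A U Y \<longrightarrow> smooth_vec A U Z \<longrightarrow> smooth_fun A U f \<longrightarrow>
        sec_eq_on U (D (\<lambda>p. f p *\<^sub>R Y p + Z p) s) (sec_add (sec_scale f (D Y s)) (D Z s)))
   \<and> (\<forall>Z. \<forall>s\<in>S U. \<forall>t\<in>S U. smooth_vec A U Z \<longrightarrow>
        sec_eq_on U (D Z (sec_add s t)) (sec_add (D Z s) (D Z t)))
   \<and> (\<forall>Z f. \<forall>s\<in>S U. smooth_vec A U Z \<longrightarrow> smooth_fun A U f \<longrightarrow>
        sec_eq_on U (D Z (sec_scale f s))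
          (sec_add (sec_scale f (D Z s)) (sec_scale (\<lambda>p. d_fun A p (Z p) f) s))))"

definition parallel_sections ::
  "('a::topological_space, 'e::euclidean_space) chart set \<Rightarrow> ('a set \<Rightarrow> ('a, 'e) section_pair set)
     \<Rightarrow> (('a \<Rightarrow> 'e) \<Rightarrow> ('a, 'e) section_pair \<Rightarrow> ('a, 'e) section_pair)
     \<Rightarrow> ('a, 'e) section_pair set" where
  "parallel_sections A S D =
     {s \<in> S UNIV. \<forall>U Z. open U \<longrightarrow> smooth_vec A U Z \<longrightarrow> sec_eq_on U (D Z s) sec_zero}"

definition connection_curv ::
  "('a, 'e::euclidean_space) chart set
     \<Rightarrow> (('a \<Rightarrow> 'e) \<Rightarrow> ('a, 'e) section_pair \<Rightarrow> ('a, 'e) section_pair)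
     \<Rightarrow> ('a \<Rightarrow> 'e) \<Rightarrow> ('a \<Rightarrow> 'e) \<Rightarrow> ('a, 'e) section_pair \<Rightarrow> ('a, 'e) section_pair" where
  "connection_curv A D Y Z s =
     sec_add (D Y (D Z s))
       (sec_scale (\<lambda>_. -1) (sec_add (D Z (D Y s)) (D (lie_bracket A Y Z) s)))"

definition flat_connection ::
  "('a::topological_space, 'e::euclidean_space) chart set \<Rightarrow> ('a set \<Rightarrow> ('a, 'e) section_pair set)
     \<Rightarrow> (('a \<Rightarrow> 'e) \<Rightarrow> ('a, 'e) section_pair \<Rightarrow> ('a, 'e) section_pair) \<Rightarrow> bool" where
  "flat_connection A S D \<longleftrightarrow> (\<forall>U Y Z. \<forall>s\<in>S U. open U \<longrightarrow> smooth_vec A U Y \<longrightarrow> smooth_vec A U Z \<longrightarrow>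
     sec_eq_on U (connection_curv A D Y Z s) sec_zero)"

text \<open>\<open>D\<close> is a prolongation of an operator on 2-forms with kernel \<open>K\<close>.\<close>

definition prolongation ::
  "('a::topological_space, 'e::euclidean_space) chart set \<Rightarrow> ('a set \<Rightarrow> ('a, 'e) section_pair set)
     \<Rightarrow> (('a \<Rightarrow> 'e) \<Rightarrow> ('a, 'e) section_pair \<Rightarrow> ('a, 'e) section_pair)
     \<Rightarrow> ('a \<Rightarrow> 'e \<Rightarrow> 'e \<Rightarrow> real) set \<Rightarrow> bool" where
  "prolongation A S D K \<longleftrightarrow> connection A S D
     \<and> (\<exists>\<Phi>. bij_betw \<Phi> (parallel_sections A S D) K
          \<and> (\<forall>s\<in>parallel_sections A S D. \<forall>t\<in>parallel_sections A S D. \<forall>c.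
               \<Phi> (sec_add (sec_scale (\<lambda>_. c) s) t) = (\<lambda>p u v. c * \<Phi> s p u v + \<Phi> t p u v)))"


section \<open>The connection on \<open>S\<^sup>2H \<oplus> S\<^sup>2E \<oplus> TM\<close>\<close>

definition qk_sections ::
  "('a, 'e::euclidean_space) chart set \<Rightarrow> ('a \<Rightarrow> 'e \<Rightarrow> 'e \<Rightarrow> real) \<Rightarrow> ('a \<Rightarrow> ('e \<Rightarrow> 'e) set)
     \<Rightarrow> 'a set \<Rightarrow> ('a, 'e) section_pair set" where
  "qk_sections A g Q U = {(\<psi>, X). smooth_form A U \<psi> \<and> (\<forall>p\<in>U. \<psi> p \<in> compatible (g p) (Q p))
     \<and> smooth_vec A U X}"

definition qk_conn_form ::
  "('a, 'e::euclidean_space) chart set \<Rightarrow> ('a \<Rightarrow> 'e \<Rightarrow> 'e \<Rightarrow> real) \<Rightarrow> ('a \<Rightarrow> ('e \<Rightarrow> 'e) set) \<Rightarrow> nat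
     \<Rightarrow> ('a \<Rightarrow> 'e) \<Rightarrow> ('a \<Rightarrow> 'e \<Rightarrow> 'e \<Rightarrow> real) \<Rightarrow> ('a \<Rightarrow> 'e) \<Rightarrow> 'a \<Rightarrow> 'e \<Rightarrow> 'e \<Rightarrow> real" where
  "qk_conn_form A g Q n Z \<psi> X p u v = (let J = adm_basis (g p) (Q p); h = g p in
     nabla_form A g p (Z p) \<psi> u v
     - 1 / (4 * real n - 1) *
         (wedge h (X p) (Z p) u v + (\<Sum>i=1..3. wedge h (J i (X p)) (J i (Z p)) u v)
          - (\<Sum>i=1..3. kaehler_form h (J i) (X p) (Z p) * kaehler_form h (J i) u v)))"

definition qk_conn_vec ::
  "('a, 'e::euclidean_space) chart set \<Rightarrow> ('a \<Rightarrow> 'e \<Rightarrow> 'e \<Rightarrow> real) \<Rightarrow> ('a \<Rightarrow> ('e \<Rightarrow> 'e) set) \<Rightarrow> nat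
     \<Rightarrow> ('a \<Rightarrow> 'e) \<Rightarrow> ('a \<Rightarrow> 'e \<Rightarrow> 'e \<Rightarrow> real) \<Rightarrow> ('a \<Rightarrow> 'e) \<Rightarrow> 'a \<Rightarrow> 'e" where
  "qk_conn_vec A g Q n Z \<psi> X p = (let \<nu> = reduced_scalar_curv A g n p in
     nabla_vec A g p (Z p) X
     - ((4 * real n - 1) / 4) *\<^sub>R sharp (g p) (\<lambda>v.
          \<nu> * proj_S2E (g p) (Q p) (\<psi> p) (Z p) v
          - 2 * \<nu> * proj_S2H (g p) (Q p) (\<psi> p) (Z p) v
          + 1 / (real n + 1) * quat_weyl_form A g Q n p (\<psi> p) (Z p) v))"

definition qk_connection ::
  "('a, 'e::euclidean_space) chart set \<Rightarrow> ('a \<Rightarrow> 'e \<Rightarrow> 'e \<Rightarrow> real) \<Rightarrow> ('a \<Rightarrow> ('e \<Rightarrow> 'e) set) \<Rightarrow> nat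
     \<Rightarrow> ('a \<Rightarrow> 'e) \<Rightarrow> ('a, 'e) section_pair \<Rightarrow> ('a, 'e) section_pair" where
  "qk_connection A g Q n Z = (\<lambda>(\<psi>, X). (qk_conn_form A g Q n Z \<psi> X, qk_conn_vec A g Q n Z \<psi> X))"

end

theory Submission
  imports Defs
begin

text \<open>Write \<open>B(X,Z) = X \<and> Z + \<Sum>\<^sub>i J\<^sub>iX \<and> J\<^sub>iZ - \<Sum>\<^sub>i \<omega>\<^sub>i(X,Z) \<omega>\<^sub>i\<close>. This form is compatible,
  \<open>B(X,\<cdot>) - X \<and> \<cdot>\<close> is totally skew, and its contraction is \<open>(1 - 4n) X\<close>. A 3-form all of whose
  contractions with a vector are compatible vanishes. Hence a compatible \<open>\<psi>\<close> is conformal-Killing if and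
  only if \<open>\<nabla>\<^sub>Z\<psi> = 1/(4n-1) B(X,Z)\<close> for some \<open>X\<close>, and then \<open>X = \<delta>\<psi>\<close>. Skew-symmetrizing the second
  covariant derivative of \<open>\<psi>\<close> and inserting the curvature, one obtains
  \<open>W\<^sup>Q\<^sub>Y\<^sub>,\<^sub>Z\<psi> = 1/(4n-1) (B(LY,Z) - B(LZ,Y))\<close>, where \<open>LY\<close> is the difference of \<open>\<nabla>\<^sub>YX\<close> and its expected
  part of constant curvature type. A contraction of this identity determines \<open>L\<close>, which yields the second
  equation of the prolongation.

  The curvature of the connection on sections \<open>(0, X)\<close> is \<open>(n+2)/(n+1) W\<^sup>Q\<close> in the component \<open>TM\<close>, so that
  flatness forces \<open>W\<^sup>Q = 0\<close>. Conversely, if \<open>W\<^sup>Q = 0\<close>, then \<open>\<nu>\<close> is locally constant by the second Bianchi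
  identity and all terms of the curvature cancel.\<close>

section \<open>Derivatives and smooth functions\<close>

text \<open>Three obstacles shape the development. Tangent vectors are stored in a base chart that
  may jump from point to point, so stored components cannot be differentiated directly. Calculus is
  done for representatives on open sets of the model space, and the transformation law of the
  Christoffel symbols carries it to any chart and back. The frames and admissible bases of the
  definitions are picked pointwise, hence not smoothly. Tensors are therefore rewritten as
  coordinate traces, or as sums over a whole admissible basis; the latter are parallel because the
  matrix of the derivatives of J_1, J_2, J_3 is skew. Finally, only the holonomy condition is given,
  so the Einstein property and the symmetries of W^Q are derived from it. The constants: on S^2E,
  the contraction that determines L is multiplication by -(4n+4), which gives the coefficient
  (4n-1)/(4(n+1)) of W^Q(\<psi>); in the curvature this produces 1 + 1/(n+1) = (n+2)/(n+1). The
  bound on n enters through the factors n-1, 2n-2 and 4n^2-4.\<close>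

abbreviation DD :: "('e::real_normed_vector \<Rightarrow> 'b::real_normed_vector) \<Rightarrow> 'e \<Rightarrow> 'e \<Rightarrow> 'b" where
  "DD f x w \<equiv> frechet_derivative f (at x) w"

lemma has_derivative_DD: "f differentiable (at x) \<Longrightarrow> (f has_derivative (\<lambda>w. DD f x w)) (at x)"
  by (simp add: frechet_derivative_works)

lemma DD_eqI: "(f has_derivative f') (at x) \<Longrightarrow> DD f x w = f' w"
  by (metis frechet_derivative_at)

lemma frechet_derivative_cong_open:
  assumes "open S" "x \<in> S" "\<And>y. y \<in> S \<Longrightarrow> f y = g y"
  shows "frechet_derivative f (at x) = frechet_derivative g (at x)"
proof -
  have "(f has_derivative f') (at x) \<longleftrightarrow> (g has_derivative f') (at x)" for f'
    using assms has_derivative_transform_within_open by metis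
  then show ?thesis unfolding frechet_derivative_def by simp
qed

lemma differentiable_cong_open:
  assumes "open S" "x \<in> S" "\<And>y. y \<in> S \<Longrightarrow> f y = g y" "f differentiable (at x)"
  shows "g differentiable (at x)"
  using assms has_derivative_transform_within_open unfolding differentiable_def by metis

lemma linear_DD: "f differentiable (at x) \<Longrightarrow> linear (\<lambda>w. DD f x w)"
  by (simp add: linear_frechet_derivative)

lemma DD_add:
  assumes "f differentiable (at x)" "g differentiable (at x)"
  shows "DD (\<lambda>x. f x + g x) x w = DD f x w + DD g x w"
  by (rule DD_eqI) (intro has_derivative_add has_derivative_DD assms)

lemma DD_diff:
  assumes "f differentiable (at x)" "g differentiable (at x)"
  shows "DD (\<lambda>x. f x - g x) x w = DD f x w - DD g x w"
  by (rule DD_eqI) (intro has_derivative_diff has_derivative_DD assms)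

lemma DD_minus:
  assumes "f differentiable (at x)"
  shows "DD (\<lambda>x. - f x) x w = - DD f x w"
  by (rule DD_eqI) (intro has_derivative_minus has_derivative_DD assms)

lemma DD_sum:
  assumes "\<And>i. i \<in> I \<Longrightarrow> f i differentiable (at x)"
  shows "DD (\<lambda>x. \<Sum>i\<in>I. f i x) x w = (\<Sum>i\<in>I. DD (f i) x w)"
  by (rule DD_eqI) (intro has_derivative_sum has_derivative_DD assms)

lemma DD_bounded_linear:
  assumes "bounded_linear l" "f differentiable (at x)"
  shows "DD (\<lambda>x. l (f x)) x w = l (DD f x w)"
  by (rule DD_eqI) (intro bounded_linear.has_derivative[OF assms(1)] has_derivative_DD assms(2))

lemma DD_bounded_bilinear:
  assumes "bounded_bilinear pr" "f differentiable (at x)" "g differentiable (at x)"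
  shows "DD (\<lambda>x. pr (f x) (g x)) x w = pr (f x) (DD g x w) + pr (DD f x w) (g x)"
  by (rule DD_eqI) (intro bounded_bilinear.FDERIV[OF assms(1)] has_derivative_DD assms(2,3))

lemma DD_scaleR:
  assumes "f differentiable (at x)" "g differentiable (at x)"
  shows "DD (\<lambda>x. f x *\<^sub>R g x) x w = f x *\<^sub>R DD g x w + DD f x w *\<^sub>R g x"
  by (rule DD_bounded_bilinear[OF bounded_bilinear_scaleR assms])

lemma DD_mult:
  fixes f g :: "_ \<Rightarrow> real"
  assumes "f differentiable (at x)" "g differentiable (at x)"
  shows "DD (\<lambda>x. f x * g x) x w = f x * DD g x w + DD f x w * g x"
  by (rule DD_bounded_bilinear[OF bounded_bilinear_mult assms])

lemma DD_compose:
  assumes "g differentiable (at x)" "f differentiable (at (g x))"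
  shows "DD (\<lambda>x. f (g x)) x w = DD f (g x) (DD g x w)"
  using frechet_derivative_compose[OF assms] by (simp add: o_def fun_eq_iff)

lemma differentiable_bounded_bilinear:
  assumes "bounded_bilinear pr" "f differentiable (at x)" "g differentiable (at x)"
  shows "(\<lambda>x. pr (f x) (g x)) differentiable (at x)"
  using bounded_bilinear.FDERIV[OF assms(1) has_derivative_DD[OF assms(2)] has_derivative_DD[OF assms(3)]]
  unfolding differentiable_def by blast

lemma differentiable_bounded_linear:
  assumes "bounded_linear l" "f differentiable (at x)"
  shows "(\<lambda>x. l (f x)) differentiable (at x)"
  using bounded_linear.has_derivative[OF assms(1) has_derivative_DD[OF assms(2)]]
  unfolding differentiable_def by blast

lemma Ck_on_cong:
  assumes "open S" "\<And>x. x \<in> S \<Longrightarrow> f x = g x" "Ck_on k S f"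
  shows "Ck_on k S g"
  using assms(2,3)
proof (induction k arbitrary: f g)
  case 0
  then show ?case using continuous_on_cong[of S S f g] by simp
next
  case (Suc k)
  have "g differentiable (at x)" if "x \<in> S" for x
    using Suc.prems that differentiable_cong_open[OF assms(1) that, of f g] by simp
  moreover have "Ck_on k S (\<lambda>x. DD g x v)" for v
  proof (rule Suc.IH)
    show "Ck_on k S (\<lambda>x. DD f x v)" using Suc.prems by simp
    show "DD f x v = DD g x v" if "x \<in> S" for x
      using frechet_derivative_cong_open[OF assms(1) that, of f g] Suc.prems by simp
  qed
  ultimately show ?case by simp
qed

lemma Ck_on_SucD: "Ck_on (Suc k) S f \<Longrightarrow> Ck_on k S f"
proof (induction k arbitrary: f)
  case 0
  then show ?case
    using differentiable_imp_continuous_within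
    by (metis Ck_on.simps continuous_at_imp_continuous_on)
next
  case (Suc k)
  have "\<forall>v. Ck_on (Suc k) S (\<lambda>x. DD f x v)" "\<forall>x\<in>S. f differentiable (at x)"
    using Suc.prems Ck_on.simps(2)[of "Suc k" S f] by blast+
  then show ?case unfolding Ck_on.simps(2)[of k S f] using Suc.IH by blast
qed

lemma Ck_on_subset: "Ck_on k S f \<Longrightarrow> T \<subseteq> S \<Longrightarrow> Ck_on k T f"
  by (induction k arbitrary: f) (auto intro: continuous_on_subset)

lemma Ck_on_const: "Ck_on k S (\<lambda>x. c)"
  by (induction k arbitrary: c) auto

lemma Ck_on_bounded_linear:
  assumes "open S" "bounded_linear l" "Ck_on k S f"
  shows "Ck_on k S (\<lambda>x. l (f x))"
  using assms(3)
proof (induction k arbitrary: f)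
  case 0
  then show ?case using assms(2) by (simp add: linear_continuous_on_compose bounded_linear.continuous_on)
next
  case (Suc k)
  then have d: "\<And>x. x \<in> S \<Longrightarrow> f differentiable (at x)" by simp
  have "Ck_on k S (\<lambda>x. DD (\<lambda>x. l (f x)) x v)" for v
    by (rule Ck_on_cong[OF assms(1), where f="\<lambda>x. l (DD f x v)"])
       (use Suc DD_bounded_linear[OF assms(2) d] in simp_all)
  then show ?case using differentiable_bounded_linear[OF assms(2) d] by simp
qed

lemma Ck_on_add:
  assumes "open S" "Ck_on k S f" "Ck_on k S g"
  shows "Ck_on k S (\<lambda>x. f x + g x)"
  using assms(2,3)
proof (induction k arbitrary: f g)
  case 0
  then show ?case by (simp add: continuous_on_add)
next
  case (Suc k)
  have "Ck_on k S (\<lambda>x. DD (\<lambda>x. f x + g x) x v)" for v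
    by (rule Ck_on_cong[OF assms(1), where f="\<lambda>x. DD f x v + DD g x v"])
       (use Suc in \<open>auto simp: DD_add\<close>)
  then show ?case using Suc.prems by simp
qed

lemma Ck_on_sum:
  assumes "open S" "\<And>i. i \<in> I \<Longrightarrow> Ck_on k S (f i)"
  shows "Ck_on k S (\<lambda>x. \<Sum>i\<in>I. f i x)"
  using assms(2)
  by (induction I rule: infinite_finite_induct) (auto intro: Ck_on_const Ck_on_add[OF assms(1)])

lemma Ck_on_bounded_bilinear:
  assumes "open S" "bounded_bilinear pr" "Ck_on k S f" "Ck_on k S g"
  shows "Ck_on k S (\<lambda>x. pr (f x) (g x))"
  using assms(3,4)
proof (induction k arbitrary: f g)
  case 0
  then show ?case using bounded_bilinear.continuous_on[OF assms(2)] by simp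
next
  case (Suc k)
  then have d: "f differentiable (at x)" "g differentiable (at x)" if "x \<in> S" for x
    using that by simp_all
  have k: "Ck_on k S f" "Ck_on k S g" using Suc.prems Ck_on_SucD by blast+
  have "Ck_on k S (\<lambda>x. DD (\<lambda>x. pr (f x) (g x)) x v)" for v
    by (rule Ck_on_cong[OF assms(1), where f="\<lambda>x. pr (f x) (DD g x v) + pr (DD f x v) (g x)"])
       (use d k Suc in \<open>auto intro!: Ck_on_add[OF assms(1)] simp: DD_bounded_bilinear[OF assms(2)]\<close>)
  then show ?case using differentiable_bounded_bilinear[OF assms(2) d] by simp
qed

lemma linear_sum_Basis:
  fixes w :: "'e::euclidean_space"
  assumes "linear f" shows "f w = (\<Sum>b\<in>Basis. (w \<bullet> b) *\<^sub>R f b)"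
  using linear_sum[OF assms, of "\<lambda>b. (w \<bullet> b) *\<^sub>R b" Basis]
  by (simp add: euclidean_representation linear_cmul[OF assms])

lemma Ck_on_inner_const:
  assumes "open S" "Ck_on k S f"
  shows "Ck_on k S (\<lambda>x. f x \<bullet> b)"
  by (rule Ck_on_bounded_linear[OF assms(1) bounded_linear_inner_left assms(2)])

text \<open>In the chain rule the inner derivative is a varying direction, whereas
  \<open>Ck_on\<close> speaks of fixed ones. Expanding it in \<open>Basis\<close> leaves products of
  components of the derivative of \<open>t\<close> with compositions covered by the induction
  hypothesis.\<close>

lemma Ck_on_compose:
  fixes t :: "'d::euclidean_space \<Rightarrow> 'e::euclidean_space"
  assumes "open S" "open T" "t ` S \<subseteq> T" "Ck_on k S t" "Ck_on k T f"
  shows "Ck_on k S (\<lambda>x. f (t x))"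
  using assms(4,5)
proof (induction k arbitrary: f)
  case 0
  then show ?case using assms(3) continuous_on_compose2[of T f S t] by simp
next
  case (Suc k)
  then have d: "t differentiable (at x)" "f differentiable (at (t x))" if "x \<in> S" for x
    using that assms(3) by auto
  have "Ck_on k S (\<lambda>x. DD (\<lambda>x. f (t x)) x v)" for v
  proof (rule Ck_on_cong[OF assms(1)])
    show "Ck_on k S (\<lambda>x. \<Sum>b\<in>Basis. (DD t x v \<bullet> b) *\<^sub>R DD f (t x) b)"
      using Suc.prems Ck_on_SucD[OF Suc.prems(1)]
      by (intro Ck_on_sum Ck_on_bounded_bilinear[OF _ bounded_bilinear_scaleR] Ck_on_inner_const
          Suc.IH assms) simp_all
    show "(\<Sum>b\<in>Basis. (DD t x v \<bullet> b) *\<^sub>R DD f (t x) b) = DD (\<lambda>x. f (t x)) x v" if "x \<in> S" for x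
      using DD_compose[OF d[OF that]] linear_sum_Basis[OF linear_DD[OF d(2)[OF that]], of "DD t x v"]
      by metis
  qed
  moreover have "(\<lambda>x. f (t x)) differentiable (at x)" if "x \<in> S" for x
    using differentiable_chain_at[OF d[OF that]] by (simp add: o_def)
  ultimately show ?case by simp
qed

lemma Ck_on_inverse:
  fixes f :: "'e::euclidean_space \<Rightarrow> real"
  assumes "open S" "\<And>x. x \<in> S \<Longrightarrow> f x \<noteq> 0" "Ck_on k S f"
  shows "Ck_on k S (\<lambda>x. inverse (f x))"
  using assms(3)
proof (induction k)
  case 0
  then show ?case using assms(2) by (simp add: continuous_on_inverse)
next
  case (Suc k)
  have d: "f differentiable (at x)" if "x \<in> S" for x using Suc.prems that by simp
  have I: "Ck_on k S (\<lambda>x. inverse (f x))" using Suc.IH Suc.prems Ck_on_SucD by blast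
  have hd: "((\<lambda>x. inverse (f x)) has_derivative (\<lambda>w. - (inverse (f x) * DD f x w * inverse (f x)))) (at x)"
    if "x \<in> S" for x
    using Deriv.has_derivative_inverse[OF assms(2)[OF that] has_derivative_DD[OF d[OF that]]] by simp
  have "Ck_on k S (\<lambda>x. DD (\<lambda>x. inverse (f x)) x v)" for v
  proof (rule Ck_on_cong[OF assms(1)])
    show "Ck_on k S (\<lambda>x. - (inverse (f x) * DD f x v * inverse (f x)))"
      using Suc.prems I assms(1)
      by (intro Ck_on_bounded_linear[OF _ bounded_linear_minus[OF bounded_linear_ident]]
          Ck_on_bounded_bilinear[OF _ bounded_bilinear_mult]) auto
    show "- (inverse (f x) * DD f x v * inverse (f x)) = DD (\<lambda>x. inverse (f x)) x v" if "x \<in> S" for x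
      using DD_eqI[OF hd[OF that]] by simp
  qed
  moreover have "(\<lambda>x. inverse (f x)) differentiable (at x)" if "x \<in> S" for x
    using hd[OF that] by (rule differentiableI)
  ultimately show ?case by simp
qed

lemma Cinf_onD: "Cinf_on S f \<Longrightarrow> x \<in> S \<Longrightarrow> f differentiable (at x)"
  unfolding Cinf_on_def using Ck_on.simps(2) by blast

lemma Cinf_on_DD: "Cinf_on S f \<Longrightarrow> Cinf_on S (\<lambda>x. DD f x v)"
  unfolding Cinf_on_def using Ck_on.simps(2) by blast

lemma Cinf_on_cong:
  "open S \<Longrightarrow> (\<And>x. x \<in> S \<Longrightarrow> f x = g x) \<Longrightarrow> Cinf_on S f \<Longrightarrow> Cinf_on S g"
  unfolding Cinf_on_def using Ck_on_cong by blast

lemma Cinf_on_subset: "Cinf_on S f \<Longrightarrow> T \<subseteq> S \<Longrightarrow> Cinf_on T f"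
  unfolding Cinf_on_def using Ck_on_subset by blast

lemma Cinf_on_const: "Cinf_on S (\<lambda>x. c)"
  by (simp add: Cinf_on_def Ck_on_const)

lemma Cinf_on_bounded_linear:
  "open S \<Longrightarrow> bounded_linear l \<Longrightarrow> Cinf_on S f \<Longrightarrow> Cinf_on S (\<lambda>x. l (f x))"
  by (simp add: Cinf_on_def Ck_on_bounded_linear)

lemma Cinf_on_inner_const: "open S \<Longrightarrow> Cinf_on S f \<Longrightarrow> Cinf_on S (\<lambda>x. f x \<bullet> b)"
  by (simp add: Cinf_on_def Ck_on_inner_const)

lemma Cinf_on_add: "open S \<Longrightarrow> Cinf_on S f \<Longrightarrow> Cinf_on S g \<Longrightarrow> Cinf_on S (\<lambda>x. f x + g x)"
  by (simp add: Cinf_on_def Ck_on_add)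

lemma Cinf_on_minus: "open S \<Longrightarrow> Cinf_on S f \<Longrightarrow> Cinf_on S (\<lambda>x. - f x)"
  by (rule Cinf_on_bounded_linear[OF _ bounded_linear_minus[OF bounded_linear_ident]])

lemma Cinf_on_diff: "open S \<Longrightarrow> Cinf_on S f \<Longrightarrow> Cinf_on S g \<Longrightarrow> Cinf_on S (\<lambda>x. f x - g x)"
  using Cinf_on_add[OF _ _ Cinf_on_minus, of S f g] by simp

lemma Cinf_on_sum: "open S \<Longrightarrow> (\<And>i. i \<in> I \<Longrightarrow> Cinf_on S (f i)) \<Longrightarrow> Cinf_on S (\<lambda>x. \<Sum>i\<in>I. f i x)"
  by (simp add: Cinf_on_def Ck_on_sum)

lemma Cinf_on_scaleR:
  "open S \<Longrightarrow> Cinf_on S f \<Longrightarrow> Cinf_on S g \<Longrightarrow> Cinf_on S (\<lambda>x. f x *\<^sub>R g x)"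
  by (simp add: Cinf_on_def Ck_on_bounded_bilinear[OF _ bounded_bilinear_scaleR])

lemma Cinf_on_mult:
  fixes f g :: "'e::euclidean_space \<Rightarrow> real"
  shows "open S \<Longrightarrow> Cinf_on S f \<Longrightarrow> Cinf_on S g \<Longrightarrow> Cinf_on S (\<lambda>x. f x * g x)"
  by (simp add: Cinf_on_def Ck_on_bounded_bilinear[OF _ bounded_bilinear_mult])

lemma Cinf_on_divide:
  fixes f g :: "'e::euclidean_space \<Rightarrow> real"
  assumes "open S" "\<And>x. x \<in> S \<Longrightarrow> g x \<noteq> 0" "Cinf_on S f" "Cinf_on S g"
  shows "Cinf_on S (\<lambda>x. f x / g x)"
  using Cinf_on_mult[OF assms(1,3), of "\<lambda>x. inverse (g x)"] assms Ck_on_inverse[OF assms(1,2)]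
  by (auto simp: Cinf_on_def divide_inverse)

lemma Cinf_on_compose:
  fixes t :: "'d::euclidean_space \<Rightarrow> 'e::euclidean_space"
  shows "open S \<Longrightarrow> open T \<Longrightarrow> t ` S \<subseteq> T \<Longrightarrow> Cinf_on S t \<Longrightarrow> Cinf_on T f \<Longrightarrow> Cinf_on S (\<lambda>x. f (t x))"
  by (simp add: Cinf_on_def Ck_on_compose)

lemmas Cinf_intros = Cinf_on_const Cinf_on_add Cinf_on_minus Cinf_on_diff Cinf_on_sum
  Cinf_on_scaleR Cinf_on_mult

section \<open>Symmetry of second derivatives\<close>

text \<open>The mean value theorem is applied once to the increment in direction \<open>v\<close>,
  as a function along \<open>u\<close>, and once to the derivative in direction \<open>u\<close>, as
  a function along \<open>v\<close>. The left side is symmetric in \<open>u\<close> and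
  \<open>v\<close>, which is what makes the formula useful.\<close>

lemma second_difference_mvt:
  fixes f :: "'e::euclidean_space \<Rightarrow> real"
  assumes "cball x r \<subseteq> S" and f: "Cinf_on S f" and t: "0 < t" "t * (norm u + norm v) \<le> r"
  shows "\<exists>y\<in>cball x (t * (norm u + norm v)).
     f (x + t *\<^sub>R u + t *\<^sub>R v) - f (x + t *\<^sub>R u) - f (x + t *\<^sub>R v) + f x
       = t * t * DD (\<lambda>y. DD f y u) y v"
proof -
  let ?p = "\<lambda>a b. x + a *\<^sub>R u + b *\<^sub>R v"
  have near: "?p a b \<in> cball x (t * (norm u + norm v))" if "0 \<le> a" "a \<le> t" "0 \<le> b" "b \<le> t" for a b
  proof -
    have "norm (a *\<^sub>R u + b *\<^sub>R v) \<le> a * norm u + b * norm v"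
      using norm_triangle_ineq[of "a *\<^sub>R u" "b *\<^sub>R v"] that by simp
    also have "\<dots> \<le> t * norm u + t * norm v"
      using that by (intro add_mono mult_right_mono) auto
    finally show ?thesis by (simp add: dist_norm algebra_simps norm_minus_commute)
  qed
  have inS: "?p a b \<in> S" if "0 \<le> a" "a \<le> t" "0 \<le> b" "b \<le> t" for a b
    using near[OF that] assms(1) t(2) by auto
  have d1: "((\<lambda>a. f (?p a b)) has_derivative (\<lambda>s. DD f (?p a b) (s *\<^sub>R u))) (at a within {0..t})"
    if "a \<in> {0..t}" "b \<in> {0..t}" for a b
  proof -
    have "((\<lambda>a. ?p a b) has_derivative (\<lambda>s. s *\<^sub>R u)) (at a within {0..t})"
      by (auto intro!: derivative_eq_intros)
    from has_derivative_in_compose[OF this has_derivative_at_withinI[OF has_derivative_DD[OF Cinf_onD[OF f inS]]]] that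
    show ?thesis by simp
  qed
  have d2: "((\<lambda>b. DD f (?p a b) u) has_derivative (\<lambda>s. DD (\<lambda>y. DD f y u) (?p a b) (s *\<^sub>R v))) (at b within {0..t})"
    if "a \<in> {0..t}" "b \<in> {0..t}" for a b
  proof -
    have "((\<lambda>b. ?p a b) has_derivative (\<lambda>s. s *\<^sub>R v)) (at b within {0..t})"
      by (auto intro!: derivative_eq_intros)
    from has_derivative_in_compose[OF this has_derivative_at_withinI[OF has_derivative_DD[OF Cinf_onD[OF Cinf_on_DD[OF f] inS]]]] that
    show ?thesis by simp
  qed
  have "\<exists>a\<in>{0<..<t}. (f (?p t t) - f (?p t 0)) - (f (?p 0 t) - f (?p 0 0))
      = DD f (?p a t) ((t - 0) *\<^sub>R u) - DD f (?p a 0) ((t - 0) *\<^sub>R u)"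
    by (rule mvt_simple[OF t(1), where f="\<lambda>a. f (?p a t) - f (?p a 0)"])
       (intro has_derivative_diff d1; use t(1) in auto)
  then obtain a where a: "a \<in> {0<..<t}"
    and e1: "f (?p t t) - f (?p t 0) - (f (?p 0 t) - f (?p 0 0))
      = DD f (?p a t) (t *\<^sub>R u) - DD f (?p a 0) (t *\<^sub>R u)" by auto
  have "\<exists>b\<in>{0<..<t}. DD f (?p a t) u - DD f (?p a 0) u = DD (\<lambda>y. DD f y u) (?p a b) ((t - 0) *\<^sub>R v)"
    by (rule mvt_simple[OF t(1), where f="\<lambda>b. DD f (?p a b) u"]) (intro d2; use a in auto)
  then obtain b where b: "b \<in> {0<..<t}"
    and e2: "DD f (?p a t) u - DD f (?p a 0) u = DD (\<lambda>y. DD f y u) (?p a b) (t *\<^sub>R v)" by auto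
  have lin: "DD f (?p a b) (t *\<^sub>R u) = t * DD f (?p a b) u" if "b \<in> {0..t}" for b
    using linear_cmul[OF linear_DD[OF Cinf_onD[OF f inS[of a b]]], of t u] that a by simp
  have lin2: "DD (\<lambda>y. DD f y u) (?p a b) (t *\<^sub>R v) = t * DD (\<lambda>y. DD f y u) (?p a b) v"
    using linear_cmul[OF linear_DD[OF Cinf_onD[OF Cinf_on_DD[OF f, of u] inS[of a b]]], of t v] b a by simp
  show ?thesis
  proof (rule bexI[of _ "?p a b"])
    show "?p a b \<in> cball x (t * (norm u + norm v))" using near a b by auto
    have "f (?p t t) - f (?p t 0) - (f (?p 0 t) - f (?p 0 0)) = t * (DD f (?p a t) u - DD f (?p a 0) u)"
      using e1 lin[of t] lin[of 0] t(1) by (simp add: algebra_simps)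
    also have "\<dots> = t * t * DD (\<lambda>y. DD f y u) (?p a b) v"
      using e2 lin2 by simp
    finally show "f (x + t *\<^sub>R u + t *\<^sub>R v) - f (x + t *\<^sub>R u) - f (x + t *\<^sub>R v) + f x
       = t * t * DD (\<lambda>y. DD f y u) (?p a b) v" by simp
  qed
qed

lemma DD_DD_commute_real:
  fixes f :: "'e::euclidean_space \<Rightarrow> real"
  assumes "open S" "x \<in> S" and f: "Cinf_on S f"
  shows "DD (\<lambda>y. DD f y u) x v = DD (\<lambda>y. DD f y v) x u"
proof -
  obtain r where r: "r > 0" "cball x r \<subseteq> S" using assms open_contains_cball by blast
  \<comment> \<open>The summand 1 keeps \<open>N\<close> positive when \<open>u\<close> and
    \<open>v\<close> both vanish; the step size is chosen so that the intermediate points lie within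
    \<open>r / (n + 1)\<close> of \<open>x\<close>.\<close>
  define N where "N = norm u + norm v + 1"
  define t where "t n = r / (N * (real n + 1))" for n :: nat
  have N: "N > 0" "norm u + norm v \<le> N" unfolding N_def by (auto simp: add_nonneg_pos)
  have t0: "t n > 0" for n unfolding t_def using r N by simp
  have tN: "t n * N = r / (real n + 1)" for n unfolding t_def using N(1) by simp
  have tr: "t n * (norm u + norm v) \<le> r / (real n + 1)" for n
    using mult_left_mono[OF N(2), of "t n"] t0[of n] tN by simp
  have tr1: "t n * (norm u + norm v) \<le> r" for n
  proof -
    have "r / (real n + 1) \<le> r" using r by (simp add: field_simps)
    then show ?thesis using tr[of n] by linarith
  qed
  have lim: "(\<lambda>n. r / (real n + 1)) \<longlonglongrightarrow> 0"
    using LIMSEQ_inverse_real_of_nat[THEN tendsto_mult_left, of r] by (simp add: field_simps)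
  have key: "\<exists>y. y \<longlonglongrightarrow> x \<and> (\<forall>n. f (x + t n *\<^sub>R u + t n *\<^sub>R v) - f (x + t n *\<^sub>R u) - f (x + t n *\<^sub>R v) + f x
       = t n * t n * DD (\<lambda>y. DD f y u) (y n) v)" if "norm u + norm v \<le> N" "\<And>n. t n * (norm u + norm v) \<le> r / (real n + 1)"
       "\<And>n. t n * (norm u + norm v) \<le> r" for u v
  proof -
    have "\<forall>n. \<exists>y. y \<in> cball x (t n * (norm u + norm v)) \<and> f (x + t n *\<^sub>R u + t n *\<^sub>R v) - f (x + t n *\<^sub>R u) - f (x + t n *\<^sub>R v) + f x
       = t n * t n * DD (\<lambda>y. DD f y u) y v"
      using second_difference_mvt[OF r(2) f t0 that(3)] by blast
    then obtain y where y: "\<And>n. y n \<in> cball x (t n * (norm u + norm v))"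
      "\<And>n. f (x + t n *\<^sub>R u + t n *\<^sub>R v) - f (x + t n *\<^sub>R u) - f (x + t n *\<^sub>R v) + f x
       = t n * t n * DD (\<lambda>y. DD f y u) (y n) v" by metis
    have "norm (y n - x) \<le> r / (real n + 1)" for n
      using y(1)[of n] that(2)[of n] by (simp add: dist_norm norm_minus_commute)
    then have "(\<lambda>n. y n - x) \<longlonglongrightarrow> 0"
      by (intro Lim_null_comparison[OF _ lim]) auto
    then show ?thesis using y(2) LIM_zero_iff[of y x] by blast
  qed
  obtain y where y: "y \<longlonglongrightarrow> x" "\<And>n. f (x + t n *\<^sub>R u + t n *\<^sub>R v) - f (x + t n *\<^sub>R u) - f (x + t n *\<^sub>R v) + f x
       = t n * t n * DD (\<lambda>y. DD f y u) (y n) v" using key[OF N(2) tr tr1] by blast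
  obtain z where z: "z \<longlonglongrightarrow> x" "\<And>n. f (x + t n *\<^sub>R v + t n *\<^sub>R u) - f (x + t n *\<^sub>R v) - f (x + t n *\<^sub>R u) + f x
       = t n * t n * DD (\<lambda>y. DD f y v) (z n) u" using key[of v u] N(2) tr tr1 by (auto simp: add.commute)
  \<comment> \<open>Both orders of differentiation come from the same second difference, so the
    mixed derivatives agree at two sequences of points tending to \<open>x\<close>; continuity does
    the rest.\<close>
  have eq: "DD (\<lambda>y. DD f y u) (y n) v = DD (\<lambda>y. DD f y v) (z n) u" for n
  proof -
    have "t n * t n * DD (\<lambda>y. DD f y u) (y n) v = t n * t n * DD (\<lambda>y. DD f y v) (z n) u"
      unfolding y(2)[symmetric] z(2)[symmetric] by (simp add: algebra_simps)
    then show ?thesis using t0[of n] by simp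
  qed
  have cont: "isCont (\<lambda>y. DD (\<lambda>y. DD f y u) y v) x" for u v
    using differentiable_imp_continuous_within[OF Cinf_onD[OF Cinf_on_DD[OF Cinf_on_DD[OF f]] assms(2)]]
    by simp
  have "(\<lambda>n. DD (\<lambda>y. DD f y u) (y n) v) \<longlonglongrightarrow> DD (\<lambda>y. DD f y u) x v"
    using isCont_tendsto_compose[OF cont y(1)] .
  moreover have "(\<lambda>n. DD (\<lambda>y. DD f y u) (y n) v) \<longlonglongrightarrow> DD (\<lambda>y. DD f y v) x u"
    unfolding eq using isCont_tendsto_compose[OF cont z(1)] .
  ultimately show ?thesis using LIMSEQ_unique by blast
qed

lemma DD_DD_commute:
  fixes f :: "'e::euclidean_space \<Rightarrow> 'b::euclidean_space"
  assumes "open S" "x \<in> S" and f: "Cinf_on S f"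
  shows "DD (\<lambda>y. DD f y u) x v = DD (\<lambda>y. DD f y v) x u"
proof (rule euclidean_eqI)
  fix b :: 'b
  have *: "DD (\<lambda>y. DD f y u) x v \<bullet> b = DD (\<lambda>y. DD (\<lambda>y. f y \<bullet> b) y u) x v" for u v
  proof -
    have "DD (\<lambda>y. DD (\<lambda>y. f y \<bullet> b) y u) x v = DD (\<lambda>y. DD f y u \<bullet> b) x v"
      using DD_bounded_linear[OF bounded_linear_inner_left Cinf_onD[OF f]] assms(1,2)
      by (intro fun_cong[OF frechet_derivative_cong_open[of S]]) auto
    also have "\<dots> = DD (\<lambda>y. DD f y u) x v \<bullet> b"
      by (intro DD_bounded_linear[OF bounded_linear_inner_left] Cinf_onD[OF Cinf_on_DD[OF f]] assms)
    finally show ?thesis by simp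
  qed
  show "DD (\<lambda>y. DD f y u) x v \<bullet> b = DD (\<lambda>y. DD f y v) x u \<bullet> b"
    unfolding * by (rule DD_DD_commute_real[OF assms(1,2)]) (intro Cinf_on_inner_const assms)
qed

section \<open>Fields of linear and bilinear maps\<close>

text \<open>Smoothness is asked only for constant arguments, which is what
  \<open>smooth_form\<close> and \<open>smooth_end\<close> provide; smoothness for varying arguments
  follows by expansion in \<open>Basis\<close>.\<close>

definition lin_field :: "'e::euclidean_space set \<Rightarrow> ('e \<Rightarrow> 'd::euclidean_space \<Rightarrow> 'b::real_normed_vector) \<Rightarrow> bool" where
  "lin_field S L \<longleftrightarrow> (\<forall>x\<in>S. linear (L x)) \<and> (\<forall>u. Cinf_on S (\<lambda>x. L x u))"

definition bil_field :: "'e::euclidean_space set \<Rightarrow> ('e \<Rightarrow> 'd::euclidean_space \<Rightarrow> 'd \<Rightarrow> 'b::real_normed_vector) \<Rightarrow> bool" where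
  "bil_field S G \<longleftrightarrow> (\<forall>x\<in>S. bilinear (G x)) \<and> (\<forall>u v. Cinf_on S (\<lambda>x. G x u v))"

lemma lin_field_Cinf:
  assumes "open S" "lin_field S L" "Cinf_on S U"
  shows "Cinf_on S (\<lambda>x. L x (U x))"
proof (rule Cinf_on_cong[OF assms(1)])
  show "Cinf_on S (\<lambda>x. \<Sum>b\<in>Basis. (U x \<bullet> b) *\<^sub>R L x b)"
    using assms by (auto intro!: Cinf_intros Cinf_on_inner_const simp: lin_field_def)
  show "(\<Sum>b\<in>Basis. (U x \<bullet> b) *\<^sub>R L x b) = L x (U x)" if "x \<in> S" for x
    using linear_sum_Basis[of "L x" "U x"] assms(2) that by (simp add: lin_field_def)
qed

lemma lin_field_DD:
  assumes "open S" "x \<in> S" "lin_field S L" "U differentiable (at x)"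
  shows "DD (\<lambda>y. L y (U y)) x w = DD (\<lambda>y. L y (U x)) x w + L x (DD U x w)"
proof -
  have lin: "linear (L y)" if "y \<in> S" for y using assms(3) that by (simp add: lin_field_def)
  have dL: "(\<lambda>y. L y b) differentiable (at x)" for b
    using assms(3) by (auto intro: Cinf_onD[OF _ assms(2)] simp: lin_field_def)
  have dU: "(\<lambda>y. U y \<bullet> b) differentiable (at x)" for b
    by (rule differentiable_bounded_linear[OF bounded_linear_inner_left assms(4)])
  have "DD (\<lambda>y. L y (U y)) x w = DD (\<lambda>y. \<Sum>b\<in>Basis. (U y \<bullet> b) *\<^sub>R L y b) x w"
    by (rule fun_cong[OF frechet_derivative_cong_open[OF assms(1,2)]]) (use lin linear_sum_Basis in metis)
  also have "\<dots> = (\<Sum>b\<in>Basis. (U x \<bullet> b) *\<^sub>R DD (\<lambda>y. L y b) x w + DD (\<lambda>y. U y \<bullet> b) x w *\<^sub>R L x b)"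
    by (subst DD_sum) (use differentiable_bounded_bilinear[OF bounded_bilinear_scaleR dU dL] DD_scaleR[OF dU dL] in auto)
  also have "\<dots> = (\<Sum>b\<in>Basis. (U x \<bullet> b) *\<^sub>R DD (\<lambda>y. L y b) x w) + (\<Sum>b\<in>Basis. (DD U x w \<bullet> b) *\<^sub>R L x b)"
    by (simp add: sum.distrib DD_bounded_linear[OF bounded_linear_inner_left assms(4)])
  also have "(\<Sum>b\<in>Basis. (DD U x w \<bullet> b) *\<^sub>R L x b) = L x (DD U x w)"
    using linear_sum_Basis[OF lin[OF assms(2)]] by metis
  also have "(\<Sum>b\<in>Basis. (U x \<bullet> b) *\<^sub>R DD (\<lambda>y. L y b) x w) = DD (\<lambda>y. \<Sum>b\<in>Basis. (U x \<bullet> b) *\<^sub>R L y b) x w"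
    by (subst DD_sum)
       (use differentiable_bounded_linear[OF bounded_linear_scaleR_right dL]
            DD_bounded_linear[OF bounded_linear_scaleR_right dL] in auto)
  also have "\<dots> = DD (\<lambda>y. L y (U x)) x w"
    by (rule fun_cong[OF frechet_derivative_cong_open[OF assms(1,2)]]) (use lin linear_sum_Basis in metis)
  finally show ?thesis .
qed

lemma lin_field_linear_DD:
  assumes "open S" "lin_field S L"
  shows "lin_field S (\<lambda>x u. DD (\<lambda>y. L y u) x w)"
  unfolding lin_field_def
proof (intro conjI ballI allI)
  show "Cinf_on S (\<lambda>x. DD (\<lambda>y. L y u) x w)" for u
    using assms(2) by (auto intro: Cinf_on_DD simp: lin_field_def)
  fix x assume x: "x \<in> S"
  have lin: "linear (L y)" if "y \<in> S" for y using assms(2) that by (simp add: lin_field_def)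
  have dL: "(\<lambda>y. L y b) differentiable (at x)" for b
    using assms(2) by (auto intro: Cinf_onD[OF _ x] simp: lin_field_def)
  show "linear (\<lambda>u. DD (\<lambda>y. L y u) x w)"
  proof (rule linearI)
    fix u v and r :: real
    have "DD (\<lambda>y. L y (u + v)) x w = DD (\<lambda>y. L y u + L y v) x w"
      by (rule fun_cong[OF frechet_derivative_cong_open[OF assms(1) x]]) (simp add: lin linear_add)
    then show "DD (\<lambda>y. L y (u + v)) x w = DD (\<lambda>y. L y u) x w + DD (\<lambda>y. L y v) x w"
      by (simp add: DD_add dL)
    have "DD (\<lambda>y. L y (r *\<^sub>R u)) x w = DD (\<lambda>y. r *\<^sub>R L y u) x w"
      by (rule fun_cong[OF frechet_derivative_cong_open[OF assms(1) x]]) (simp add: lin linear_cmul)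
    then show "DD (\<lambda>y. L y (r *\<^sub>R u)) x w = r *\<^sub>R DD (\<lambda>y. L y u) x w"
      using DD_bounded_linear[OF bounded_linear_scaleR_right dL] by simp
  qed
qed

lemma bil_field_left: "bil_field S G \<Longrightarrow> lin_field S (\<lambda>x u. G x u v)"
  by (auto simp: bil_field_def lin_field_def bilinear_def)

lemma bil_field_right: "bil_field S G \<Longrightarrow> lin_field S (\<lambda>x v. G x u v)"
  by (auto simp: bil_field_def lin_field_def bilinear_def)

lemma bil_field_right_var:
  assumes "open S" "bil_field S G" "Cinf_on S U"
  shows "lin_field S (\<lambda>x v. G x (U x) v)"
  using lin_field_Cinf[OF assms(1) bil_field_left[OF assms(2)] assms(3)] assms(2)
  by (auto simp: bil_field_def lin_field_def bilinear_def)

lemma bil_field_Cinf: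
  assumes "open S" "bil_field S G" "Cinf_on S U" "Cinf_on S V"
  shows "Cinf_on S (\<lambda>x. G x (U x) (V x))"
  by (rule lin_field_Cinf[OF assms(1) bil_field_right_var[OF assms(1-3)] assms(4)])

lemma bil_field_DD:
  assumes "open S" "x \<in> S" "bil_field S G" "Cinf_on S U" "Cinf_on S V"
  shows "DD (\<lambda>y. G y (U y) (V y)) x w
    = DD (\<lambda>y. G y (U x) (V x)) x w + G x (DD U x w) (V x) + G x (U x) (DD V x w)"
  using lin_field_DD[OF assms(1,2) bil_field_right_var[OF assms(1,3,4)] Cinf_onD[OF assms(5,2)], of w]
    lin_field_DD[OF assms(1,2) bil_field_left[OF assms(3)] Cinf_onD[OF assms(4,2)], of "V x" w]
  by simp

section \<open>Inner products on the model space\<close>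

definition inner_form :: "('e::euclidean_space \<Rightarrow> 'e \<Rightarrow> real) \<Rightarrow> bool" where
  "inner_form h \<longleftrightarrow> bilinear h \<and> (\<forall>u v. h u v = h v u) \<and> (\<forall>v. v \<noteq> 0 \<longrightarrow> h v v > 0)"

lemma inner_form_ext:
  assumes "inner_form h" "\<And>z. h v z = h w z" shows "v = w"
proof (rule ccontr)
  assume "v \<noteq> w"
  then have "h (v - w) (v - w) > 0" using assms(1) by (simp add: inner_form_def)
  moreover have "h (v - w) (v - w) = h v (v - w) - h w (v - w)"
    using assms(1) by (simp add: inner_form_def bilinear_lsub)
  ultimately show False using assms(2) by simp
qed

text \<open>Gram-Schmidt without normalization: orthogonal fields suffice, so only divisions by
  nonvanishing smooth functions occur and no square root has to be differentiated. The condition on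
  the span keeps each new field nonzero.\<close>

lemma gram_schmidt_fields:
  fixes h :: "'e::euclidean_space \<Rightarrow> 'e \<Rightarrow> 'e \<Rightarrow> real"
  assumes "open S" and inner: "\<And>x. x \<in> S \<Longrightarrow> inner_form (h x)"
    and smooth: "\<And>u v. Cinf_on S (\<lambda>x. h x u v)"
    and "finite B" "B \<subseteq> Basis"
  shows "\<exists>f. (\<forall>b\<in>B. Cinf_on S (f b)) \<and> (\<forall>x\<in>S. (\<forall>b\<in>B. f b x \<noteq> 0)
    \<and> (\<forall>b\<in>B. \<forall>c\<in>B. b \<noteq> c \<longrightarrow> h x (f b x) (f c x) = 0) \<and> span ((\<lambda>b. f b x) ` B) = span B)"
  using assms(4,5)
proof (induction B rule: finite_induct)
  case empty
  then show ?case by simp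
next
  case (insert a B)
  then obtain f where F: "\<forall>b\<in>B. Cinf_on S (f b)" "\<forall>x\<in>S. (\<forall>b\<in>B. f b x \<noteq> 0)
    \<and> (\<forall>b\<in>B. \<forall>c\<in>B. b \<noteq> c \<longrightarrow> h x (f b x) (f c x) = 0) \<and> span ((\<lambda>b. f b x) ` B) = span B"
    by auto
  then have f: "\<And>b. b \<in> B \<Longrightarrow> Cinf_on S (f b)"
      "\<And>x b. x \<in> S \<Longrightarrow> b \<in> B \<Longrightarrow> f b x \<noteq> 0"
      "\<And>x b c. x \<in> S \<Longrightarrow> b \<in> B \<Longrightarrow> c \<in> B \<Longrightarrow> b \<noteq> c \<Longrightarrow> h x (f b x) (f c x) = 0"
      "\<And>x. x \<in> S \<Longrightarrow> span ((\<lambda>b. f b x) ` B) = span B" by auto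
  have bil: "bil_field S h" using inner smooth by (simp add: bil_field_def inner_form_def)
  have pos: "h x (f b x) (f b x) \<noteq> 0" if "x \<in> S" "b \<in> B" for x b
    using inner[OF that(1)] f(2)[OF that] by (force simp: inner_form_def)
  \<comment> \<open>The orthogonal projection of the constant field \<open>a\<close> to the span of
    the fields already constructed.\<close>
  define p where "p x = (\<Sum>b\<in>B. (h x a (f b x) / h x (f b x) (f b x)) *\<^sub>R f b x)" for x
  define f' where "f' b x = (if b = a then a - p x else f b x)" for b x
  have f'B: "f' b = f b" if "b \<in> B" for b using insert.hyps that by (auto simp: f'_def fun_eq_iff)
  have smooth_p: "Cinf_on S p"
    unfolding p_def using pos f(1)
    by (intro Cinf_intros Cinf_on_divide bil_field_Cinf[OF _ bil] assms(1)) auto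
  have p_span: "p x \<in> span B" if "x \<in> S" for x
    unfolding p_def f(4)[OF that, symmetric] by (intro span_sum span_scale span_base) auto
  have hp: "h x (p x) (f c x) = h x a (f c x)" if "x \<in> S" "c \<in> B" for x c
  proof -
    have lin: "linear (\<lambda>u. h x u (f c x))" using inner[OF that(1)] by (simp add: inner_form_def bilinear_def)
    have "h x (p x) (f c x) = (\<Sum>b\<in>B. (h x a (f b x) / h x (f b x) (f b x)) * h x (f b x) (f c x))"
      unfolding p_def by (simp add: linear_sum[OF lin] linear_cmul[OF lin])
    also have "\<dots> = (\<Sum>b\<in>B. if b = c then h x a (f b x) else 0)"
      using f(3)[OF that(1)] pos[OF that(1)] that(2) by (intro sum.cong) auto
    finally show ?thesis using insert.hyps(1) that(2) by simp
  qed
  have indep: "a \<notin> span B"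
  proof -
    have "independent (insert a B)" using independent_mono[OF independent_Basis insert.prems] .
    then show ?thesis using insert.hyps(2) by (simp add: independent_insert)
  qed
  show ?case
  proof (intro exI[of _ f'] conjI ballI impI)
    show "Cinf_on S (f' b)" if "b \<in> insert a B" for b
    proof (cases "b = a")
      case True
      then have "f' b = (\<lambda>x. a - p x)" by (simp add: f'_def fun_eq_iff)
      then show ?thesis using Cinf_on_diff[OF assms(1) Cinf_on_const smooth_p, of a] by simp
    next
      case False
      then show ?thesis using f'B f(1) that by simp
    qed
    fix x assume x: "x \<in> S"
    show "f' b x \<noteq> 0" if "b \<in> insert a B" for b
    proof (cases "b = a")
      case True
      then show ?thesis using p_span[OF x] indep by (auto simp: f'_def)
    next
      case False
      then show ?thesis using f'B f(2)[OF x] that by simp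
    qed
    have orth: "h x (f' a x) (f b x) = 0" if "b \<in> B" for b
      using hp[OF x that] bilinear_lsub[of "h x" a "p x" "f b x"] inner[OF x]
      by (simp add: f'_def inner_form_def)
    have sym: "h x u v = h x v u" for u v using inner[OF x] by (simp add: inner_form_def)
    show "h x (f' b x) (f' c x) = 0" if "b \<in> insert a B" "c \<in> insert a B" "b \<noteq> c" for b c
      using that orth[of c] orth[of b] sym f(3)[OF x, of b c] f'B by auto
    have "(\<lambda>b. f' b x) ` insert a B = insert (a - p x) ((\<lambda>b. f b x) ` B)"
      using f'B by (simp add: f'_def[of a] image_insert cong: image_cong)
    moreover have "span (insert (a - p x) ((\<lambda>b. f b x) ` B)) = span (insert a B)"
    proof -
      have s: "span (insert c ((\<lambda>b. f b x) ` B)) = span (insert c B)" for c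
        unfolding span_insert f(4)[OF x] ..
      have "span (insert (a - p x) B) = span (insert a B)"
      proof (rule subset_antisym)
        have pin: "p x \<in> span (insert c B)" for c
          using p_span[OF x] span_mono[of B "insert c B"] by auto
        have "a - p x \<in> span (insert a B)" using pin by (intro span_diff) (auto intro: span_base)
        then show "span (insert (a - p x) B) \<subseteq> span (insert a B)"
          by (intro span_minimal) (auto intro: span_base)
        have "(a - p x) + p x \<in> span (insert (a - p x) B)"
          using pin by (intro span_add) (auto intro: span_base)
        then have "a \<in> span (insert (a - p x) B)" by simp
        then show "span (insert a B) \<subseteq> span (insert (a - p x) B)"
          by (intro span_minimal) (auto intro: span_base)
      qed
      then show ?thesis using s by simp
    qed
    ultimately show "span ((\<lambda>b. f' b x) ` insert a B) = span (insert a B)" by simp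
  qed
qed

lemma orthogonal_fields:
  fixes h :: "'e::euclidean_space \<Rightarrow> 'e \<Rightarrow> 'e \<Rightarrow> real"
  assumes "open S" "\<And>x. x \<in> S \<Longrightarrow> inner_form (h x)" "\<And>u v. Cinf_on S (\<lambda>x. h x u v)"
  obtains f :: "'e \<Rightarrow> 'e \<Rightarrow> 'e" where "\<And>b. b \<in> Basis \<Longrightarrow> Cinf_on S (f b)"
    "\<And>x b. x \<in> S \<Longrightarrow> b \<in> Basis \<Longrightarrow> f b x \<noteq> 0"
    "\<And>x b c. x \<in> S \<Longrightarrow> b \<in> Basis \<Longrightarrow> c \<in> Basis \<Longrightarrow> b \<noteq> c \<Longrightarrow> h x (f b x) (f c x) = 0"
    "\<And>x. x \<in> S \<Longrightarrow> span ((\<lambda>b. f b x) ` Basis) = (UNIV :: 'e set)"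
proof -
  have "\<exists>f :: 'e \<Rightarrow> 'e \<Rightarrow> 'e. (\<forall>b\<in>Basis. Cinf_on S (f b)) \<and> (\<forall>x\<in>S. (\<forall>b\<in>Basis. f b x \<noteq> 0)
    \<and> (\<forall>b\<in>Basis. \<forall>c\<in>Basis. b \<noteq> c \<longrightarrow> h x (f b x) (f c x) = 0)
    \<and> span ((\<lambda>b. f b x) ` Basis) = span (Basis :: 'e set))"
    by (rule gram_schmidt_fields[OF assms]) auto
  then show thesis using that by (metis span_Basis)
qed

lemma sharp_eqI:
  assumes "inner_form h" "\<And>z. h w z = \<alpha> z" shows "sharp h \<alpha> = w"
  unfolding sharp_def
proof (rule the_equality)
  show "\<forall>z. h w z = \<alpha> z" using assms(2) by blast
  show "w' = w" if "\<forall>z. h w' z = \<alpha> z" for w'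
    using inner_form_ext[OF assms(1)] that assms(2) by metis
qed

lemma orthogonal_expansion:
  assumes "inner_form h" "linear \<alpha>"
    and f: "\<And>b. b \<in> Basis \<Longrightarrow> f b \<noteq> 0"
      "\<And>b c. b \<in> Basis \<Longrightarrow> c \<in> Basis \<Longrightarrow> b \<noteq> c \<Longrightarrow> h (f b) (f c) = 0" "span (f ` Basis) = (UNIV :: 'e::euclidean_space set)"
  shows "h (\<Sum>b\<in>Basis. (\<alpha> (f b) / h (f b) (f b)) *\<^sub>R f b) z = \<alpha> z"
proof -
  let ?w = "\<Sum>b\<in>Basis. (\<alpha> (f b) / h (f b) (f b)) *\<^sub>R f b"
  have lin: "linear (\<lambda>u. h u v)" "linear (\<lambda>u. h v u)" for v
    using assms(1) by (simp_all add: inner_form_def bilinear_def)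
  have pos: "h (f b) (f b) \<noteq> 0" if "b \<in> Basis" for b
    using assms(1) f(1)[OF that] by (force simp: inner_form_def)
  have c: "h ?w (f c) = \<alpha> (f c)" if "c \<in> Basis" for c
  proof -
    have "h ?w (f c) = (\<Sum>b\<in>Basis. (\<alpha> (f b) / h (f b) (f b)) * h (f b) (f c))"
      by (simp add: linear_sum[OF lin(1)] linear_cmul[OF lin(1)])
    also have "\<dots> = (\<Sum>b\<in>Basis. if b = c then \<alpha> (f b) else 0)"
      using f(2) pos that by (intro sum.cong) auto
    finally show ?thesis using that by simp
  qed
  show ?thesis
    by (rule linear_eq_on_span[OF lin(2) assms(2), of "f ` Basis"]) (use c f(3) in auto)
qed

text \<open>Existence of the vector that \<open>sharp\<close> describes by \<open>THE\<close>. The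
  orthogonal fields are used here for a metric that does not depend on the point.\<close>

lemma inner_form_sharp:
  fixes h :: "'e::euclidean_space \<Rightarrow> 'e \<Rightarrow> real"
  assumes "inner_form h" "linear \<alpha>"
  shows "h (sharp h \<alpha>) z = \<alpha> z"
proof -
  obtain f :: "'e \<Rightarrow> 'e \<Rightarrow> 'e" where f: "\<And>x b. b \<in> Basis \<Longrightarrow> f b x \<noteq> 0"
      "\<And>x b c. b \<in> Basis \<Longrightarrow> c \<in> Basis \<Longrightarrow> b \<noteq> c \<Longrightarrow> h (f b x) (f c x) = 0"
      "\<And>x. span ((\<lambda>b. f b x) ` Basis) = (UNIV :: 'e set)"
    by (rule orthogonal_fields[of "UNIV :: 'e set" "\<lambda>_. h"]) (use assms(1) Cinf_on_const in auto)
  show ?thesis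
    using sharp_eqI[OF assms(1) orthogonal_expansion[OF assms, of "\<lambda>b. f b 0"]]
      orthogonal_expansion[OF assms, of "\<lambda>b. f b 0"] f by simp
qed

text \<open>The orthogonal expansion is an explicit formula for the vector given by
  \<open>THE\<close> at each point, and all its ingredients are smooth.\<close>

lemma sharp_Cinf:
  fixes h :: "'e::euclidean_space \<Rightarrow> 'e \<Rightarrow> 'e \<Rightarrow> real"
  assumes "open S" "\<And>x. x \<in> S \<Longrightarrow> inner_form (h x)" "\<And>u v. Cinf_on S (\<lambda>x. h x u v)"
    and \<alpha>: "lin_field S \<alpha>"
  shows "Cinf_on S (\<lambda>x. sharp (h x) (\<alpha> x))"
proof -
  obtain f :: "'e \<Rightarrow> 'e \<Rightarrow> 'e" where f: "\<And>b. b \<in> Basis \<Longrightarrow> Cinf_on S (f b)"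
      "\<And>x b. x \<in> S \<Longrightarrow> b \<in> Basis \<Longrightarrow> f b x \<noteq> 0"
      "\<And>x b c. x \<in> S \<Longrightarrow> b \<in> Basis \<Longrightarrow> c \<in> Basis \<Longrightarrow> b \<noteq> c \<Longrightarrow> h x (f b x) (f c x) = 0"
      "\<And>x. x \<in> S \<Longrightarrow> span ((\<lambda>b. f b x) ` Basis) = (UNIV :: 'e set)"
    by (rule orthogonal_fields[OF assms(1-3)]) auto
  have bil: "bil_field S h" using assms(2,3) by (simp add: bil_field_def inner_form_def)
  have pos: "h x (f b x) (f b x) \<noteq> 0" if "x \<in> S" "b \<in> Basis" for x b
    using assms(2)[OF that(1)] f(2)[OF that] by (force simp: inner_form_def)
  show ?thesis
  proof (rule Cinf_on_cong[OF assms(1)])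
    show "Cinf_on S (\<lambda>x. \<Sum>b\<in>Basis. (\<alpha> x (f b x) / h x (f b x) (f b x)) *\<^sub>R f b x)"
      using pos f(1)
      by (intro Cinf_intros Cinf_on_divide bil_field_Cinf[OF _ bil] lin_field_Cinf[OF _ \<alpha>] assms(1)) auto
    fix x assume x: "x \<in> S"
    have "linear (\<alpha> x)" using \<alpha> x by (simp add: lin_field_def)
    then show "(\<Sum>b\<in>Basis. (\<alpha> x (f b x) / h x (f b x) (f b x)) *\<^sub>R f b x) = sharp (h x) (\<alpha> x)"
      using sharp_eqI[OF assms(2)[OF x] orthogonal_expansion[OF assms(2)[OF x], of "\<alpha> x" "\<lambda>b. f b x"]] f(2-4)[OF x]
      by simp
  qed
qed

lemma orthonormal_frame_frame:
  fixes h :: "'e::euclidean_space \<Rightarrow> 'e \<Rightarrow> real"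
  assumes "inner_form h"
  shows "orthonormal_frame h (frame h)"
proof -
  obtain f :: "'e \<Rightarrow> 'e \<Rightarrow> 'e" where f: "\<And>x b. b \<in> Basis \<Longrightarrow> f b x \<noteq> 0"
      "\<And>x b c. b \<in> Basis \<Longrightarrow> c \<in> Basis \<Longrightarrow> b \<noteq> c \<Longrightarrow> h (f b x) (f c x) = 0"
    by (rule orthogonal_fields[of "UNIV :: 'e set" "\<lambda>_. h"]) (use assms(1) Cinf_on_const in auto)
  have pos: "h (f b 0) (f b 0) > 0" if "b \<in> Basis" for b
    using assms(1) f(1)[OF that] by (force simp: inner_form_def)
  have bil: "bilinear h" using assms by (simp add: inner_form_def)
  have "orthonormal_frame h (\<lambda>b. (1 / sqrt (h (f b 0) (f b 0))) *\<^sub>R f b 0)"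
    unfolding orthonormal_frame_def bilinear_lmul[OF bil] bilinear_rmul[OF bil]
    using pos[THEN less_imp_neq] pos f(2) by (auto simp: abs_of_pos)
  then show ?thesis unfolding frame_def by (rule someI[where P="orthonormal_frame h"])
qed

text \<open>The linear map that takes the standard basis to the frame is injective by
  orthonormality, hence surjective by dimension.\<close>

lemma frame_expansion:
  fixes h :: "'e::euclidean_space \<Rightarrow> 'e \<Rightarrow> real"
  assumes "inner_form h" "orthonormal_frame h e"
  shows "(\<Sum>b\<in>Basis. h v (e b) *\<^sub>R e b) = v"
proof -
  define L where "L x = (\<Sum>b\<in>Basis. (x \<bullet> b) *\<^sub>R e b)" for x
  have lin: "linear (\<lambda>u. h u v)" for v
    using assms(1) by (simp add: inner_form_def bilinear_def)
  have hL: "h (L x) (e c) = x \<bullet> c" if "c \<in> Basis" for x c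
  proof -
    have "h (L x) (e c) = (\<Sum>b\<in>Basis. (x \<bullet> b) * h (e b) (e c))"
      unfolding L_def by (simp add: linear_sum[OF lin] linear_cmul[OF lin])
    also have "\<dots> = (\<Sum>b\<in>Basis. if b = c then x \<bullet> b else 0)"
      using assms(2) that by (intro sum.cong) (auto simp: orthonormal_frame_def)
    finally show ?thesis using that by simp
  qed
  have "linear L" unfolding L_def
    by (intro linearI) (simp_all add: inner_add_left scaleR_add_left sum.distrib scaleR_sum_right)
  moreover have "inj L"
    by (rule injI) (metis euclidean_eqI hL)
  ultimately have "surj L" using linear_injective_imp_surjective by blast
  then obtain x where x: "v = L x" by blast
  show ?thesis unfolding x using hL by (simp add: L_def)
qed

lemma frame_contract:
  fixes h :: "'e::euclidean_space \<Rightarrow> 'e \<Rightarrow> real"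
  assumes "inner_form h" "orthonormal_frame h e" "linear f"
  shows "(\<Sum>b\<in>Basis. h v (e b) *\<^sub>R f (e b)) = f v"
  using frame_expansion[OF assms(1,2), of v] linear_sum[OF assms(3), of "\<lambda>b. h v (e b) *\<^sub>R e b" Basis]
    linear_cmul[OF assms(3)] by simp

text \<open>The frame \<open>e\<close> is chosen pointwise and need not vary smoothly. A trace over
  it is rewritten as a contraction of coordinate vectors with the duals of the coordinate
  functionals, which does vary smoothly. \<open>F\<close> leads from coordinates to the tangent
  space and \<open>T\<close> back.\<close>

lemma trace_coordinates:
  fixes h :: "'e::euclidean_space \<Rightarrow> 'e \<Rightarrow> real" and t :: "'e \<Rightarrow> 'e \<Rightarrow> real" and F :: "'e \<Rightarrow> 'e"
  assumes h: "inner_form h" "orthonormal_frame h e" and F: "linear F" "\<And>v. F (T v) = v"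
    and G: "inner_form G" "\<And>u v. G u v = h (F u) (F v)" and t: "bilinear t"
  shows "(\<Sum>b\<in>Basis. t (e b) (e b)) = (\<Sum>a\<in>Basis. t (F a) (F (sharp G (\<lambda>z. a \<bullet> z))))"
proof -
  have lin: "linear (\<lambda>z. a \<bullet> z)" for a :: 'e by (simp add: bounded_linear.linear bounded_linear_inner_right)
  have s: "h (F (sharp G (\<lambda>z. a \<bullet> z))) (e b) = T (e b) \<bullet> a" for a b
  proof -
    have "h (F (sharp G (\<lambda>z. a \<bullet> z))) (e b) = G (sharp G (\<lambda>z. a \<bullet> z)) (T (e b))"
      by (simp add: G(2) F(2))
    also have "\<dots> = a \<bullet> T (e b)" by (rule inner_form_sharp[OF G(1) lin])
    finally show ?thesis by (simp add: inner_commute)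
  qed
  have lint: "linear (t u)" "linear (\<lambda>u. t u v)" for u v using t by (simp_all add: bilinear_def)
  have "(\<Sum>a\<in>Basis. t (F a) (F (sharp G (\<lambda>z. a \<bullet> z))))
      = (\<Sum>a\<in>Basis. \<Sum>b\<in>Basis. (T (e b) \<bullet> a) * t (F a) (e b))"
  proof (intro sum.cong refl)
    fix a
    show "t (F a) (F (sharp G (\<lambda>z. a \<bullet> z))) = (\<Sum>b\<in>Basis. (T (e b) \<bullet> a) * t (F a) (e b))"
      using frame_contract[OF h lint(1), of "F (sharp G (\<lambda>z. a \<bullet> z))" "F a"] unfolding s by simp
  qed
  also have "\<dots> = (\<Sum>b\<in>Basis. \<Sum>a\<in>Basis. (T (e b) \<bullet> a) * t (F a) (e b))"
    by (rule sum.swap)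
  also have "\<dots> = (\<Sum>b\<in>Basis. t (F (T (e b))) (e b))"
  proof (intro sum.cong refl)
    fix b
    show "(\<Sum>a\<in>Basis. (T (e b) \<bullet> a) * t (F a) (e b)) = t (F (T (e b))) (e b)"
      using linear_sum_Basis[OF linear_compose[OF F(1) lint(2)], of "e b" "T (e b)"] by (simp add: o_def)
  qed
  finally show ?thesis by (simp add: F(2))
qed

section \<open>Covariant derivatives in coordinates\<close>

definition chr :: "('e::euclidean_space \<Rightarrow> 'e \<Rightarrow> 'e \<Rightarrow> real) \<Rightarrow> 'e \<Rightarrow> 'e \<Rightarrow> 'e \<Rightarrow> 'e" where
  "chr G x u v = sharp (G x) (\<lambda>z. 1 / 2 *
     (DD (\<lambda>y. G y v z) x u + DD (\<lambda>y. G y u z) x v - DD (\<lambda>y. G y u v) x z))"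

definition nab :: "('e::euclidean_space \<Rightarrow> 'e \<Rightarrow> 'e \<Rightarrow> real) \<Rightarrow> ('e \<Rightarrow> 'e) \<Rightarrow> 'e \<Rightarrow> 'e \<Rightarrow> 'e" where
  "nab G V x w = DD V x w + chr G x w (V x)"

definition nabf :: "('e::euclidean_space \<Rightarrow> 'e \<Rightarrow> 'e \<Rightarrow> real) \<Rightarrow> ('e \<Rightarrow> 'e \<Rightarrow> 'e \<Rightarrow> real) \<Rightarrow> 'e \<Rightarrow> 'e \<Rightarrow> 'e \<Rightarrow> 'e \<Rightarrow> real" where
  "nabf G \<psi> x w u v = DD (\<lambda>y. \<psi> y u v) x w - \<psi> x (chr G x w u) v - \<psi> x u (chr G x w v)"

definition nabe :: "('e::euclidean_space \<Rightarrow> 'e \<Rightarrow> 'e \<Rightarrow> real) \<Rightarrow> ('e \<Rightarrow> 'e \<Rightarrow> 'e) \<Rightarrow> 'e \<Rightarrow> 'e \<Rightarrow> 'e \<Rightarrow> 'e" where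
  "nabe G J x w u = DD (\<lambda>y. J y u) x w + chr G x w (J x u) - J x (chr G x w u)"

text \<open>For constant coordinate fields the bracket vanishes and \<open>nab\<close> of a constant
  field is a Christoffel term, so this is the curvature tensor.\<close>

definition crv :: "('e::euclidean_space \<Rightarrow> 'e \<Rightarrow> 'e \<Rightarrow> real) \<Rightarrow> 'e \<Rightarrow> 'e \<Rightarrow> 'e \<Rightarrow> 'e \<Rightarrow> 'e" where
  "crv G x u v w = nab G (\<lambda>y. chr G y v w) x u - nab G (\<lambda>y. chr G y u w) x v"

locale loc_riem =
  fixes S :: "'e::euclidean_space set" and G :: "'e \<Rightarrow> 'e \<Rightarrow> 'e \<Rightarrow> real"
  assumes open_S: "open S"
    and inner_G: "x \<in> S \<Longrightarrow> inner_form (G x)"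
    and smooth_G: "Cinf_on S (\<lambda>x. G x u v)"
begin

lemma bil_G: "bil_field S G"
  using inner_G smooth_G by (simp add: bil_field_def inner_form_def)

lemma G_sym: "x \<in> S \<Longrightarrow> G x u v = G x v u"
  using inner_G by (simp add: inner_form_def)

lemma G_add: "x \<in> S \<Longrightarrow> G x (u + v) w = G x u w + G x v w" "x \<in> S \<Longrightarrow> G x w (u + v) = G x w u + G x w v"
  using inner_G by (simp_all add: inner_form_def bilinear_ladd bilinear_radd)

lemma DD_G_sym: "x \<in> S \<Longrightarrow> DD (\<lambda>y. G y u v) x w = DD (\<lambda>y. G y v u) x w"
  by (rule fun_cong[OF frechet_derivative_cong_open[OF open_S]]) (auto simp: G_sym)

lemma lin_DD_G: "x \<in> S \<Longrightarrow> linear (\<lambda>z. DD (\<lambda>y. G y z v) x w)" "x \<in> S \<Longrightarrow> linear (\<lambda>z. DD (\<lambda>y. G y v z) x w)"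
   "x \<in> S \<Longrightarrow> linear (\<lambda>z. DD (\<lambda>y. G y u v) x z)"
  using lin_field_linear_DD[OF open_S bil_field_left[OF bil_G]]
    lin_field_linear_DD[OF open_S bil_field_right[OF bil_G]] linear_DD[OF Cinf_onD[OF smooth_G]]
  by (auto simp: lin_field_def)

lemma koszul_lin_field: "lin_field S (\<lambda>x z. 1 / 2 *
     (DD (\<lambda>y. G y v z) x u + DD (\<lambda>y. G y u z) x v - DD (\<lambda>y. G y u v) x z))"
  unfolding lin_field_def
proof (intro conjI ballI allI)
  fix x assume x: "x \<in> S"
  show "linear (\<lambda>z. 1 / 2 * (DD (\<lambda>y. G y v z) x u + DD (\<lambda>y. G y u z) x v - DD (\<lambda>y. G y u v) x z))"
    by (intro linearI; simp add: linear_add[OF lin_DD_G(2)[OF x]] linear_add[OF lin_DD_G(3)[OF x]]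
       linear_cmul[OF lin_DD_G(2)[OF x]] linear_cmul[OF lin_DD_G(3)[OF x]] algebra_simps)
next
  show "Cinf_on S (\<lambda>x. 1 / 2 * (DD (\<lambda>y. G y v z) x u + DD (\<lambda>y. G y u z) x v - DD (\<lambda>y. G y u v) x z))" for z
    by (intro Cinf_intros Cinf_on_DD smooth_G open_S)
qed

lemma G_chr: "x \<in> S \<Longrightarrow> G x (chr G x u v) z = 1 / 2 *
     (DD (\<lambda>y. G y v z) x u + DD (\<lambda>y. G y u z) x v - DD (\<lambda>y. G y u v) x z)"
  unfolding chr_def using koszul_lin_field[of v u]
  by (subst inner_form_sharp[OF inner_G]) (auto simp: lin_field_def)

lemma chr_sym:
  assumes x: "x \<in> S" shows "chr G x u v = chr G x v u"
proof (rule inner_form_ext[OF inner_G[OF x]])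
  show "G x (chr G x u v) z = G x (chr G x v u) z" for z
    unfolding G_chr[OF x] DD_G_sym[OF x, of u v] by simp
qed

lemma bil_chr: "bil_field S (chr G)"
proof -
  have l: "linear (chr G x u)" if x: "x \<in> S" for x u
  proof -
    have bG: "bilinear (G x)" using inner_G[OF x] by (simp add: inner_form_def)
    show ?thesis
    proof (rule linearI)
      fix v w and r :: real
      show "chr G x u (v + w) = chr G x u v + chr G x u w"
        by (rule inner_form_ext[OF inner_G[OF x]])
           (simp add: G_chr G_add x linear_add[OF lin_DD_G(1)[OF x]] linear_add[OF lin_DD_G(2)[OF x]]
             linear_add[OF lin_DD_G(3)[OF x]] algebra_simps)
      show "chr G x u (r *\<^sub>R v) = r *\<^sub>R chr G x u v"
        by (rule inner_form_ext[OF inner_G[OF x]])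
           (simp add: G_chr x bilinear_lmul[OF bG] linear_cmul[OF lin_DD_G(1)[OF x]] linear_cmul[OF lin_DD_G(2)[OF x]]
             linear_cmul[OF lin_DD_G(3)[OF x]] algebra_simps)
    qed
  qed
  have "linear (\<lambda>u. chr G x u v)" if "x \<in> S" for x v
    using l[OF that, of v] chr_sym[OF that] by (metis (no_types, lifting) ext)
  moreover have "Cinf_on S (\<lambda>x. chr G x u v)" for u v
    unfolding chr_def by (rule sharp_Cinf[OF open_S inner_G smooth_G koszul_lin_field])
  ultimately show ?thesis using l by (simp add: bil_field_def bilinear_def)
qed

lemma smooth_chr: "Cinf_on S (\<lambda>x. chr G x u v)"
  using bil_chr by (simp add: bil_field_def)

lemma lin_chr: "x \<in> S \<Longrightarrow> linear (chr G x u)" "x \<in> S \<Longrightarrow> linear (\<lambda>u. chr G x u v)"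
  using bil_chr by (simp_all add: bil_field_def bilinear_def)

text \<open>The connection is metric: adding the Koszul formulas for \<open>u\<close> and
  \<open>v\<close>, the derivatives in the directions \<open>u\<close> and \<open>v\<close>
  cancel.\<close>

lemma metric_DD:
  assumes x: "x \<in> S" shows "DD (\<lambda>y. G y u v) x w = G x (chr G x w u) v + G x u (chr G x w v)"
  using G_chr[OF x, of w u v] G_chr[OF x, of w v u] DD_G_sym[OF x, of v u w]
    G_sym[OF x, of u "chr G x w v"]
  by simp

lemma nabf_G: "x \<in> S \<Longrightarrow> nabf G G x w u v = 0"
  by (simp add: nabf_def metric_DD)

lemma nab_cong:
  assumes "x \<in> S" "\<And>y. y \<in> S \<Longrightarrow> V y = W y"
  shows "nab G V x w = nab G W x w"
  using frechet_derivative_cong_open[OF open_S assms(1), of V W] assms by (simp add: nab_def)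

lemma nab_const: "nab G (\<lambda>y. u) x w = chr G x w u"
  by (simp add: nab_def)

lemma nab_add:
  assumes "x \<in> S" "Cinf_on S V" "Cinf_on S W"
  shows "nab G (\<lambda>y. V y + W y) x w = nab G V x w + nab G W x w"
  by (simp add: nab_def DD_add Cinf_onD[OF assms(2,1)] Cinf_onD[OF assms(3,1)] linear_add[OF lin_chr(1)[OF assms(1)]])

lemma nab_diff:
  assumes "x \<in> S" "Cinf_on S V" "Cinf_on S W"
  shows "nab G (\<lambda>y. V y - W y) x w = nab G V x w - nab G W x w"
  by (simp add: nab_def DD_diff Cinf_onD[OF assms(2,1)] Cinf_onD[OF assms(3,1)] linear_diff[OF lin_chr(1)[OF assms(1)]])

lemma nab_scaleR:
  assumes "x \<in> S" "Cinf_on S f" "Cinf_on S W"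
  shows "nab G (\<lambda>y. f y *\<^sub>R W y) x w = f x *\<^sub>R nab G W x w + DD f x w *\<^sub>R W x"
  by (simp add: nab_def DD_scaleR Cinf_onD[OF assms(2,1)] Cinf_onD[OF assms(3,1)]
      linear_cmul[OF lin_chr(1)[OF assms(1)]] scaleR_add_right)

lemma lin_nab:
  assumes "Cinf_on S V" shows "lin_field S (nab G V)"
  unfolding lin_field_def
proof (intro conjI ballI allI)
  show "linear (nab G V x)" if "x \<in> S" for x
    unfolding nab_def using linear_compose_add[OF linear_DD[OF Cinf_onD[OF assms that]] lin_chr(2)[OF that]] by simp
  show "Cinf_on S (\<lambda>x. nab G V x w)" for w
    unfolding nab_def by (intro Cinf_intros open_S Cinf_on_DD assms lin_field_Cinf[OF open_S bil_field_right[OF bil_chr]])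
qed

lemma smooth_nab: "Cinf_on S V \<Longrightarrow> Cinf_on S Z \<Longrightarrow> Cinf_on S (\<lambda>x. nab G V x (Z x))"
  by (rule lin_field_Cinf[OF open_S lin_nab])

lemma nab_var:
  assumes "x \<in> S" "Cinf_on S W" "Cinf_on S V"
  shows "nab G (\<lambda>y. nab G W y (V y)) x w = nab G (\<lambda>y. nab G W y (V x)) x w + nab G W x (DD V x w)"
  using lin_field_DD[OF open_S assms(1) lin_nab[OF assms(2)] Cinf_onD[OF assms(3,1)], of w]
  by (simp add: nab_def[of G "\<lambda>y. nab G W y (V y)"] nab_def[of G "\<lambda>y. nab G W y (V x)"])

lemma DD_nabf:
  assumes "x \<in> S" "bil_field S \<psi>" "Cinf_on S U" "Cinf_on S V"
  shows "DD (\<lambda>y. \<psi> y (U y) (V y)) x w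
    = nabf G \<psi> x w (U x) (V x) + \<psi> x (nab G U x w) (V x) + \<psi> x (U x) (nab G V x w)"
proof -
  have "bilinear (\<psi> x)" using assms(1,2) by (simp add: bil_field_def)
  then show ?thesis
    by (simp add: bil_field_DD[OF open_S assms] nabf_def nab_def bilinear_ladd bilinear_radd)
qed

lemma nab_nabe:
  assumes "x \<in> S" "lin_field S J" "Cinf_on S U"
  shows "nab G (\<lambda>y. J y (U y)) x w = nabe G J x w (U x) + J x (nab G U x w)"
proof -
  have "linear (J x)" using assms(1,2) by (simp add: lin_field_def)
  then show ?thesis
    by (simp add: lin_field_DD[OF open_S assms(1,2) Cinf_onD[OF assms(3,1)]] nabe_def nab_def linear_add)
qed

lemma nabf_lin:
  assumes "bil_field S \<psi>"
  shows "lin_field S (\<lambda>x w. nabf G \<psi> x w u v)" "bil_field S (\<lambda>x u v. nabf G \<psi> x w u v)"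
proof -
  have s: "Cinf_on S (\<lambda>x. nabf G \<psi> x w u v)" for w u v
    unfolding nabf_def
    by (intro Cinf_intros open_S Cinf_on_DD bil_field_Cinf[OF open_S assms] smooth_chr)
  have b: "bilinear (\<psi> x)" if "x \<in> S" for x using assms that by (simp add: bil_field_def)
  have l: "linear (\<lambda>w. nabf G \<psi> x w u v)" if x: "x \<in> S" for x u v
  proof -
    have d: "linear (DD (\<lambda>y. \<psi> y u v) x)"
      using assms by (intro linear_DD Cinf_onD[OF _ x]) (simp add: bil_field_def)
    show ?thesis unfolding nabf_def
      by (rule linearI)
         (simp_all add: linear_add[OF d] linear_cmul[OF d] linear_add[OF lin_chr(2)[OF x]]
           linear_cmul[OF lin_chr(2)[OF x]] bilinear_ladd[OF b[OF x]] bilinear_radd[OF b[OF x]]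
           bilinear_lmul[OF b[OF x]] bilinear_rmul[OF b[OF x]] algebra_simps)
  qed
  show "lin_field S (\<lambda>x w. nabf G \<psi> x w u v)" using s l by (simp add: lin_field_def)
  have "linear (\<lambda>u. nabf G \<psi> x w u v) \<and> linear (\<lambda>v. nabf G \<psi> x w u v)" if x: "x \<in> S" for x u v w
  proof -
    have d: "linear (\<lambda>u. DD (\<lambda>y. \<psi> y u v) x w)" "linear (\<lambda>v. DD (\<lambda>y. \<psi> y u v) x w)" for u v
      using lin_field_linear_DD[OF open_S bil_field_left[OF assms]] lin_field_linear_DD[OF open_S bil_field_right[OF assms]] x
      by (simp_all add: lin_field_def)
    show ?thesis unfolding nabf_def
      by (intro conjI linearI)
         (simp_all add: linear_add[OF d(1)] linear_cmul[OF d(1)] linear_add[OF d(2)] linear_cmul[OF d(2)]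
           linear_add[OF lin_chr(1)[OF x]] linear_cmul[OF lin_chr(1)[OF x]]
           bilinear_ladd[OF b[OF x]] bilinear_radd[OF b[OF x]]
           bilinear_lmul[OF b[OF x]] bilinear_rmul[OF b[OF x]] algebra_simps)
  qed
  then show "bil_field S (\<lambda>x u v. nabf G \<psi> x w u v)" using s by (simp add: bil_field_def bilinear_def)
qed

lemma nabf_cong:
  assumes "x \<in> S" "\<And>y u v. y \<in> S \<Longrightarrow> \<psi> y u v = \<phi> y u v"
  shows "nabf G \<psi> x w u v = nabf G \<phi> x w u v"
  using frechet_derivative_cong_open[OF open_S assms(1), of "\<lambda>y. \<psi> y u v" "\<lambda>y. \<phi> y u v"] assms
  by (simp add: nabf_def)

lemma nabf_field:
  assumes "bil_field S \<psi>" "Cinf_on S Z"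
  shows "bil_field S (\<lambda>x u v. nabf G \<psi> x (Z x) u v)"
  using nabf_lin(2)[OF assms(1)] lin_field_Cinf[OF open_S nabf_lin(1)[OF assms(1)] assms(2)]
  by (simp add: bil_field_def)

lemma nabf_var:
  assumes "x \<in> S" "bil_field S \<psi>" "Cinf_on S Z"
  shows "nabf G (\<lambda>y u v. nabf G \<psi> y (Z y) u v) x w a b
    = nabf G (\<lambda>y u v. nabf G \<psi> y (Z x) u v) x w a b + nabf G \<psi> x (DD Z x w) a b"
  using lin_field_DD[OF open_S assms(1) nabf_lin(1)[OF assms(2)] Cinf_onD[OF assms(3,1)], of a b w]
  by (simp add: nabf_def[of G "\<lambda>y u v. nabf G \<psi> y (Z y) u v"] nabf_def[of G "\<lambda>y u v. nabf G \<psi> y (Z x) u v"])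

lemma nabe_lin:
  assumes "lin_field S J"
  shows "lin_field S (\<lambda>x w. nabe G J x w u)" "lin_field S (\<lambda>x u. nabe G J x w u)"
proof -
  have s: "Cinf_on S (\<lambda>x. nabe G J x w u)" for w u
    unfolding nabe_def using assms
    by (intro Cinf_intros open_S Cinf_on_DD lin_field_Cinf[OF open_S assms]
        lin_field_Cinf[OF open_S bil_field_right[OF bil_chr]] smooth_chr)
  have lJ: "linear (J x)" if "x \<in> S" for x using assms that by (simp add: lin_field_def)
  have "linear (\<lambda>w. nabe G J x w u)" if x: "x \<in> S" for x u
  proof -
    have d: "linear (DD (\<lambda>y. J y u) x)"
      using assms by (intro linear_DD Cinf_onD[OF _ x]) (simp add: lin_field_def)
    show ?thesis unfolding nabe_def
      by (rule linearI)
         (simp_all add: linear_add[OF d] linear_cmul[OF d] linear_add[OF lin_chr(2)[OF x]]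
           linear_cmul[OF lin_chr(2)[OF x]] linear_add[OF lJ[OF x]] linear_cmul[OF lJ[OF x]] algebra_simps)
  qed
  then show "lin_field S (\<lambda>x w. nabe G J x w u)" using s by (simp add: lin_field_def)
  have "linear (nabe G J x w)" if x: "x \<in> S" for x w
  proof -
    have d: "linear (\<lambda>u. DD (\<lambda>y. J y u) x w)"
      using lin_field_linear_DD[OF open_S assms] x by (simp add: lin_field_def)
    show ?thesis unfolding nabe_def
      by (rule linearI)
         (simp_all add: linear_add[OF d] linear_cmul[OF d] linear_add[OF lin_chr(1)[OF x]]
           linear_cmul[OF lin_chr(1)[OF x]] linear_add[OF lJ[OF x]] linear_cmul[OF lJ[OF x]] algebra_simps)
  qed
  then show "lin_field S (\<lambda>x u. nabe G J x w u)" using s by (simp add: lin_field_def)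
qed

lemma nabe_field:
  assumes "lin_field S J" "Cinf_on S Z"
  shows "lin_field S (\<lambda>x u. nabe G J x (Z x) u)"
  using nabe_lin(2)[OF assms(1)] lin_field_Cinf[OF open_S nabe_lin(1)[OF assms(1)] assms(2)]
  by (simp add: lin_field_def)

section \<open>Curvature in coordinates\<close>

text \<open>The second derivatives of \<open>W\<close> cancel by symmetry and the first derivatives
  occur symmetrically in \<open>u\<close> and \<open>v\<close>, so only the value of
  \<open>W\<close> at \<open>x\<close> survives.\<close>

lemma nab_nab_const:
  assumes x: "x \<in> S" and W: "Cinf_on S W"
  shows "nab G (\<lambda>y. nab G W y v) x u - nab G (\<lambda>y. nab G W y u) x v = crv G x u v (W x)"
proof -
  have e: "nab G (\<lambda>y. nab G W y v) x u = DD (\<lambda>y. DD W y v) x u + nab G (\<lambda>y. chr G y v (W x)) x u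
      + chr G x v (DD W x u) + chr G x u (DD W x v)" for u v
  proof -
    have "DD (\<lambda>y. nab G W y v) x u = DD (\<lambda>y. DD W y v) x u + DD (\<lambda>y. chr G y v (W y)) x u"
      unfolding nab_def
      by (intro DD_add Cinf_onD[OF Cinf_on_DD[OF W] x] Cinf_onD[OF lin_field_Cinf[OF open_S bil_field_right[OF bil_chr] W] x])
    then show ?thesis
      using lin_field_DD[OF open_S x bil_field_right[OF bil_chr] Cinf_onD[OF W x], of v u]
      by (simp add: nab_def linear_add[OF lin_chr(1)[OF x]])
  qed
  show ?thesis unfolding e crv_def using DD_DD_commute[OF open_S x W, of u v] by simp
qed

lemma nab_nab:
  assumes x: "x \<in> S" and UVW: "Cinf_on S U" "Cinf_on S V" "Cinf_on S W"
  shows "nab G (\<lambda>y. nab G W y (V y)) x (U x) - nab G (\<lambda>y. nab G W y (U y)) x (V x)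
     - nab G W x (DD V x (U x) - DD U x (V x)) = crv G x (U x) (V x) (W x)"
proof -
  have "linear (nab G W x)" using lin_nab[OF UVW(3)] x by (simp add: lin_field_def)
  then show ?thesis
    using nab_nab_const[OF x UVW(3), of "V x" "U x"]
    by (simp add: nab_var[OF x UVW(3)] UVW(1,2) linear_diff)
qed

lemma torsion_free:
  "x \<in> S \<Longrightarrow> nab G V x (U x) - nab G U x (V x) = DD V x (U x) - DD U x (V x)"
  by (simp add: nab_def chr_sym[of x "U x" "V x"])

text \<open>Ricci identity for bilinear forms in constant directions. The terms with a derivative of
  \<open>\<psi>\<close> or with two Christoffel factors are, taken together, symmetric in
  \<open>u\<close> and \<open>v\<close>; the derivatives of the Christoffel terms remain and form
  \<open>crv\<close>.\<close>

lemma nabf_nabf: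
  assumes x: "x \<in> S" and \<psi>: "bil_field S \<psi>"
  shows "nabf G (\<lambda>y a b. nabf G \<psi> y v a b) x u a b - nabf G (\<lambda>y a b. nabf G \<psi> y u a b) x v a b
    = - \<psi> x (crv G x u v a) b - \<psi> x a (crv G x u v b)"
proof -
  have smooth: "Cinf_on S (\<lambda>y. \<psi> y a b)" using \<psi> by (simp add: bil_field_def)
  have bil: "bilinear (\<psi> x)" using \<psi> x by (simp add: bil_field_def)
  have e: "DD (\<lambda>y. nabf G \<psi> y v a b) x u = DD (\<lambda>y. DD (\<lambda>y. \<psi> y a b) y v) x u
     - (nabf G \<psi> x u (chr G x v a) b + \<psi> x (nab G (\<lambda>y. chr G y v a) x u) b + \<psi> x (chr G x v a) (chr G x u b))
     - (nabf G \<psi> x u a (chr G x v b) + \<psi> x (chr G x u a) (chr G x v b) + \<psi> x a (nab G (\<lambda>y. chr G y v b) x u))" for u v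
  proof -
    have "DD (\<lambda>y. nabf G \<psi> y v a b) x u = DD (\<lambda>y. DD (\<lambda>y. \<psi> y a b) y v) x u
       - DD (\<lambda>y. \<psi> y (chr G y v a) b) x u - DD (\<lambda>y. \<psi> y a (chr G y v b)) x u"
    proof -
      have d: "(\<lambda>y. DD (\<lambda>y. \<psi> y a b) y v) differentiable at x" "(\<lambda>y. \<psi> y (chr G y v a) b) differentiable at x"
        "(\<lambda>y. \<psi> y a (chr G y v b)) differentiable at x"
        by (intro Cinf_onD[OF _ x] Cinf_on_DD smooth bil_field_Cinf[OF open_S \<psi>] smooth_chr Cinf_on_const)+
      show ?thesis unfolding nabf_def using d by (simp add: DD_diff)
    qed
    then show ?thesis
      using DD_nabf[OF x \<psi> smooth_chr Cinf_on_const] DD_nabf[OF x \<psi> Cinf_on_const smooth_chr]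
      by (simp add: nab_const)
  qed
  have n: "nabf G (\<lambda>y a b. nabf G \<psi> y v a b) x u a b = DD (\<lambda>y. nabf G \<psi> y v a b) x u
     - nabf G \<psi> x v (chr G x u a) b - nabf G \<psi> x v a (chr G x u b)" for u v
    by (simp add: nabf_def[of G "\<lambda>y a b. nabf G \<psi> y v a b"])
  show ?thesis unfolding n e crv_def
    using DD_DD_commute_real[OF open_S x smooth, of u v]
    by (simp add: bilinear_lsub[OF bil] bilinear_rsub[OF bil])
qed

lemma nabe_nabe:
  assumes x: "x \<in> S" and J: "lin_field S J"
  shows "nabe G (\<lambda>y a. nabe G J y v a) x u a - nabe G (\<lambda>y a. nabe G J y u a) x v a
    = crv G x u v (J x a) - J x (crv G x u v a)"
proof -
  have sJ: "Cinf_on S (\<lambda>y. J y a)" using J by (simp add: lin_field_def)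
  have lJ: "linear (J x)" using J x by (simp add: lin_field_def)
  have e: "nab G (\<lambda>y. nab G (\<lambda>y. J y a) y v) x u = nabe G (\<lambda>y a. nabe G J y v a) x u a
     + nabe G J x v (chr G x u a) + nabe G J x u (chr G x v a) + J x (nab G (\<lambda>y. chr G y v a) x u)" for u v
  proof -
    have "nab G (\<lambda>y. nab G (\<lambda>y. J y a) y v) x u = nab G (\<lambda>y. nabe G J y v a + J y (chr G y v a)) x u"
      by (rule nab_cong[OF x]) (simp add: nab_nabe[OF _ J Cinf_on_const] nab_const)
    also have "\<dots> = nab G (\<lambda>y. nabe G J y v a) x u + nab G (\<lambda>y. J y (chr G y v a)) x u"
      using nabe_lin(1)[OF J] lin_field_Cinf[OF open_S J smooth_chr]
      by (intro nab_add[OF x]) (auto simp: lin_field_def)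
    finally show ?thesis
      using nab_nabe[OF x nabe_lin(2)[OF J] Cinf_on_const] nab_nabe[OF x J smooth_chr]
      by (simp add: nab_const)
  qed
  show ?thesis using nab_nab_const[OF x sJ, of v u] unfolding e crv_def[of G x u v a]
    by (simp add: linear_diff[OF lJ] algebra_simps)
qed

lemma crv_skew: "crv G x u v w = - crv G x v u w"
  by (simp add: crv_def)

lemma crv_bianchi: "x \<in> S \<Longrightarrow> crv G x u v w + crv G x v w u + crv G x w u v = 0"
  using nab_cong[of x "\<lambda>y. chr G y v w" "\<lambda>y. chr G y w v" u] nab_cong[of x "\<lambda>y. chr G y u w" "\<lambda>y. chr G y w u" v]
    nab_cong[of x "\<lambda>y. chr G y u v" "\<lambda>y. chr G y v u" w] chr_sym
  by (simp add: crv_def)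

text \<open>This is the Ricci identity for the metric itself, whose covariant derivative vanishes
  identically.\<close>

lemma crv_metric:
  assumes "x \<in> S" shows "G x (crv G x u v a) b = - G x a (crv G x u v b)"
proof -
  have "nabf G (\<lambda>y a b. nabf G G y v a b) x u a b = 0" for u v
    using nabf_cong[OF assms, of "\<lambda>y a b. nabf G G y v a b" "\<lambda>y a b. 0"] nabf_G by (simp add: nabf_def[of G "\<lambda>y a b. 0"])
  then show ?thesis using nabf_nabf[OF assms bil_G, of v u a b] by simp
qed

lemma lin_crv:
  assumes x: "x \<in> S"
  shows "linear (\<lambda>u. crv G x u v w)" "linear (\<lambda>v. crv G x u v w)" "linear (crv G x u v)"
proof -
  have l1: "linear (nab G (\<lambda>y. chr G y v w) x)" for v w
    using lin_nab[OF smooth_chr] x by (simp add: lin_field_def)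
  have d: "linear (\<lambda>v. DD (\<lambda>y. chr G y v w) x u)" "linear (\<lambda>w. DD (\<lambda>y. chr G y v w) x u)" for u v w
    using lin_field_linear_DD[OF open_S bil_field_left[OF bil_chr]] lin_field_linear_DD[OF open_S bil_field_right[OF bil_chr]] x
    by (simp_all add: lin_field_def)
  have l2: "linear (\<lambda>v. nab G (\<lambda>y. chr G y v w) x u)" for u w
    unfolding nab_def
    by (rule linearI) (simp_all add: linear_add[OF d(1)] linear_cmul[OF d(1)] linear_add[OF lin_chr(1)[OF x]]
       linear_cmul[OF lin_chr(1)[OF x]] linear_add[OF lin_chr(2)[OF x]] linear_cmul[OF lin_chr(2)[OF x]] algebra_simps)
  have l3: "linear (\<lambda>w. nab G (\<lambda>y. chr G y v w) x u)" for u v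
    unfolding nab_def
    by (rule linearI) (simp_all add: linear_add[OF d(2)] linear_cmul[OF d(2)] linear_add[OF lin_chr(1)[OF x]]
       linear_cmul[OF lin_chr(1)[OF x]] algebra_simps)
  show "linear (\<lambda>u. crv G x u v w)" "linear (\<lambda>v. crv G x u v w)" "linear (crv G x u v)"
    unfolding crv_def by (rule linear_compose_sub; fact l1 l2 l3)+
qed

lemma smooth_crv:
  assumes "Cinf_on S U" "Cinf_on S V" "Cinf_on S W"
  shows "Cinf_on S (\<lambda>x. crv G x (U x) (V x) (W x))"
proof -
  have s: "Cinf_on S (\<lambda>x. crv G x u v w)" for u v w
    unfolding crv_def by (intro Cinf_intros open_S smooth_nab smooth_chr Cinf_on_const)
  have "lin_field S (\<lambda>x u. crv G x u v w)" for v w using s lin_crv by (simp add: lin_field_def)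
  from lin_field_Cinf[OF open_S this assms(1)]
  have "lin_field S (\<lambda>x v. crv G x (U x) v w)" for w using lin_crv by (simp add: lin_field_def)
  from lin_field_Cinf[OF open_S this assms(2)]
  have "lin_field S (\<lambda>x w. crv G x (U x) (V x) w)" using lin_crv by (simp add: lin_field_def)
  from lin_field_Cinf[OF open_S this assms(3)] show ?thesis .
qed

text \<open>The second Bianchi identity, in the form of the Jacobi identity for the operators \<open>nab\<close>
  in constant directions.\<close>

lemma crv_jacobi:
  assumes x: "x \<in> S" and W: "Cinf_on S W"
  shows "(nab G (\<lambda>y. crv G y v w (W y)) x u - crv G x v w (nab G W x u))
    + (nab G (\<lambda>y. crv G y w u (W y)) x v - crv G x w u (nab G W x v))
    + (nab G (\<lambda>y. crv G y u v (W y)) x w - crv G x u v (nab G W x w)) = 0"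
proof -
  have s1: "Cinf_on S (\<lambda>y. nab G W y u)" for u by (intro smooth_nab W Cinf_on_const)
  have s2: "Cinf_on S (\<lambda>y. nab G (\<lambda>y. nab G W y u) y v)" for u v by (intro smooth_nab s1 Cinf_on_const)
  have a: "nab G (\<lambda>y. crv G y v w (W y)) x u
     = nab G (\<lambda>y. nab G (\<lambda>y. nab G W y w) y v) x u - nab G (\<lambda>y. nab G (\<lambda>y. nab G W y v) y w) x u" for u v w
    using nab_cong[OF x, of "\<lambda>y. crv G y v w (W y)" "\<lambda>y. nab G (\<lambda>y. nab G W y w) y v - nab G (\<lambda>y. nab G W y v) y w" u]
      nab_nab_const[OF _ W] by (simp add: nab_diff[OF x s2 s2])
  have b: "crv G x v w (nab G W x u)
     = nab G (\<lambda>y. nab G (\<lambda>y. nab G W y u) y w) x v - nab G (\<lambda>y. nab G (\<lambda>y. nab G W y u) y v) x w" for u v w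
    using nab_nab_const[OF x s1] by simp
  show ?thesis unfolding a b by simp
qed

end

section \<open>Changes of coordinates\<close>

text \<open>The map \<open>t\<close> is isometric in the sense that \<open>G\<close> is the pullback
  of \<open>G'\<close>. Surjectivity of its differential allows vectors of the target to be tested
  against images of vectors of the source.\<close>

locale coord_change = src: loc_riem S G + tgt: loc_riem S' G'
  for S :: "'e::euclidean_space set" and G and S' :: "'e set" and G' +
  fixes t :: "'e \<Rightarrow> 'e"
  assumes t_smooth: "Cinf_on S t" and t_into: "x \<in> S \<Longrightarrow> t x \<in> S'"
    and t_surj: "x \<in> S \<Longrightarrow> surj (DD t x)"
    and G_pull: "x \<in> S \<Longrightarrow> G x u v = G' (t x) (DD t x u) (DD t x v)"
begin

lemma lin_Dt: "x \<in> S \<Longrightarrow> linear (DD t x)"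
  using linear_DD[OF Cinf_onD[OF t_smooth]] by simp

lemma Dt_smooth: "Cinf_on S (\<lambda>y. DD t y u)"
  using t_smooth by (rule Cinf_on_DD)

lemma lin_field_Dt: "lin_field S (DD t)"
  using lin_Dt Dt_smooth by (simp add: lin_field_def)

lemma DD_pull:
  assumes x: "x \<in> S" and f: "Cinf_on S' f"
  shows "DD (\<lambda>y. f (t y)) x w = DD f (t x) (DD t x w)"
  by (rule DD_compose[OF Cinf_onD[OF t_smooth x] Cinf_onD[OF f t_into[OF x]]])

lemma smooth_pull: "Cinf_on S' f \<Longrightarrow> Cinf_on S (\<lambda>y. f (t y))"
  by (rule Cinf_on_compose[OF src.open_S tgt.open_S _ t_smooth]) (auto simp: t_into)

lemma DD_pull_form:
  assumes x: "x \<in> S" and \<psi>: "bil_field S' \<psi>"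
    and pull: "\<And>y u v. y \<in> S \<Longrightarrow> \<phi> y u v = \<psi> (t y) (DD t y u) (DD t y v)"
  shows "DD (\<lambda>y. \<phi> y u v) x w = DD (\<lambda>z. \<psi> z (DD t x u) (DD t x v)) (t x) (DD t x w)
    + \<psi> (t x) (DD (\<lambda>y. DD t y u) x w) (DD t x v) + \<psi> (t x) (DD t x u) (DD (\<lambda>y. DD t y v) x w)"
proof -
  have bil: "bil_field S (\<lambda>y. \<psi> (t y))"
    using \<psi> t_into smooth_pull[of "\<lambda>z. \<psi> z u v" for u v] by (simp add: bil_field_def)
  have "DD (\<lambda>y. \<phi> y u v) x w = DD (\<lambda>y. \<psi> (t y) (DD t y u) (DD t y v)) x w"
    by (rule fun_cong[OF frechet_derivative_cong_open[OF src.open_S x]]) (simp add: pull)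
  also have "\<dots> = DD (\<lambda>y. \<psi> (t y) (DD t x u) (DD t x v)) x w
    + \<psi> (t x) (DD (\<lambda>y. DD t y u) x w) (DD t x v) + \<psi> (t x) (DD t x u) (DD (\<lambda>y. DD t y v) x w)"
    by (rule bil_field_DD[OF src.open_S x bil Dt_smooth Dt_smooth])
  finally show ?thesis using DD_pull[OF x, of "\<lambda>z. \<psi> z (DD t x u) (DD t x v)"] \<psi>
    by (simp add: bil_field_def)
qed

text \<open>The inhomogeneous transformation law. Paired with the image of a vector
  \<open>z\<close>, both sides become Koszul formulas. Pulling back the derivatives of
  \<open>G'\<close> produces six terms with second derivatives of \<open>t\<close>; two of them add
  up and the other four cancel by symmetry of second derivatives.\<close>

lemma chr_transform:
  assumes x: "x \<in> S"
  shows "DD t x (chr G x w u) = chr G' (t x) (DD t x w) (DD t x u) + DD (\<lambda>y. DD t y u) x w"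
proof (rule inner_form_ext[OF tgt.inner_G[OF t_into[OF x]]])
  fix z'
  obtain z where z: "z' = DD t x z" using t_surj[OF x] by blast
  note D = DD_pull_form[OF x tgt.bil_G, of G, OF G_pull]
  note sym2 = DD_DD_commute[OF src.open_S x t_smooth]
  note sym = tgt.G_sym[OF t_into[OF x]]
  have "G' (t x) (DD t x (chr G x w u)) z' = G x (chr G x w u) z"
    unfolding z by (simp add: G_pull[OF x])
  also have "\<dots> = 1 / 2 * (DD (\<lambda>y. G y u z) x w + DD (\<lambda>y. G y w z) x u - DD (\<lambda>y. G y w u) x z)"
    by (rule src.G_chr[OF x])
  also have "\<dots> = G' (t x) (chr G' (t x) (DD t x w) (DD t x u)) z' + G' (t x) (DD (\<lambda>y. DD t y u) x w) z'"
    unfolding z tgt.G_chr[OF t_into[OF x]]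
    using D[of u z w] D[of w z u] D[of w u z] sym2[of w z] sym2[of u z] sym2[of w u]
      sym[of "DD t x u"] sym[of "DD t x w"]
    by (simp add: algebra_simps)
  finally show "G' (t x) (DD t x (chr G x w u)) z'
      = G' (t x) (chr G' (t x) (DD t x w) (DD t x u) + DD (\<lambda>y. DD t y u) x w) z'"
    by (simp add: tgt.G_add t_into x)
qed

lemma nab_transform:
  assumes x: "x \<in> S" and V: "Cinf_on S V" and V': "Cinf_on S' V'"
    and VV': "\<And>y. y \<in> S \<Longrightarrow> V' (t y) = DD t y (V y)"
  shows "nab G' V' (t x) (DD t x w) = DD t x (nab G V x w)"
proof -
  have "DD V' (t x) (DD t x w) = DD (\<lambda>y. DD t y (V y)) x w"
    using DD_pull[OF x V'] frechet_derivative_cong_open[OF src.open_S x VV'] by simp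
  also have "\<dots> = DD (\<lambda>y. DD t y (V x)) x w + DD t x (DD V x w)"
    by (rule lin_field_DD[OF src.open_S x lin_field_Dt Cinf_onD[OF V x]])
  finally show ?thesis
    by (simp add: nab_def linear_add[OF lin_Dt[OF x]] chr_transform[OF x] VV'[OF x])
qed

lemma nabf_transform:
  assumes x: "x \<in> S" and \<psi>: "bil_field S' \<psi>"
    and pull: "\<And>y u v. y \<in> S \<Longrightarrow> \<phi> y u v = \<psi> (t y) (DD t y u) (DD t y v)"
  shows "nabf G' \<psi> (t x) (DD t x w) (DD t x u) (DD t x v) = nabf G \<phi> x w u v"
proof -
  have "bilinear (\<psi> (t x))" using \<psi> t_into x by (simp add: bil_field_def)
  then show ?thesis
    by (simp add: nabf_def DD_pull_form[OF x \<psi> pull] pull[OF x] chr_transform[OF x] bilinear_ladd bilinear_radd)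
qed

lemma nabe_transform:
  assumes x: "x \<in> S" and J: "lin_field S J" and J': "lin_field S' J'"
    and JJ': "\<And>y u. y \<in> S \<Longrightarrow> J' (t y) (DD t y u) = DD t y (J y u)"
  shows "nabe G' J' (t x) (DD t x w) (DD t x u) = DD t x (nabe G J x w u)"
proof -
  have lin: "lin_field S (\<lambda>y. J' (t y))" using J' t_into smooth_pull[of "\<lambda>z. J' z u" for u] by (simp add: lin_field_def)
  have sJ: "Cinf_on S (\<lambda>y. J y u)" using J by (simp add: lin_field_def)
  have lJ': "linear (J' (t x))" using J' t_into x by (simp add: lin_field_def)
  have "DD (\<lambda>y. J' (t y) (DD t x u)) x w + J' (t x) (DD (\<lambda>y. DD t y u) x w) = DD (\<lambda>y. J' (t y) (DD t y u)) x w"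
    by (rule lin_field_DD[OF src.open_S x lin Cinf_onD[OF Dt_smooth x], symmetric])
  also have "\<dots> = DD (\<lambda>y. DD t y (J y u)) x w"
    by (rule fun_cong[OF frechet_derivative_cong_open[OF src.open_S x]]) (rule JJ')
  also have "\<dots> = DD (\<lambda>y. DD t y (J x u)) x w + DD t x (DD (\<lambda>y. J y u) x w)"
    by (rule lin_field_DD[OF src.open_S x lin_field_Dt Cinf_onD[OF sJ x]])
  finally have "DD (\<lambda>z. J' z (DD t x u)) (t x) (DD t x w) + J' (t x) (DD (\<lambda>y. DD t y u) x w)
      = DD (\<lambda>y. DD t y (J x u)) x w + DD t x (DD (\<lambda>y. J y u) x w)"
    using DD_pull[OF x, of "\<lambda>z. J' z (DD t x u)"] J' by (simp add: lin_field_def)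
  moreover have "DD t x (J x (chr G x w u))
      = J' (t x) (chr G' (t x) (DD t x w) (DD t x u)) + J' (t x) (DD (\<lambda>y. DD t y u) x w)"
    by (simp add: JJ'[OF x, symmetric] chr_transform[OF x] linear_add[OF lJ'])
  ultimately show ?thesis
    by (simp add: nabe_def JJ'[OF x] linear_add[OF lin_Dt[OF x]] linear_diff[OF lin_Dt[OF x]]
        chr_transform[OF x] algebra_simps)
qed

end

section \<open>Quaternionic linear algebra\<close>

locale quat_alg =
  fixes h :: "'e::euclidean_space \<Rightarrow> 'e \<Rightarrow> real" and I J K :: "'e \<Rightarrow> 'e" and n :: nat
  assumes inner_h: "inner_form h"
    and lin_I: "linear I" and lin_J: "linear J" and lin_K: "linear K"
    and I_orth: "h (I u) (I v) = h u v" and J_orth: "h (J u) (J v) = h u v" and K_orth: "h (K u) (K v) = h u v"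
    and II: "I (I v) = - v" and JJ: "J (J v) = - v" and KK: "K (K v) = - v"
    and IJ: "I (J v) = K v" and JI: "J (I v) = - K v"
    and JK: "J (K v) = I v" and KJ: "K (J v) = - I v"
    and KI: "K (I v) = J v" and IK: "I (K v) = - J v"
    and dim: "DIM('e) = 4 * n" and n2: "n \<ge> 2"
begin

text \<open>Facts proved for \<open>I\<close> are carried to \<open>J\<close> and \<open>K\<close>
  by interpreting the locale in rotated form; one equation for three unknowns then becomes a cyclic
  linear system.\<close>

lemma cyclic: "quat_alg h J K I n"
  using quat_alg_axioms unfolding quat_alg_def by simp

lemmas Jmul = II JJ KK IJ JI JK KJ KI IK

lemma bil_h: "bilinear h" using inner_h by (simp add: inner_form_def)

lemma h_sym: "h u v = h v u" using inner_h by (simp add: inner_form_def)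

lemmas h_lin = bilinear_ladd[OF bil_h] bilinear_radd[OF bil_h] bilinear_lmul[OF bil_h] bilinear_rmul[OF bil_h]
  bilinear_lneg[OF bil_h] bilinear_rneg[OF bil_h] bilinear_lsub[OF bil_h] bilinear_rsub[OF bil_h]
  bilinear_lzero[OF bil_h] bilinear_rzero[OF bil_h]

lemmas J_lin = linear_add[OF lin_I] linear_add[OF lin_J] linear_add[OF lin_K]
  linear_cmul[OF lin_I] linear_cmul[OF lin_J] linear_cmul[OF lin_K]
  linear_neg[OF lin_I] linear_neg[OF lin_J] linear_neg[OF lin_K]
  linear_diff[OF lin_I] linear_diff[OF lin_J] linear_diff[OF lin_K]

lemma h_I: "h u (I v) = - h (I u) v" using I_orth[of u "I v"] by (simp add: II h_lin)

lemma h_J: "h u (J v) = - h (J u) v" using J_orth[of u "J v"] by (simp add: JJ h_lin)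

lemma h_K: "h u (K v) = - h (K u) v" using K_orth[of u "K v"] by (simp add: KK h_lin)

lemmas qs = Jmul h_lin J_lin h_I h_J h_K

lemma h_skew: "h (I u) v = - h (I v) u" "h (J u) v = - h (J v) u" "h (K u) v = - h (K v) u"
  using h_I[of v u] h_J[of v u] h_K[of v u] h_sym by (simp_all add: h_sym)

lemma h_self: "h (I u) u = 0" "h (J u) u = 0" "h (K u) u = 0"
  using h_skew[of u u] by simp_all

abbreviation e :: "'e \<Rightarrow> 'e" where "e \<equiv> frame h"

lemma frame_e: "orthonormal_frame h e" by (rule orthonormal_frame_frame[OF inner_h])

lemma contract:
  fixes f :: "'e \<Rightarrow> real"
  assumes "linear f" shows "(\<Sum>b\<in>Basis. h v (e b) * f (e b)) = f v"
  using frame_contract[OF inner_h frame_e assms] by simp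

definition tr :: "('e \<Rightarrow> 'e \<Rightarrow> real) \<Rightarrow> real" where
  "tr t = (\<Sum>b\<in>Basis. t (e b) (e b))"

lemma tr_add: "tr (\<lambda>x y. s x y + t x y) = tr s + tr t" by (simp add: tr_def sum.distrib)
lemma tr_diff: "tr (\<lambda>x y. s x y - t x y) = tr s - tr t" by (simp add: tr_def sum_subtractf)
lemma tr_neg: "tr (\<lambda>x y. - t x y) = - tr t" by (simp add: tr_def sum_negf)
lemma tr_cmul: "tr (\<lambda>x y. c * t x y) = c * tr t" by (simp add: tr_def sum_distrib_left)
lemma tr_mulc: "tr (\<lambda>x y. t x y * c) = tr t * c" by (simp add: tr_def sum_distrib_right)
lemma tr_zero: "tr (\<lambda>x y. 0) = 0" by (simp add: tr_def)

lemmas tr_simps = tr_add tr_diff tr_neg tr_cmul tr_mulc tr_zero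

lemma tr_h: "tr h = 4 * real n"
proof -
  have "tr h = (\<Sum>b\<in>(Basis :: 'e set). 1)"
    unfolding tr_def using frame_e by (intro sum.cong) (auto simp: orthonormal_frame_def)
  then show ?thesis using dim by simp
qed

lemma tr_hJ: "tr (\<lambda>x y. h (I x) y) = 0" "tr (\<lambda>x y. h (J x) y) = 0" "tr (\<lambda>x y. h (K x) y) = 0"
  by (simp_all add: tr_def h_self)

lemma tr_contract: "linear f \<Longrightarrow> tr (\<lambda>x y. h v x * f y) = f v" "linear f \<Longrightarrow> tr (\<lambda>x y. f x * h v y) = f v"
  using contract[of f v] by (simp_all add: tr_def mult.commute)

text \<open>Expanding in the frame turns each side into a double sum over the matrix entries of
  \<open>A\<close> and of its adjoint, and the two sums differ by an exchange of indices.\<close>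

lemma tr_adjoint:
  assumes t: "bilinear t" and A: "linear A" "linear B" "\<And>u v. h (A u) v = h u (B v)"
  shows "tr (\<lambda>x y. t (A x) y) = tr (\<lambda>x y. t x (B y))"
proof -
  have l: "linear (\<lambda>u. t u v)" "linear (\<lambda>u. t v u)" "linear (\<lambda>u. t v (B u))" for v
    using t linear_compose[OF A(2)] by (auto simp: bilinear_def o_def)
  have "tr (\<lambda>x y. t (A x) y) = (\<Sum>b\<in>Basis. \<Sum>c\<in>Basis. h (A (e b)) (e c) * t (e c) (e b))"
    unfolding tr_def using contract[OF l(1)] by simp
  also have "\<dots> = (\<Sum>c\<in>Basis. \<Sum>b\<in>Basis. h (B (e c)) (e b) * t (e c) (e b))"
    using A(3) h_sym by (subst sum.swap) (intro sum.cong refl, metis)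
  also have "\<dots> = tr (\<lambda>x y. t x (B y))"
    unfolding tr_def using contract[OF l(2)] by simp
  finally show ?thesis .
qed

lemma tr_I: "bilinear t \<Longrightarrow> tr (\<lambda>x y. t (I x) y) = - tr (\<lambda>x y. t x (I y))"
  "bilinear t \<Longrightarrow> tr (\<lambda>x y. t (J x) y) = - tr (\<lambda>x y. t x (J y))"
  "bilinear t \<Longrightarrow> tr (\<lambda>x y. t (K x) y) = - tr (\<lambda>x y. t x (K y))"
  using tr_adjoint[OF _ lin_I linear_compose_neg[OF lin_I], of t] tr_adjoint[OF _ lin_J linear_compose_neg[OF lin_J], of t]
    tr_adjoint[OF _ lin_K linear_compose_neg[OF lin_K], of t]
  by (simp_all add: qs bilinear_rneg tr_neg)

lemma bil_compose: "bilinear t \<Longrightarrow> linear A \<Longrightarrow> linear B \<Longrightarrow> bilinear (\<lambda>x y. t (A x) (B y))"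
  unfolding bilinear_def using linear_compose[of A "\<lambda>x. t x v" for v] linear_compose[of B "t u" for u]
  by (auto simp: o_def)

lemma tr_inv:
  assumes "bilinear t"
  shows "tr (\<lambda>x y. t (I x) (I y)) = tr t" "tr (\<lambda>x y. t (J x) (J y)) = tr t" "tr (\<lambda>x y. t (K x) (K y)) = tr t"
  using tr_I(1)[OF bil_compose[OF assms linear_id lin_I]] tr_I(2)[OF bil_compose[OF assms linear_id lin_J]]
    tr_I(3)[OF bil_compose[OF assms linear_id lin_K]] assms
  by (simp_all add: Jmul bilinear_rneg tr_neg)

text \<open>Membership in \<open>S\<^sup>2H \<oplus> S\<^sup>2E\<close>; the numbers \<open>a, b, c\<close> are the coefficients of the \<open>S\<^sup>2H\<close> part in the
  basis of Kaehler forms.\<close>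

definition cpt :: "real \<Rightarrow> real \<Rightarrow> real \<Rightarrow> ('e \<Rightarrow> 'e \<Rightarrow> real) \<Rightarrow> bool" where
  "cpt a b c \<psi> \<longleftrightarrow> bilinear \<psi> \<and> (\<forall>u v. \<psi> u v = - \<psi> v u)
    \<and> (\<forall>u v. \<psi> (I u) (I v) = \<psi> u v - 2 * (b * h (J u) v + c * h (K u) v))
    \<and> (\<forall>u v. \<psi> (J u) (J v) = \<psi> u v - 2 * (c * h (K u) v + a * h (I u) v))
    \<and> (\<forall>u v. \<psi> (K u) (K v) = \<psi> u v - 2 * (a * h (I u) v + b * h (J u) v))"

lemma cptD:
  assumes "cpt a b c \<psi>"
  shows "bilinear \<psi>" "\<psi> u v = - \<psi> v u"
    "\<psi> (I u) (I v) = \<psi> u v - 2 * (b * h (J u) v + c * h (K u) v)"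
    "\<psi> (J u) (J v) = \<psi> u v - 2 * (c * h (K u) v + a * h (I u) v)"
    "\<psi> (K u) (K v) = \<psi> u v - 2 * (a * h (I u) v + b * h (J u) v)"
  using assms unfolding cpt_def by blast+

lemma cpt_cyclic: "cpt a b c \<psi> \<longleftrightarrow> quat_alg.cpt h J K I b c a \<psi>"
  unfolding cpt_def quat_alg.cpt_def[OF cyclic] by auto

text \<open>The trace is invariant under \<open>J\<close>, but \<open>J\<close> anticommutes with
  \<open>I\<close>; comparing the two by means of the compatibility rule for \<open>J\<close>
  isolates \<open>a\<close>.\<close>

lemma cpt_coeff1:
  assumes "cpt a b c \<psi>"
  shows "4 * real n * a = tr (\<lambda>x y. \<psi> x (I y))"
proof -
  note bil = cptD(1)[OF assms]
  have "tr (\<lambda>x y. \<psi> x (I y)) = tr (\<lambda>x y. \<psi> (J x) (I (J y)))"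
    using tr_inv(2)[OF bil_compose[OF bil linear_id lin_I]] by simp
  also have "\<dots> = - tr (\<lambda>x y. \<psi> (J x) (J (I y)))"
    by (simp add: Jmul bilinear_rneg[OF bil] tr_neg)
  also have "\<dots> = - tr (\<lambda>x y. \<psi> x (I y) - 2 * (c * h (K x) (I y) + a * h (I x) (I y)))"
    unfolding cptD(4)[OF assms] ..
  also have "\<dots> = - tr (\<lambda>x y. \<psi> x (I y)) + 2 * a * (4 * real n)"
    by (simp add: tr_simps qs tr_h tr_hJ)
  finally show ?thesis by simp
qed

lemma cpt_coeff:
  assumes "cpt a b c \<psi>"
  shows "a = tr (\<lambda>x y. \<psi> x (I y)) / (4 * real n)" "b = tr (\<lambda>x y. \<psi> x (J y)) / (4 * real n)"
    "c = tr (\<lambda>x y. \<psi> x (K y)) / (4 * real n)"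
proof -
  interpret q1: quat_alg h J K I n by (rule cyclic)
  interpret q2: quat_alg h K I J n by (rule q1.cyclic)
  have 1: "q1.cpt b c a \<psi>" using assms cpt_cyclic by simp
  then have 2: "q2.cpt c a b \<psi>" using q1.cpt_cyclic by simp
  show "a = tr (\<lambda>x y. \<psi> x (I y)) / (4 * real n)" "b = tr (\<lambda>x y. \<psi> x (J y)) / (4 * real n)"
    "c = tr (\<lambda>x y. \<psi> x (K y)) / (4 * real n)"
    using cpt_coeff1[OF assms] q1.cpt_coeff1[OF 1] q2.cpt_coeff1[OF 2] n2 by (simp_all add: field_simps)
qed

lemma cptI:
  assumes "bilinear \<psi>" "\<And>u v. \<psi> u v = - \<psi> v u"
    "\<And>u v. \<psi> (I u) (I v) = \<psi> u v - 2 * (b * h (J u) v + c * h (K u) v)"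
    "\<And>u v. \<psi> (J u) (J v) = \<psi> u v - 2 * (c * h (K u) v + a * h (I u) v)"
    "\<And>u v. \<psi> (K u) (K v) = \<psi> u v - 2 * (a * h (I u) v + b * h (J u) v)"
  shows "cpt a b c \<psi>"
  unfolding cpt_def by (intro conjI allI; fact assms)

lemma cpt_add:
  assumes "cpt a b c \<psi>" "cpt a' b' c' \<phi>"
  shows "cpt (a + a') (b + b') (c + c') (\<lambda>u v. \<psi> u v + \<phi> u v)"
proof (rule cptI)
  show "bilinear (\<lambda>u v. \<psi> u v + \<phi> u v)"
    using cptD(1)[OF assms(1)] cptD(1)[OF assms(2)] by (auto simp: bilinear_def intro: linear_compose_add)
  show "\<psi> u v + \<phi> u v = - (\<psi> v u + \<phi> v u)" for u v
    using cptD(2)[OF assms(1), of u v] cptD(2)[OF assms(2), of u v] by simp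
qed (simp_all add: cptD(3-5)[OF assms(1)] cptD(3-5)[OF assms(2)] algebra_simps)

lemma cpt_cmul:
  assumes "cpt a b c \<psi>" shows "cpt (r * a) (r * b) (r * c) (\<lambda>u v. r * \<psi> u v)"
proof (rule cptI)
  note bil = cptD(1)[OF assms]
  show "bilinear (\<lambda>u v. r * \<psi> u v)"
    unfolding bilinear_def by (auto intro!: linearI simp: bilinear_ladd[OF bil] bilinear_radd[OF bil]
      bilinear_lmul[OF bil] bilinear_rmul[OF bil] algebra_simps)
  show "r * \<psi> u v = - (r * \<psi> v u)" for u v
    using cptD(2)[OF assms, of u v] by simp
qed (simp_all add: cptD(3-5)[OF assms] algebra_simps)

subsection \<open>The form \<open>X \<and> Z + \<Sum> J\<^sub>i X \<and> J\<^sub>i Z - \<Sum> \<omega>\<^sub>i(X,Z) \<omega>\<^sub>i\<close>\<close>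

definition BB :: "'e \<Rightarrow> 'e \<Rightarrow> 'e \<Rightarrow> 'e \<Rightarrow> real" where
  "BB X Z u v = h X u * h Z v - h Z u * h X v
    + (h (I X) u * h (I Z) v - h (I Z) u * h (I X) v)
    + (h (J X) u * h (J Z) v - h (J Z) u * h (J X) v)
    + (h (K X) u * h (K Z) v - h (K Z) u * h (K X) v)
    - (h (I X) Z * h (I u) v + h (J X) Z * h (J u) v + h (K X) Z * h (K u) v)"

lemma linear_h: "linear (\<lambda>u. h u v)" "linear (h v)" using bil_h by (simp_all add: bilinear_def)

lemma BB_lin:
  "BB (X + Y) Z u v = BB X Z u v + BB Y Z u v" "BB (r *\<^sub>R X) Z u v = r * BB X Z u v"
  "BB X (Y + Z) u v = BB X Y u v + BB X Z u v" "BB X (r *\<^sub>R Z) u v = r * BB X Z u v"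
  "BB X Z (u + w) v = BB X Z u v + BB X Z w v" "BB X Z (r *\<^sub>R u) v = r * BB X Z u v"
  "BB X Z u (v + w) = BB X Z u v + BB X Z u w" "BB X Z u (r *\<^sub>R v) = r * BB X Z u v"
  unfolding BB_def by (simp_all add: qs algebra_simps)

text \<open>Composition with \<open>I\<close>, \<open>J\<close> or \<open>K\<close> only permutes
  the four wedge products, so their sum lies in S^2E; the S^2H part is the last term of
  \<open>BB\<close>, whose coefficients are those displayed.\<close>

lemma BB_cpt: "cpt (- h (I X) Z) (- h (J X) Z) (- h (K X) Z) (BB X Z)"
proof -
  have "bilinear (BB X Z)" unfolding bilinear_def by (auto intro!: linearI simp: BB_lin)
  moreover have "BB X Z u v = - BB X Z v u" for u v
    unfolding BB_def using h_skew[of u v] by (simp add: algebra_simps)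
  ultimately show ?thesis
    unfolding cpt_def by (intro conjI allI) (simp_all add: BB_def qs algebra_simps)
qed

text \<open>The contributions of the wedge products with \<open>I\<close>, \<open>J\<close>,
  \<open>K\<close> cancel against those of the last term of \<open>BB\<close>, so the contraction is
  the one of \<open>X \<and> Z\<close> alone.\<close>

lemma BB_contract: "(\<Sum>b\<in>Basis. BB X (e b) (e b) v) = (1 - 4 * real n) * h X v"
proof -
  have l: "linear (\<lambda>y. h y v)" "linear (\<lambda>y. h (I y) v)" "linear (\<lambda>y. h (J y) v)" "linear (\<lambda>y. h (K y) v)"
    by (auto intro!: linearI simp: qs)
  have "(\<Sum>b\<in>Basis. BB X (e b) (e b) v) = tr (\<lambda>x y. BB X x y v)" by (simp add: tr_def)
  also have "\<dots> = tr (\<lambda>x y. h X y * h x v) - tr h * h X v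
    + (tr (\<lambda>x y. h (I X) y * h (I x) v) - tr (\<lambda>x y. h (I x) y) * h (I X) v)
    + (tr (\<lambda>x y. h (J X) y * h (J x) v) - tr (\<lambda>x y. h (J x) y) * h (J X) v)
    + (tr (\<lambda>x y. h (K X) y * h (K x) v) - tr (\<lambda>x y. h (K x) y) * h (K X) v)
    - (tr (\<lambda>x y. h (I X) x * h (I y) v) + tr (\<lambda>x y. h (J X) x * h (J y) v) + tr (\<lambda>x y. h (K X) x * h (K y) v))"
    unfolding BB_def by (simp add: tr_simps)
  also have "\<dots> = (1 - 4 * real n) * h X v"
    using tr_contract(2)[OF l(1), of X] tr_contract(2)[OF l(2), of "I X"] tr_contract(2)[OF l(3), of "J X"]
      tr_contract(2)[OF l(4), of "K X"] tr_contract(1)[OF l(2), of "I X"] tr_contract(1)[OF l(3), of "J X"]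
      tr_contract(1)[OF l(4), of "K X"]
    by (simp add: tr_h tr_hJ Jmul h_lin mult.commute right_diff_distrib)
  finally show ?thesis .
qed

text \<open>Beyond \<open>X \<and> Z\<close>, the value of \<open>BB X Z u v\<close> is minus that
  of the 3-form \<open>\<Sum> (J\<^sub>i X) \<and> \<omega>\<^sub>i\<close> on \<open>Z\<close>,
  \<open>u\<close>, \<open>v\<close>.\<close>

lemma BB_skew: "BB X Z u v - (h X u * h Z v - h Z u * h X v) = - (BB X u Z v - (h X Z * h u v - h u Z * h X v))"
  unfolding BB_def using h_skew(1)[of Z u] h_skew(2)[of Z u] h_skew(3)[of Z u] by (simp add: algebra_simps)

subsection \<open>Three-forms with compatible contractions vanish\<close>

text \<open>As for the Koszul formula: compatibility evaluates the sum of the two insertions of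
  \<open>I\<close> into \<open>\<sigma> Z\<close>, and combining three such sums with the arguments
  exchanged solves for \<open>\<sigma> Z u (I v)\<close> in terms of the coefficients. The trace of
  that formula is the linear relation.\<close>

lemma three_form_coeff:
  assumes lin: "\<And>u v. linear (\<lambda>Z. \<sigma> Z u v)" and skew: "\<And>Z u v. \<sigma> Z u v = - \<sigma> Z v u" "\<And>Z u v. \<sigma> Z u v = - \<sigma> u Z v"
    and c: "\<And>Z. cpt (a Z) (b Z) (c Z) (\<sigma> Z)"
  shows "2 * real n * a (I Z) = b (J Z) + c (K Z)"
    and "2 * \<sigma> Z u (I v) = 2 * (c Z * h (J u) v - b Z * h (K u) v) - 2 * (c u * h (J Z) v - b u * h (K Z) v)
       - 2 * (c v * h (J Z) u - b v * h (K Z) u)"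
proof -
  have bil: "bilinear (\<sigma> Z)" for Z using c cptD(1) by blast
  have F: "\<sigma> Z (I u) v + \<sigma> Z u (I v) = 2 * (c Z * h (J u) v - b Z * h (K u) v)" for Z u v
    using cptD(3)[OF c, of Z u "I v"] by (simp add: qs bilinear_rneg[OF bil] algebra_simps)
  show P: "2 * \<sigma> Z u (I v) = 2 * (c Z * h (J u) v - b Z * h (K u) v) - 2 * (c u * h (J Z) v - b u * h (K Z) v)
       - 2 * (c v * h (J Z) u - b v * h (K Z) u)" for Z u v
    using F[of Z u v] F[of u Z v] F[of v Z u] skew(2)[of "I Z" u v] skew(2)[of Z u "I v"]
      skew(1)[of "I Z" u v] skew(2)[of v "I Z" u] skew(1)[of Z "I u" v] skew(2)[of v Z "I u"]
    by linarith
  \<comment> \<open>The coefficients are given by traces and are therefore linear in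
    \<open>Z\<close>.\<close>
  have lc: "linear c" "linear b"
  proof -
    have "linear (\<lambda>Z. tr (\<lambda>x y. \<sigma> Z x (A y)) / (4 * real n))" for A
      unfolding tr_def by (rule linearI)
        (simp_all add: linear_add[OF lin] linear_cmul[OF lin] sum.distrib add_divide_distrib sum_distrib_left)
    then show "linear c" "linear b" using cpt_coeff[OF c] by (metis (no_types, lifting) ext)+
  qed
  have t: "tr (\<lambda>x y. c x * h (J Z) y) = c (J Z)" "tr (\<lambda>x y. b x * h (K Z) y) = b (K Z)"
    "tr (\<lambda>x y. c y * h (J Z) x) = c (J Z)" "tr (\<lambda>x y. b y * h (K Z) x) = b (K Z)" for Z
    using tr_contract(2)[OF lc(1), of "J Z"] tr_contract(2)[OF lc(2), of "K Z"] tr_contract(1)[OF lc(1), of "J Z"]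
      tr_contract(1)[OF lc(2), of "K Z"] by (simp_all add: mult.commute)
  have "8 * real n * a Z = tr (\<lambda>x y. 2 * \<sigma> Z x (I y))" for Z
    using cpt_coeff1[OF c, of Z] by (simp add: tr_simps)
  also have "\<dots> Z = - 4 * (c (J Z) - b (K Z))" for Z
    unfolding P by (simp add: tr_simps tr_hJ t)
  finally have "8 * real n * a (I Z) = - 4 * (c (J (I Z)) - b (K (I Z)))" .
  then show "2 * real n * a (I Z) = b (J Z) + c (K Z)"
    by (simp add: Jmul linear_neg[OF lc(1)])
qed

text \<open>The three rotated relations among the coefficients have only the zero solution. Without
  coefficients the formula for \<open>\<sigma> Z u (I v)\<close> vanishes, and every vector is of
  the form \<open>I v\<close>.\<close>

lemma three_form_zero:
  assumes lin: "\<And>u v. linear (\<lambda>Z. \<sigma> Z u v)" and skew: "\<And>Z u v. \<sigma> Z u v = - \<sigma> Z v u" "\<And>Z u v. \<sigma> Z u v = - \<sigma> u Z v"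
    and c: "\<And>Z. cpt (a Z) (b Z) (c Z) (\<sigma> Z)"
  shows "\<sigma> Z u v = 0"
proof -
  interpret q1: quat_alg h J K I n by (rule cyclic)
  interpret q2: quat_alg h K I J n by (rule q1.cyclic)
  have c1: "q1.cpt (b Z) (c Z) (a Z) (\<sigma> Z)" for Z using c cpt_cyclic by simp
  then have c2: "q2.cpt (c Z) (a Z) (b Z) (\<sigma> Z)" for Z using q1.cpt_cyclic by simp
  have e: "2 * real n * a (I Z) = b (J Z) + c (K Z)" "2 * real n * b (J Z) = c (K Z) + a (I Z)"
     "2 * real n * c (K Z) = a (I Z) + b (J Z)" for Z
    using three_form_coeff(1)[OF lin skew c] q1.three_form_coeff(1)[OF lin skew c1]
      q2.three_form_coeff(1)[OF lin skew c2] by auto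
  have z: "a (I Z) = 0 \<and> b (J Z) = 0 \<and> c (K Z) = 0" for Z
  proof -
    \<comment> \<open>The sum of the three relations carries the factor \<open>2n - 2\<close>,
      nonzero because \<open>n \<ge> 2\<close>. Once the sum vanishes, each relation says that
      \<open>2n + 1\<close> times one coefficient is zero.\<close>
    have "(2 * real n - 2) * (a (I Z) + b (J Z) + c (K Z)) = 0" using e[of Z] by (simp add: algebra_simps)
    then have s: "a (I Z) + b (J Z) + c (K Z) = 0" using n2 by simp
    then have "(2 * real n + 1) * a (I Z) = 0" "(2 * real n + 1) * b (J Z) = 0" "(2 * real n + 1) * c (K Z) = 0"
      using e[of Z] by (simp_all add: algebra_simps)
    then show ?thesis using n2 by simp
  qed
  have zero: "a Z = 0" "b Z = 0" "c Z = 0" for Z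
    using z[of "- I Z"] z[of "- J Z"] z[of "- K Z"] by (simp_all add: qs)
  have "2 * \<sigma> Z u (I (- I v)) = 0"
    using three_form_coeff(2)[OF lin skew c, of Z u "- I v"] zero by simp
  then show ?thesis by (simp add: qs)
qed

end

text \<open>The classical combination of four Bianchi identities. It is stated for a bare function
  because it serves both the full curvature and its Weyl part.\<close>

lemma pair_symmetry:
  fixes F :: "'e \<Rightarrow> 'e \<Rightarrow> 'e \<Rightarrow> 'e \<Rightarrow> real"
  assumes s1: "\<And>X Y Z V. F X Y Z V = - F Y X Z V" and s2: "\<And>X Y Z V. F X Y Z V = - F X Y V Z"
    and b: "\<And>X Y Z V. F X Y Z V + F Y Z X V + F Z X Y V = 0"
  shows "F X Y Z V = F Z V X Y"
  using b[of X Y Z V] b[of Y Z V X] b[of Z V X Y] b[of V X Y Z]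
    s1[of X Z Y V] s2[of Z X Y V] s1[of Z X V Y] s1[of V Y Z X] s2[of Y V Z X] s2[of Y V X Z] s1[of Y V X Z]
    s2[of X Y Z V] s2[of Y Z X V] s2[of Z V Y X] s2[of V Y Z X] s2[of V X Z Y] s2[of X Y V Z] s2[of X Z V Y]
    s1[of V X Y Z] s2[of X V Y Z] s1[of V X Z Y] s2[of V X Y Z]
  by argo

section \<open>The normalizer of the quaternionic structure and the model curvature\<close>

context quat_alg begin

lemma one_IJK_independent:
  assumes "\<And>v. a *\<^sub>R v + b *\<^sub>R I v + c *\<^sub>R J v + d *\<^sub>R K v = 0"
  shows "a = 0" "b = 0" "c = 0" "d = 0"
proof -
  obtain v :: 'e where v: "v \<noteq> 0" using nonzero_Basis nonempty_Basis by blast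
  then have pos: "h v v > 0" using inner_h by (simp add: inner_form_def)
  have p: "h (a *\<^sub>R v + b *\<^sub>R I v + c *\<^sub>R J v + d *\<^sub>R K v) w = 0" for w
    using assms by (simp add: h_lin)
  show "a = 0" using p[of v] pos by (simp add: h_lin h_self)
  show "b = 0" using p[of "I v"] pos by (simp add: qs h_self)
  show "c = 0" using p[of "J v"] pos by (simp add: qs h_self)
  show "d = 0" using p[of "K v"] pos by (simp add: qs h_self)
qed

text \<open>The commutator with \<open>A\<close> acts as a derivation on the span of
  \<open>I\<close>, \<open>J\<close>, \<open>K\<close>, hence by a skew matrix. Comparison with the
  commutators of \<open>a I + b J + c K\<close>, for instance \<open>2 c J - 2 b K\<close> for
  \<open>I\<close>, gives the coefficients; what is left of \<open>A\<close> commutes with the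
  structures.\<close>

lemma normalizer_cpt:
  assumes A: "linear A" "\<And>u v. h (A u) v = - h u (A v)"
    and I: "\<And>w. A (I w) - I (A w) = x1 *\<^sub>R I w + y1 *\<^sub>R J w + z1 *\<^sub>R K w"
    and J: "\<And>w. A (J w) - J (A w) = x2 *\<^sub>R I w + y2 *\<^sub>R J w + z2 *\<^sub>R K w"
    and K: "\<And>w. A (K w) - K (A w) = x3 *\<^sub>R I w + y3 *\<^sub>R J w + z3 *\<^sub>R K w"
  shows "cpt (z2 / 2) (- z1 / 2) (y1 / 2) (\<lambda>u v. h (A u) v)"
proof -
  note Alin = linear_neg[OF A(1)] linear_add[OF A(1)] linear_cmul[OF A(1)]
  have "(- 2 * x1) *\<^sub>R v + 0 *\<^sub>R I v + 0 *\<^sub>R J v + 0 *\<^sub>R K v = 0" for v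
  proof -
    \<comment> \<open>The derivation property applied to the square of \<open>I\<close>, which is
      minus the identity.\<close>
    have "I (A (I v) - I (A v)) + (A (I (I v)) - I (A (I v))) = 0" by (simp add: J_lin Jmul Alin)
    then have "(- x1) *\<^sub>R v + (- x1) *\<^sub>R v = 0" unfolding I by (simp add: J_lin Jmul) (metis add.right_inverse)
    then show ?thesis unfolding scaleR_add_left[symmetric] by simp
  qed
  from one_IJK_independent(1)[OF this] have x1: "x1 = 0" by simp
  have "(- 2 * y2) *\<^sub>R v + 0 *\<^sub>R I v + 0 *\<^sub>R J v + 0 *\<^sub>R K v = 0" for v
  proof -
    have "J (A (J v) - J (A v)) + (A (J (J v)) - J (A (J v))) = 0" by (simp add: J_lin Jmul Alin)
    then have "(- y2) *\<^sub>R v + (- y2) *\<^sub>R v = 0" unfolding J by (simp add: J_lin Jmul) (metis add.right_inverse)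
    then show ?thesis unfolding scaleR_add_left[symmetric] by simp
  qed
  from one_IJK_independent(1)[OF this] have y2: "y2 = 0" by simp
  have "(- y1 - x2) *\<^sub>R v + (- z1 - x3) *\<^sub>R I v + (- z2 - y3) *\<^sub>R J v + (- z3) *\<^sub>R K v = 0" for v
  proof -
    \<comment> \<open>The derivation property applied to the product \<open>I J = K\<close> links
      the three rows of coefficients.\<close>
    have "(A (I (J v)) - I (A (J v))) + I (A (J v) - J (A v)) = A (K v) - K (A v)"
      by (simp add: J_lin Jmul)
    then show ?thesis unfolding I J K
      by (simp add: J_lin Jmul x1 y2 algebra_simps) (simp add: neg_eq_iff_add_eq_0 ac_simps)
  qed
  from one_IJK_independent[OF this] have r: "x2 = - y1" "x3 = - z1" "y3 = - z2" "z3 = 0" by simp_all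
  have AI: "A (I w) = I (A w) + y1 *\<^sub>R J w + z1 *\<^sub>R K w" for w using I[of w] x1 by (simp add: algebra_simps)
  have AJ: "A (J w) = J (A w) - y1 *\<^sub>R I w + z2 *\<^sub>R K w" for w using J[of w] y2 r by (simp add: algebra_simps)
  have AK: "A (K w) = K (A w) - z1 *\<^sub>R I w - z2 *\<^sub>R J w" for w using K[of w] r by (simp add: algebra_simps)
  show ?thesis
  proof (rule cptI)
    show "bilinear (\<lambda>u v. h (A u) v)"
      unfolding bilinear_def by (auto intro!: linearI simp: h_lin Alin)
    show "h (A u) v = - h (A v) u" for u v using A(2)[of u v] h_sym by simp
  qed (simp_all add: AI AJ AK qs algebra_simps)
qed

text \<open>The curvature of quaternionic projective space is \<open>- (\<nu>/4) rz\<close>.\<close>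

definition rz :: "'e \<Rightarrow> 'e \<Rightarrow> 'e \<Rightarrow> 'e" where
  "rz X Y Z = h X Z *\<^sub>R Y - h Y Z *\<^sub>R X + (h (I X) Z *\<^sub>R I Y - h (I Y) Z *\<^sub>R I X)
    + (h (J X) Z *\<^sub>R J Y - h (J Y) Z *\<^sub>R J X) + (h (K X) Z *\<^sub>R K Y - h (K Y) Z *\<^sub>R K X)
    + 2 *\<^sub>R (h (I X) Y *\<^sub>R I Z + h (J X) Y *\<^sub>R J Z + h (K X) Y *\<^sub>R K Z)"

lemma rz_lin:
  "rz (X + X') Y Z = rz X Y Z + rz X' Y Z" "rz (r *\<^sub>R X) Y Z = r *\<^sub>R rz X Y Z"
  "rz X (Y + Y') Z = rz X Y Z + rz X Y' Z" "rz X (r *\<^sub>R Y) Z = r *\<^sub>R rz X Y Z"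
  "rz X Y (Z + Z') = rz X Y Z + rz X Y Z'" "rz X Y (r *\<^sub>R Z) = r *\<^sub>R rz X Y Z"
  unfolding rz_def by (simp_all add: qs algebra_simps)

lemma rz_skew: "rz X Y Z = - rz Y X Z"
  unfolding rz_def using h_skew[of X Y] by (simp add: algebra_simps)

lemma rz_metric: "h (rz X Y a) b = - h a (rz X Y b)"
  unfolding rz_def using h_sym[of a X] h_sym[of a Y] by (simp add: qs h_skew[of a] algebra_simps)

lemma rz_bianchi: "rz X Y Z + rz Y Z X + rz Z X Y = 0"
proof (rule inner_form_ext[OF inner_h])
  show "h (rz X Y Z + rz Y Z X + rz Z X Y) V = h 0 V" for V
    unfolding rz_def using h_sym[of X Y] h_sym[of X Z] h_sym[of Y Z] h_skew[of X Y] h_skew[of X Z] h_skew[of Y Z]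
    by (simp add: h_lin algebra_simps)
qed

lemma rz_cpt: "cpt (2 * h (I X) Y) (2 * h (J X) Y) (2 * h (K X) Y) (\<lambda>u v. h (rz X Y u) v)"
proof (rule cptI)
  show "bilinear (\<lambda>u v. h (rz X Y u) v)"
    unfolding bilinear_def by (auto intro!: linearI simp: h_lin rz_lin)
  show "h (rz X Y u) v = - h (rz X Y v) u" for u v using rz_metric[of X Y u v] h_sym by simp
qed (simp_all add: rz_def qs algebra_simps)

text \<open>With the factor \<open>- \<nu>/4\<close> the Ricci tensor of the model is
  \<open>\<nu> (n + 2) h\<close>, with trace \<open>4 n (n + 2) \<nu>\<close>; this is the
  normalization in the reduced scalar curvature.\<close>

lemma rz_ricci: "tr (\<lambda>x y. h (rz x v w) y) = - (4 * real n + 8) * h v w"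
proof -
  have l: "linear (\<lambda>y. h y w)" "linear (\<lambda>y. h (I y) w)" "linear (\<lambda>y. h (J y) w)" "linear (\<lambda>y. h (K y) w)"
    by (auto intro!: linearI simp: qs)
  have "tr (\<lambda>x y. h (rz x v w) y) = tr (\<lambda>x y. h x w * h v y) - h v w * tr h
     + (tr (\<lambda>x y. h (I x) w * h (I v) y) - h (I v) w * tr (\<lambda>x y. h (I x) y))
     + (tr (\<lambda>x y. h (J x) w * h (J v) y) - h (J v) w * tr (\<lambda>x y. h (J x) y))
     + (tr (\<lambda>x y. h (K x) w * h (K v) y) - h (K v) w * tr (\<lambda>x y. h (K x) y))
     + 2 * (tr (\<lambda>x y. h (I x) v * h (I w) y) + tr (\<lambda>x y. h (J x) v * h (J w) y) + tr (\<lambda>x y. h (K x) v * h (K w) y))"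
    by (simp add: rz_def h_lin tr_simps)
  moreover have "linear (\<lambda>y. h (I y) v)" "linear (\<lambda>y. h (J y) v)" "linear (\<lambda>y. h (K y) v)"
    by (auto intro!: linearI simp: qs)
  ultimately show ?thesis using h_sym[of w v]
    by (simp add: tr_contract(2) l tr_h tr_hJ Jmul h_lin algebra_simps)
qed

text \<open>On \<open>S\<^sup>2H \<oplus> S\<^sup>2E\<close> this is \<open>\<psi>\<^sup>E - 2 \<psi>\<^sup>H\<close> for the components \<open>\<psi>\<^sup>E\<close>, \<open>\<psi>\<^sup>H\<close> of \<open>\<psi>\<close>.\<close>

definition chi :: "('e \<Rightarrow> 'e \<Rightarrow> real) \<Rightarrow> 'e \<Rightarrow> 'e \<Rightarrow> real" where
  "chi \<psi> u v = 3 / 4 * (\<psi> (I u) (I v) + \<psi> (J u) (J v) + \<psi> (K u) (K v)) - 5 / 4 * \<psi> u v"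

lemma chi_cpt:
  assumes "cpt a b c \<psi>"
  shows "chi \<psi> u v = \<psi> u v - 3 * (a * h (I u) v + b * h (J u) v + c * h (K u) v)"
  unfolding chi_def cptD(3-5)[OF assms] by (simp add: algebra_simps)

lemma cpt_decompose:
  assumes "cpt a b c \<psi>"
  obtains \<beta> where "cpt 0 0 0 \<beta>" "\<And>u v. \<psi> u v = \<beta> u v + (a * h (I u) v + b * h (J u) v + c * h (K u) v)"
proof -
  let ?\<beta> = "\<lambda>u v. \<psi> u v - (a * h (I u) v + b * h (J u) v + c * h (K u) v)"
  note bil = cptD(1)[OF assms]
  have "cpt 0 0 0 ?\<beta>"
  proof (rule cptI)
    show "bilinear ?\<beta>"
      unfolding bilinear_def by (auto intro!: linearI simp: bilinear_ladd[OF bil] bilinear_radd[OF bil]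
        bilinear_lmul[OF bil] bilinear_rmul[OF bil] qs algebra_simps)
    show "?\<beta> u v = - ?\<beta> v u" for u v
      using cptD(2)[OF assms, of u v] h_skew[of u v] by simp
  qed (simp_all add: cptD(3-5)[OF assms] qs algebra_simps)
  then show thesis using that[of ?\<beta>] by simp
qed

lemma cpt0_move:
  assumes "cpt 0 0 0 \<beta>"
  shows "\<beta> u (I v) = - \<beta> (I u) v" "\<beta> u (J v) = - \<beta> (J u) v" "\<beta> u (K v) = - \<beta> (K u) v"
  using cptD(3)[OF assms, of u "I v"] cptD(4)[OF assms, of u "J v"] cptD(5)[OF assms, of u "K v"]
  by (simp_all add: Jmul bilinear_rneg[OF cptD(1)[OF assms]])

text \<open>The model curvature acts on compatible forms through the same operation
  \<open>BB\<close> that occurs in the connection, with \<open>chi \<psi>\<close> in place of the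
  derivative of \<open>X\<close>. This is the origin of the weights 1 and -2 of the two components.
  Splitting off the S^2H part leaves an invariant form \<open>\<beta>\<close>, through which the
  structures can be moved.\<close>

lemma rz_action:
  assumes \<psi>: "cpt a b c \<psi>" and P: "\<And>v. h P v = chi \<psi> Y v" and P': "\<And>v. h P' v = chi \<psi> Z v"
  shows "\<psi> (rz Y Z u) v + \<psi> u (rz Y Z v) = BB P Z u v - BB P' Y u v"
proof -
  obtain \<beta> where \<beta>: "cpt 0 0 0 \<beta>" and e: "\<And>u v. \<psi> u v = \<beta> u v + (a * h (I u) v + b * h (J u) v + c * h (K u) v)"
    using cpt_decompose[OF \<psi>] by blast
  note bil = cptD(1)[OF \<beta>]
  note bl = bilinear_ladd[OF bil] bilinear_radd[OF bil] bilinear_lmul[OF bil] bilinear_rmul[OF bil]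
    bilinear_lneg[OF bil] bilinear_rneg[OF bil] bilinear_lsub[OF bil] bilinear_rsub[OF bil]
  have hP: "h P w = \<beta> Y w - 2 * (a * h (I Y) w + b * h (J Y) w + c * h (K Y) w)"
    "h P' w = \<beta> Z w - 2 * (a * h (I Z) w + b * h (J Z) w + c * h (K Z) w)" for w
    using P[of w] P'[of w] unfolding chi_cpt[OF \<psi>] e by simp_all
  \<comment> \<open>The structures are shifted away from \<open>P\<close> and \<open>P'\<close>, so
    that these occur only in the form to which \<open>hP\<close> applies.\<close>
  have m: "h (I Q) w = - h Q (I w)" "h (J Q) w = - h Q (J w)" "h (K Q) w = - h Q (K w)" for Q w
    by (simp_all add: h_I h_J h_K)
  have BP: "BB P Z u v - BB P' Y u v =
      (h P u * h Z v - h Z u * h P v) - (h P' u * h Y v - h Y u * h P' v)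
    + (- h P (I u) * h (I Z) v + h (I Z) u * h P (I v)) - (- h P' (I u) * h (I Y) v + h (I Y) u * h P' (I v))
    + (- h P (J u) * h (J Z) v + h (J Z) u * h P (J v)) - (- h P' (J u) * h (J Y) v + h (J Y) u * h P' (J v))
    + (- h P (K u) * h (K Z) v + h (K Z) u * h P (K v)) - (- h P' (K u) * h (K Y) v + h (K Y) u * h P' (K v))
    + ((h P (I Z) - h P' (I Y)) * h (I u) v + (h P (J Z) - h P' (J Y)) * h (J u) v + (h P (K Z) - h P' (K Y)) * h (K u) v)"
    unfolding BB_def m[of P] m[of P'] by (simp add: algebra_simps)
  have \<beta>s: "\<beta> u w = - \<beta> w u" for w by (rule cptD(2)[OF \<beta>])
  have r: "\<psi> u (rz Y Z v) = - \<psi> (rz Y Z v) u" by (rule cptD(2)[OF \<psi>])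
  have s1: "\<beta> (I v) u = \<beta> (I u) v" "\<beta> (J v) u = \<beta> (J u) v" "\<beta> (K v) u = \<beta> (K u) v"
    using cptD(2)[OF \<beta>, of _ u] cpt0_move[OF \<beta>, of u v] by auto
  have s2: "\<beta> (I Z) Y = \<beta> (I Y) Z" "\<beta> (J Z) Y = \<beta> (J Y) Z" "\<beta> (K Z) Y = \<beta> (K Y) Z"
    using cptD(2)[OF \<beta>, of _ Y] cpt0_move[OF \<beta>, of Y Z] by auto
  have s3: "\<beta> (I u) w = \<beta> (I w) u" "\<beta> (J u) w = \<beta> (J w) u" "\<beta> (K u) w = \<beta> (K w) u" for w
    using cptD(2)[OF \<beta>, of _ w] cpt0_move[OF \<beta>, of w u] by auto
  show ?thesis
    unfolding BP hP r e rz_def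
    by (simp add: qs bl cpt0_move[OF \<beta>] s1 s2 s3[of Y] s3[of Z] \<beta>s[of Y] \<beta>s[of Z] h_sym[of Z Y] h_sym[of v u]
      h_sym[of u Y] h_sym[of u Z] h_skew[of u Y] h_skew[of u Z] h_skew[of Z Y] h_skew[of v u] algebra_simps)
qed

text \<open>The counterpart of \<open>rz_action\<close> for vectors: \<open>chi\<close> applied to
  \<open>BB\<close> reproduces the model curvature, so that the model part of the curvature will
  cancel in the vector component of the connection.\<close>

lemma rz_chi: "h (rz Y Z X) v = chi (BB X Z) Y v - chi (BB X Y) Z v"
  unfolding chi_cpt[OF BB_cpt] unfolding rz_def BB_def
  using h_sym[of X Y] h_sym[of X Z] h_sym[of Y Z] h_skew[of X Y] h_skew[of X Z] h_skew[of Y Z]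
  by (simp add: h_lin algebra_simps)

end

section \<open>Curvature tensors normalizing the quaternionic structure: the Einstein
  property\<close>

locale quat_curv = quat_alg +
  fixes R :: "'a \<Rightarrow> 'a \<Rightarrow> 'a \<Rightarrow> 'a"
  assumes R_lin1: "linear (\<lambda>X. R X Y Z)" and R_lin2: "linear (\<lambda>Y. R X Y Z)" and R_lin3: "linear (R X Y)"
    and R_skew: "R X Y Z = - R Y X Z" and R_bianchi: "R X Y Z + R Y Z X + R Z X Y = 0"
    and R_metric: "h (R X Y a) b = - h a (R X Y b)"
    and R_I: "\<exists>x y z. \<forall>w. R X Y (I w) - I (R X Y w) = x *\<^sub>R I w + y *\<^sub>R J w + z *\<^sub>R K w"
    and R_J: "\<exists>x y z. \<forall>w. R X Y (J w) - J (R X Y w) = x *\<^sub>R I w + y *\<^sub>R J w + z *\<^sub>R K w"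
    and R_K: "\<exists>x y z. \<forall>w. R X Y (K w) - K (R X Y w) = x *\<^sub>R I w + y *\<^sub>R J w + z *\<^sub>R K w"
begin

definition Rm :: "'a \<Rightarrow> 'a \<Rightarrow> 'a \<Rightarrow> 'a \<Rightarrow> real" where "Rm X Y Z V = h (R X Y Z) V"

definition ric :: "'a \<Rightarrow> 'a \<Rightarrow> real" where "ric v w = tr (\<lambda>x y. h (R x v w) y)"

definition scal :: real where "scal = tr ric"

definition nu :: real where "nu = scal / (4 * real n * (real n + 2))"

lemma Rm_skew: "Rm X Y Z V = - Rm Y X Z V" "Rm X Y Z V = - Rm X Y V Z"
  using R_skew[of X Y Z] R_metric[of X Y Z V] h_sym[of Z "R X Y V"] by (simp_all add: Rm_def h_lin)

lemma Rm_bianchi: "Rm X Y Z V + Rm Y Z X V + Rm Z X Y V = 0"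
  unfolding Rm_def h_lin(1)[symmetric] R_bianchi by (simp add: h_lin)

lemma Rm_lin: "linear (\<lambda>X. Rm X Y Z V)" "linear (\<lambda>Y. Rm X Y Z V)" "linear (\<lambda>Z. Rm X Y Z V)" "linear (\<lambda>V. Rm X Y Z V)"
  unfolding Rm_def by (auto intro!: linearI simp: h_lin linear_add[OF R_lin1] linear_cmul[OF R_lin1] linear_add[OF R_lin2]
    linear_cmul[OF R_lin2] linear_add[OF R_lin3] linear_cmul[OF R_lin3])

lemma Rm_pair: "Rm X Y Z V = Rm Z V X Y"
  by (rule pair_symmetry; fact Rm_skew Rm_bianchi)

lemma bil_Rm: "bilinear (Rm X Y)" "bilinear (\<lambda>Y. Rm X Y Z)" "bilinear (\<lambda>Y V. Rm X Y Z V)"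
   "bilinear (\<lambda>X V. Rm X Y Z V)" "bilinear (\<lambda>X Z. Rm X Y Z V)" "bilinear (\<lambda>Y Z. Rm X Y Z V)"
  using Rm_lin by (auto simp: bilinear_def)

lemma curv_cyclic: "quat_curv h J K I n R"
proof -
  have s: "\<exists>x y z. \<forall>w. f w = x *\<^sub>R J w + y *\<^sub>R K w + z *\<^sub>R I w"
    if "\<exists>x y z. \<forall>w. f w = x *\<^sub>R I w + y *\<^sub>R J w + z *\<^sub>R K w" for f
  proof -
    from that obtain x y z where "\<And>w. f w = x *\<^sub>R I w + y *\<^sub>R J w + z *\<^sub>R K w" by blast
    then have "f w = y *\<^sub>R J w + z *\<^sub>R K w + x *\<^sub>R I w" for w by simp
    then show ?thesis by blast
  qed
  show ?thesis
    using cyclic R_lin1 R_lin2 R_lin3 R_skew R_bianchi R_metric s[OF R_I] s[OF R_J] s[OF R_K]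
    unfolding quat_curv_def quat_curv_axioms_def by blast
qed

text \<open>The S^2H coefficients of \<open>Rm X Y\<close>. They are defined by traces, not taken
  from the existential assumptions on \<open>R\<close>, so that their dependence on \<open>X\<close>
  and \<open>Y\<close> is visibly linear.\<close>

definition rI :: "'a \<Rightarrow> 'a \<Rightarrow> real" where "rI X Y = tr (\<lambda>x y. Rm X Y x (I y)) / (4 * real n)"
definition rJ :: "'a \<Rightarrow> 'a \<Rightarrow> real" where "rJ X Y = tr (\<lambda>x y. Rm X Y x (J y)) / (4 * real n)"
definition rK :: "'a \<Rightarrow> 'a \<Rightarrow> real" where "rK X Y = tr (\<lambda>x y. Rm X Y x (K y)) / (4 * real n)"

lemma Rm_cpt: "cpt (rI X Y) (rJ X Y) (rK X Y) (Rm X Y)"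
proof -
  obtain x1 y1 z1 where 1: "\<And>w. R X Y (I w) - I (R X Y w) = x1 *\<^sub>R I w + y1 *\<^sub>R J w + z1 *\<^sub>R K w"
    using R_I by blast
  obtain x2 y2 z2 where 2: "\<And>w. R X Y (J w) - J (R X Y w) = x2 *\<^sub>R I w + y2 *\<^sub>R J w + z2 *\<^sub>R K w"
    using R_J by blast
  obtain x3 y3 z3 where 3: "\<And>w. R X Y (K w) - K (R X Y w) = x3 *\<^sub>R I w + y3 *\<^sub>R J w + z3 *\<^sub>R K w"
    using R_K by blast
  have "Rm X Y = (\<lambda>u v. h (R X Y u) v)" by (simp add: Rm_def fun_eq_iff)
  then have "cpt (z2 / 2) (- z1 / 2) (y1 / 2) (Rm X Y)"
    using normalizer_cpt[OF R_lin3 R_metric 1 2 3] by simp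
  then show ?thesis using cpt_coeff[of "z2 / 2" "- z1 / 2" "y1 / 2" "Rm X Y"] by (simp add: rI_def rJ_def rK_def)
qed

lemma r_lin: "linear (\<lambda>X. rI X Y)" "linear (\<lambda>X. rJ X Y)" "linear (\<lambda>X. rK X Y)"
  unfolding rI_def rJ_def rK_def tr_def
  by (auto intro!: linearI simp: linear_add[OF Rm_lin(1)] linear_cmul[OF Rm_lin(1)] sum.distrib
    add_divide_distrib sum_distrib_left)

lemma r_skew: "rI X Y = - rI Y X" "rJ X Y = - rJ Y X" "rK X Y = - rK Y X"
  unfolding rI_def rJ_def rK_def by (subst Rm_skew(1), simp add: tr_neg)+

lemma ric_Rm: "ric v w = tr (\<lambda>x y. Rm x v w y)"
  by (simp add: ric_def Rm_def)

lemma ric_sym: "ric v w = ric w v"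
proof -
  have "Rm x v w y = Rm y w v x" for x y
    using Rm_pair[of x v w y] Rm_skew(1)[of w y x v] Rm_skew(2)[of y w x v] by argo
  then have "tr (\<lambda>x y. Rm x v w y) = tr (\<lambda>x y. Rm y w v x)" by (intro arg_cong[where f=tr] ext)
  then show ?thesis unfolding ric_Rm by (simp add: tr_def)
qed

lemma ric_lin: "linear (ric v)"
  unfolding ric_Rm tr_def
  by (auto intro!: linearI simp: linear_add[OF Rm_lin(3)] linear_cmul[OF Rm_lin(3)] sum.distrib sum_distrib_left)

text \<open>The trace of the first Bianchi identity against \<open>I\<close>. Two of its terms
  contribute equally, by pair symmetry and invariance of the trace; removing \<open>I\<close> from
  the second pair by compatibility leaves the Ricci tensor and the coefficients for \<open>J\<close>
  and \<open>K\<close>.\<close>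

lemma r_ric1: "real n * rI X (I Y) + rJ X (J Y) + rK X (K Y) = - ric X Y / 2"
proof -
  have T: "tr (\<lambda>x y. Rm Z x X (I y)) = tr (\<lambda>x y. Rm x X Z (I y))" for Z
  proof -
    have "tr (\<lambda>x y. Rm Z x X (I y)) = tr (\<lambda>x y. Rm Z (I x) X (I (I y)))"
      using tr_inv(1)[OF bil_compose[OF bil_Rm(3) linear_id lin_I]] by simp
    also have "\<dots> = - tr (\<lambda>x y. Rm Z (I x) X y)"
      by (simp add: Jmul linear_neg[OF Rm_lin(4)] tr_neg)
    also have "\<dots> = - tr (\<lambda>x y. Rm X x Z (I y))"
      using Rm_pair[of Z _ X] by (simp add: tr_def)
    also have "\<dots> = tr (\<lambda>x y. Rm x X Z (I y))"
      by (subst Rm_skew(1)) (simp add: tr_neg)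
    finally show ?thesis .
  qed
  have "4 * real n * rI X (I Y) = tr (\<lambda>x y. Rm X (I Y) x (I y))"
    using n2 by (simp add: rI_def)
  also have "\<dots> = tr (\<lambda>x y. - Rm (I Y) x X (I y) - Rm x X (I Y) (I y))"
    using Rm_bianchi[of X "I Y"] by (intro arg_cong[where f=tr] ext) (simp add: algebra_simps eq_neg_iff_add_eq_0)
  also have "\<dots> = - 2 * tr (\<lambda>x y. Rm x X (I Y) (I y))"
    by (simp add: tr_simps T)
  also have "\<dots> = - 2 * tr (\<lambda>x y. Rm x X Y y - 2 * (rJ x X * h (J Y) y + rK x X * h (K Y) y))"
    unfolding cptD(3)[OF Rm_cpt] ..
  also have "\<dots> = - 2 * (ric X Y - 2 * (rJ (J Y) X + rK (K Y) X))"
    by (simp add: tr_simps ric_Rm tr_contract(2)[OF r_lin(2)] tr_contract(2)[OF r_lin(3)])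
  finally show ?thesis using r_skew[of _ X] by (simp add: algebra_simps)
qed

lemma r_ric2:
  "rI X (I Y) = - ric X Y / (2 * (real n + 2))" "rJ X (J Y) = - ric X Y / (2 * (real n + 2))"
  "rK X (K Y) = - ric X Y / (2 * (real n + 2))"
proof -
  interpret q1: quat_curv h J K I n R by (rule curv_cyclic)
  interpret q2: quat_curv h K I J n R by (rule q1.curv_cyclic)
  let ?i = "rI X (I Y)" and ?j = "rJ X (J Y)" and ?k = "rK X (K Y)"
  have eqs: "real n * ?i + ?j + ?k = - ric X Y / 2" "real n * ?j + ?k + ?i = - ric X Y / 2" "real n * ?k + ?i + ?j = - ric X Y / 2"
    using r_ric1[of X Y] q1.r_ric1[of X Y] q2.r_ric1[of X Y]
    by (simp_all add: rI_def rJ_def rK_def q1.rI_def q1.rJ_def q1.rK_def q2.rI_def q2.rJ_def q2.rK_def)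
  \<comment> \<open>Differences of the three rotated equations carry the factor
    \<open>n - 1\<close>, so the unknowns coincide, and each equation becomes \<open>n + 2\<close>
    times their common value.\<close>
  have "(real n - 1) * (?i - ?j) = 0" "(real n - 1) * (?i - ?k) = 0" using eqs by (simp_all add: algebra_simps)
  then have eq: "?j = ?i" "?k = ?i" using n2 by simp_all
  have "(real n + 2) * ?i = - ric X Y / 2" using eqs(1) unfolding eq by (simp add: algebra_simps)
  then have "?i = - ric X Y / (2 * (real n + 2))" by (simp add: field_simps)
  then show "rI X (I Y) = - ric X Y / (2 * (real n + 2))" "rJ X (J Y) = - ric X Y / (2 * (real n + 2))"
    "rK X (K Y) = - ric X Y / (2 * (real n + 2))" using eq by simp_all
qed

end

context quat_curv begin

text \<open>By the formulas just proved \<open>ric X (I Y)\<close> is a multiple of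
  \<open>rI X Y\<close>, hence skew, whereas \<open>ric\<close> is symmetric.\<close>

lemma ric_move: "ric X (I Y) = - ric (I X) Y" "ric X (J Y) = - ric (J X) Y" "ric X (K Y) = - ric (K X) Y"
proof -
  note neg = linear_neg[OF ric_lin]
  have r: "rI X Y = ric X (I Y) / (2 * (real n + 2))" "rJ X Y = ric X (J Y) / (2 * (real n + 2))"
     "rK X Y = ric X (K Y) / (2 * (real n + 2))" for X Y
    using r_ric2(1)[of X "- I Y"] r_ric2(2)[of X "- J Y"] r_ric2(3)[of X "- K Y"]
    by (simp_all add: J_lin Jmul neg)
  have c: "x = - y" if "x / (2 * (real n + 2)) = - (y / (2 * (real n + 2)))" for x y
  proof -
    have "x / (2 * (real n + 2)) = - y / (2 * (real n + 2))" using that by (simp only: minus_divide_left)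
    then show ?thesis unfolding divide_cancel_right by simp
  qed
  show "ric X (I Y) = - ric (I X) Y" "ric X (J Y) = - ric (J X) Y" "ric X (K Y) = - ric (K X) Y"
    using r_skew[of X Y] c[of "ric X (I Y)" "ric Y (I X)"] c[of "ric X (J Y)" "ric Y (J X)"]
      c[of "ric X (K Y)" "ric Y (K X)"] unfolding r by (simp_all add: ric_sym[of Y])
qed

lemma r_ric:
  "rI X Y = ric X (I Y) / (2 * (real n + 2))" "rJ X Y = ric X (J Y) / (2 * (real n + 2))"
  "rK X Y = ric X (K Y) / (2 * (real n + 2))"
  using r_ric2(1)[of X "- I Y"] r_ric2(2)[of X "- J Y"] r_ric2(3)[of X "- K Y"]
  by (simp_all add: J_lin Jmul linear_neg[OF ric_lin])

text \<open>Pair symmetry turns compatibility in the second pair into a rule for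
  \<open>Rm (I X) (I Y)\<close>. Its trace against \<open>J\<close> evaluates
  \<open>rJ (I X) (I Y)\<close>, which equals \<open>- rJ X Y\<close> because \<open>ric\<close> is
  invariant under \<open>I\<close>. Thus \<open>rJ\<close> is a multiple of a Kaehler form, and the
  Einstein property follows.\<close>

lemma rJ_omega: "rJ X Y = - (nu / 2) * h (J X) Y"
proof -
  note neg = linear_neg[OF ric_lin]
  have Rm: "Rm (I X) (I Y) Z V = Rm X Y Z V - 2 * (rJ Z V * h (J X) Y + rK Z V * h (K X) Y)" for Z V
    using cptD(3)[OF Rm_cpt, of Z V X Y] Rm_pair[of "I X" "I Y" Z V] Rm_pair[of X Y Z V] by simp
  have "4 * real n * rJ (I X) (I Y) = tr (\<lambda>x y. Rm (I X) (I Y) x (J y))"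
    using n2 by (simp add: rJ_def)
  also have "\<dots> = tr (\<lambda>x y. Rm X Y x (J y)) - 2 * (tr (\<lambda>x y. rJ x (J y)) * h (J X) Y + tr (\<lambda>x y. rK x (J y)) * h (K X) Y)"
    unfolding Rm by (simp add: tr_simps)
  also have "tr (\<lambda>x y. rJ x (J y)) = - (scal / (2 * (real n + 2)))"
    unfolding r_ric2 scal_def by (simp add: tr_def sum_divide_distrib sum_negf)
  also have "tr (\<lambda>x y. rK x (J y)) = 0"
  proof -
    have "ric x (I x) = 0" for x using ric_move(1)[of x x] ric_sym[of "I x" x] by simp
    then show ?thesis unfolding r_ric by (simp add: tr_def Jmul neg)
  qed
  also have "tr (\<lambda>x y. Rm X Y x (J y)) = 4 * real n * rJ X Y"
    using n2 by (simp add: rJ_def)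
  also have "rJ (I X) (I Y) = - rJ X Y"
    unfolding r_ric by (simp add: Jmul neg ric_move(1)[of "I X" "K Y", symmetric] ric_move(1)[of X "I (K Y)"] ric_move(1)[symmetric])
  finally have "4 * real n * (2 * rJ X Y) = - (scal / (real n + 2)) * h (J X) Y"
    by (simp add: field_simps)
  then have "8 * real n * rJ X Y = - (scal / (real n + 2)) * h (J X) Y" by simp
  moreover have "rJ X Y = 8 * real n * rJ X Y / (8 * real n)" using n2 by simp
  ultimately show ?thesis by (simp add: nu_def mult.commute)
qed

lemma ric_einstein: "ric X Y = nu * (real n + 2) * h X Y"
proof -
  have "ric X Y = - 2 * (real n + 2) * rJ X (J Y)" using n2 by (simp add: r_ric2 field_simps)
  then show ?thesis using rJ_omega[of X "J Y"] by (simp add: qs field_simps)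
qed

lemma r_omega: "rI X Y = - (nu / 2) * h (I X) Y" "rJ X Y = - (nu / 2) * h (J X) Y" "rK X Y = - (nu / 2) * h (K X) Y"
  using n2 unfolding r_ric ric_einstein by (simp_all add: qs field_simps)

definition Wv :: "'a \<Rightarrow> 'a \<Rightarrow> 'a \<Rightarrow> 'a" where
  "Wv X Y Z = R X Y Z + (nu / 4) *\<^sub>R rz X Y Z"

end

section \<open>The quaternionic-Weyl tensor and its action on 2-forms\<close>

locale weyl_alg = quat_alg +
  fixes W :: "'a \<Rightarrow> 'a \<Rightarrow> 'a \<Rightarrow> 'a"
  assumes W_lin1: "linear (\<lambda>X. W X Y Z)" and W_lin2: "linear (\<lambda>Y. W X Y Z)" and W_lin3: "linear (W X Y)"
    and W_skew: "W X Y Z = - W Y X Z" and W_bianchi: "W X Y Z + W Y Z X + W Z X Y = 0"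
    and W_cpt: "cpt 0 0 0 (\<lambda>u v. h (W X Y u) v)"
    and W_ricci: "tr (\<lambda>x y. h (W x v w) y) = 0"

text \<open>The S^2H coefficients \<open>- (\<nu>/2) \<omega>\<^sub>i\<close> of the curvature
  cancel those of \<open>(\<nu>/4) rz\<close>, and the Einstein constant
  \<open>\<nu> (n + 2)\<close> cancels the Ricci contraction of the model term.\<close>

sublocale quat_curv \<subseteq> weyl: weyl_alg h I J K n Wv
proof (rule weyl_alg.intro[OF quat_alg_axioms], rule weyl_alg_axioms.intro)
  show "linear (\<lambda>X. Wv X Y Z)" for Y Z
    unfolding Wv_def by (auto intro!: linearI simp: rz_lin linear_add[OF R_lin1] linear_cmul[OF R_lin1] algebra_simps)
  show "linear (\<lambda>Y. Wv X Y Z)" for X Z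
    unfolding Wv_def by (auto intro!: linearI simp: rz_lin linear_add[OF R_lin2] linear_cmul[OF R_lin2] algebra_simps)
  show "linear (Wv X Y)" for X Y
    unfolding Wv_def by (auto intro!: linearI simp: rz_lin linear_add[OF R_lin3] linear_cmul[OF R_lin3] algebra_simps)
  show "Wv X Y Z = - Wv Y X Z" for X Y Z
    unfolding Wv_def using R_skew[of X Y Z] rz_skew[of X Y Z] by simp
  show "Wv X Y Z + Wv Y Z X + Wv Z X Y = 0" for X Y Z
  proof -
    have "Wv X Y Z + Wv Y Z X + Wv Z X Y
      = (R X Y Z + R Y Z X + R Z X Y) + (nu / 4) *\<^sub>R (rz X Y Z + rz Y Z X + rz Z X Y)"
      by (simp add: Wv_def algebra_simps)
    then show ?thesis by (simp add: R_bianchi rz_bianchi)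
  qed
  show "cpt 0 0 0 (\<lambda>u v. h (Wv X Y u) v)" for X Y
    using cpt_add[OF Rm_cpt[of X Y] cpt_cmul[OF rz_cpt[of X Y], of "nu / 4"]]
    by (simp add: r_omega Wv_def Rm_def h_lin)
  show "tr (\<lambda>x y. h (Wv x v w) y) = 0" for v w
  proof -
    have "tr (\<lambda>x y. h (Wv x v w) y) = ric v w + (nu / 4) * tr (\<lambda>x y. h (rz x v w) y)"
      unfolding Wv_def by (simp add: h_lin tr_def ric_def sum.distrib sum_distrib_left)
    then show ?thesis by (simp add: rz_ricci ric_einstein algebra_simps)
  qed
qed

context weyl_alg begin

definition Wm :: "'a \<Rightarrow> 'a \<Rightarrow> 'a \<Rightarrow> 'a \<Rightarrow> real" where "Wm X Y Z V = h (W X Y Z) V"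

lemma Wm_skew: "Wm X Y Z V = - Wm Y X Z V" "Wm X Y Z V = - Wm X Y V Z"
  using W_skew[of X Y Z] cptD(2)[OF W_cpt, of X Y Z V] by (simp_all add: Wm_def h_lin)

lemma Wm_bianchi: "Wm X Y Z V + Wm Y Z X V + Wm Z X Y V = 0"
  unfolding Wm_def h_lin(1)[symmetric] W_bianchi by (simp add: h_lin)

lemma Wm_lin: "linear (\<lambda>X. Wm X Y Z V)" "linear (\<lambda>Y. Wm X Y Z V)" "linear (\<lambda>Z. Wm X Y Z V)" "linear (\<lambda>V. Wm X Y Z V)"
  unfolding Wm_def by (auto intro!: linearI simp: h_lin linear_add[OF W_lin1] linear_cmul[OF W_lin1] linear_add[OF W_lin2]
    linear_cmul[OF W_lin2] linear_add[OF W_lin3] linear_cmul[OF W_lin3])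

lemma bil_Wm: "bilinear (Wm X Y)" "bilinear (\<lambda>Y. Wm X Y Z)" "bilinear (\<lambda>Y V. Wm X Y Z V)"
   "bilinear (\<lambda>X V. Wm X Y Z V)" "bilinear (\<lambda>X Z. Wm X Y Z V)" "bilinear (\<lambda>Y Z. Wm X Y Z V)" "bilinear (\<lambda>X Y. Wm X Y Z V)"
  using Wm_lin by (auto simp: bilinear_def)

lemma Wm_pair: "Wm X Y Z V = Wm Z V X Y"
  by (rule pair_symmetry; fact Wm_skew Wm_bianchi)

lemma Wm_inv: "Wm X Y (I Z) (I V) = Wm X Y Z V" "Wm X Y (J Z) (J V) = Wm X Y Z V" "Wm X Y (K Z) (K V) = Wm X Y Z V"
  using cptD(3-5)[OF W_cpt] by (simp_all add: Wm_def)

lemma Wm_inv': "Wm (I X) (I Y) Z V = Wm X Y Z V" "Wm (J X) (J Y) Z V = Wm X Y Z V" "Wm (K X) (K Y) Z V = Wm X Y Z V"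
  by (metis Wm_pair Wm_inv)+

definition Wf :: "('a \<Rightarrow> 'a \<Rightarrow> real) \<Rightarrow> 'a \<Rightarrow> 'a \<Rightarrow> real" where
  "Wf \<psi> u v = 1 / 2 * (\<Sum>b\<in>Basis. h (W (e b) (sharp h (\<psi> (e b))) u) v)"

lemma Wf_tr: "Wf \<psi> u v = 1 / 2 * tr (\<lambda>x y. Wm x (sharp h (\<psi> y)) u v)"
  by (simp add: Wf_def tr_def Wm_def)

lemma Wf_cpt: "cpt 0 0 0 (Wf \<psi>)"
proof (rule cptI)
  show "bilinear (Wf \<psi>)"
    unfolding Wf_tr bilinear_def tr_def
    by (auto intro!: linearI simp: linear_add[OF Wm_lin(3)] linear_add[OF Wm_lin(4)] linear_cmul[OF Wm_lin(3)]
      linear_cmul[OF Wm_lin(4)] sum.distrib sum_distrib_left add_divide_distrib)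
  show "Wf \<psi> u v = - Wf \<psi> v u" for u v
    unfolding Wf_tr by (subst Wm_skew(2)) (simp add: tr_neg)
qed (simp_all add: Wf_tr Wm_inv)

lemma sharp_eq:
  assumes "bilinear \<psi>" shows "h (sharp h (\<psi> x)) v = \<psi> x v"
  using inner_form_sharp[OF inner_h] assms by (simp add: bilinear_def)

lemma linear_sharp:
  assumes "bilinear \<psi>" shows "linear (\<lambda>x. sharp h (\<psi> x))"
  by (intro linearI inner_form_ext[OF inner_h])
     (simp_all add: h_lin sharp_eq[OF assms] bilinear_ladd[OF assms] bilinear_lmul[OF assms])

lemma Wm_tr_I: "tr (\<lambda>x y. Wm x (I y) Z V) = 0" "tr (\<lambda>x y. Wm x (J y) Z V) = 0" "tr (\<lambda>x y. Wm x (K y) Z V) = 0"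
proof -
  have "cpt 0 0 0 (\<lambda>x y. Wm x y Z V)"
    by (intro cptI bil_Wm Wm_skew) (simp_all add: Wm_inv')
  from cpt_coeff[OF this] show "tr (\<lambda>x y. Wm x (I y) Z V) = 0" "tr (\<lambda>x y. Wm x (J y) Z V) = 0" "tr (\<lambda>x y. Wm x (K y) Z V) = 0"
    using n2 by simp_all
qed

text \<open>Each of the four wedge products contributes \<open>Wm X Z u v\<close>, since
  \<open>W\<close> is invariant under the structures; the last term of \<open>BB\<close> contributes
  nothing, since \<open>W\<close> annihilates the Kaehler forms.\<close>

lemma Wf_BB: "Wf (BB X Z) u v = 4 * Wm X Z u v"
proof -
  have bil: "bilinear (BB X Z)" using BB_cpt cptD(1) by blast
  have s: "sharp h (BB X Z y) = h X y *\<^sub>R Z - h Z y *\<^sub>R X + (h (I X) y *\<^sub>R I Z - h (I Z) y *\<^sub>R I X)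
     + (h (J X) y *\<^sub>R J Z - h (J Z) y *\<^sub>R J X) + (h (K X) y *\<^sub>R K Z - h (K Z) y *\<^sub>R K X)
     - (h (I X) Z *\<^sub>R I y + h (J X) Z *\<^sub>R J y + h (K X) Z *\<^sub>R K y)" for y
    by (rule sharp_eqI[OF inner_h]) (simp add: h_lin BB_def)
  note W2 = linear_add[OF Wm_lin(2)] linear_diff[OF Wm_lin(2)] linear_cmul[OF Wm_lin(2)]
  have c: "tr (\<lambda>x y. h A y * Wm x B u v) = Wm A B u v" for A B
    using tr_contract(2)[OF Wm_lin(1), of B u v A] by (simp add: mult.commute)
  have "2 * Wf (BB X Z) u v = (Wm X Z u v - Wm Z X u v) + (Wm (I X) (I Z) u v - Wm (I Z) (I X) u v)
     + (Wm (J X) (J Z) u v - Wm (J Z) (J X) u v) + (Wm (K X) (K Z) u v - Wm (K Z) (K X) u v)"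
    unfolding Wf_tr s by (simp add: W2 tr_simps c Wm_tr_I)
  then show ?thesis using Wm_skew(1)[of Z X u v] by (simp add: Wm_inv')
qed

text \<open>Taking the trace and the three traces against \<open>I, J, K\<close> removes all traces from the equation; the symmetric
  part of \<open>m\<close> then vanishes, and on the skew part the remaining operator has nonzero eigenvalues.\<close>

lemma trace_operator_injective:
  assumes m: "bilinear m"
    and eq: "\<And>Y v. - (4 * real n - 2) * m Y v - tr m * h Y v
      + (tr (\<lambda>x y. m x (I y)) * h (I Y) v + tr (\<lambda>x y. m x (J y)) * h (J Y) v + tr (\<lambda>x y. m x (K y)) * h (K Y) v)
      - (m (I Y) (I v) + m (J Y) (J v) + m (K Y) (K v)) + (m (I v) (I Y) + m (J v) (J Y) + m (K v) (K Y)) = 0"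
  shows "m Y v = 0"
proof -
  let ?t = "tr m" and ?i = "tr (\<lambda>x y. m x (I y))" and ?j = "tr (\<lambda>x y. m x (J y))" and ?k = "tr (\<lambda>x y. m x (K y))"
  note neg = bilinear_rneg[OF m] bilinear_lneg[OF m]
  have tn: "tr (\<lambda>x. h (- f x)) = - tr (\<lambda>x. h (f x))" for f
    by (simp add: tr_def h_lin sum_negf)
  have sw: "tr (\<lambda>x y. m (A y) (B x)) = tr (\<lambda>x y. m (A x) (B y))" for A B by (simp add: tr_def)
  have sw': "tr (\<lambda>x y. m y (B x)) = tr (\<lambda>x y. m x (B y))" for B by (simp add: tr_def)
  have "tr (\<lambda>x y. - (4 * real n - 2) * m x y - ?t * h x y + (?i * h (I x) y + ?j * h (J x) y + ?k * h (K x) y)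
      - (m (I x) (I y) + m (J x) (J y) + m (K x) (K y)) + (m (I y) (I x) + m (J y) (J x) + m (K y) (K x))) = 0"
    unfolding eq by (simp add: tr_zero)
  then have "(8 * real n - 2) * ?t = 0"
    by (simp add: tr_simps tr_inv[OF m] sw tr_h tr_hJ algebra_simps)
  then have t: "?t = 0" using n2 by simp
  \<comment> \<open>The mixed traces that arise when the equation is composed with \<open>I\<close>
    reduce to the trace against \<open>I\<close> itself.\<close>
  have ji: "tr (\<lambda>x y. m (J x) (K y)) = ?i" "tr (\<lambda>x y. m (K x) (J y)) = - ?i"
    using tr_inv(2)[OF bil_compose[OF m linear_id lin_I]] tr_inv(3)[OF bil_compose[OF m linear_id lin_I]]
    by (simp_all add: Jmul neg tr_neg)
  have "tr (\<lambda>x y. - (4 * real n - 2) * m x (I y) - ?t * h x (I y) + (?i * h (I x) (I y) + ?j * h (J x) (I y) + ?k * h (K x) (I y))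
      - (m (I x) (I (I y)) + m (J x) (J (I y)) + m (K x) (K (I y)))
      + (m (I (I y)) (I x) + m (J (I y)) (J x) + m (K (I y)) (K x))) = 0"
    unfolding eq by (simp add: tr_zero)
  then have "4 * ?i = 0"
    by (simp add: Jmul neg h_I I_orth tr_simps t tn tr_I[OF m] sw sw' ji tr_h tr_hJ algebra_simps)
  then have i: "?i = 0" by simp
  have ij: "tr (\<lambda>x y. m (K x) (I y)) = ?j" "tr (\<lambda>x y. m (I x) (K y)) = - ?j"
    using tr_inv(3)[OF bil_compose[OF m linear_id lin_J]] tr_inv(1)[OF bil_compose[OF m linear_id lin_J]]
    by (simp_all add: Jmul neg tr_neg)
  have "tr (\<lambda>x y. - (4 * real n - 2) * m x (J y) - ?t * h x (J y) + (?i * h (I x) (J y) + ?j * h (J x) (J y) + ?k * h (K x) (J y))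
      - (m (I x) (I (J y)) + m (J x) (J (J y)) + m (K x) (K (J y)))
      + (m (I (J y)) (I x) + m (J (J y)) (J x) + m (K (J y)) (K x))) = 0"
    unfolding eq by (simp add: tr_zero)
  then have "4 * ?j = 0"
    by (simp add: Jmul neg h_J J_orth tr_simps t tn tr_I[OF m] sw sw' ij tr_h tr_hJ algebra_simps)
  then have j: "?j = 0" by simp
  have ik: "tr (\<lambda>x y. m (I x) (J y)) = ?k" "tr (\<lambda>x y. m (J x) (I y)) = - ?k"
    using tr_inv(1)[OF bil_compose[OF m linear_id lin_K]] tr_inv(2)[OF bil_compose[OF m linear_id lin_K]]
    by (simp_all add: Jmul neg tr_neg)
  have "tr (\<lambda>x y. - (4 * real n - 2) * m x (K y) - ?t * h x (K y) + (?i * h (I x) (K y) + ?j * h (J x) (K y) + ?k * h (K x) (K y))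
      - (m (I x) (I (K y)) + m (J x) (J (K y)) + m (K x) (K (K y)))
      + (m (I (K y)) (I x) + m (J (K y)) (J x) + m (K (K y)) (K x))) = 0"
    unfolding eq by (simp add: tr_zero)
  then have "4 * ?k = 0"
    by (simp add: Jmul neg h_K K_orth tr_simps t tn tr_I[OF m] sw sw' ik tr_h tr_hJ algebra_simps)
  then have k: "?k = 0" by simp
  have e: "(4 * real n - 2) * m Y v = (m (I v) (I Y) + m (J v) (J Y) + m (K v) (K Y)) - (m (I Y) (I v) + m (J Y) (J v) + m (K Y) (K v))" for Y v
    using eq[of Y v] unfolding t i j k by (simp add: algebra_simps)
  have skew: "m v Y = - m Y v" for Y v
  proof -
    have "(4 * real n - 2) * (m Y v + m v Y) = 0"
      using e[of Y v] e[of v Y] by (simp add: algebra_simps)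
    then have "m Y v + m v Y = 0" using n2 by simp
    then show ?thesis by simp
  qed
  let ?N = "\<lambda>Y v. m (I Y) (I v) + m (J Y) (J v) + m (K Y) (K v)"
  have N: "(2 * real n - 1) * m Y v = - ?N Y v" for Y v
    using e[of Y v] skew[of "I Y" "I v"] skew[of "J Y" "J v"] skew[of "K Y" "K v"] by (simp add: algebra_simps)
  \<comment> \<open>The sum of the three pullbacks satisfies \<open>N\<^sup>2 = 3 + 2 N\<close>, so
    its eigenvalues are 3 and -1. The equation makes \<open>m\<close> an eigenvector for
    \<open>1 - 2n\<close>, and the discrepancy is the factor \<open>4 n\<^sup>2 - 4\<close>, nonzero
    for \<open>n \<ge> 2\<close>.\<close>
  have NN: "?N (I Y) (I v) + ?N (J Y) (J v) + ?N (K Y) (K v) = 3 * m Y v + 2 * ?N Y v"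
    by (simp add: Jmul neg)
  have "(2 * real n - 1) * ((2 * real n - 1) * m Y v) = ?N (I Y) (I v) + ?N (J Y) (J v) + ?N (K Y) (K v)"
    unfolding N using N[of "I Y" "I v"] N[of "J Y" "J v"] N[of "K Y" "K v"] by (simp add: algebra_simps)
  also have "\<dots> = 3 * m Y v - 2 * ((2 * real n - 1) * m Y v)"
    unfolding NN N by simp
  finally have "(4 * (real n * real n) - 4) * m Y v = 0" by (simp add: algebra_simps)
  moreover have "real n * real n > 1" using n2 by (simp add: less_1_mult)
  ultimately show ?thesis by simp
qed

text \<open>Ricci-flatness says that the sum of \<open>W Y (e b) (e b)\<close> over the frame
  vanishes.\<close>

lemma W_contract_form:
  assumes "bilinear \<psi>" shows "tr (\<lambda>x y. \<psi> (W Y x y) v) = 0"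
proof -
  have "(\<Sum>b\<in>Basis. W Y (e b) (e b)) = 0"
  proof (rule inner_form_ext[OF inner_h])
    fix V
    have "h (\<Sum>b\<in>Basis. W Y (e b) (e b)) V = tr (\<lambda>x y. Wm Y x y V)"
      unfolding tr_def Wm_def using linear_sum[OF linear_h(1)] by simp
    also have "\<dots> = tr (\<lambda>x y. Wm x Y V y)"
      using Wm_skew(1)[of Y _ _ V] Wm_skew(2)[of _ Y _ V] by (simp add: tr_def)
    finally show "h (\<Sum>b\<in>Basis. W Y (e b) (e b)) V = h 0 V"
      using W_ricci[of Y V] by (simp add: Wm_def h_lin)
  qed
  moreover have l: "linear (\<lambda>u. \<psi> u v)" using assms by (simp add: bilinear_def)
  ultimately show ?thesis
    unfolding tr_def using linear_sum[OF l, of "\<lambda>b. W Y (e b) (e b)" Basis] linear_0[OF l] by simp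
qed

text \<open>With \<open>\<psi>\<close> read as a skew endomorphism, the Bianchi identity splits the
  sum that defines \<open>Wf\<close> into two parts, equal because the endomorphism can be moved
  through the trace.\<close>

lemma W_contract_form2:
  assumes \<psi>: "bilinear \<psi>" "\<And>u v. \<psi> u v = - \<psi> v u"
  shows "tr (\<lambda>x y. \<psi> y (W Y x v)) = Wf \<psi> Y v"
proof -
  let ?S = "\<lambda>x. sharp h (\<psi> x)"
  let ?q = "tr (\<lambda>x y. Wm Y x (?S y) v)"
  note S = sharp_eq[OF \<psi>(1)] and lS = linear_sharp[OF \<psi>(1)]
  have adj: "h (?S u) v = h u (- ?S v)" for u v
    using \<psi>(2)[of u v] S[of v u] by (simp add: S h_lin h_sym[of u])
  have "tr (\<lambda>x y. Wm (?S y) Y x v) = tr (\<lambda>x y. Wm (?S x) Y y v)" by (simp add: tr_def)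
  also have "\<dots> = tr (\<lambda>x y. Wm x Y (- ?S y) v)"
    by (rule tr_adjoint[OF bil_Wm(5) lS linear_compose_neg[OF lS] adj])
  also have "\<dots> = ?q"
    using Wm_skew(1)[of _ Y] by (simp add: linear_neg[OF Wm_lin(3)])
  finally have a: "tr (\<lambda>x y. Wm (?S y) Y x v) = ?q" .
  have "2 * Wf \<psi> Y v = tr (\<lambda>x y. Wm x (?S y) Y v)" by (simp add: Wf_tr)
  also have "\<dots> = tr (\<lambda>x y. - Wm (?S y) Y x v - Wm Y x (?S y) v)"
  proof (intro arg_cong[where f=tr] ext)
    show "Wm x (?S y) Y v = - Wm (?S y) Y x v - Wm Y x (?S y) v" for x y
      using Wm_bianchi[of x "?S y" Y v] by simp
  qed
  also have "\<dots> = - 2 * ?q" using a by (simp add: tr_simps)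
  finally have "Wf \<psi> Y v = - ?q" by simp
  moreover have "\<psi> y (W Y x v) = - Wm Y x (?S y) v" for x y
    using Wm_skew(2)[of Y x "?S y" v] h_sym by (simp add: S[symmetric] Wm_def)
  ultimately show ?thesis by (simp add: tr_neg)
qed

text \<open>Contraction over \<open>Z\<close> and \<open>u\<close> annihilates one Weyl term and
  turns the other into \<open>Wf \<psi>\<close>. What is left is a linear equation for the bilinear
  form of \<open>L\<close>; the stated multiple of \<open>Wf \<psi>\<close> solves it, and
  \<open>trace_operator_injective\<close> makes the solution unique.\<close>

lemma weyl_determines:
  assumes \<psi>: "cpt a b c \<psi>" and L: "linear L"
    and eq: "\<And>Y Z u v. - \<psi> (W Y Z u) v - \<psi> u (W Y Z v) = 1 / (4 * real n - 1) * (BB (L Y) Z u v - BB (L Z) Y u v)"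
  shows "h (L Y) v = (4 * real n - 1) / (4 * (real n + 1)) * Wf \<psi> Y v"
proof -
  note bil = cptD(1)[OF \<psi>] and skew = cptD(2)[OF \<psi>]
  note Llin = linear_add[OF L] linear_cmul[OF L]
  define m where "m x y = h (L x) y" for x y
  have bm: "bilinear m" unfolding bilinear_def m_def by (auto intro!: linearI simp: h_lin Llin)
  have lm: "linear (\<lambda>x. m x y)" "linear (m x)" for x y using bm by (simp_all add: bilinear_def)
  \<comment> \<open>\<open>Wf \<psi>\<close> is skew, invariant under the structures and without
    traces, so the left side of \<open>Phi\<close> multiplies it by
    \<open>- (4n - 2) - 3 - 3 = - (4n + 4)\<close>, while the right side has the factor
    \<open>- (4n - 1)\<close>.\<close>
  define \<mu> where "\<mu> = (4 * real n - 1) / (4 * (real n + 1))"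
  define M where "M x y = m x y - \<mu> * Wf \<psi> x y" for x y
  have bW: "bilinear (Wf \<psi>)" using Wf_cpt cptD(1) by blast
  have bM: "bilinear M" unfolding M_def bilinear_def
    by (auto intro!: linearI simp: bilinear_ladd[OF bm] bilinear_radd[OF bm] bilinear_lmul[OF bm] bilinear_rmul[OF bm]
       bilinear_ladd[OF bW] bilinear_radd[OF bW] bilinear_lmul[OF bW] bilinear_rmul[OF bW] algebra_simps)
  have hL: "h (L x) y = m x y" "h (I (L x)) y = - m x (I y)" "h (J (L x)) y = - m x (J y)" "h (K (L x)) y = - m x (K y)" for x y
    by (simp_all add: m_def h_I h_J h_K)
  have Phi: "- (4 * real n - 2) * m Y v - tr m * h Y v
      + (tr (\<lambda>x y. m x (I y)) * h (I Y) v + tr (\<lambda>x y. m x (J y)) * h (J Y) v + tr (\<lambda>x y. m x (K y)) * h (K Y) v)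
      - (m (I Y) (I v) + m (J Y) (J v) + m (K Y) (K v)) + (m (I v) (I Y) + m (J v) (J Y) + m (K v) (K Y))
      = - (4 * real n - 1) * Wf \<psi> Y v" for Y v
  proof -
    have c: "tr (\<lambda>x y. h A y * m x B) = m A B" for A B
      using tr_contract(2)[OF lm(1), of B A] by (simp add: mult.commute)
    have t1: "tr (\<lambda>x y. BB (L x) Y y v) = tr m * h Y v - m Y v
       - tr (\<lambda>x y. m x (I y)) * h (I Y) v + m (I Y) (I v) - tr (\<lambda>x y. m x (J y)) * h (J Y) v + m (J Y) (J v)
       - tr (\<lambda>x y. m x (K y)) * h (K Y) v + m (K Y) (K v)
       - (m (I v) (I Y) + m (J v) (J Y) + m (K v) (K Y))"
    proof -
      have y: "h (I y) v = - h (I v) y" "h (J y) v = - h (J v) y" "h (K y) v = - h (K v) y" for y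
        by (rule h_skew)+
      have b: "BB (L x) Y y v = m x y * h Y v - h Y y * m x v
         + (- (m x (I y) * h (I Y) v) + h (I Y) y * m x (I v)) + (- (m x (J y) * h (J Y) v) + h (J Y) y * m x (J v))
         + (- (m x (K y) * h (K Y) v) + h (K Y) y * m x (K v))
         - (h (I v) y * m x (I Y) + h (J v) y * m x (J Y) + h (K v) y * m x (K Y))" for x y
        unfolding BB_def unfolding hL unfolding y by simp
      show ?thesis unfolding b by (simp add: tr_simps c)
    qed
    have t2: "tr (\<lambda>x y. BB (L Y) x y v) = (1 - 4 * real n) * m Y v"
      using BB_contract[of "L Y" v] by (simp add: tr_def m_def)
    have "- Wf \<psi> Y v = tr (\<lambda>x y. - \<psi> (W Y x y) v - \<psi> y (W Y x v))"
      by (simp add: tr_simps W_contract_form[OF bil] W_contract_form2[OF bil skew])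
    also have "\<dots> = 1 / (4 * real n - 1) * (tr (\<lambda>x y. BB (L Y) x y v) - tr (\<lambda>x y. BB (L x) Y y v))"
      unfolding eq by (simp only: tr_simps)
    finally have "- Wf \<psi> Y v * (4 * real n - 1) = tr (\<lambda>x y. BB (L Y) x y v) - tr (\<lambda>x y. BB (L x) Y y v)"
      using n2 by (simp add: field_simps)
    then show ?thesis unfolding t1 t2 by (simp add: algebra_simps)
  qed
  have trW: "tr (Wf \<psi>) = 0" "tr (\<lambda>x y. Wf \<psi> x (I y)) = 0" "tr (\<lambda>x y. Wf \<psi> x (J y)) = 0" "tr (\<lambda>x y. Wf \<psi> x (K y)) = 0"
  proof -
    have "Wf \<psi> x x = 0" for x using cptD(2)[OF Wf_cpt, of \<psi> x x] by simp
    then show "tr (Wf \<psi>) = 0" by (simp add: tr_def)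
    show "tr (\<lambda>x y. Wf \<psi> x (I y)) = 0" "tr (\<lambda>x y. Wf \<psi> x (J y)) = 0" "tr (\<lambda>x y. Wf \<psi> x (K y)) = 0"
      using cpt_coeff[OF Wf_cpt[of \<psi>]] n2 by simp_all
  qed
  have "M Y v = 0"
  proof (rule trace_operator_injective[OF bM])
    fix Y v
    have w: "Wf \<psi> (I u) (I v) = Wf \<psi> u v" "Wf \<psi> (J u) (J v) = Wf \<psi> u v" "Wf \<psi> (K u) (K v) = Wf \<psi> u v" for u v
      using cptD(3-5)[OF Wf_cpt[of \<psi>], of u v] by simp_all
    have trM: "tr M = tr m" "tr (\<lambda>x y. M x (I y)) = tr (\<lambda>x y. m x (I y))" "tr (\<lambda>x y. M x (J y)) = tr (\<lambda>x y. m x (J y))"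
      "tr (\<lambda>x y. M x (K y)) = tr (\<lambda>x y. m x (K y))"
      unfolding M_def by (simp_all add: tr_simps trW)
    have "\<mu> * (4 * real n + 4) = 4 * real n - 1" unfolding \<mu>_def by (simp add: field_simps)
    then have "\<mu> * (4 * real n + 4) * Wf \<psi> Y v = (4 * real n - 1) * Wf \<psi> Y v" by simp
    then show "- (4 * real n - 2) * M Y v - tr M * h Y v
      + (tr (\<lambda>x y. M x (I y)) * h (I Y) v + tr (\<lambda>x y. M x (J y)) * h (J Y) v + tr (\<lambda>x y. M x (K y)) * h (K Y) v)
      - (M (I Y) (I v) + M (J Y) (J v) + M (K Y) (K v)) + (M (I v) (I Y) + M (J v) (J Y) + M (K v) (K Y)) = 0"
      using Phi[of Y v] cptD(2)[OF Wf_cpt[of \<psi>], of v Y] unfolding trM unfolding M_def w by (simp add: algebra_simps)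
  qed
  then show ?thesis by (simp add: M_def m_def \<mu>_def)
qed

end

section \<open>The full curvature acting on compatible forms and on vectors\<close>

context quat_curv begin

lemma curvature_action:
  assumes "cpt a b c \<psi>" and P: "\<And>x v. h (P x) v = chi \<psi> x v"
  shows "- \<psi> (R Y Z u) v - \<psi> u (R Y Z v) = - \<psi> (Wv Y Z u) v - \<psi> u (Wv Y Z v)
     + nu / 4 * (BB (P Y) Z u v - BB (P Z) Y u v)"
proof -
  note bil = cptD(1)[OF assms(1)]
  have "nu / 4 * (\<psi> (rz Y Z u) v + \<psi> u (rz Y Z v)) = nu / 4 * (BB (P Y) Z u v - BB (P Z) Y u v)"
    by (simp only: rz_action[OF assms(1) P P, of Y Z u v])
  then show ?thesis
    unfolding Wv_def by (simp add: bilinear_ladd[OF bil] bilinear_radd[OF bil] bilinear_lmul[OF bil]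
      bilinear_rmul[OF bil] algebra_simps)
qed

text \<open>The \<open>chi\<close> terms cancel the model part of \<open>R\<close>. In the Weyl part
  the factor 4 of \<open>Wf_BB\<close> cancels the \<open>1 / 4\<close>, and the Bianchi identity
  turns the difference into \<open>1 / (n + 1)\<close> times \<open>Wv Y Z X\<close>, to be added to
  the \<open>Wv\<close> already contained in \<open>R\<close>.\<close>

lemma curvature_vector:
  "h (R Y Z X) v + 1 / 4 * ((nu * chi (BB X Z) Y v + 1 / (real n + 1) * weyl.Wf (BB X Z) Y v)
      - (nu * chi (BB X Y) Z v + 1 / (real n + 1) * weyl.Wf (BB X Y) Z v))
    = (real n + 2) / (real n + 1) * h (Wv Y Z X) v"
proof -
  have "h (R Y Z X) v = h (Wv Y Z X) v - nu / 4 * (chi (BB X Z) Y v - chi (BB X Y) Z v)"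
    using rz_chi[of Y Z X v] by (simp add: Wv_def h_lin)
  moreover have "weyl.Wm X Z Y v - weyl.Wm X Y Z v = h (Wv Y Z X) v"
    using weyl.Wm_bianchi[of X Z Y v] weyl.Wm_skew(1)[of Y X Z v] weyl.Wm_skew(1)[of Z Y X v]
    by (simp add: weyl.Wm_def)
  moreover have "1 / 4 * ((p + r * (4 * w)) - (q + r * (4 * w'))) = (p - q) / 4 + r * (w - w')" for p q r w w' :: real
    by (simp add: field_simps)
  moreover have "w + 1 / (real n + 1) * w = (real n + 2) / (real n + 1) * w" for w
    by (simp add: field_simps)
  ultimately show ?thesis
    unfolding weyl.Wf_BB by (simp only:) (simp add: right_diff_distrib diff_divide_distrib)
qed

end

section \<open>Admissible bases\<close>

text \<open>Indices \<open>J 1\<close> must not be rewritten to \<open>J (Suc 0)\<close>.\<close>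

declare One_nat_def [simp del]

lemma sum_1_3: "(\<Sum>i=1..3. f i) = f 1 + f 2 + f (3::nat)"
  by (simp add: numeral_3_eq_3 numeral_2_eq_2 One_nat_def add.assoc)

lemma admissible_quat_alg:
  fixes h :: "'e::euclidean_space \<Rightarrow> 'e \<Rightarrow> real"
  assumes h: "inner_form h" and adm: "admissible h q JJ" and dim: "DIM('e) = 4 * n" "n \<ge> 2"
  shows "quat_alg h (JJ 1) (JJ 2) (JJ 3) n"
    and "q = {(\<lambda>v. a *\<^sub>R JJ 1 v + b *\<^sub>R JJ 2 v + c *\<^sub>R JJ 3 v) | a b c. True}"
proof -
  have i: "linear (JJ i)" "JJ i (JJ i v) = - v" "h (JJ i u) (JJ i v) = h u v" if "i \<in> {1..3}" for i u v
    using adm that unfolding admissible_def by blast+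
  have mem: "1 \<in> {1..3::nat}" "2 \<in> {1..3::nat}" "3 \<in> {1..3::nat}" by auto
  note lin = mem[THEN i(1)] and sq = mem[THEN i(2)] and orth = mem[THEN i(3)]
  have "\<forall>i\<in>{1..3}. \<forall>j\<in>{1..3}. i \<noteq> j \<longrightarrow> (\<forall>v. JJ i (JJ j v) = - JJ j (JJ i v))"
    using adm unfolding admissible_def by blast
  then have anti: "JJ 1 (JJ 2 v) = - JJ 2 (JJ 1 v)" for v
    using mem by (metis one_eq_numeral_iff semiring_norm(85))
  have three: "JJ 3 v = JJ 1 (JJ 2 v)" for v
    using adm unfolding admissible_def by blast
  have J21: "JJ 2 (JJ 1 v) = - JJ 3 v" for v using anti[of v] three[of v] by simp
  have neg: "JJ 1 (- v) = - JJ 1 v" "JJ 2 (- v) = - JJ 2 v" "JJ 3 (- v) = - JJ 3 v" for v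
    using lin[THEN linear_neg] by auto
  have a: "JJ 3 (JJ 2 v) = - JJ 1 v" for v using three[of "JJ 2 v"] sq(2) neg by simp
  have b: "JJ 1 (JJ 3 v) = - JJ 2 v" for v using three[of v] sq(1) by simp
  have c: "JJ 3 (JJ 1 v) = JJ 2 v" for v using three[of "JJ 1 v"] J21 b neg by simp
  have d: "JJ 2 (JJ 3 v) = JJ 1 v" for v using three[of v] J21[of "JJ 2 v"] a neg by simp
  show "quat_alg h (JJ 1) (JJ 2) (JJ 3) n"
    by (rule quat_alg.intro; fact h lin sq orth dim a b c d J21 three[symmetric])
  have "q = {(\<lambda>v. \<Sum>i=1..3. a i *\<^sub>R JJ i v) | a :: nat \<Rightarrow> real. True}"
    using adm unfolding admissible_def by blast
  also have "\<dots> = {(\<lambda>v. a *\<^sub>R JJ 1 v + b *\<^sub>R JJ 2 v + c *\<^sub>R JJ 3 v) | a b c. True}"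
  proof (intro equalityI subsetI)
    fix B assume "B \<in> {(\<lambda>v. a *\<^sub>R JJ 1 v + b *\<^sub>R JJ 2 v + c *\<^sub>R JJ 3 v) | a b c. True}"
    then obtain a b c where "B = (\<lambda>v. a *\<^sub>R JJ 1 v + b *\<^sub>R JJ 2 v + c *\<^sub>R JJ 3 v)" by blast
    then have "B = (\<lambda>v. \<Sum>i=1..3. (if i = 1 then a else if i = 2 then b else c) *\<^sub>R JJ i v)"
      unfolding sum_1_3 by simp
    then show "B \<in> {(\<lambda>v. \<Sum>i=1..3. a i *\<^sub>R JJ i v) | a :: nat \<Rightarrow> real. True}"
      by (intro CollectI exI[of _ "\<lambda>i. if i = 1 then a else if i = 2 then b else c"]) simp
  qed (auto simp only: sum_1_3)
  finally show "q = {(\<lambda>v. a *\<^sub>R JJ 1 v + b *\<^sub>R JJ 2 v + c *\<^sub>R JJ 3 v) | a b c. True}" .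
qed

lemma admissible_mem:
  fixes h :: "'e::euclidean_space \<Rightarrow> 'e \<Rightarrow> real"
  assumes "inner_form h" "admissible h q JJ" "DIM('e) = 4 * n" "n \<ge> 2"
  shows "JJ 1 \<in> q" "JJ 2 \<in> q" "JJ 3 \<in> q"
proof -
  show "JJ 1 \<in> q" unfolding admissible_quat_alg(2)[OF assms]
    by (rule CollectI, rule exI[of _ 1], rule exI[of _ 0], rule exI[of _ 0]) simp
  show "JJ 2 \<in> q" unfolding admissible_quat_alg(2)[OF assms]
    by (rule CollectI, rule exI[of _ 0], rule exI[of _ 1], rule exI[of _ 0]) simp
  show "JJ 3 \<in> q" unfolding admissible_quat_alg(2)[OF assms]
    by (rule CollectI, rule exI[of _ 0], rule exI[of _ 0], rule exI[of _ 1]) simp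
qed

text \<open>A right inverse of a square matrix is a left inverse. It will be applied to the matrix
  that expresses one admissible basis in another.\<close>

lemma orthonormal_rows_columns:
  fixes x y z :: "3 \<Rightarrow> real"
  assumes "\<And>i j. x i * x j + y i * y j + z i * z j = (if i = j then 1 else 0)"
  shows "(\<Sum>i\<in>UNIV. x i * x i) = 1" "(\<Sum>i\<in>UNIV. y i * y i) = 1" "(\<Sum>i\<in>UNIV. z i * z i) = 1"
    "(\<Sum>i\<in>UNIV. x i * y i) = 0" "(\<Sum>i\<in>UNIV. x i * z i) = 0" "(\<Sum>i\<in>UNIV. y i * z i) = 0"
proof -
  define M :: "real^3^3" where "M = (\<chi> i. vector [x i, y i, z i])"
  have Mx: "M $ i $ 1 = x i" and My: "M $ i $ 2 = y i" and Mz: "M $ i $ 3 = z i" for i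
    by (simp_all add: M_def)
  have "M ** transpose M = mat 1"
    unfolding vec_eq_iff matrix_matrix_mult_def mat_def
    by (simp add: transpose_def sum_3 Mx My Mz assms)
  then have "transpose M ** M = mat 1" by (simp add: matrix_left_right_inverse)
  then have "(transpose M ** M) $ i $ j = mat 1 $ i $ j" for i j by simp
  then have e: "(\<Sum>k\<in>UNIV. M $ k $ i * M $ k $ j) = (if i = j then 1 else 0)" for i j
    by (simp only: matrix_matrix_mult_def transpose_def mat_def vec_lambda_beta)
  show "(\<Sum>i\<in>UNIV. x i * x i) = 1" using e[of 1 1] by (simp add: Mx My Mz)
  show "(\<Sum>i\<in>UNIV. y i * y i) = 1" using e[of 2 2] by (simp add: Mx My Mz)
  show "(\<Sum>i\<in>UNIV. z i * z i) = 1" using e[of 3 3] by (simp add: Mx My Mz)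
  show "(\<Sum>i\<in>UNIV. x i * y i) = 0" using e[of 1 2] by (simp add: Mx My Mz)
  show "(\<Sum>i\<in>UNIV. x i * z i) = 0" using e[of 1 3] by (simp add: Mx My Mz)
  show "(\<Sum>i\<in>UNIV. y i * z i) = 0" using e[of 2 3] by (simp add: Mx My Mz)
qed

text \<open>The anticommutation relations of both bases say that the transition matrix has
  orthonormal rows. Its columns are then orthonormal too, and this makes the mixed terms of the sum
  disappear.\<close>

lemma admissible_sum_unique:
  fixes h :: "'e::euclidean_space \<Rightarrow> 'e \<Rightarrow> real" and \<beta> :: "'e \<Rightarrow> 'e \<Rightarrow> 'b::real_vector"
  assumes h: "inner_form h" and adm: "admissible h q JJ" "admissible h q JJ'"
    and dim: "DIM('e) = 4 * n" "n \<ge> 2" and \<beta>: "bilinear \<beta>"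
  shows "(\<Sum>i=1..3. \<beta> (JJ' i u) (JJ' i v)) = (\<Sum>i=1..3. \<beta> (JJ i u) (JJ i v))"
proof -
  interpret q: quat_alg h "JJ 1" "JJ 2" "JJ 3" n by (rule admissible_quat_alg(1)[OF h adm(1) dim])
  interpret q': quat_alg h "JJ' 1" "JJ' 2" "JJ' 3" n by (rule admissible_quat_alg(1)[OF h adm(2) dim])
  \<comment> \<open>The second basis, reindexed by the three-element type so that the coefficients
    form a square matrix.\<close>
  define F where "F i = JJ' (if i = 1 then 1 else if i = 2 then 2 else 3)" for i :: 3
  have F: "F 1 = JJ' 1" "F 2 = JJ' 2" "F 3 = JJ' 3" by (simp_all add: F_def)
  have "F i \<in> q" for i
  proof -
    have "JJ' 1 \<in> q" "JJ' 2 \<in> q" "JJ' 3 \<in> q"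
      using admissible_mem[OF h adm(2) dim] by blast+
    then show ?thesis by (simp add: F_def)
  qed
  then have "\<forall>i. \<exists>x y z. F i = (\<lambda>v. x *\<^sub>R JJ 1 v + y *\<^sub>R JJ 2 v + z *\<^sub>R JJ 3 v)"
    unfolding admissible_quat_alg(2)[OF h adm(1) dim] by blast
  then obtain x y z where xyz: "\<And>i v. F i v = x i *\<^sub>R JJ 1 v + y i *\<^sub>R JJ 2 v + z i *\<^sub>R JJ 3 v" by metis
  have FF: "F i (F j v) + F j (F i v) = (if i = j then - 2 else 0) *\<^sub>R v" for i j v
    using exhaust_3[of i] exhaust_3[of j] by (auto simp: F q'.Jmul scaleR_2)
  have rows: "x i * x j + y i * y j + z i * z j = (if i = j then 1 else 0)" for i j
  proof -
    have "(- 2 * (x i * x j + y i * y j + z i * z j) - (if i = j then - 2 else 0)) *\<^sub>R v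
       + 0 *\<^sub>R JJ 1 v + 0 *\<^sub>R JJ 2 v + 0 *\<^sub>R JJ 3 v = 0" for v
    proof -
      let ?s = "- (x i * x j + y i * y j + z i * z j)"
      have "F i (F j v) + F j (F i v) = ?s *\<^sub>R v + ?s *\<^sub>R v"
        unfolding xyz by (simp only: q.J_lin q.Jmul) (simp add: algebra_simps)
      also have "\<dots> = (- 2 * (x i * x j + y i * y j + z i * z j)) *\<^sub>R v"
        by (simp add: scaleR_left_distrib[symmetric])
      finally show ?thesis using FF[of i j v] by (simp add: scaleR_left_diff_distrib)
    qed
    from q.one_IJK_independent(1)[OF this] show ?thesis by (simp split: if_splits)
  qed
  note cols = orthonormal_rows_columns[of x y z, OF rows]
  note bl = bilinear_ladd[OF \<beta>] bilinear_radd[OF \<beta>] bilinear_lmul[OF \<beta>] bilinear_rmul[OF \<beta>]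
  have "(\<Sum>i=1..3. \<beta> (JJ' i u) (JJ' i v)) = (\<Sum>i\<in>UNIV. \<beta> (F i u) (F i v))"
    unfolding sum_1_3 sum_3 F ..
  also have "\<dots> = (\<Sum>i\<in>UNIV. (x i * x i) *\<^sub>R \<beta> (JJ 1 u) (JJ 1 v) + (y i * y i) *\<^sub>R \<beta> (JJ 2 u) (JJ 2 v)
      + (z i * z i) *\<^sub>R \<beta> (JJ 3 u) (JJ 3 v)
      + ((x i * y i) *\<^sub>R (\<beta> (JJ 1 u) (JJ 2 v) + \<beta> (JJ 2 u) (JJ 1 v))
       + (x i * z i) *\<^sub>R (\<beta> (JJ 1 u) (JJ 3 v) + \<beta> (JJ 3 u) (JJ 1 v))
       + (y i * z i) *\<^sub>R (\<beta> (JJ 2 u) (JJ 3 v) + \<beta> (JJ 3 u) (JJ 2 v))))"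
    unfolding xyz bl by (intro sum.cong refl) (simp add: algebra_simps)
  also have "\<dots> = (\<Sum>i=1..3. \<beta> (JJ i u) (JJ i v))"
    unfolding sum.distrib scaleR_sum_left[symmetric] cols sum_1_3 by simp
  finally show ?thesis .
qed

lemma admissible_adm_basis: "admissible h q JJ \<Longrightarrow> admissible h q (adm_basis h q)"
  unfolding adm_basis_def by (rule someI[where P="admissible h q"])

locale quat_point =
  fixes h :: "'e::euclidean_space \<Rightarrow> 'e \<Rightarrow> real" and q :: "('e \<Rightarrow> 'e) set" and n :: nat and JJ :: "nat \<Rightarrow> 'e \<Rightarrow> 'e"
  assumes inner_form_h: "inner_form h" and adm_JJ: "admissible h q JJ"
    and dim_4n: "DIM('e) = 4 * n" and n_ge_2: "n \<ge> 2"
begin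

sublocale quat_alg h "JJ 1" "JJ 2" "JJ 3" n
  by (rule admissible_quat_alg(1)[OF inner_form_h adm_JJ dim_4n n_ge_2])

lemmas q_eq = admissible_quat_alg(2)[OF inner_form_h adm_JJ dim_4n n_ge_2]

text \<open>\<open>S2E\<close> asks for invariance under all admissible bases, but a single one
  decides: the members of another basis are \<open>x I + y J + z K\<close> with
  \<open>x\<^sup>2 + y\<^sup>2 + z\<^sup>2 = 1\<close>, as their square is minus the identity, and
  for an invariant form the mixed terms cancel.\<close>

lemma S2E_iff: "\<beta> \<in> S2E h q \<longleftrightarrow> cpt 0 0 0 \<beta>"
proof
  assume "\<beta> \<in> S2E h q"
  then have b: "bilinear \<beta>" "\<And>u v. \<beta> u v = - \<beta> v u" "\<And>i u v. i \<in> {1..3} \<Longrightarrow> \<beta> (JJ i u) (JJ i v) = \<beta> u v"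
    using adm_JJ unfolding S2E_def by blast+
  show "cpt 0 0 0 \<beta>"
    using b(3)[of 1] b(3)[of 2] b(3)[of 3] by (intro cptI b(1,2)) simp_all
next
  assume \<beta>: "cpt 0 0 0 \<beta>"
  note bil = cptD(1)[OF \<beta>]
  note bl = bilinear_ladd[OF bil] bilinear_radd[OF bil] bilinear_lmul[OF bil] bilinear_rmul[OF bil]
  have "\<beta> (J' i u) (J' i v) = \<beta> u v" if J': "admissible h q J'" and i: "i \<in> {1..3}" for J' i u v
  proof -
    interpret q': quat_alg h "J' 1" "J' 2" "J' 3" n
      by (rule admissible_quat_alg(1)[OF inner_form_h J' dim_4n n_ge_2])
    have i': "i = 1 \<or> i = 2 \<or> i = 3" using i by auto
    have sq: "J' i (J' i v) = - v" for v using i' q'.Jmul by auto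
    have "J' 1 \<in> q" "J' 2 \<in> q" "J' 3 \<in> q"
      using admissible_mem[OF inner_form_h J' dim_4n n_ge_2] by blast+
    then have "J' i \<in> q" using i' by auto
    then obtain x y z where "J' i = (\<lambda>v. x *\<^sub>R JJ 1 v + y *\<^sub>R JJ 2 v + z *\<^sub>R JJ 3 v)"
      unfolding q_eq by blast
    then have xyz: "J' i v = x *\<^sub>R JJ 1 v + y *\<^sub>R JJ 2 v + z *\<^sub>R JJ 3 v" for v by simp
    have "(1 - (x * x + y * y + z * z)) *\<^sub>R v + 0 *\<^sub>R JJ 1 v + 0 *\<^sub>R JJ 2 v + 0 *\<^sub>R JJ 3 v = 0" for v
    proof -
      have "J' i (J' i v) = - ((x * x + y * y + z * z) *\<^sub>R v)"
        unfolding xyz by (simp only: J_lin Jmul) (simp add: algebra_simps)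
      then show ?thesis using sq[of v] by (simp add: scaleR_left_diff_distrib)
    qed
    from one_IJK_independent(1)[OF this] have n: "x * x + y * y + z * z = 1" by simp
    have "\<beta> (J' i u) (J' i v) = (x * x + y * y + z * z) * \<beta> u v"
      unfolding xyz bl using cptD(3-5)[OF \<beta>]
      by (simp add: cpt0_move[OF \<beta>] Jmul bilinear_lneg[OF bil] algebra_simps)
    then show ?thesis using n by simp
  qed
  then show "\<beta> \<in> S2E h q" using bil cptD(2)[OF \<beta>] unfolding S2E_def by blast
qed

lemma compatible_iff: "\<psi> \<in> compatible h q \<longleftrightarrow> (\<exists>a b c. cpt a b c \<psi>)"
proof
  assume "\<psi> \<in> compatible h q"
  then obtain \<alpha> \<beta> where \<psi>: "\<psi> = (\<lambda>u v. \<alpha> u v + \<beta> u v)" and "\<alpha> \<in> S2H h q" and \<beta>: "cpt 0 0 0 \<beta>"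
    unfolding compatible_def S2E_iff by blast
  then obtain a b c where \<alpha>: "\<alpha> = (\<lambda>u v. h (a *\<^sub>R JJ 1 u + b *\<^sub>R JJ 2 u + c *\<^sub>R JJ 3 u) v)"
    unfolding S2H_def q_eq kaehler_form_def by blast
  have "cpt a b c \<alpha>"
  proof (rule cptI)
    show "bilinear \<alpha>" unfolding \<alpha> bilinear_def by (auto intro!: linearI simp: qs algebra_simps)
    show "\<alpha> u v = - \<alpha> v u" for u v unfolding \<alpha> using h_skew[of u v] by (simp add: h_lin)
  qed (simp_all add: \<alpha> qs algebra_simps)
  from cpt_add[OF this \<beta>] show "\<exists>a b c. cpt a b c \<psi>" unfolding \<psi> by auto
next
  assume "\<exists>a b c. cpt a b c \<psi>"
  then obtain a b c where "cpt a b c \<psi>" by blast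
  then obtain \<beta> where \<beta>: "cpt 0 0 0 \<beta>" and e: "\<And>u v. \<psi> u v = \<beta> u v + (a * h (JJ 1 u) v + b * h (JJ 2 u) v + c * h (JJ 3 u) v)"
    using cpt_decompose by blast
  have "kaehler_form h (\<lambda>v. a *\<^sub>R JJ 1 v + b *\<^sub>R JJ 2 v + c *\<^sub>R JJ 3 v) \<in> S2H h q"
    unfolding S2H_def q_eq by blast
  moreover have "\<psi> = (\<lambda>u v. kaehler_form h (\<lambda>v. a *\<^sub>R JJ 1 v + b *\<^sub>R JJ 2 v + c *\<^sub>R JJ 3 v) u v + \<beta> u v)"
    by (simp add: fun_eq_iff e kaehler_form_def h_lin)
  ultimately show "\<psi> \<in> compatible h q"
    unfolding compatible_def using \<beta> S2E_iff by blast
qed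

lemma quat_point_adm_basis: "quat_point h q n (adm_basis h q)"
  by (intro quat_point.intro inner_form_h admissible_adm_basis[OF adm_JJ] dim_4n n_ge_2)

end

text \<open>With the two components of a compatible form, \<open>\<psi>\<^sup>E - 2 \<psi>\<^sup>H =
  \<psi> - 3 \<psi>\<^sup>H\<close>; the frame sums in \<open>proj_S2H\<close> are \<open>4n\<close>
  times the coefficients.\<close>

lemma (in quat_point) chi_proj:
  assumes "cpt a b c \<psi>" and adm: "adm_basis h q = JJ"
  shows "\<nu> * proj_S2E h q \<psi> u v - 2 * \<nu> * proj_S2H h q \<psi> u v = \<nu> * chi \<psi> u v"
proof -
  have H: "proj_S2H h q \<psi> u v = a * h (JJ 1 u) v + b * h (JJ 2 u) v + c * h (JJ 3 u) v"
  proof -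
    have "(\<Sum>b\<in>Basis. \<psi> (e b) (JJ 1 (e b))) = 4 * real n * a" "(\<Sum>b\<in>Basis. \<psi> (e b) (JJ 2 (e b))) = 4 * real n * b"
      "(\<Sum>b\<in>Basis. \<psi> (e b) (JJ 3 (e b))) = 4 * real n * c"
      using cpt_coeff[OF assms(1)] n_ge_2 by (simp_all add: tr_def)
    then have "proj_S2H h q \<psi> u v = 1 / (4 * real n)
       * (4 * real n * a * h (JJ 1 u) v + 4 * real n * b * h (JJ 2 u) v + 4 * real n * c * h (JJ 3 u) v)"
      unfolding proj_S2H_def adm Let_def sum_1_3 kaehler_form_def sum_distrib_right[symmetric] dim_4n by simp
    then show ?thesis using n_ge_2 by (simp add: distrib_left)
  qed
  have E: "proj_S2E h q \<psi> u v = \<psi> u v - (a * h (JJ 1 u) v + b * h (JJ 2 u) v + c * h (JJ 3 u) v)"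
    unfolding proj_S2E_def adm Let_def sum_1_3 cptD(3-5)[OF assms(1)] by (simp add: algebra_simps)
  show ?thesis unfolding H E chi_cpt[OF assms(1)] by (simp add: algebra_simps)
qed

lemma (in quat_point) BB_sums:
  "wedge h X Z u v + (\<Sum>i=1..3. wedge h (JJ i X) (JJ i Z) u v)
     - (\<Sum>i=1..3. kaehler_form h (JJ i) X Z * kaehler_form h (JJ i) u v) = BB X Z u v"
  unfolding sum_1_3 BB_def wedge_def wedge_end_def kaehler_form_def by (simp add: h_lin)

lemma (in quat_point) rz_sums:
  "wedge_end h X Y Z + (\<Sum>i=1..3. wedge_end h (JJ i X) (JJ i Y) Z)
     + 2 *\<^sub>R (\<Sum>i=1..3. kaehler_form h (JJ i) X Y *\<^sub>R JJ i Z) = rz X Y Z"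
  unfolding sum_1_3 rz_def wedge_end_def kaehler_form_def by simp

section \<open>Charts\<close>

definition chart_trans :: "('a, 'e) chart \<Rightarrow> ('a, 'e) chart \<Rightarrow> 'e \<Rightarrow> 'e" where
  "chart_trans b c x = snd c (chart_inv b x)"

definition cdom :: "('a, 'e) chart \<Rightarrow> 'a set \<Rightarrow> 'e set" where
  "cdom c U = snd c ` (fst c \<inter> U)"

text \<open>The point is moved to the first place, as in \<open>bil_field\<close>;
  \<open>erep\<close> does the same for \<open>lin_field\<close>.\<close>

definition frep :: "('a, 'e::euclidean_space) chart set \<Rightarrow> ('a, 'e) chart \<Rightarrow> ('a \<Rightarrow> 'e \<Rightarrow> 'e \<Rightarrow> real) \<Rightarrow> 'e \<Rightarrow> 'e \<Rightarrow> 'e \<Rightarrow> real" where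
  "frep A c \<psi> x u v = form_rep A c \<psi> u v x"

definition erep :: "('a, 'e::euclidean_space) chart set \<Rightarrow> ('a, 'e) chart \<Rightarrow> ('a \<Rightarrow> 'e \<Rightarrow> 'e) \<Rightarrow> 'e \<Rightarrow> 'e \<Rightarrow> 'e" where
  "erep A c J x u = end_rep A c J u x"

locale atlas =
  fixes A :: "('a::{t2_space,second_countable_topology}, 'e::euclidean_space) chart set"
  assumes atlas: "smooth_atlas A"
begin

abbreviation bc :: "'a \<Rightarrow> ('a, 'e) chart" where "bc p \<equiv> base_chart A p"

lemma bc_in: "bc p \<in> A" and bc_dom: "p \<in> fst (bc p)"
proof -
  obtain c where "c \<in> A" "p \<in> fst c" using atlas unfolding smooth_atlas_def by blast
  then have "bc p \<in> A \<and> p \<in> fst (bc p)"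
    unfolding base_chart_def by (intro someI[where P="\<lambda>c. c \<in> A \<and> p \<in> fst c"]) simp
  then show "bc p \<in> A" "p \<in> fst (bc p)" by auto
qed

lemma open_chart: "c \<in> A \<Longrightarrow> open (fst c)"
  using atlas unfolding smooth_atlas_def by blast

lemma chart_homeo: "c \<in> A \<Longrightarrow> homeomorphism (fst c) (snd c ` fst c) (snd c) (chart_inv c)"
  using atlas unfolding smooth_atlas_def by blast

lemma chart_inv_chart [simp]: "c \<in> A \<Longrightarrow> p \<in> fst c \<Longrightarrow> chart_inv c (snd c p) = p"
  using chart_homeo homeomorphism_apply1 by blast

lemma open_cdom: assumes "c \<in> A" "open U" shows "open (cdom c U)"
proof -
  have "openin (top_of_set (fst c)) (fst c \<inter> U)" using assms(2) by blast
  then have "openin (top_of_set (snd c ` fst c)) (snd c ` (fst c \<inter> U))"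
    using homeomorphism_imp_open_map[OF chart_homeo[OF assms(1)]] by blast
  moreover have "open (snd c ` fst c)" using atlas assms(1) unfolding smooth_atlas_def by blast
  ultimately show ?thesis unfolding cdom_def using openin_open_trans by blast
qed

lemma cdom_iff: "c \<in> A \<Longrightarrow> x \<in> cdom c U \<longleftrightarrow> x \<in> snd c ` fst c \<and> chart_inv c x \<in> fst c \<and> chart_inv c x \<in> U"
  unfolding cdom_def by force

lemma cdomI: "p \<in> fst c \<Longrightarrow> p \<in> U \<Longrightarrow> snd c p \<in> cdom c U"
  unfolding cdom_def by blast

lemma cdomE:
  assumes "x \<in> cdom c U" obtains p where "p \<in> fst c" "p \<in> U" "x = snd c p"
  using assms unfolding cdom_def by blast

lemma trans_smooth: "b \<in> A \<Longrightarrow> c \<in> A \<Longrightarrow> Cinf_on (cdom b (fst c)) (chart_trans b c)"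
  using atlas unfolding smooth_atlas_def cdom_def chart_trans_def by blast

lemma trans_apply: "b \<in> A \<Longrightarrow> p \<in> fst b \<Longrightarrow> chart_trans b c (snd b p) = snd c p"
  by (simp add: chart_trans_def)

lemma trans_diff: "b \<in> A \<Longrightarrow> c \<in> A \<Longrightarrow> p \<in> fst b \<Longrightarrow> p \<in> fst c \<Longrightarrow> chart_trans b c differentiable at (snd b p)"
  by (rule Cinf_onD[OF trans_smooth]) (auto intro: cdomI)

lemma DD_trans_id:
  assumes "b \<in> A" "p \<in> fst b" shows "DD (chart_trans b b) (snd b p) w = w"
proof -
  have "DD (chart_trans b b) (snd b p) w = DD (\<lambda>x. x) (snd b p) w"
    by (rule fun_cong[OF frechet_derivative_cong_open[OF open_cdom[OF assms(1) open_chart[OF assms(1)]]]])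
       (use assms in \<open>auto intro: cdomI elim!: cdomE simp: trans_apply\<close>)
  then show ?thesis by simp
qed

lemma DD_trans_comp:
  assumes "b \<in> A" "c \<in> A" "d \<in> A" "p \<in> fst b" "p \<in> fst c" "p \<in> fst d"
  shows "DD (chart_trans c d) (snd c p) (DD (chart_trans b c) (snd b p) w) = DD (chart_trans b d) (snd b p) w"
proof -
  have "DD (chart_trans b d) (snd b p) w = DD (\<lambda>x. chart_trans c d (chart_trans b c x)) (snd b p) w"
    by (rule fun_cong[OF frechet_derivative_cong_open[OF open_cdom[OF assms(1) open_Int[OF open_chart[OF assms(2)] open_chart[OF assms(3)]]]]])
       (use assms in \<open>auto intro: cdomI elim!: cdomE simp: trans_apply\<close>)
  also have "\<dots> = DD (chart_trans c d) (snd c p) (DD (chart_trans b c) (snd b p) w)"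
    using DD_compose[OF trans_diff[OF assms(1,2,4,5)], of "chart_trans c d"] trans_diff[OF assms(2,3,5,6)]
    by (simp add: trans_apply assms)
  finally show ?thesis by simp
qed

lemma linear_DD_trans: "b \<in> A \<Longrightarrow> c \<in> A \<Longrightarrow> p \<in> fst b \<Longrightarrow> p \<in> fst c \<Longrightarrow> linear (DD (chart_trans b c) (snd b p))"
  using linear_DD[OF trans_diff] by simp

lemma to_chart_eq: "to_chart A c p w = DD (chart_trans (bc p) c) (snd (bc p) p) w"
  by (simp add: to_chart_def base_pt_def chart_trans_def[abs_def])

lemma from_chart_eq: "from_chart A c p w = DD (chart_trans c (bc p)) (snd c p) w"
  by (simp add: from_chart_def chart_trans_def[abs_def])

lemma to_from [simp]: "c \<in> A \<Longrightarrow> p \<in> fst c \<Longrightarrow> to_chart A c p (from_chart A c p u) = u"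
  unfolding to_chart_eq from_chart_eq by (simp add: DD_trans_comp bc_in bc_dom DD_trans_id)

lemma from_to [simp]: "c \<in> A \<Longrightarrow> p \<in> fst c \<Longrightarrow> from_chart A c p (to_chart A c p u) = u"
  unfolding to_chart_eq from_chart_eq by (simp add: DD_trans_comp bc_in bc_dom DD_trans_id)

lemma linear_to: "c \<in> A \<Longrightarrow> p \<in> fst c \<Longrightarrow> linear (to_chart A c p)"
  unfolding to_chart_eq by (intro linear_DD_trans bc_in bc_dom)

lemma linear_from: "c \<in> A \<Longrightarrow> p \<in> fst c \<Longrightarrow> linear (from_chart A c p)"
  unfolding from_chart_eq by (intro linear_DD_trans bc_in bc_dom)

lemma trans_to: "c \<in> A \<Longrightarrow> d \<in> A \<Longrightarrow> p \<in> fst c \<Longrightarrow> p \<in> fst d \<Longrightarrow> DD (chart_trans c d) (snd c p) (to_chart A c p u) = to_chart A d p u"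
  unfolding to_chart_eq by (rule DD_trans_comp) (auto intro: bc_in bc_dom)

lemma from_trans: "c \<in> A \<Longrightarrow> d \<in> A \<Longrightarrow> p \<in> fst c \<Longrightarrow> p \<in> fst d \<Longrightarrow> from_chart A d p (DD (chart_trans c d) (snd c p) u) = from_chart A c p u"
  unfolding from_chart_eq by (rule DD_trans_comp) (auto intro: bc_in bc_dom)

lemma to_base [simp]: "to_chart A (bc p) p u = u" and from_base [simp]: "from_chart A (bc p) p u = u"
  unfolding to_chart_eq from_chart_eq by (simp_all add: DD_trans_id bc_in bc_dom)

lemma vec_rep_at: "c \<in> A \<Longrightarrow> p \<in> fst c \<Longrightarrow> vec_rep A c X (snd c p) = to_chart A c p (X p)"
  by (simp add: vec_rep_def)

lemma frep_at: "c \<in> A \<Longrightarrow> p \<in> fst c \<Longrightarrow> frep A c \<psi> (snd c p) u v = \<psi> p (from_chart A c p u) (from_chart A c p v)"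
  by (simp add: frep_def form_rep_def)

lemma erep_at: "c \<in> A \<Longrightarrow> p \<in> fst c \<Longrightarrow> erep A c J (snd c p) u = to_chart A c p (J p (from_chart A c p u))"
  by (simp add: erep_def end_rep_def)

lemma fun_rep_at: "c \<in> A \<Longrightarrow> p \<in> fst c \<Longrightarrow> fun_rep c f (snd c p) = f p"
  by (simp add: fun_rep_def)

lemma smooth_vec_iff: "smooth_vec A U X \<longleftrightarrow> (\<forall>c\<in>A. Cinf_on (cdom c U) (vec_rep A c X))"
  by (simp add: smooth_vec_def cdom_def)

lemma smooth_fun_iff: "smooth_fun A U f \<longleftrightarrow> (\<forall>c\<in>A. Cinf_on (cdom c U) (fun_rep c f))"
  by (simp add: smooth_fun_def cdom_def)

lemma smooth_form_bil_field:
  assumes "smooth_form A U \<psi>" "\<And>p. p \<in> U \<Longrightarrow> bilinear (\<psi> p)" "c \<in> A"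
  shows "bil_field (cdom c U) (frep A c \<psi>)"
proof -
  have "bilinear (frep A c \<psi> x)" if "x \<in> cdom c U" for x
  proof -
    from that obtain p where p: "p \<in> fst c" "p \<in> U" "x = snd c p" by (rule cdomE)
    note b = assms(2)[OF p(2)]
    show ?thesis unfolding bilinear_def p(3) frep_at[OF assms(3) p(1)]
      by (auto intro!: linearI simp: linear_add[OF linear_from[OF assms(3) p(1)]] linear_cmul[OF linear_from[OF assms(3) p(1)]]
         bilinear_ladd[OF b] bilinear_radd[OF b] bilinear_lmul[OF b] bilinear_rmul[OF b] frep_at[OF assms(3) p(1)])
  qed
  then show ?thesis using assms(1,3) unfolding bil_field_def smooth_form_def frep_def cdom_def by blast
qed

lemma smooth_formI:
  assumes "\<And>c u v. c \<in> A \<Longrightarrow> Cinf_on (cdom c U) (\<lambda>x. frep A c \<psi> x u v)"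
  shows "smooth_form A U \<psi>"
  using assms by (simp add: smooth_form_def frep_def cdom_def)

lemma smooth_end_lin_field:
  assumes "smooth_end A U J" "\<And>p. p \<in> U \<Longrightarrow> linear (J p)" "c \<in> A"
  shows "lin_field (cdom c U) (erep A c J)"
proof -
  have "linear (erep A c J x)" if "x \<in> cdom c U" for x
  proof -
    from that obtain p where p: "p \<in> fst c" "p \<in> U" "x = snd c p" by (rule cdomE)
    have "erep A c J x = (\<lambda>u. to_chart A c p (J p (from_chart A c p u)))"
      unfolding p(3) by (simp add: fun_eq_iff erep_at[OF assms(3) p(1)])
    then show ?thesis
      using linear_compose[OF linear_compose[OF linear_from[OF assms(3) p(1)] assms(2)[OF p(2)]] linear_to[OF assms(3) p(1)]]
      by (simp add: o_def)
  qed
  then show ?thesis using assms(1,3) unfolding lin_field_def smooth_end_def erep_def cdom_def by blast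
qed

lemma smooth_subset:
  "smooth_vec A U X \<Longrightarrow> V \<subseteq> U \<Longrightarrow> smooth_vec A V X"
  "smooth_form A U \<psi> \<Longrightarrow> V \<subseteq> U \<Longrightarrow> smooth_form A V \<psi>"
  "smooth_fun A U f \<Longrightarrow> V \<subseteq> U \<Longrightarrow> smooth_fun A V f"
  "smooth_end A U J \<Longrightarrow> V \<subseteq> U \<Longrightarrow> smooth_end A V J"
  unfolding smooth_vec_def smooth_form_def smooth_fun_def smooth_end_def
  by (meson Cinf_on_subset Int_mono image_mono order_refl)+

text \<open>In another chart a coordinate field is represented by a directional derivative of the
  coordinate change. Coordinate fields extend arbitrary tangent vectors, so conditions on all local
  fields can be tested pointwise.\<close>

lemma smooth_coord_field: "smooth_vec A (fst (bc p)) (coord_field A p u)"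
  unfolding smooth_vec_iff
proof
  fix c assume c: "c \<in> A"
  let ?b = "bc p" and ?S = "cdom c (fst (bc p))"
  have S: "open ?S" by (intro open_cdom c open_chart bc_in)
  have T: "open (cdom ?b (fst c))" by (intro open_cdom c open_chart bc_in)
  show "Cinf_on ?S (vec_rep A c (coord_field A p u))"
  proof (rule Cinf_on_cong[OF S])
    show "Cinf_on ?S (\<lambda>x. DD (chart_trans ?b c) (chart_trans c ?b x) u)"
    proof (rule Cinf_on_compose[OF S T, where t="chart_trans c ?b" and f="\<lambda>y. DD (chart_trans ?b c) y u"])
      show "chart_trans c ?b ` ?S \<subseteq> cdom ?b (fst c)"
        using c by (auto elim!: cdomE simp: trans_apply intro: cdomI)
      show "Cinf_on ?S (chart_trans c ?b)" by (rule trans_smooth[OF c bc_in])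
      show "Cinf_on (cdom ?b (fst c)) (\<lambda>y. DD (chart_trans ?b c) y u)"
        by (intro Cinf_on_DD trans_smooth c bc_in)
    qed
    fix x assume "x \<in> ?S"
    then obtain q where q: "q \<in> fst c" "q \<in> fst ?b" "x = snd c q" by (rule cdomE)
    have "DD (chart_trans ?b c) (snd ?b q) u = to_chart A c q (from_chart A ?b q u)"
      using trans_to[OF bc_in c q(2,1), of "from_chart A ?b q u"] to_from[OF bc_in q(2)] by simp
    then show "DD (chart_trans ?b c) (chart_trans c ?b x) u = vec_rep A c (coord_field A p u) x"
      unfolding q(3) by (simp add: trans_apply c q vec_rep_at coord_field_def)
  qed
qed

lemma coord_field_at [simp]: "coord_field A p u p = u"
  by (simp add: coord_field_def)

end

section \<open>Covariant derivatives on the manifold in charts\<close>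

locale riem_atlas = atlas A
  for A :: "('a::{t2_space,second_countable_topology}, 'e::euclidean_space) chart set" +
  fixes g :: "'a \<Rightarrow> 'e \<Rightarrow> 'e \<Rightarrow> real"
  assumes metric: "riemannian_metric A g"
begin

lemma inner_g: "inner_form (g p)"
  using metric unfolding riemannian_metric_def inner_form_def by blast

abbreviation G :: "('a, 'e) chart \<Rightarrow> 'e \<Rightarrow> 'e \<Rightarrow> 'e \<Rightarrow> real" where "G c \<equiv> frep A c g"

lemma loc_riem_chart:
  assumes "c \<in> A" "open U" shows "loc_riem (cdom c U) (G c)"
proof
  show "open (cdom c U)" by (rule open_cdom[OF assms])
  show "inner_form (G c x)" if "x \<in> cdom c U" for x
  proof -
    from that obtain p where p: "p \<in> fst c" "x = snd c p" by (rule cdomE)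
    have b: "bilinear (g p)" and s: "g p u v = g p v u" and pos: "v \<noteq> 0 \<Longrightarrow> g p v v > 0" for u v
      using inner_g[of p] by (auto simp: inner_form_def)
    note F = linear_from[OF assms(1) p(1)]
    have "bilinear (G c x)" unfolding bilinear_def p(2) frep_at[OF assms(1) p(1)]
      by (auto intro!: linearI simp: linear_add[OF F] linear_cmul[OF F]
         bilinear_ladd[OF b] bilinear_radd[OF b] bilinear_lmul[OF b] bilinear_rmul[OF b] frep_at[OF assms(1) p(1)])
    moreover have "from_chart A c p v \<noteq> 0" if "v \<noteq> 0" for v
      using that to_from[OF assms(1) p(1), of v] linear_0[OF linear_to[OF assms(1) p(1)]] by metis
    ultimately show ?thesis unfolding inner_form_def p(2) using s pos
      by (simp add: frep_at[OF assms(1) p(1)])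
  qed
  show "Cinf_on (cdom c U) (\<lambda>x. G c x u v)" for u v
    using metric assms(1) unfolding riemannian_metric_def smooth_form_def frep_def cdom_def
    by (meson Cinf_on_subset Int_mono image_mono order_refl subset_UNIV)
qed

lemma coord_change_charts:
  assumes "b \<in> A" "c \<in> A" "open U"
  shows "coord_change (cdom b (fst c \<inter> U)) (G b) (cdom c (fst b \<inter> U)) (G c) (chart_trans b c)"
proof -
  interpret src: loc_riem "cdom b (fst c \<inter> U)" "G b"
    using assms by (intro loc_riem_chart open_Int open_chart)
  interpret tgt: loc_riem "cdom c (fst b \<inter> U)" "G c"
    using assms by (intro loc_riem_chart open_Int open_chart)
  show ?thesis
  proof
    show "Cinf_on (cdom b (fst c \<inter> U)) (chart_trans b c)"
      by (rule Cinf_on_subset[OF trans_smooth[OF assms(1,2)]]) (auto simp: cdom_def)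
    fix x assume "x \<in> cdom b (fst c \<inter> U)"
    then obtain p where p: "p \<in> fst b" "p \<in> fst c" "p \<in> U" "x = snd b p" by (auto elim: cdomE)
    show "chart_trans b c x \<in> cdom c (fst b \<inter> U)" using p by (auto simp: trans_apply assms intro: cdomI)
    have "DD (chart_trans b c) x (DD (chart_trans c b) (snd c p) u) = u" for u
      using DD_trans_comp[OF assms(2,1,2) p(2,1,2)] DD_trans_id[OF assms(2) p(2)] p(4) by simp
    then show "surj (DD (chart_trans b c) x)" by (metis surjI)
    show "G b x u v = G c (chart_trans b c x) (DD (chart_trans b c) x u) (DD (chart_trans b c) x v)" for u v
      unfolding p(4) by (simp add: trans_apply assms p(1) frep_at p(2) from_trans)
  qed
qed

lemma christoffel_chr: "christoffel A g p u v = chr (G (bc p)) (base_pt A p) u v"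
proof -
  have "G (bc p) (base_pt A p) = g p"
    by (simp add: fun_eq_iff base_pt_def frep_at bc_in bc_dom)
  then show ?thesis unfolding christoffel_def chr_def by (simp add: d_form_def frep_def)
qed

lemma nabla_vec_base: "nabla_vec A g p w X = nab (G (bc p)) (vec_rep A (bc p) X) (snd (bc p) p) w"
  by (simp add: nabla_vec_def nab_def christoffel_chr d_vec_def base_pt_def vec_rep_at bc_in bc_dom)

lemma nabla_form_base: "nabla_form A g p w \<psi> u v = nabf (G (bc p)) (frep A (bc p) \<psi>) (snd (bc p) p) w u v"
  by (simp add: nabla_form_def nabf_def christoffel_chr d_form_def base_pt_def frep_at bc_in bc_dom)
     (simp add: frep_def)

lemma nabla_end_base: "nabla_end A g p w J u = nabe (G (bc p)) (erep A (bc p) J) (snd (bc p) p) w u"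
  by (simp add: nabla_end_def nabe_def christoffel_chr d_end_def base_pt_def erep_at bc_in bc_dom)
     (simp add: erep_def)

text \<open>By definition the derivative at \<open>p\<close> is computed in the base chart of
  \<open>p\<close>. To differentiate the result once more its values near \<open>p\<close> are
  needed in one chart, although the base charts of the neighbouring points may differ.\<close>

lemma nabla_vec_chart:
  assumes U: "open U" "p \<in> U" and X: "smooth_vec A U X" and c: "c \<in> A" "p \<in> fst c"
  shows "to_chart A c p (nabla_vec A g p w X) = nab (G c) (vec_rep A c X) (snd c p) (to_chart A c p w)"
proof -
  let ?b = "bc p"
  interpret coord_change "cdom ?b (fst c \<inter> U)" "G ?b" "cdom c (fst ?b \<inter> U)" "G c" "chart_trans ?b c"
    by (rule coord_change_charts[OF bc_in c(1) U(1)])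
  have X': "Cinf_on (cdom d V) (vec_rep A d X)" if "d \<in> A" "V \<subseteq> U" for d V
    using smooth_subset(1)[OF X that(2)] that(1) smooth_vec_iff by blast
  have x: "snd ?b p \<in> cdom ?b (fst c \<inter> U)" using c U bc_dom by (auto intro: cdomI)
  have "nab (G c) (vec_rep A c X) (chart_trans ?b c (snd ?b p)) (DD (chart_trans ?b c) (snd ?b p) w)
      = DD (chart_trans ?b c) (snd ?b p) (nab (G ?b) (vec_rep A ?b X) (snd ?b p) w)"
  proof (rule nab_transform[OF x X'[OF bc_in Int_lower2] X'[OF c(1) Int_lower2]])
    fix y assume "y \<in> cdom ?b (fst c \<inter> U)"
    then obtain q where q: "q \<in> fst ?b" "q \<in> fst c" "y = snd ?b q" by (auto elim: cdomE)
    show "vec_rep A c X (chart_trans ?b c y) = DD (chart_trans ?b c) y (vec_rep A ?b X y)"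
      unfolding q(3) by (simp add: trans_apply bc_in c(1) q(1,2) vec_rep_at trans_to)
  qed
  then show ?thesis by (simp add: nabla_vec_base to_chart_eq trans_apply bc_in bc_dom)
qed

lemma nabla_form_chart:
  assumes U: "open U" "p \<in> U" and \<psi>: "smooth_form A U \<psi>" "\<And>q. q \<in> U \<Longrightarrow> bilinear (\<psi> q)" and c: "c \<in> A" "p \<in> fst c"
  shows "nabla_form A g p w \<psi> u v
    = nabf (G c) (frep A c \<psi>) (snd c p) (to_chart A c p w) (to_chart A c p u) (to_chart A c p v)"
proof -
  let ?b = "bc p"
  interpret coord_change "cdom ?b (fst c \<inter> U)" "G ?b" "cdom c (fst ?b \<inter> U)" "G c" "chart_trans ?b c"
    by (rule coord_change_charts[OF bc_in c(1) U(1)])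
  have b: "bil_field (cdom c (fst ?b \<inter> U)) (frep A c \<psi>)"
    by (rule smooth_form_bil_field[OF smooth_subset(2)[OF \<psi>(1) Int_lower2] _ c(1)]) (use \<psi>(2) in auto)
  have x: "snd ?b p \<in> cdom ?b (fst c \<inter> U)" using c U bc_dom by (auto intro: cdomI)
  have "nabf (G c) (frep A c \<psi>) (chart_trans ?b c (snd ?b p)) (DD (chart_trans ?b c) (snd ?b p) w) (DD (chart_trans ?b c) (snd ?b p) u) (DD (chart_trans ?b c) (snd ?b p) v)
      = nabf (G ?b) (frep A ?b \<psi>) (snd ?b p) w u v"
  proof (rule nabf_transform[OF x b])
    fix y u v assume "y \<in> cdom ?b (fst c \<inter> U)"
    then obtain q where q: "q \<in> fst ?b" "q \<in> fst c" "y = snd ?b q" by (auto elim: cdomE)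
    show "frep A ?b \<psi> y u v = frep A c \<psi> (chart_trans ?b c y) (DD (chart_trans ?b c) y u) (DD (chart_trans ?b c) y v)"
      unfolding q(3) by (simp add: trans_apply bc_in c(1) q(1,2) frep_at from_trans)
  qed
  then show ?thesis by (simp add: nabla_form_base to_chart_eq trans_apply bc_in bc_dom)
qed

lemma nabla_end_chart:
  assumes U: "open U" "p \<in> U" and J: "smooth_end A U J" "\<And>q. q \<in> U \<Longrightarrow> linear (J q)" and c: "c \<in> A" "p \<in> fst c"
  shows "to_chart A c p (nabla_end A g p w J u)
    = nabe (G c) (erep A c J) (snd c p) (to_chart A c p w) (to_chart A c p u)"
proof -
  let ?b = "bc p"
  interpret coord_change "cdom ?b (fst c \<inter> U)" "G ?b" "cdom c (fst ?b \<inter> U)" "G c" "chart_trans ?b c"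
    by (rule coord_change_charts[OF bc_in c(1) U(1)])
  have l: "lin_field (cdom d (V \<inter> U)) (erep A d J)" if "d \<in> A" for d V
    by (rule smooth_end_lin_field[OF smooth_subset(4)[OF J(1) Int_lower2] _ that]) (use J(2) in auto)
  have x: "snd ?b p \<in> cdom ?b (fst c \<inter> U)" using c U bc_dom by (auto intro: cdomI)
  have "nabe (G c) (erep A c J) (chart_trans ?b c (snd ?b p)) (DD (chart_trans ?b c) (snd ?b p) w) (DD (chart_trans ?b c) (snd ?b p) u)
      = DD (chart_trans ?b c) (snd ?b p) (nabe (G ?b) (erep A ?b J) (snd ?b p) w u)"
  proof (rule nabe_transform[OF x l[OF bc_in] l[OF c(1)]])
    fix y u assume "y \<in> cdom ?b (fst c \<inter> U)"
    then obtain q where q: "q \<in> fst ?b" "q \<in> fst c" "y = snd ?b q" by (auto elim: cdomE)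
    show "erep A c J (chart_trans ?b c y) (DD (chart_trans ?b c) y u) = DD (chart_trans ?b c) y (erep A ?b J y u)"
      unfolding q(3) by (simp add: trans_apply bc_in c(1) q(1,2) erep_at from_trans trans_to)
  qed
  then show ?thesis by (simp add: nabla_end_base to_chart_eq trans_apply bc_in bc_dom)
qed

end

section \<open>Locality of smoothness and covariant derivatives of fields in one chart\<close>

lemma Ck_on_local:
  assumes "\<And>x. x \<in> S \<Longrightarrow> \<exists>T. open T \<and> x \<in> T \<and> Ck_on k T f"
  shows "Ck_on k S f"
  using assms
proof (induction k arbitrary: f)
  case 0
  show ?case unfolding Ck_on.simps
  proof (intro continuous_at_imp_continuous_on ballI)
    fix x assume "x \<in> S"
    from 0[OF this] obtain T where "open T" "x \<in> T" "continuous_on T f" unfolding Ck_on.simps by blast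
    then show "isCont f x" by (simp add: continuous_on_eq_continuous_at)
  qed
next
  case (Suc k)
  have "f differentiable (at x)" if "x \<in> S" for x
    using Suc.prems[OF that] unfolding Ck_on.simps by blast
  moreover have "Ck_on k S (\<lambda>x. DD f x v)" for v
  proof (rule Suc.IH)
    fix x assume "x \<in> S"
    from Suc.prems[OF this] show "\<exists>T. open T \<and> x \<in> T \<and> Ck_on k T (\<lambda>x. DD f x v)"
      unfolding Ck_on.simps by blast
  qed
  ultimately show ?case unfolding Ck_on.simps by blast
qed

lemma Cinf_on_local:
  assumes "\<And>x. x \<in> S \<Longrightarrow> \<exists>T. open T \<and> x \<in> T \<and> Cinf_on T f"
  shows "Cinf_on S f"
  unfolding Cinf_on_def
proof
  show "Ck_on k S f" for k
  proof (rule Ck_on_local)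
    fix x assume "x \<in> S"
    from assms[OF this] show "\<exists>T. open T \<and> x \<in> T \<and> Ck_on k T f" unfolding Cinf_on_def by blast
  qed
qed

context riem_atlas begin

lemma smooth_vecD: "smooth_vec A U X \<Longrightarrow> c \<in> A \<Longrightarrow> Cinf_on (cdom c U) (vec_rep A c X)"
  using smooth_vec_iff by blast

lemma vec_rep_nabla:
  assumes "open U" "smooth_vec A U X" "c \<in> A" "x \<in> cdom c U"
  shows "vec_rep A c (\<lambda>q. nabla_vec A g q (Z q) X) x = nab (G c) (vec_rep A c X) x (vec_rep A c Z x)"
proof -
  from assms(4) obtain p where p: "p \<in> fst c" "p \<in> U" "x = snd c p" by (rule cdomE)
  show ?thesis unfolding p(3) vec_rep_at[OF assms(3) p(1)]
    by (rule nabla_vec_chart[OF assms(1) p(2) assms(2,3) p(1)])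
qed

lemma smooth_nabla_vec:
  assumes "open U" "smooth_vec A U X" "smooth_vec A U Z"
  shows "smooth_vec A U (\<lambda>q. nabla_vec A g q (Z q) X)"
  unfolding smooth_vec_iff
proof
  fix c assume c: "c \<in> A"
  interpret loc_riem "cdom c U" "G c" by (rule loc_riem_chart[OF c assms(1)])
  show "Cinf_on (cdom c U) (vec_rep A c (\<lambda>q. nabla_vec A g q (Z q) X))"
    by (rule Cinf_on_cong[OF open_S _ smooth_nab[OF smooth_vecD[OF assms(2) c] smooth_vecD[OF assms(3) c]]])
       (simp add: vec_rep_nabla[OF assms(1,2) c])
qed

lemma frep_nabla:
  assumes "open U" "smooth_form A U \<psi>" "\<And>q. q \<in> U \<Longrightarrow> bilinear (\<psi> q)" "c \<in> A" "x \<in> cdom c U"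
  shows "frep A c (\<lambda>q. nabla_form A g q (Z q) \<psi>) x u v = nabf (G c) (frep A c \<psi>) x (vec_rep A c Z x) u v"
proof -
  from assms(5) obtain p where p: "p \<in> fst c" "p \<in> U" "x = snd c p" by (rule cdomE)
  show ?thesis unfolding p(3) vec_rep_at[OF assms(4) p(1)] frep_at[OF assms(4) p(1), of "\<lambda>q. nabla_form A g q (Z q) \<psi>"]
    using nabla_form_chart[OF assms(1) p(2) assms(2,3,4) p(1), of "Z p" "from_chart A c p u" "from_chart A c p v"]
    by (simp add: assms(4) p(1))
qed

lemma erep_nabla:
  assumes "open U" "smooth_end A U J" "\<And>q. q \<in> U \<Longrightarrow> linear (J q)" "c \<in> A" "x \<in> cdom c U"
  shows "erep A c (\<lambda>q. nabla_end A g q (Z q) J) x u = nabe (G c) (erep A c J) x (vec_rep A c Z x) u"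
proof -
  from assms(5) obtain p where p: "p \<in> fst c" "p \<in> U" "x = snd c p" by (rule cdomE)
  show ?thesis unfolding p(3) vec_rep_at[OF assms(4) p(1)] erep_at[OF assms(4) p(1), of "\<lambda>q. nabla_end A g q (Z q) J"]
    using nabla_end_chart[OF assms(1) p(2) assms(2,3,4) p(1), of "Z p" "from_chart A c p u"]
    by (simp add: assms(4) p(1))
qed

lemma smooth_nabla_end:
  assumes "open U" "smooth_end A U J" "\<And>q. q \<in> U \<Longrightarrow> linear (J q)" "smooth_vec A U Z"
  shows "smooth_end A U (\<lambda>q. nabla_end A g q (Z q) J)"
proof -
  have "Cinf_on (cdom c U) (\<lambda>x. erep A c (\<lambda>q. nabla_end A g q (Z q) J) x u)" if c: "c \<in> A" for c u
  proof -
    interpret loc_riem "cdom c U" "G c" by (rule loc_riem_chart[OF c assms(1)])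
    have "lin_field (cdom c U) (\<lambda>x u. nabe (G c) (erep A c J) x (vec_rep A c Z x) u)"
      by (rule nabe_field[OF smooth_end_lin_field[OF assms(2,3) c] smooth_vecD[OF assms(4) c]])
    then have s: "Cinf_on (cdom c U) (\<lambda>x. nabe (G c) (erep A c J) x (vec_rep A c Z x) u)"
      unfolding lin_field_def by blast
    show ?thesis
      by (rule Cinf_on_cong[OF open_S _ s]) (rule erep_nabla[OF assms(1,2,3) c, symmetric])
  qed
  then show ?thesis by (simp add: smooth_end_def erep_def cdom_def)
qed

text \<open>This is torsion-freeness. In this form the bracket inherits its behaviour under
  coordinate changes from the covariant derivative.\<close>

lemma lie_bracket_nabla: "lie_bracket A X Y p = nabla_vec A g p (X p) Y - nabla_vec A g p (Y p) X"
proof -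
  interpret loc_riem "cdom (bc p) UNIV" "G (bc p)" by (rule loc_riem_chart[OF bc_in open_UNIV])
  have "base_pt A p \<in> cdom (bc p) UNIV" unfolding base_pt_def by (rule cdomI[OF bc_dom UNIV_I])
  then show ?thesis
    by (simp add: lie_bracket_def nabla_vec_def christoffel_chr chr_sym[of _ "X p" "Y p"])
qed

lemma lie_bracket_chart:
  assumes "open U" "smooth_vec A U X" "smooth_vec A U Y" "c \<in> A" "p \<in> fst c" "p \<in> U"
  shows "to_chart A c p (lie_bracket A X Y p)
    = DD (vec_rep A c Y) (snd c p) (vec_rep A c X (snd c p)) - DD (vec_rep A c X) (snd c p) (vec_rep A c Y (snd c p))"
proof -
  interpret loc_riem "cdom c U" "G c" by (rule loc_riem_chart[OF assms(4,1)])
  show ?thesis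
    unfolding lie_bracket_nabla linear_diff[OF linear_to[OF assms(4,5)]]
      nabla_vec_chart[OF assms(1,6,2,4,5)] nabla_vec_chart[OF assms(1,6,3,4,5)]
      vec_rep_at[OF assms(4,5), symmetric]
    by (rule torsion_free[OF cdomI[OF assms(5,6)]])
qed

lemma curv_op_chart:
  assumes "open U" "smooth_vec A U X" "smooth_vec A U Y" "smooth_vec A U Z" "c \<in> A" "p \<in> fst c" "p \<in> U"
  shows "to_chart A c p (curv_op A g X Y Z p)
    = crv (G c) (snd c p) (vec_rep A c X (snd c p)) (vec_rep A c Y (snd c p)) (vec_rep A c Z (snd c p))"
proof -
  interpret loc_riem "cdom c U" "G c" by (rule loc_riem_chart[OF assms(5,1)])
  note x = cdomI[OF assms(6,7)]
  have n: "to_chart A c p (nabla_vec A g p (V p) (\<lambda>q. nabla_vec A g q (W q) Z))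
     = nab (G c) (\<lambda>y. nab (G c) (vec_rep A c Z) y (vec_rep A c W y)) (snd c p) (vec_rep A c V (snd c p))"
    if "smooth_vec A U W" for V W
    unfolding nabla_vec_chart[OF assms(1,7) smooth_nabla_vec[OF assms(1,4) that] assms(5,6)] vec_rep_at[OF assms(5,6)]
    by (rule nab_cong[OF x]) (rule vec_rep_nabla[OF assms(1,4,5)])
  show ?thesis
    unfolding curv_op_def linear_diff[OF linear_to[OF assms(5,6)]] n[OF assms(2)] n[OF assms(3)]
      nabla_vec_chart[OF assms(1,7,4,5,6)] lie_bracket_chart[OF assms(1,2,3,5,6,7)]
    by (rule nab_nab[OF x]) (intro smooth_vecD assms)+
qed

lemma curv_chart:
  assumes "c \<in> A" "p \<in> fst c"
  shows "to_chart A c p (curv A g p u v w)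
    = crv (G c) (snd c p) (to_chart A c p u) (to_chart A c p v) (to_chart A c p w)"
  unfolding curv_def
  by (subst curv_op_chart[OF open_chart[OF bc_in] smooth_coord_field smooth_coord_field smooth_coord_field assms bc_dom])
     (simp add: vec_rep_at[OF assms])

lemma curv_base: "curv A g p u v w = crv (G (bc p)) (snd (bc p) p) u v w"
  using curv_chart[OF bc_in bc_dom, of p u v w] by simp

lemma G_base: "G (bc p) (snd (bc p) p) = g p"
  by (simp add: fun_eq_iff frep_at bc_in bc_dom)

lemma coord_field_base:
  assumes "x \<in> cdom (bc p) UNIV" shows "vec_rep A (bc p) (coord_field A p u) x = u"
  using assms by (auto elim!: cdomE simp: vec_rep_at bc_in coord_field_def)

lemma g_chart: "c \<in> A \<Longrightarrow> p \<in> fst c \<Longrightarrow> G c (snd c p) (to_chart A c p u) (to_chart A c p v) = g p u v"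
  by (simp add: frep_at)

lemma sharp_chart:
  assumes "c \<in> A" "p \<in> fst c" "linear \<alpha>"
  shows "to_chart A c p (sharp (g p) \<alpha>) = sharp (G c (snd c p)) (\<lambda>z. \<alpha> (from_chart A c p z))"
proof -
  interpret loc_riem "cdom c UNIV" "G c" by (rule loc_riem_chart[OF assms(1) open_UNIV])
  have "G c (snd c p) (to_chart A c p (sharp (g p) \<alpha>)) z = \<alpha> (from_chart A c p z)" for z
    by (simp add: frep_at assms inner_form_sharp[OF inner_g assms(3)])
  then show ?thesis using sharp_eqI[OF inner_G[OF cdomI[OF assms(2) UNIV_I]]] by metis
qed

lemma trace_chart:
  fixes t :: "'e \<Rightarrow> 'e \<Rightarrow> real"
  assumes "c \<in> A" "p \<in> fst c" "bilinear t"
  shows "(\<Sum>b\<in>Basis. t (frame (g p) b) (frame (g p) b))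
    = (\<Sum>a\<in>Basis. t (from_chart A c p a) (from_chart A c p (sharp (G c (snd c p)) (\<lambda>z. a \<bullet> z))))"
proof -
  interpret loc_riem "cdom c UNIV" "G c" by (rule loc_riem_chart[OF assms(1) open_UNIV])
  show ?thesis
    by (rule trace_coordinates[OF inner_g orthonormal_frame_frame[OF inner_g] linear_from[OF assms(1,2)]
       _ inner_G[OF cdomI[OF assms(2) UNIV_I]] _ assms(3), of "to_chart A c p"])
       (simp_all add: assms frep_at)
qed

end

section \<open>Quaternionic structures in coordinates\<close>

text \<open>The tensors \<open>BB\<close>, \<open>rz\<close> and \<open>chi\<close> as sums over the whole admissible basis: in this form they do not
  depend on the basis and are parallel, although the single \<open>J\<^sub>i\<close> are not.\<close>

definition qf :: "('e::euclidean_space \<Rightarrow> 'e \<Rightarrow> real) \<Rightarrow> (nat \<Rightarrow> 'e \<Rightarrow> 'e) \<Rightarrow> 'e \<Rightarrow> 'e \<Rightarrow> 'e \<Rightarrow> 'e \<Rightarrow> real" where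
  "qf h JJ X Z u v = (\<Sum>i=1..3. h (JJ i X) u * h (JJ i Z) v)"

definition qB :: "('e::euclidean_space \<Rightarrow> 'e \<Rightarrow> real) \<Rightarrow> (nat \<Rightarrow> 'e \<Rightarrow> 'e) \<Rightarrow> 'e \<Rightarrow> 'e \<Rightarrow> 'e \<Rightarrow> 'e \<Rightarrow> real" where
  "qB h JJ X Z u v = h X u * h Z v - h Z u * h X v + qf h JJ X Z u v - qf h JJ Z X u v - qf h JJ X u Z v"

definition qR :: "('e::euclidean_space \<Rightarrow> 'e \<Rightarrow> real) \<Rightarrow> (nat \<Rightarrow> 'e \<Rightarrow> 'e) \<Rightarrow> 'e \<Rightarrow> 'e \<Rightarrow> 'e \<Rightarrow> 'e \<Rightarrow> real" where
  "qR h JJ X Y Z V = h X Z * h Y V - h Y Z * h X V + qf h JJ X Y Z V - qf h JJ Y X Z V + 2 * qf h JJ X Z Y V"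

definition qK :: "(nat \<Rightarrow> 'e \<Rightarrow> 'e) \<Rightarrow> ('e \<Rightarrow> 'e \<Rightarrow> real) \<Rightarrow> 'e \<Rightarrow> 'e \<Rightarrow> real" where
  "qK JJ \<psi> u v = (\<Sum>i=1..3. \<psi> (JJ i u) (JJ i v))"

lemma (in quat_point) BB_qB: "BB X Z u v = qB h JJ X Z u v"
  unfolding BB_def qB_def qf_def sum_1_3 by simp

lemma (in quat_point) rz_qR: "h (rz X Y Z) V = qR h JJ X Y Z V"
  unfolding rz_def qR_def qf_def sum_1_3 by (simp add: h_lin)

lemma (in quat_point) chi_qK: "chi \<psi> u v = 3 / 4 * qK JJ \<psi> u v - 5 / 4 * \<psi> u v"
  unfolding chi_def qK_def sum_1_3 by simp

lemma qK_unique: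
  fixes h :: "'e::euclidean_space \<Rightarrow> 'e \<Rightarrow> real"
  assumes "inner_form h" "admissible h q JJ" "admissible h q JJ'" "DIM('e) = 4 * n" "n \<ge> 2" "bilinear \<psi>"
  shows "qK JJ' \<psi> = qK JJ \<psi>"
  unfolding qK_def using admissible_sum_unique[OF assms] by (simp add: fun_eq_iff)

lemma qf_unique:
  fixes h :: "'e::euclidean_space \<Rightarrow> 'e \<Rightarrow> real"
  assumes "inner_form h" "admissible h q JJ" "admissible h q JJ'" "DIM('e) = 4 * n" "n \<ge> 2"
  shows "qf h JJ' = qf h JJ"
proof (intro ext)
  fix X Z u v
  have bil: "bilinear h" using assms(1) by (simp add: inner_form_def)
  have "bilinear (\<lambda>a b. h a u * h b v)"
    unfolding bilinear_def by (auto intro!: linearI simp: bilinear_ladd[OF bil] bilinear_lmul[OF bil] algebra_simps)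
  from admissible_sum_unique[OF assms this] show "qf h JJ' X Z u v = qf h JJ X Z u v" unfolding qf_def .
qed

lemma qf_pull:
  assumes "\<And>u v. h' (T u) (T v) = h u v" "\<And>i u. i \<in> {1..3} \<Longrightarrow> JJ' i (T u) = T (JJ i u)"
  shows "qf h' JJ' (T X) (T Z) (T u) (T v) = qf h JJ X Z u v"
  unfolding qf_def using assms by (intro sum.cong) auto

locale qk_chart = loc_riem S G for S :: "'e::euclidean_space set" and G +
  fixes JJ :: "nat \<Rightarrow> 'e \<Rightarrow> 'e \<Rightarrow> 'e" and q :: "'e \<Rightarrow> ('e \<Rightarrow> 'e) set" and n :: nat
  assumes adm: "x \<in> S \<Longrightarrow> admissible (G x) (q x) (\<lambda>i. JJ i x)"
    and lin_JJ: "i \<in> {1..3} \<Longrightarrow> lin_field S (JJ i)"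
    and nabe_JJ: "x \<in> S \<Longrightarrow> i \<in> {1..3} \<Longrightarrow> nabe G (JJ i) x w \<in> q x"
    and dim4: "DIM('e) = 4 * n" and nge2: "n \<ge> 2"
begin

lemma qp: "x \<in> S \<Longrightarrow> quat_point (G x) (q x) n (\<lambda>i. JJ i x)"
  by (intro quat_point.intro inner_G adm dim4 nge2)

lemma JJ_anticommute:
  assumes x: "x \<in> S" and i: "i \<in> {1..3}" and j: "j \<in> {1..3}"
  shows "JJ i x (JJ j x v) + JJ j x (JJ i x v) = (if i = j then - 2 else 0) *\<^sub>R v"
proof -
  interpret y: quat_point "G x" "q x" n "\<lambda>i. JJ i x" by (rule qp[OF x])
  have "i = 1 \<or> i = 2 \<or> i = 3" "j = 1 \<or> j = 2 \<or> j = 3" using i j by auto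
  then show ?thesis by (elim disjE) (simp_all add: y.Jmul scaleR_2)
qed

lemma lin_JJx: "x \<in> S \<Longrightarrow> i \<in> {1..3} \<Longrightarrow> linear (JJ i x)"
  using lin_JJ by (simp add: lin_field_def)

lemma smooth_JJ: "i \<in> {1..3} \<Longrightarrow> Cinf_on S V \<Longrightarrow> Cinf_on S (\<lambda>y. JJ i y (V y))"
  by (rule lin_field_Cinf[OF open_S lin_JJ])

lemma nabe_anticommute:
  assumes x: "x \<in> S" and i: "i \<in> {1..3}" and j: "j \<in> {1..3}"
  shows "nabe G (JJ i) x w (JJ j x v) + JJ i x (nabe G (JJ j) x w v)
    + nabe G (JJ j) x w (JJ i x v) + JJ j x (nabe G (JJ i) x w v) = 0"
proof -
  have e: "nab G (\<lambda>y. JJ i y (JJ j y v)) x w = nabe G (JJ i) x w (JJ j x v) + JJ i x (nabe G (JJ j) x w v) + JJ i x (JJ j x (chr G x w v))"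
    if "i \<in> {1..3}" "j \<in> {1..3}" for i j
    unfolding nab_nabe[OF x lin_JJ[OF that(1)] smooth_JJ[OF that(2) Cinf_on_const]]
      nab_nabe[OF x lin_JJ[OF that(2)] Cinf_on_const] nab_const
    by (simp add: linear_add[OF lin_JJx[OF x that(1)]])
  have "nab G (\<lambda>y. JJ i y (JJ j y v)) x w + nab G (\<lambda>y. JJ j y (JJ i y v)) x w
     = nab G (\<lambda>y. JJ i y (JJ j y v) + JJ j y (JJ i y v)) x w"
    by (rule nab_add[OF x, symmetric]) (intro smooth_JJ i j Cinf_on_const)+
  also have "\<dots> = nab G (\<lambda>y. (if i = j then - 2 else 0) *\<^sub>R v) x w"
    by (rule nab_cong[OF x]) (rule JJ_anticommute[OF _ i j])
  also have "\<dots> = (if i = j then - 2 else 0) *\<^sub>R chr G x w v"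
    unfolding nab_const by (rule linear_cmul[OF lin_chr(1)[OF x]])
  also have "\<dots> = JJ i x (JJ j x (chr G x w v)) + JJ j x (JJ i x (chr G x w v))"
    by (rule JJ_anticommute[OF x i j, symmetric])
  finally show ?thesis unfolding e[OF i j] e[OF j i] by (simp add: algebra_simps)
qed

text \<open>The tensor \<open>\<Sum> J\<^sub>i \<otimes> J\<^sub>i\<close> is parallel:
  differentiating the anticommutation relations shows that the matrix of the derivatives of the
  \<open>J\<^sub>i\<close> in the basis itself is skew, and its contraction with this sum is
  zero.\<close>

lemma nabe_sum_cancel:
  assumes x: "x \<in> S" and \<beta>: "bilinear (\<beta> :: 'e \<Rightarrow> 'e \<Rightarrow> real)"
  shows "(\<Sum>i=1..3. \<beta> (nabe G (JJ i) x w u) (JJ i x v) + \<beta> (JJ i x u) (nabe G (JJ i) x w v)) = 0"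
proof -
  interpret y: quat_point "G x" "q x" n "\<lambda>i. JJ i x" by (rule qp[OF x])
  have "\<exists>a b c. nabe G (JJ i) x w = (\<lambda>v. a *\<^sub>R JJ 1 x v + b *\<^sub>R JJ 2 x v + c *\<^sub>R JJ 3 x v)" if "i \<in> {1..3}" for i
    using nabe_JJ[OF x that, of w] unfolding y.q_eq by blast
  then have "\<exists>a. \<forall>v. nabe G (JJ i) x w v = (\<Sum>k=1..3. a k *\<^sub>R JJ k x v)" if "i \<in> {1..3}" for i
  proof -
    from that \<open>\<And>i. i \<in> {1..3} \<Longrightarrow> \<exists>a b c. nabe G (JJ i) x w = (\<lambda>v. a *\<^sub>R JJ 1 x v + b *\<^sub>R JJ 2 x v + c *\<^sub>R JJ 3 x v)\<close>
    obtain a b c where e: "nabe G (JJ i) x w = (\<lambda>v. a *\<^sub>R JJ 1 x v + b *\<^sub>R JJ 2 x v + c *\<^sub>R JJ 3 x v)" by blast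
    show ?thesis
      by (rule exI[of _ "\<lambda>k. if k = 1 then a else if k = 2 then b else c"]) (simp add: e sum_1_3)
  qed
  then obtain co where N: "\<And>i v. i \<in> {1..3} \<Longrightarrow> nabe G (JJ i) x w v = (\<Sum>k=1..3. co i k *\<^sub>R JJ k x v)"
    by metis
  \<comment> \<open>The anticommutator with \<open>J\<^sub>j\<close> reads off the coefficient of
    \<open>J\<^sub>j\<close>.\<close>
  have h: "nabe G (JJ i) x w (JJ j x v) + JJ j x (nabe G (JJ i) x w v) = (- 2 * co i j) *\<^sub>R v"
    if ij: "i \<in> {1..3}" "j \<in> {1..3}" for i j v
  proof -
    have "nabe G (JJ i) x w (JJ j x v) + JJ j x (nabe G (JJ i) x w v)
       = (\<Sum>k=1..3. co i k *\<^sub>R (JJ k x (JJ j x v) + JJ j x (JJ k x v)))"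
      unfolding N[OF ij(1)] linear_sum[OF lin_JJx[OF x ij(2)]] linear_cmul[OF lin_JJx[OF x ij(2)]]
      by (simp add: sum.distrib scaleR_add_right)
    also have "\<dots> = (\<Sum>k=1..3. if k = j then (- 2 * co i j) *\<^sub>R v else 0)"
      using ij by (intro sum.cong refl) (auto simp: JJ_anticommute[OF x])
    finally show ?thesis using ij by simp
  qed
  have co: "co i j + co j i = 0" if ij: "i \<in> {1..3}" "j \<in> {1..3}" for i j
  proof -
    obtain v :: 'e where v: "v \<noteq> 0" using nonzero_Basis nonempty_Basis by blast
    have "(- 2 * co i j) *\<^sub>R v + (- 2 * co j i) *\<^sub>R v = 0"
      unfolding h[OF ij, of v, symmetric] h[OF ij(2,1), of v, symmetric]
      using nabe_anticommute[OF x ij, of w v] by (simp add: ac_simps)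
    then have "(- 2 * (co i j + co j i)) *\<^sub>R v = 0" by (simp add: algebra_simps)
    then show ?thesis using v by simp
  qed
  note lb = linear_sum[of "\<lambda>u. \<beta> u v" for v] linear_sum[of "\<beta> u" for u]
  have l: "linear (\<lambda>u. \<beta> u v)" "linear (\<beta> u)" for u v using \<beta> by (simp_all add: bilinear_def)
  have "(\<Sum>i=1..3. \<beta> (nabe G (JJ i) x w u) (JJ i x v) + \<beta> (JJ i x u) (nabe G (JJ i) x w v))
     = (\<Sum>i=1..3. \<Sum>k=1..3. co i k * \<beta> (JJ k x u) (JJ i x v)) + (\<Sum>i=1..3. \<Sum>k=1..3. co i k * \<beta> (JJ i x u) (JJ k x v))"
    unfolding sum.distrib[symmetric]
    by (intro sum.cong refl) (simp add: N linear_sum[OF l(1)] linear_sum[OF l(2)] linear_cmul[OF l(1)] linear_cmul[OF l(2)] sum.distrib)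
  also have "(\<Sum>i=1..3. \<Sum>k=1..3. co i k * \<beta> (JJ i x u) (JJ k x v)) = (\<Sum>i=1..3. \<Sum>k=1..3. co k i * \<beta> (JJ k x u) (JJ i x v))"
    by (rule sum.swap)
  also have "(\<Sum>i=1..3. \<Sum>k=1..3. co i k * \<beta> (JJ k x u) (JJ i x v)) + \<dots>
     = (\<Sum>i=1..3. \<Sum>k=1..3. (co i k + co k i) * \<beta> (JJ k x u) (JJ i x v))"
    by (simp only: sum.distrib distrib_right)
  also have "\<dots> = 0" using co by (intro sum.neutral ballI) simp
  finally show ?thesis .
qed

lemma bil_qK:
  assumes "bil_field S \<beta>" shows "bil_field S (\<lambda>x. qK (\<lambda>i. JJ i x) (\<beta> x))"
  unfolding bil_field_def
proof (intro conjI ballI allI)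
  fix x assume x: "x \<in> S"
  have b: "bilinear (\<beta> x)" using assms x by (simp add: bil_field_def)
  have l: "linear (JJ i x)" if "i \<in> {1..3}" for i by (rule lin_JJx[OF x that])
  show "bilinear (qK (\<lambda>i. JJ i x) (\<beta> x))"
    unfolding bilinear_def qK_def
    by (auto intro!: linear_compose_sum linear_compose[OF l, unfolded o_def] simp: b[unfolded bilinear_def])
next
  show "Cinf_on S (\<lambda>x. qK (\<lambda>i. JJ i x) (\<beta> x) u v)" for u v
    unfolding qK_def by (intro Cinf_on_sum open_S bil_field_Cinf[OF open_S assms] smooth_JJ Cinf_on_const)
qed

lemma nabf_qK:
  assumes x: "x \<in> S" and \<beta>: "bil_field S \<beta>"
  shows "nabf G (\<lambda>x. qK (\<lambda>i. JJ i x) (\<beta> x)) x w u v = qK (\<lambda>i. JJ i x) (nabf G \<beta> x w) u v"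
proof -
  have b: "bilinear (\<beta> x)" using \<beta> x by (simp add: bil_field_def)
  have s: "Cinf_on S (\<lambda>y. JJ i y u)" if "i \<in> {1..3}" for i u by (rule smooth_JJ[OF that Cinf_on_const])
  have "DD (\<lambda>y. qK (\<lambda>i. JJ i y) (\<beta> y) u v) x w = (\<Sum>i=1..3. DD (\<lambda>y. \<beta> y (JJ i y u) (JJ i y v)) x w)"
    unfolding qK_def by (intro DD_sum Cinf_onD[OF _ x] bil_field_Cinf[OF open_S \<beta>] s)
  also have "\<dots> = (\<Sum>i=1..3. nabf G \<beta> x w (JJ i x u) (JJ i x v)
     + (\<beta> x (JJ i x (chr G x w u)) (JJ i x v) + \<beta> x (JJ i x u) (JJ i x (chr G x w v)))
     + (\<beta> x (nabe G (JJ i) x w u) (JJ i x v) + \<beta> x (JJ i x u) (nabe G (JJ i) x w v)))"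
    by (intro sum.cong refl)
       (simp add: DD_nabf[OF x \<beta> s s] nab_nabe[OF x lin_JJ Cinf_on_const] nab_const bilinear_ladd[OF b] bilinear_radd[OF b])
  also have "\<dots> = qK (\<lambda>i. JJ i x) (nabf G \<beta> x w) u v
     + (qK (\<lambda>i. JJ i x) (\<beta> x) (chr G x w u) v + qK (\<lambda>i. JJ i x) (\<beta> x) u (chr G x w v))"
    unfolding sum.distrib nabe_sum_cancel[OF x b, unfolded sum.distrib] qK_def by simp
  finally show ?thesis by (simp add: nabf_def[of G "\<lambda>x. qK (\<lambda>i. JJ i x) (\<beta> x)"])
qed

lemma smooth_qf:
  assumes "Cinf_on S X" "Cinf_on S Z" "Cinf_on S U" "Cinf_on S V"
  shows "Cinf_on S (\<lambda>x. qf (G x) (\<lambda>i. JJ i x) (X x) (Z x) (U x) (V x))"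
  unfolding qf_def by (intro Cinf_on_sum Cinf_on_mult open_S bil_field_Cinf[OF open_S bil_G] smooth_JJ assms)

lemma smooth_G_fields:
  "Cinf_on S U \<Longrightarrow> Cinf_on S V \<Longrightarrow> Cinf_on S (\<lambda>x. G x (U x) (V x))"
  by (rule bil_field_Cinf[OF open_S bil_G])

lemma smooth_qB:
  assumes "Cinf_on S X" "Cinf_on S Z" "Cinf_on S U" "Cinf_on S V"
  shows "Cinf_on S (\<lambda>x. qB (G x) (\<lambda>i. JJ i x) (X x) (Z x) (U x) (V x))"
  unfolding qB_def by (intro Cinf_intros open_S smooth_qf smooth_G_fields assms)

lemma smooth_qR:
  assumes "Cinf_on S X" "Cinf_on S Y" "Cinf_on S Z" "Cinf_on S V"
  shows "Cinf_on S (\<lambda>x. qR (G x) (\<lambda>i. JJ i x) (X x) (Y x) (Z x) (V x))"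
  unfolding qR_def by (intro Cinf_intros open_S smooth_qf smooth_G_fields assms)

lemma DD_G_fields:
  assumes x: "x \<in> S" and UV: "Cinf_on S U" "Cinf_on S V"
  shows "DD (\<lambda>y. G y (U y) (V y)) x w = G x (nab G U x w) (V x) + G x (U x) (nab G V x w)"
  using DD_nabf[OF x bil_G UV] by (simp add: nabf_G[OF x])

lemma DD_qf:
  assumes x: "x \<in> S" and s: "Cinf_on S X" "Cinf_on S Z" "Cinf_on S U" "Cinf_on S V"
  shows "DD (\<lambda>y. qf (G y) (\<lambda>i. JJ i y) (X y) (Z y) (U y) (V y)) x w
    = qf (G x) (\<lambda>i. JJ i x) (nab G X x w) (Z x) (U x) (V x) + qf (G x) (\<lambda>i. JJ i x) (X x) (nab G Z x w) (U x) (V x)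
    + qf (G x) (\<lambda>i. JJ i x) (X x) (Z x) (nab G U x w) (V x) + qf (G x) (\<lambda>i. JJ i x) (X x) (Z x) (U x) (nab G V x w)"
proof -
  have bG: "bilinear (G x)" using inner_G[OF x] by (simp add: inner_form_def)
  have b: "bilinear (\<lambda>a b. G x a (U x) * G x b (V x))"
    unfolding bilinear_def by (auto intro!: linearI simp: bilinear_ladd[OF bG] bilinear_lmul[OF bG] algebra_simps)
  have d: "(\<lambda>y. G y (JJ i y (X y)) (U y)) differentiable at x" if "i \<in> {1..3}" "Cinf_on S X" "Cinf_on S U" for i X U
    by (intro Cinf_onD[OF _ x] smooth_G_fields smooth_JJ that)
  have e: "DD (\<lambda>y. G y (JJ i y (X y)) (U y)) x w
     = G x (nabe G (JJ i) x w (X x)) (U x) + G x (JJ i x (nab G X x w)) (U x) + G x (JJ i x (X x)) (nab G U x w)"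
    if "i \<in> {1..3}" "Cinf_on S X" "Cinf_on S U" for i X U
    by (simp add: DD_G_fields[OF x smooth_JJ[OF that(1,2)] that(3)] nab_nabe[OF x lin_JJ[OF that(1)] that(2)] bilinear_ladd[OF bG])
  have "DD (\<lambda>y. qf (G y) (\<lambda>i. JJ i y) (X y) (Z y) (U y) (V y)) x w
    = (\<Sum>i=1..3. DD (\<lambda>y. G y (JJ i y (X y)) (U y) * G y (JJ i y (Z y)) (V y)) x w)"
    unfolding qf_def by (intro DD_sum differentiable_bounded_bilinear[OF bounded_bilinear_mult] d s)
  also have "\<dots> = (\<Sum>i=1..3. (G x (nabe G (JJ i) x w (X x)) (U x) * G x (JJ i x (Z x)) (V x)
          + G x (JJ i x (X x)) (U x) * G x (nabe G (JJ i) x w (Z x)) (V x))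
      + (G x (JJ i x (nab G X x w)) (U x) * G x (JJ i x (Z x)) (V x) + G x (JJ i x (X x)) (U x) * G x (JJ i x (nab G Z x w)) (V x)
       + G x (JJ i x (X x)) (nab G U x w) * G x (JJ i x (Z x)) (V x) + G x (JJ i x (X x)) (U x) * G x (JJ i x (Z x)) (nab G V x w)))"
    by (intro sum.cong refl)
       (simp add: DD_mult[OF d[OF _ s(1,3)] d[OF _ s(2,4)]] e[OF _ s(1,3)] e[OF _ s(2,4)] algebra_simps)
  finally show ?thesis
    using nabe_sum_cancel[OF x b, of w "X x" "Z x"] by (simp add: sum.distrib qf_def)
qed

lemma DD_qB:
  assumes x: "x \<in> S" and s: "Cinf_on S X" "Cinf_on S Z" "Cinf_on S U" "Cinf_on S V"
  shows "DD (\<lambda>y. qB (G y) (\<lambda>i. JJ i y) (X y) (Z y) (U y) (V y)) x w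
    = qB (G x) (\<lambda>i. JJ i x) (nab G X x w) (Z x) (U x) (V x) + qB (G x) (\<lambda>i. JJ i x) (X x) (nab G Z x w) (U x) (V x)
    + qB (G x) (\<lambda>i. JJ i x) (X x) (Z x) (nab G U x w) (V x) + qB (G x) (\<lambda>i. JJ i x) (X x) (Z x) (U x) (nab G V x w)"
proof -
  have d: "(\<lambda>y. G y (U y) (V y)) differentiable at x" if "Cinf_on S U" "Cinf_on S V" for U V
    by (intro Cinf_onD[OF _ x] smooth_G_fields that)
  have dq: "(\<lambda>y. qf (G y) (\<lambda>i. JJ i y) (X y) (Z y) (U y) (V y)) differentiable at x"
    if "Cinf_on S X" "Cinf_on S Z" "Cinf_on S U" "Cinf_on S V" for X Z U V
    by (intro Cinf_onD[OF _ x] smooth_qf that)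
  have dm: "(\<lambda>y. f y * g y) differentiable at x" if "f differentiable at x" "g differentiable at x" for f g :: "'e \<Rightarrow> real"
    by (rule differentiable_bounded_bilinear[OF bounded_bilinear_mult that])
  show ?thesis
    unfolding qB_def
    by (simp add: DD_add DD_diff DD_mult d dq dm s DD_G_fields[OF x] DD_qf[OF x] algebra_simps)
qed

lemma DD_qR:
  assumes x: "x \<in> S" and s: "Cinf_on S X" "Cinf_on S Y" "Cinf_on S Z" "Cinf_on S V"
  shows "DD (\<lambda>y. qR (G y) (\<lambda>i. JJ i y) (X y) (Y y) (Z y) (V y)) x w
    = qR (G x) (\<lambda>i. JJ i x) (nab G X x w) (Y x) (Z x) (V x) + qR (G x) (\<lambda>i. JJ i x) (X x) (nab G Y x w) (Z x) (V x)
    + qR (G x) (\<lambda>i. JJ i x) (X x) (Y x) (nab G Z x w) (V x) + qR (G x) (\<lambda>i. JJ i x) (X x) (Y x) (Z x) (nab G V x w)"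
proof -
  have d: "(\<lambda>y. G y (U y) (V y)) differentiable at x" if "Cinf_on S U" "Cinf_on S V" for U V
    by (intro Cinf_onD[OF _ x] smooth_G_fields that)
  have dq: "(\<lambda>y. qf (G y) (\<lambda>i. JJ i y) (X y) (Z y) (U y) (V y)) differentiable at x"
    if "Cinf_on S X" "Cinf_on S Z" "Cinf_on S U" "Cinf_on S V" for X Z U V
    by (intro Cinf_onD[OF _ x] smooth_qf that)
  have dm: "(\<lambda>y. f y * g y) differentiable at x" if "f differentiable at x" "g differentiable at x" for f g :: "'e \<Rightarrow> real"
    by (rule differentiable_bounded_bilinear[OF bounded_bilinear_mult that])
  show ?thesis
    unfolding qR_def
    by (simp add: DD_add DD_diff DD_mult d dq dm s DD_G_fields[OF x] DD_qf[OF x] algebra_simps)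
qed

end

section \<open>Derivatives of compatible forms and the differential of the reduced scalar
  curvature\<close>

context quat_alg begin

text \<open>On 2-forms the operator on the left of \<open>eq\<close> is the identity on S^2H and its
  kernel is S^2E, so a form that it maps into S^2H is compatible. The rule for each structure
  results from \<open>eq\<close> at two pairs of arguments.\<close>

lemma cpt_from_projection:
  assumes \<phi>: "bilinear \<phi>" "\<And>u v. \<phi> u v = - \<phi> v u"
    and eq: "\<And>u v. 3 / 4 * \<phi> u v - 1 / 4 * (\<phi> (I u) (I v) + \<phi> (J u) (J v) + \<phi> (K u) (K v))
        = a * h (I u) v + b * h (J u) v + c * h (K u) v"
  shows "cpt a b c \<phi>"
proof -
  note neg = bilinear_lneg[OF \<phi>(1)] bilinear_rneg[OF \<phi>(1)]
  have eq': "\<phi> (I u) (I v) + \<phi> (J u) (J v) + \<phi> (K u) (K v)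
     = 3 * \<phi> u v - 4 * (a * h (I u) v + b * h (J u) v + c * h (K u) v)" for u v
    using eq[of u v] by (simp add: field_simps)
  show ?thesis
  proof (rule cptI[OF \<phi>])
    fix u v
    show "\<phi> (I u) (I v) = \<phi> u v - 2 * (b * h (J u) v + c * h (K u) v)"
      using eq'[of u v] eq'[of "I u" "I v"] by (simp add: Jmul neg qs algebra_simps)
    show "\<phi> (J u) (J v) = \<phi> u v - 2 * (c * h (K u) v + a * h (I u) v)"
      using eq'[of u v] eq'[of "J u" "J v"] by (simp add: Jmul neg qs algebra_simps)
    show "\<phi> (K u) (K v) = \<phi> u v - 2 * (a * h (I u) v + b * h (J u) v)"
      using eq'[of u v] eq'[of "K u" "K v"] by (simp add: Jmul neg qs algebra_simps)
  qed
qed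

text \<open>The trace against \<open>I\<close> in the last two slots says that the wedge product of
  \<open>a\<close> with the Kaehler form of \<open>I\<close> vanishes. Setting \<open>v = x\<close>,
  \<open>w = I y\<close> and tracing once more gives \<open>(4n - 2) * a u = 0\<close>.\<close>

lemma cyclic_rz_zero:
  assumes a: "linear a"
    and eq: "\<And>u v w s z. a u * h (rz v w s) z + a v * h (rz w u s) z + a w * h (rz u v s) z = (0::real)"
  shows "a u = 0"
proof -
  have t: "tr (\<lambda>x y. h (rz v w x) (I y)) = 8 * real n * h (I v) w" for v w
    using cpt_coeff1[OF rz_cpt, of v w] by simp
  have 1: "a u * h (I v) w + a v * h (I w) u + a w * h (I u) v = 0" for u v w
  proof -
    have "tr (\<lambda>x y. a u * h (rz v w x) (I y) + a v * h (rz w u x) (I y) + a w * h (rz u v x) (I y)) = 0"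
      unfolding eq by (simp add: tr_zero)
    then have "8 * real n * (a u * h (I v) w + a v * h (I w) u + a w * h (I u) v) = 0"
      by (simp add: tr_simps t algebra_simps)
    then show ?thesis using n2 by simp
  qed
  have lI: "linear (\<lambda>x. a (I x))" using linear_compose[OF lin_I a] by (simp add: o_def)
  have c: "tr (\<lambda>x y. a x * h u y) = a u" "tr (\<lambda>x y. a (I x) * h (I u) y) = a (I (I u))"
    using tr_contract(2)[OF a] tr_contract(2)[OF lI] by simp_all
  have "tr (\<lambda>x y. a u * h (I x) (I y) + a x * h (I (I y)) u + a (I x) * h (I u) y) = 0"
  proof -
    have "tr (\<lambda>x y. a u * h (I x) (I y) + a x * h (I (I y)) u + a (I x) * h (I u) y)
       = tr (\<lambda>x y. a u * h (I x) (I y) + a x * h (I (I y)) u + a (I y) * h (I u) x)"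
      by (simp add: tr_def)
    then show ?thesis unfolding 1 by (simp add: tr_zero)
  qed
  then have "(4 * real n - 2) * a u = 0"
    by (simp add: I_orth Jmul h_lin h_sym[of _ u] tr_simps c tr_h linear_neg[OF a] algebra_simps)
  then show ?thesis using n2 by simp
qed

end

context qk_chart begin

text \<open>The S^2H part of \<open>\<psi>\<close> is a combination of local Kaehler forms with
  smooth coefficients, so its derivative stays in S^2H because the quaternionic bundle is preserved.
  The projection \<open>th\<close> is built from the parallel sum \<open>qK\<close> and commutes
  with the derivative, so \<open>cpt_from_projection\<close> applies.\<close>

lemma nabf_compatible:
  assumes x: "x \<in> S" and \<psi>: "bil_field S \<psi>" and c: "\<And>y. y \<in> S \<Longrightarrow> \<psi> y \<in> compatible (G y) (q y)"
  shows "nabf G \<psi> x w \<in> compatible (G x) (q x)"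
proof -
  interpret X: quat_point "G x" "q x" n "\<lambda>i. JJ i x" by (rule qp[OF x])
  have skew: "\<psi> y u v = - \<psi> y v u" if "y \<in> S" for y u v
  proof -
    interpret Y: quat_point "G y" "q y" n "\<lambda>i. JJ i y" by (rule qp[OF that])
    show ?thesis using c[OF that] Y.compatible_iff Y.cptD(2) by blast
  qed
  define th where "th y u v = 3 / 4 * \<psi> y u v - 1 / 4 * qK (\<lambda>i. JJ i y) (\<psi> y) u v" for y u v
  have sm: "Cinf_on S (\<lambda>y. \<psi> y u v)" "Cinf_on S (\<lambda>y. qK (\<lambda>i. JJ i y) (\<psi> y) u v)" for u v
    using \<psi> bil_qK[OF \<psi>] by (auto simp: bil_field_def)
  have bth: "bil_field S th"
  proof -
    have "bilinear (th y)" if "y \<in> S" for y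
    proof -
      have b: "bilinear (\<psi> y)" "bilinear (qK (\<lambda>i. JJ i y) (\<psi> y))"
        using \<psi> bil_qK[OF \<psi>] that by (auto simp: bil_field_def)
      show ?thesis unfolding bilinear_def th_def
        by (auto intro!: linearI simp: bilinear_ladd[OF b(1)] bilinear_radd[OF b(1)] bilinear_lmul[OF b(1)] bilinear_rmul[OF b(1)]
           bilinear_ladd[OF b(2)] bilinear_radd[OF b(2)] bilinear_lmul[OF b(2)] bilinear_rmul[OF b(2)] field_simps)
    qed
    moreover have "Cinf_on S (\<lambda>y. th y u v)" for u v
      unfolding th_def by (intro Cinf_intros open_S sm)
    ultimately show ?thesis by (simp add: bil_field_def)
  qed
  \<comment> \<open>Evaluation on a fixed nonzero \<open>z\<close> and the
    \<open>J\<^sub>i z\<close>, which are mutually orthogonal, reads off the coefficients by a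
    formula that is smooth in the point.\<close>
  obtain z :: 'e where z: "z \<noteq> 0" using nonzero_Basis nonempty_Basis by blast
  have pos: "G y z z > 0" if "y \<in> S" for y using inner_G[OF that] z by (simp add: inner_form_def)
  define a where "a i y = th y z (JJ i y z) / G y z z" for i y
  have sa: "Cinf_on S (a i)" if "i \<in> {1..3}" for i
  proof -
    have nz: "G y z z \<noteq> 0" if "y \<in> S" for y using pos[OF that] by simp
    show ?thesis unfolding a_def
      by (rule Cinf_on_divide[OF open_S nz bil_field_Cinf[OF open_S bth Cinf_on_const smooth_JJ[OF that Cinf_on_const]] smooth_G])
  qed
  have th: "th y u v = (\<Sum>i=1..3. a i y * G y (JJ i y u) v)" if y: "y \<in> S" for y u v
  proof -
    interpret Y: quat_point "G y" "q y" n "\<lambda>i. JJ i y" by (rule qp[OF y])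
    obtain a1 a2 a3 where cp: "Y.cpt a1 a2 a3 (\<psi> y)" using c[OF y] Y.compatible_iff by blast
    have t: "th y u v = a1 * G y (JJ 1 y u) v + a2 * G y (JJ 2 y u) v + a3 * G y (JJ 3 y u) v" for u v
      unfolding th_def qK_def sum_1_3 Y.cptD(3-5)[OF cp] by (simp add: algebra_simps)
    have "a 1 y = a1" "a 2 y = a2" "a 3 y = a3"
      unfolding a_def t using pos[OF y] by (simp_all add: Y.h_I Y.h_J Y.h_K Y.Jmul Y.h_lin Y.h_self)
    then show ?thesis unfolding t sum_1_3 by simp
  qed
  have bG: "bilinear (G x)" using inner_G[OF x] by (simp add: inner_form_def)
  have eq1: "nabf G th x w u v = 3 / 4 * nabf G \<psi> x w u v - 1 / 4 * qK (\<lambda>i. JJ i x) (nabf G \<psi> x w) u v" for u v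
  proof -
    have d: "(\<lambda>y. \<psi> y u v) differentiable at x" "(\<lambda>y. qK (\<lambda>i. JJ i y) (\<psi> y) u v) differentiable at x"
      by (rule Cinf_onD[OF _ x], rule sm)+
    have "DD (\<lambda>y. th y u v) x w = 3 / 4 * DD (\<lambda>y. \<psi> y u v) x w - 1 / 4 * DD (\<lambda>y. qK (\<lambda>i. JJ i y) (\<psi> y) u v) x w"
      unfolding th_def
      by (subst DD_diff)
         (simp_all add: d DD_bounded_linear[OF bounded_linear_mult_right] DD_bounded_linear[OF bounded_linear_divide])
    then show ?thesis
      unfolding nabf_qK[OF x \<psi>, symmetric] by (simp add: nabf_def th_def algebra_simps)
  qed
  have "\<exists>co. \<forall>u v. nabf G th x w u v = (\<Sum>i=1..3. co i * G x (JJ i x u) v)"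
  proof -
    have "\<exists>a b c. nabe G (JJ i) x w = (\<lambda>v. a *\<^sub>R JJ 1 x v + b *\<^sub>R JJ 2 x v + c *\<^sub>R JJ 3 x v)" if "i \<in> {1..3}" for i
      using nabe_JJ[OF x that, of w] unfolding X.q_eq by blast
    then obtain b1 b2 b3 where N: "\<And>i v. i \<in> {1..3} \<Longrightarrow> nabe G (JJ i) x w v = b1 i *\<^sub>R JJ 1 x v + b2 i *\<^sub>R JJ 2 x v + b3 i *\<^sub>R JJ 3 x v"
      by metis
    define co where "co i = DD (a i) x w + (if i = 1 then (\<Sum>k=1..3. a k x * b1 k) else if i = 2 then (\<Sum>k=1..3. a k x * b2 k)
        else (\<Sum>k=1..3. a k x * b3 k))" for i :: nat
    have "nabf G th x w u v = (\<Sum>i=1..3. co i * G x (JJ i x u) v)" for u v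
    proof -
      have d: "(\<lambda>y. G y (JJ i y u) v) differentiable at x" "a i differentiable at x" if "i \<in> {1..3}" for i
        by (rule Cinf_onD[OF smooth_G_fields[OF smooth_JJ[OF that Cinf_on_const] Cinf_on_const] x],
            rule Cinf_onD[OF sa[OF that] x])
      have e: "DD (\<lambda>y. G y (JJ i y u) v) x w = G x (nabe G (JJ i) x w u) v + G x (JJ i x (chr G x w u)) v + G x (JJ i x u) (chr G x w v)"
        if "i \<in> {1..3}" for i
        by (simp add: DD_G_fields[OF x smooth_JJ[OF that Cinf_on_const] Cinf_on_const] nab_nabe[OF x lin_JJ[OF that] Cinf_on_const]
            nab_const bilinear_ladd[OF bG])
      have "DD (\<lambda>y. th y u v) x w = DD (\<lambda>y. \<Sum>i=1..3. a i y * G y (JJ i y u) v) x w"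
        by (rule fun_cong[OF frechet_derivative_cong_open[OF open_S x]]) (rule th)
      also have "\<dots> = (\<Sum>i=1..3. DD (\<lambda>y. a i y * G y (JJ i y u) v) x w)"
        by (intro DD_sum differentiable_bounded_bilinear[OF bounded_bilinear_mult] d)
      also have "\<dots> = (\<Sum>i=1..3. DD (a i) x w * G x (JJ i x u) v + a i x * G x (nabe G (JJ i) x w u) v
           + a i x * G x (JJ i x (chr G x w u)) v + a i x * G x (JJ i x u) (chr G x w v))"
        by (intro sum.cong refl) (simp add: DD_mult[OF d(2) d(1)] e algebra_simps)
      finally have "nabf G th x w u v = (\<Sum>i=1..3. DD (a i) x w * G x (JJ i x u) v + a i x * G x (nabe G (JJ i) x w u) v)"
        unfolding nabf_def th[OF x] by (simp add: sum.distrib)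
      also have "\<dots> = (\<Sum>i=1..3. co i * G x (JJ i x u) v)"
        unfolding sum_1_3 co_def
        by (simp add: N bilinear_ladd[OF bG] bilinear_lmul[OF bG] algebra_simps)
      finally show ?thesis .
    qed
    then show ?thesis by blast
  qed
  then obtain co where co: "\<And>u v. nabf G th x w u v = (\<Sum>i=1..3. co i * G x (JJ i x u) v)" by blast
  have "X.cpt (co 1) (co 2) (co 3) (nabf G \<psi> x w)"
  proof (rule X.cpt_from_projection)
    show "bilinear (nabf G \<psi> x w)" using nabf_lin(2)[OF \<psi>] x by (simp add: bil_field_def)
    show "nabf G \<psi> x w u v = - nabf G \<psi> x w v u" for u v
    proof -
      have "DD (\<lambda>y. \<psi> y u v) x w = DD (\<lambda>y. - \<psi> y v u) x w"
        by (rule fun_cong[OF frechet_derivative_cong_open[OF open_S x]]) (rule skew)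
      also have "\<dots> = - DD (\<lambda>y. \<psi> y v u) x w" by (rule DD_minus[OF Cinf_onD[OF sm(1) x]])
      finally show ?thesis
        using skew[OF x, of "chr G x w u" v] skew[OF x, of u "chr G x w v"] by (simp add: nabf_def)
    qed
    show "3 / 4 * nabf G \<psi> x w u v - 1 / 4 * (nabf G \<psi> x w (JJ 1 x u) (JJ 1 x v) + nabf G \<psi> x w (JJ 2 x u) (JJ 2 x v)
       + nabf G \<psi> x w (JJ 3 x u) (JJ 3 x v)) = co 1 * G x (JJ 1 x u) v + co 2 * G x (JJ 2 x u) v + co 3 * G x (JJ 3 x u) v" for u v
      using eq1[of u v] unfolding co qK_def sum_1_3 by simp
  qed
  then show ?thesis using X.compatible_iff by blast
qed

lemma nabf_qB:
  assumes x: "x \<in> S" and s: "Cinf_on S X" "Cinf_on S Z"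
  shows "nabf G (\<lambda>y. qB (G y) (\<lambda>i. JJ i y) (X y) (Z y)) x w u v
    = qB (G x) (\<lambda>i. JJ i x) (nab G X x w) (Z x) u v + qB (G x) (\<lambda>i. JJ i x) (X x) (nab G Z x w) u v"
  using DD_qB[OF x s Cinf_on_const Cinf_on_const, of u v w] by (simp add: nabf_def nab_const)

text \<open>Because the model tensor \<open>qR\<close> is parallel, the second Bianchi identity leaves only the terms with
  the differential of \<open>\<nu>\<close>, to which \<open>cyclic_rz_zero\<close> applies.\<close>

lemma weyl_zero_DD_nu:
  assumes x: "x \<in> S" and \<nu>: "Cinf_on S \<nu>"
    and R: "\<And>y u v w z. y \<in> S \<Longrightarrow> G y (crv G y u v w) z = - (\<nu> y / 4) * qR (G y) (\<lambda>i. JJ i y) u v w z"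
  shows "DD \<nu> x u = 0"
proof -
  interpret X: quat_point "G x" "q x" n "\<lambda>i. JJ i x" by (rule qp[OF x])
  let ?R = "qR (G x) (\<lambda>i. JJ i x)"
  have qR_skew: "?R X Y Z V = - ?R Y X Z V" for X Y Z V
    unfolding X.rz_qR[symmetric] using X.rz_skew[of X Y Z] by (simp add: X.h_lin)
  \<comment> \<open>Since \<open>qR\<close> is parallel, the Christoffel terms in the last two slots
    cancel. The derivative of \<open>\<nu>\<close> remains, with Christoffel terms in the first two
    slots that will drop out of the cyclic sum.\<close>
  have T: "G x (nab G (\<lambda>y. crv G y v w s) x u - crv G x v w (nab G (\<lambda>y. s) x u)) z
     = - (1 / 4) * (DD \<nu> x u * ?R v w s z + \<nu> x * (?R (chr G x u v) w s z + ?R v (chr G x u w) s z))" for u v w s z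
  proof -
    have sc: "Cinf_on S (\<lambda>y. crv G y v w s)" by (intro smooth_crv Cinf_on_const)
    have sR: "Cinf_on S (\<lambda>y. qR (G y) (\<lambda>i. JJ i y) v w s z)" by (intro smooth_qR Cinf_on_const)
    have "G x (nab G (\<lambda>y. crv G y v w s) x u) z + G x (crv G x v w s) (chr G x u z) = DD (\<lambda>y. G y (crv G y v w s) z) x u"
      using DD_G_fields[OF x sc Cinf_on_const] by (simp add: nab_const)
    also have "\<dots> = DD (\<lambda>y. (- 1 / 4) * (\<nu> y * qR (G y) (\<lambda>i. JJ i y) v w s z)) x u"
      by (rule fun_cong[OF frechet_derivative_cong_open[OF open_S x]]) (simp add: R)
    also have "\<dots> = (- 1 / 4) * DD (\<lambda>y. \<nu> y * qR (G y) (\<lambda>i. JJ i y) v w s z) x u"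
      by (intro DD_bounded_linear[OF bounded_linear_mult_right] Cinf_onD[OF _ x] Cinf_on_mult open_S \<nu> sR)
    also have "DD (\<lambda>y. \<nu> y * qR (G y) (\<lambda>i. JJ i y) v w s z) x u
       = \<nu> x * (?R (chr G x u v) w s z + ?R v (chr G x u w) s z + ?R v w (chr G x u s) z + ?R v w s (chr G x u z)) + DD \<nu> x u * ?R v w s z"
      using DD_qR[OF x Cinf_on_const Cinf_on_const Cinf_on_const Cinf_on_const, of v w s z u]
      by (simp add: DD_mult[OF Cinf_onD[OF \<nu> x] Cinf_onD[OF sR x]] nab_const)
    finally show ?thesis
      by (simp add: R[OF x] X.h_lin nab_const algebra_simps)
  qed
  have cyc: "DD \<nu> x u * ?R v w s z + DD \<nu> x v * ?R w u s z + DD \<nu> x w * ?R u v s z = 0" for u v w s z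
  proof -
    have "G x ((nab G (\<lambda>y. crv G y v w s) x u - crv G x v w (nab G (\<lambda>y. s) x u))
      + (nab G (\<lambda>y. crv G y w u s) x v - crv G x w u (nab G (\<lambda>y. s) x v))
      + (nab G (\<lambda>y. crv G y u v s) x w - crv G x u v (nab G (\<lambda>y. s) x w))) z = 0"
      unfolding crv_jacobi[OF x Cinf_on_const] by (simp add: X.h_lin)
    then show ?thesis
      unfolding X.h_lin(1) T
      using qR_skew[of "chr G x u v" w s z] qR_skew[of "chr G x u w" v s z] qR_skew[of "chr G x v w" u s z]
        chr_sym[OF x, of v u] chr_sym[OF x, of w u] chr_sym[OF x, of w v]
      by (simp add: algebra_simps)
  qed
  show ?thesis
    by (rule X.cyclic_rz_zero[OF linear_DD[OF Cinf_onD[OF \<nu> x]]]) (simp add: X.rz_qR cyc)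
qed

end

section \<open>Quaternionic-Kaehler manifolds in charts\<close>

lemma transport_admissible:
  fixes h h' :: "'e::euclidean_space \<Rightarrow> 'e \<Rightarrow> real" and T F :: "'e \<Rightarrow> 'e"
  assumes adm: "admissible h q JJ" and T: "linear T" "linear F" "\<And>u. F (T u) = u" "\<And>u. T (F u) = u"
    and h': "\<And>u v. h' u v = h (F u) (F v)"
  shows "admissible h' ((\<lambda>B u. T (B (F u))) ` q) (\<lambda>i u. T (JJ i (F u)))"
proof -
  have i: "linear (JJ i)" "JJ i (JJ i v) = - v" "h (JJ i u) (JJ i v) = h u v" if "i \<in> {1..3}" for i u v
    using adm that unfolding admissible_def by blast+
  have ij: "JJ i (JJ j v) = - JJ j (JJ i v)" if "i \<in> {1..3}" "j \<in> {1..3}" "i \<noteq> j" for i j v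
    using adm that unfolding admissible_def by blast
  have three: "JJ 3 v = JJ 1 (JJ 2 v)" for v using adm unfolding admissible_def by blast
  have q: "q = {(\<lambda>v. \<Sum>i=1..3. a i *\<^sub>R JJ i v) | a :: nat \<Rightarrow> real. True}"
    using adm unfolding admissible_def by blast
  have Ts: "T (\<Sum>i=1..3. a i *\<^sub>R JJ i (F u)) = (\<Sum>i=1..3. a i *\<^sub>R T (JJ i (F u)))" for a :: "nat \<Rightarrow> real" and u
    by (simp add: linear_sum[OF T(1)] linear_cmul[OF T(1)])
  have qT: "(\<lambda>B u. T (B (F u))) ` q = {(\<lambda>v. \<Sum>i=1..3. a i *\<^sub>R T (JJ i (F v))) | a :: nat \<Rightarrow> real. True}"
  proof -
    have "{f a | a :: nat \<Rightarrow> real. True} = range f" for f :: "(nat \<Rightarrow> real) \<Rightarrow> 'e \<Rightarrow> 'e" by auto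
    moreover have "(\<lambda>B u. T (B (F u))) ` range (\<lambda>a v. \<Sum>i=1..3. a i *\<^sub>R JJ i v) = range (\<lambda>a v. \<Sum>i=1..3. a i *\<^sub>R T (JJ i (F v)))"
      by (simp add: image_image Ts)
    ultimately show ?thesis unfolding q by simp
  qed
  show ?thesis
    unfolding admissible_def
  proof (intro conjI ballI allI impI)
    fix k :: nat assume k: "k \<in> {1..3}"
    show "linear (\<lambda>u. T (JJ k (F u)))"
      using linear_compose[OF linear_compose[OF T(2) i(1)[OF k]] T(1)] by (simp add: o_def)
    show "T (JJ k (F (T (JJ k (F v))))) = - v" for v
      by (simp add: T i(2)[OF k] linear_neg[OF T(1)])
    show "h' (T (JJ k (F u))) (T (JJ k (F v))) = h' u v" for u v
      by (simp add: T h' i(3)[OF k])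
    show "T (JJ k (F (T (JJ j (F v))))) = - T (JJ j (F (T (JJ k (F v)))))" if "j \<in> {1..3}" "k \<noteq> j" for j v
      by (simp add: T ij[OF k that] linear_neg[OF T(1)])
  next
    show "T (JJ 3 (F v)) = T (JJ 1 (F (T (JJ 2 (F v)))))" for v by (simp add: T three)
    show "(\<lambda>B u. T (B (F u))) ` q = {(\<lambda>v. \<Sum>i=1..3. a i *\<^sub>R T (JJ i (F v))) | a :: nat \<Rightarrow> real. True}"
      by (rule qT)
  qed
qed

locale qk = riem_atlas A g
  for A :: "('a::{t2_space,second_countable_topology}, 'e::euclidean_space) chart set"
    and g :: "'a \<Rightarrow> 'e \<Rightarrow> 'e \<Rightarrow> real" +
  fixes Q :: "'a \<Rightarrow> ('e \<Rightarrow> 'e) set" and n :: nat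
  assumes quat_kaehler: "quaternionic_kaehler A g Q n"
begin

abbreviation ad :: "'a \<Rightarrow> nat \<Rightarrow> 'e \<Rightarrow> 'e" where "ad p \<equiv> adm_basis (g p) (Q p)"

abbreviation nu :: "'a \<Rightarrow> real" where "nu p \<equiv> reduced_scalar_curv A g n p"

lemma dim_n: "DIM('e) = 4 * n" and n_ge_2: "n \<ge> 2"
  using quat_kaehler unfolding quaternionic_kaehler_def by blast+

lemma nabla_Q:
  assumes "open U" "smooth_end A U B" "\<And>q. q \<in> U \<Longrightarrow> B q \<in> Q q" "p \<in> U"
  shows "nabla_end A g p w B \<in> Q p"
  using quat_kaehler assms unfolding quaternionic_kaehler_def by blast

definition local_basis :: "'a set \<Rightarrow> (nat \<Rightarrow> 'a \<Rightarrow> 'e \<Rightarrow> 'e) \<Rightarrow> bool" where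
  "local_basis U J \<longleftrightarrow> open U \<and> (\<forall>i\<in>{1..3}. smooth_end A U (J i)) \<and> (\<forall>q\<in>U. admissible (g q) (Q q) (\<lambda>i. J i q))"

lemma local_basis_exists:
  assumes "open U" "p \<in> U" obtains V J where "local_basis V J" "p \<in> V" "V \<subseteq> U"
proof -
  obtain W J where W: "open W" "p \<in> W" "\<forall>i\<in>{1..3}. smooth_end A W (J i)" "\<forall>q\<in>W. admissible (g q) (Q q) (\<lambda>i. J i q)"
    using quat_kaehler unfolding quaternionic_kaehler_def by blast
  have "local_basis (W \<inter> U) J"
    unfolding local_basis_def using W assms smooth_subset(4)[of W _ "W \<inter> U"] by auto
  then show thesis using that[of "W \<inter> U" J] W assms by blast
qed

lemma quat_point_local: "local_basis U J \<Longrightarrow> p \<in> U \<Longrightarrow> quat_point (g p) (Q p) n (\<lambda>i. J i p)"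
  unfolding local_basis_def by (intro quat_point.intro inner_g dim_n n_ge_2) blast

lemma quat_point_ad: "quat_point (g p) (Q p) n (ad p)"
proof -
  obtain V J where "local_basis V J" "p \<in> V" using local_basis_exists[OF open_UNIV UNIV_I] by metis
  then interpret quat_point "g p" "Q p" n "\<lambda>i. J i p" by (rule quat_point_local)
  show ?thesis by (rule quat_point_adm_basis)
qed

lemma local_basis_linear:
  assumes "local_basis U J" "p \<in> U" "i \<in> {1..3}" shows "linear (J i p)"
proof -
  have "admissible (g p) (Q p) (\<lambda>i. J i p)" using assms(1,2) unfolding local_basis_def by blast
  then show ?thesis using assms(3) unfolding admissible_def by blast
qed

lemma local_basis_mem:
  assumes "local_basis U J" "p \<in> U" "i \<in> {1..3}" shows "J i p \<in> Q p"
proof -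
  have "admissible (g p) (Q p) (\<lambda>i. J i p)" using assms(1,2) unfolding local_basis_def by blast
  note m = admissible_mem[OF inner_g this dim_n n_ge_2]
  show ?thesis
  proof -
    have "i = 1 \<or> i = 2 \<or> i = 3" using assms(3) by auto
    then show ?thesis using m by blast
  qed
qed

definition qrep :: "('a, 'e) chart \<Rightarrow> 'e \<Rightarrow> ('e \<Rightarrow> 'e) set" where
  "qrep c x = (\<lambda>B u. to_chart A c (chart_inv c x) (B (from_chart A c (chart_inv c x) u))) ` Q (chart_inv c x)"

lemma qrep_base: "qrep (bc p) (snd (bc p) p) = Q p"
  by (simp add: qrep_def bc_in bc_dom)

lemma qk_chart_local:
  assumes c: "c \<in> A" and J: "local_basis U J"
  shows "qk_chart (cdom c U) (G c) (\<lambda>i. erep A c (J i)) (qrep c) n"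
proof -
  have U: "open U" and sJ: "\<And>i. i \<in> {1..3} \<Longrightarrow> smooth_end A U (J i)"
    and aJ: "\<And>p. p \<in> U \<Longrightarrow> admissible (g p) (Q p) (\<lambda>i. J i p)"
    using J unfolding local_basis_def by blast+
  interpret loc_riem "cdom c U" "G c" by (rule loc_riem_chart[OF c U])
  show ?thesis
  proof
    fix x assume x: "x \<in> cdom c U"
    then obtain p where p: "p \<in> fst c" "p \<in> U" "x = snd c p" by (rule cdomE)
    have e: "(\<lambda>i. erep A c (J i) x) = (\<lambda>i u. to_chart A c p (J i p (from_chart A c p u)))"
      unfolding p(3) by (simp add: fun_eq_iff erep_at[OF c p(1)])
    have q: "qrep c x = (\<lambda>B u. to_chart A c p (B (from_chart A c p u))) ` Q p"
      unfolding qrep_def p(3) by (simp add: c p(1))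
    show "admissible (G c x) (qrep c x) (\<lambda>i. erep A c (J i) x)"
      unfolding e q
      by (rule transport_admissible[OF aJ[OF p(2)] linear_to[OF c p(1)] linear_from[OF c p(1)]])
         (simp_all add: c p frep_at)
    fix w and i :: nat assume i: "i \<in> {1..3}"
    have "nabe (G c) (erep A c (J i)) x w = (\<lambda>u. to_chart A c p (nabla_end A g p (from_chart A c p w) (J i) (from_chart A c p u)))"
    proof
      fix u
      show "nabe (G c) (erep A c (J i)) x w u = to_chart A c p (nabla_end A g p (from_chart A c p w) (J i) (from_chart A c p u))"
        unfolding p(3) using nabla_end_chart[OF U p(2) sJ[OF i] local_basis_linear[OF J _ i] c p(1), of "from_chart A c p w" "from_chart A c p u"]
        by (simp add: c p(1))
    qed
    moreover have "nabla_end A g p (from_chart A c p w) (J i) \<in> Q p"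
      by (rule nabla_Q[OF U sJ[OF i] local_basis_mem[OF J _ i] p(2)])
    ultimately show "nabe (G c) (erep A c (J i)) x w \<in> qrep c x"
      unfolding q by blast
  next
    show "lin_field (cdom c U) (erep A c (J i))" if "i \<in> {1..3}" for i
      by (rule smooth_end_lin_field[OF sJ[OF that] local_basis_linear[OF J _ that] c])
  qed (fact dim_n n_ge_2)+
qed

lemma qf_chart:
  assumes J: "local_basis U J" "p \<in> U" and c: "c \<in> A" "p \<in> fst c"
  shows "qf (g p) (ad p) X Z u v
    = qf (G c (snd c p)) (\<lambda>i. erep A c (J i) (snd c p)) (to_chart A c p X) (to_chart A c p Z) (to_chart A c p u) (to_chart A c p v)"
proof -
  interpret quat_point "g p" "Q p" n "\<lambda>i. J i p" by (rule quat_point_local[OF J])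
  interpret a: quat_point "g p" "Q p" n "ad p" by (rule quat_point_ad)
  have "qf (g p) (ad p) = qf (g p) (\<lambda>i. J i p)"
    by (rule qf_unique[OF inner_g adm_JJ a.adm_JJ dim_n n_ge_2])
  moreover have "qf (G c (snd c p)) (\<lambda>i. erep A c (J i) (snd c p)) (to_chart A c p X) (to_chart A c p Z) (to_chart A c p u) (to_chart A c p v)
    = qf (g p) (\<lambda>i. J i p) X Z u v"
    by (rule qf_pull) (simp_all add: c g_chart erep_at)
  ultimately show ?thesis by simp
qed

lemma qB_chart:
  assumes "local_basis U J" "p \<in> U" "c \<in> A" "p \<in> fst c"
  shows "qB (g p) (ad p) X Z u v
    = qB (G c (snd c p)) (\<lambda>i. erep A c (J i) (snd c p)) (to_chart A c p X) (to_chart A c p Z) (to_chart A c p u) (to_chart A c p v)"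
  unfolding qB_def qf_chart[OF assms] by (simp add: g_chart assms)

lemma qR_chart:
  assumes "local_basis U J" "p \<in> U" "c \<in> A" "p \<in> fst c"
  shows "qR (g p) (ad p) X Z u v
    = qR (G c (snd c p)) (\<lambda>i. erep A c (J i) (snd c p)) (to_chart A c p X) (to_chart A c p Z) (to_chart A c p u) (to_chart A c p v)"
  unfolding qR_def qf_chart[OF assms] by (simp add: g_chart assms)

lemma qK_chart:
  assumes J: "local_basis U J" "p \<in> U" and c: "c \<in> A" "p \<in> fst c" and b: "bilinear (\<psi> p)"
  shows "qK (ad p) (\<psi> p) u v
    = qK (\<lambda>i. erep A c (J i) (snd c p)) (frep A c \<psi> (snd c p)) (to_chart A c p u) (to_chart A c p v)"
proof -
  interpret quat_point "g p" "Q p" n "\<lambda>i. J i p" by (rule quat_point_local[OF J])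
  interpret a: quat_point "g p" "Q p" n "ad p" by (rule quat_point_ad)
  have "qK (ad p) (\<psi> p) u v = qK (\<lambda>i. J i p) (\<psi> p) u v"
    by (simp only: qK_unique[OF inner_g adm_JJ a.adm_JJ dim_n n_ge_2 b])
  then show ?thesis unfolding qK_def by (simp add: c frep_at erep_at)
qed

subsection \<open>The curvature at a point\<close>

lemma curv_linear:
  "linear (\<lambda>u. curv A g p u v w)" "linear (\<lambda>v. curv A g p u v w)" "linear (curv A g p u v)"
proof -
  interpret loc_riem "cdom (bc p) UNIV" "G (bc p)" by (rule loc_riem_chart[OF bc_in open_UNIV])
  note x = cdomI[OF bc_dom UNIV_I]
  have e: "curv A g p u v = crv (G (bc p)) (snd (bc p) p) u v" for u v
    by (simp add: fun_eq_iff curv_base)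
  show "linear (\<lambda>u. curv A g p u v w)" "linear (\<lambda>v. curv A g p u v w)" "linear (curv A g p u v)"
    unfolding e by (rule lin_crv[OF x])+
qed

text \<open>The commutator is the skew part of the second covariant derivative of
  \<open>J i\<close>. Preservation of \<open>Q\<close> can be used twice, because the first
  derivative along a coordinate field is again a smooth local section of \<open>Q\<close>.\<close>

lemma curv_commutator:
  assumes J: "local_basis U J" "p \<in> U" and i: "i \<in> {1..3}"
  shows "(\<lambda>w. curv A g p u v (J i p w) - J i p (curv A g p u v w)) \<in> Q p"
proof -
  let ?b = "bc p" and ?V = "U \<inter> fst (bc p)"
  have U: "open U" and sJ: "smooth_end A U (J i)"
    using J i unfolding local_basis_def by blast+
  have V: "open ?V" "p \<in> ?V" using U J(2) open_chart[OF bc_in] bc_dom by auto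
  have JV: "smooth_end A ?V (J i)" by (rule smooth_subset(4)[OF sJ]) auto
  have lJ: "linear (J i q)" if "q \<in> ?V" for q using local_basis_linear[OF J(1) _ i] that by blast
  define N where "N v q = nabla_end A g q (coord_field A p v q) (J i)" for v q
  have sN: "smooth_end A ?V (N v)" for v
    unfolding N_def by (rule smooth_nabla_end[OF V(1) JV lJ smooth_subset(1)[OF smooth_coord_field]]) auto
  have NQ: "N v q \<in> Q q" if "q \<in> ?V" for v q
    unfolding N_def by (rule nabla_Q[OF U sJ local_basis_mem[OF J(1) _ i]]) (use that in auto)
  have NN: "nabla_end A g p u (N v) \<in> Q p" for u v by (rule nabla_Q[OF V(1) sN NQ V(2)])
  interpret loc_riem "cdom ?b ?V" "G ?b" by (rule loc_riem_chart[OF bc_in V(1)])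
  note x = cdomI[OF bc_dom V(2)]
  have lin: "lin_field (cdom ?b ?V) (erep A ?b (J i))" by (rule smooth_end_lin_field[OF JV lJ bc_in])
  have e: "erep A ?b (N v) y w = nabe (G ?b) (erep A ?b (J i)) y v w" if "y \<in> cdom ?b ?V" for v w y
  proof -
    have "y \<in> cdom ?b UNIV" using that by (auto simp: cdom_def)
    then show ?thesis
      unfolding N_def using erep_nabla[OF V(1) JV lJ bc_in that, of "coord_field A p v" w] coord_field_base by simp
  qed
  have n: "nabla_end A g p u (N v) w = nabe (G ?b) (\<lambda>y a. nabe (G ?b) (erep A ?b (J i)) y v a) (snd ?b p) u w" for u v w
  proof -
    have "DD (\<lambda>y. erep A ?b (N v) y w) (snd ?b p) u = DD (\<lambda>y. nabe (G ?b) (erep A ?b (J i)) y v w) (snd ?b p) u"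
      by (rule fun_cong[OF frechet_derivative_cong_open[OF open_S x]]) (rule e)
    then show ?thesis unfolding nabla_end_base
      by (simp add: nabe_def[of "G ?b" "erep A ?b (N v)"] nabe_def[of "G ?b" "\<lambda>y a. nabe (G ?b) (erep A ?b (J i)) y v a"] e[OF x])
  qed
  have Jp: "erep A ?b (J i) (snd ?b p) w = J i p w" for w by (simp add: erep_at bc_in bc_dom)
  have "(\<lambda>w. curv A g p u v (J i p w) - J i p (curv A g p u v w))
     = (\<lambda>w. nabla_end A g p u (N v) w - nabla_end A g p v (N u) w)"
    unfolding n curv_base using nabe_nabe[OF x lin, of v u] by (simp add: Jp)
  moreover interpret P: quat_point "g p" "Q p" n "\<lambda>i. J i p" by (rule quat_point_local[OF J])
  obtain a b c where a: "nabla_end A g p u (N v) = (\<lambda>w. a *\<^sub>R J 1 p w + b *\<^sub>R J 2 p w + c *\<^sub>R J 3 p w)"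
    using NN[of u v] unfolding P.q_eq by blast
  obtain a' b' c' where a': "nabla_end A g p v (N u) = (\<lambda>w. a' *\<^sub>R J 1 p w + b' *\<^sub>R J 2 p w + c' *\<^sub>R J 3 p w)"
    using NN[of v u] unfolding P.q_eq by blast
  note ab = a a'
  have "(\<lambda>w. nabla_end A g p u (N v) w - nabla_end A g p v (N u) w) \<in> Q p"
    unfolding P.q_eq ab
    by (rule CollectI, rule exI[of _ "a - a'"], rule exI[of _ "b - b'"], rule exI[of _ "c - c'"]) (simp add: fun_eq_iff algebra_simps)
  ultimately show ?thesis by simp
qed

text \<open>By linearity the result for a smooth local basis extends to the whole fibre. This is
  needed for \<open>ad p\<close>, which is chosen at the single point \<open>p\<close> and comes
  without a smooth extension.\<close>

lemma curv_commutator_Q: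
  assumes "B \<in> Q p" shows "(\<lambda>w. curv A g p u v (B w) - B (curv A g p u v w)) \<in> Q p"
proof -
  obtain U J where J: "local_basis U J" "p \<in> U" using local_basis_exists[OF open_UNIV UNIV_I] by metis
  interpret P: quat_point "g p" "Q p" n "\<lambda>i. J i p" by (rule quat_point_local[OF J])
  obtain a b c where B: "B = (\<lambda>w. a *\<^sub>R J 1 p w + b *\<^sub>R J 2 p w + c *\<^sub>R J 3 p w)"
    using assms unfolding P.q_eq by blast
  have m: "1 \<in> {1..3::nat}" "2 \<in> {1..3::nat}" "3 \<in> {1..3::nat}" by auto
  note C = curv_commutator[OF J m(1), of u v] curv_commutator[OF J m(2), of u v] curv_commutator[OF J m(3), of u v]
  note L = linear_add[OF curv_linear(3)] linear_cmul[OF curv_linear(3)]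
  obtain a1 b1 c1 where
    e1: "(\<lambda>w. curv A g p u v (J 1 p w) - J 1 p (curv A g p u v w)) = (\<lambda>w. a1 *\<^sub>R J 1 p w + b1 *\<^sub>R J 2 p w + c1 *\<^sub>R J 3 p w)"
    using C(1) unfolding P.q_eq by blast
  obtain a2 b2 c2 where
    e2: "(\<lambda>w. curv A g p u v (J 2 p w) - J 2 p (curv A g p u v w)) = (\<lambda>w. a2 *\<^sub>R J 1 p w + b2 *\<^sub>R J 2 p w + c2 *\<^sub>R J 3 p w)"
    using C(2) unfolding P.q_eq by blast
  obtain a3 b3 c3 where
    e3: "(\<lambda>w. curv A g p u v (J 3 p w) - J 3 p (curv A g p u v w)) = (\<lambda>w. a3 *\<^sub>R J 1 p w + b3 *\<^sub>R J 2 p w + c3 *\<^sub>R J 3 p w)"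
    using C(3) unfolding P.q_eq by blast
  note e = e1[THEN fun_cong] e2[THEN fun_cong] e3[THEN fun_cong]
  have "curv A g p u v (B w) - B (curv A g p u v w)
     = (a * a1 + b * a2 + c * a3) *\<^sub>R J 1 p w + (a * b1 + b * b2 + c * b3) *\<^sub>R J 2 p w + (a * c1 + b * c2 + c * c3) *\<^sub>R J 3 p w" for w
  proof -
    have "curv A g p u v (B w) - B (curv A g p u v w) = a *\<^sub>R (curv A g p u v (J 1 p w) - J 1 p (curv A g p u v w))
       + b *\<^sub>R (curv A g p u v (J 2 p w) - J 2 p (curv A g p u v w)) + c *\<^sub>R (curv A g p u v (J 3 p w) - J 3 p (curv A g p u v w))"
      unfolding B by (simp add: L algebra_simps)
    then show ?thesis unfolding e by (simp add: algebra_simps)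
  qed
  then show ?thesis unfolding P.q_eq by blast
qed

lemma quat_curv_at: "quat_curv (g p) (ad p 1) (ad p 2) (ad p 3) n (curv A g p)"
proof -
  interpret P: quat_point "g p" "Q p" n "ad p" by (rule quat_point_ad)
  interpret loc_riem "cdom (bc p) UNIV" "G (bc p)" by (rule loc_riem_chart[OF bc_in open_UNIV])
  note x = cdomI[OF bc_dom UNIV_I]
  have m: "\<exists>x y z. \<forall>w. curv A g p X Y (B w) - B (curv A g p X Y w) = x *\<^sub>R ad p 1 w + y *\<^sub>R ad p 2 w + z *\<^sub>R ad p 3 w"
    if "B \<in> Q p" for X Y B
  proof -
    from subsetD[OF equalityD1[OF P.q_eq] curv_commutator_Q[OF that, of X Y]]
    obtain x y z where e: "(\<lambda>w. curv A g p X Y (B w) - B (curv A g p X Y w)) = (\<lambda>w. x *\<^sub>R ad p 1 w + y *\<^sub>R ad p 2 w + z *\<^sub>R ad p 3 w)"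
      by blast
    then show ?thesis
      by (intro exI[of _ x] exI[of _ y] exI[of _ z] allI) (rule fun_cong[OF e])
  qed
  show ?thesis
  proof (intro quat_curv.intro P.quat_alg_axioms quat_curv_axioms.intro)
    show "linear (\<lambda>X. curv A g p X Y Z)" for Y Z by (rule curv_linear)
    show "linear (\<lambda>Y. curv A g p X Y Z)" for X Z by (rule curv_linear)
    show "linear (curv A g p X Y)" for X Y by (rule curv_linear)
    show "curv A g p X Y Z = - curv A g p Y X Z" for X Y Z
      unfolding curv_base by (rule crv_skew)
    show "curv A g p X Y Z + curv A g p Y Z X + curv A g p Z X Y = 0" for X Y Z
      unfolding curv_base by (rule crv_bianchi[OF x])
    show "g p (curv A g p X Y a) b = - g p a (curv A g p X Y b)" for X Y a b
      using crv_metric[OF x] unfolding curv_base G_base by simp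
    note mem = admissible_mem[OF inner_g P.adm_JJ dim_n n_ge_2]
    show "\<exists>x y z. \<forall>w. curv A g p X Y (ad p 1 w) - ad p 1 (curv A g p X Y w) = x *\<^sub>R ad p 1 w + y *\<^sub>R ad p 2 w + z *\<^sub>R ad p 3 w" for X Y
      by (rule m[OF mem(1)])
    show "\<exists>x y z. \<forall>w. curv A g p X Y (ad p 2 w) - ad p 2 (curv A g p X Y w) = x *\<^sub>R ad p 1 w + y *\<^sub>R ad p 2 w + z *\<^sub>R ad p 3 w" for X Y
      by (rule m[OF mem(2)])
    show "\<exists>x y z. \<forall>w. curv A g p X Y (ad p 3 w) - ad p 3 (curv A g p X Y w) = x *\<^sub>R ad p 1 w + y *\<^sub>R ad p 2 w + z *\<^sub>R ad p 3 w" for X Y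
      by (rule m[OF mem(3)])
  qed
qed

end

locale qk_at = qk + fixes p :: 'a

sublocale qk_at \<subseteq> P: quat_point "g p" "Q p" n "ad p"
  by (rule quat_point_ad)

sublocale qk_at \<subseteq> P: quat_curv "g p" "ad p 1" "ad p 2" "ad p 3" n "curv A g p"
  by (rule quat_curv_at)

context qk_at begin

lemma ricci_eq: "ricci A g p v w = P.ric v w"
  by (simp add: ricci_def P.ric_def P.tr_def Let_def)

lemma nu_eq: "nu p = P.nu"
  by (simp add: reduced_scalar_curv_def scalar_curv_def ricci_eq P.nu_def P.scal_def P.tr_def Let_def)

lemma quat_weyl_eq: "quat_weyl A g Q n p X Y Z = P.Wv X Y Z"
  unfolding quat_weyl_def Let_def nu_eq P.rz_sums P.Wv_def ..

lemma quat_weyl_form_eq: "quat_weyl_form A g Q n p \<psi> u v = P.weyl.Wf \<psi> u v"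
  unfolding quat_weyl_form_def Let_def quat_weyl_eq P.weyl.Wf_def ..

end

section \<open>The connection and its smoothness\<close>

context weyl_alg begin

lemma Wf_linear:
  assumes "bilinear \<psi>" "bilinear \<phi>"
  shows "Wf (\<lambda>u v. r * \<psi> u v + \<phi> u v) u v = r * Wf \<psi> u v + Wf \<phi> u v"
proof -
  have b: "bilinear (\<lambda>u v. r * \<psi> u v + \<phi> u v)"
    unfolding bilinear_def
    by (auto intro!: linearI simp: bilinear_ladd[OF assms(1)] bilinear_radd[OF assms(1)] bilinear_lmul[OF assms(1)]
      bilinear_rmul[OF assms(1)] bilinear_ladd[OF assms(2)] bilinear_radd[OF assms(2)] bilinear_lmul[OF assms(2)]
      bilinear_rmul[OF assms(2)] algebra_simps)
  have "sharp h ((\<lambda>u v. r * \<psi> u v + \<phi> u v) x) = r *\<^sub>R sharp h (\<psi> x) + sharp h (\<phi> x)" for x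
    by (rule inner_form_ext[OF inner_h]) (simp add: h_lin sharp_eq[OF b] sharp_eq[OF assms(1)] sharp_eq[OF assms(2)])
  then show ?thesis
    by (simp add: Wf_tr linear_add[OF Wm_lin(2)] linear_cmul[OF Wm_lin(2)] tr_add tr_cmul algebra_simps)
qed

end

context qk begin

text \<open>The 2-tensor whose contraction with \<open>Z\<close> is subtracted in the component \<open>TM\<close> of the connection.\<close>

definition al :: "'a \<Rightarrow> ('e \<Rightarrow> 'e \<Rightarrow> real) \<Rightarrow> 'e \<Rightarrow> 'e \<Rightarrow> real" where
  "al p \<psi> z v = nu p * (3 / 4 * qK (ad p) \<psi> z v - 5 / 4 * \<psi> z v) + 1 / (real n + 1) * quat_weyl_form A g Q n p \<psi> z v"

lemma conn_form_eq:
  "qk_conn_form A g Q n Z \<psi> X p = (\<lambda>u v. nabla_form A g p (Z p) \<psi> u v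
     - 1 / (4 * real n - 1) * qB (g p) (ad p) (X p) (Z p) u v)"
proof -
  interpret qk_at A g Q n p ..
  show ?thesis unfolding fun_eq_iff qk_conn_form_def Let_def P.BB_sums P.BB_qB by blast
qed

lemma conn_vec_eq:
  assumes "\<psi> p \<in> compatible (g p) (Q p)"
  shows "qk_conn_vec A g Q n Z \<psi> X p
    = nabla_vec A g p (Z p) X - ((4 * real n - 1) / 4) *\<^sub>R sharp (g p) (al p (\<psi> p) (Z p))"
proof -
  interpret qk_at A g Q n p ..
  obtain a b c where "P.cpt a b c (\<psi> p)" using assms unfolding P.compatible_iff by blast
  from P.chi_proj[OF this refl, of "nu p"] show ?thesis
    unfolding qk_conn_vec_def Let_def al_def P.chi_qK by simp
qed

lemma compatible_bilinear: "\<phi> \<in> compatible (g p) (Q p) \<Longrightarrow> bilinear \<phi>"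
  and compatible_skew: "\<phi> \<in> compatible (g p) (Q p) \<Longrightarrow> \<phi> u v = - \<phi> v u"
proof -
  interpret qk_at A g Q n p ..
  show "bilinear \<phi>" if "\<phi> \<in> compatible (g p) (Q p)" using that P.cptD(1) unfolding P.compatible_iff by blast
  show "\<phi> u v = - \<phi> v u" if "\<phi> \<in> compatible (g p) (Q p)" using that P.cptD(2) unfolding P.compatible_iff by blast
qed

lemma compatible_add:
  assumes "\<psi> \<in> compatible (g p) (Q p)" "\<phi> \<in> compatible (g p) (Q p)"
  shows "(\<lambda>u v. r * \<psi> u v + \<phi> u v) \<in> compatible (g p) (Q p)"
proof -
  interpret qk_at A g Q n p ..
  show ?thesis using assms P.cpt_add[OF P.cpt_cmul] unfolding P.compatible_iff by blast
qed

lemma qB_compatible: "qB (g p) (ad p) X Z \<in> compatible (g p) (Q p)"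
proof -
  interpret qk_at A g Q n p ..
  have "qB (g p) (ad p) X Z = P.BB X Z" by (simp add: fun_eq_iff P.BB_qB)
  then show ?thesis using P.BB_cpt unfolding P.compatible_iff by metis
qed

lemma bilinear_al:
  assumes "bilinear \<psi>" shows "bilinear (al p \<psi>)"
proof -
  interpret qk_at A g Q n p ..
  note l = bilinear_ladd[OF assms] bilinear_radd[OF assms] bilinear_lmul[OF assms] bilinear_rmul[OF assms]
    bilinear_ladd[OF P.cptD(1)[OF P.weyl.Wf_cpt]] bilinear_radd[OF P.cptD(1)[OF P.weyl.Wf_cpt]]
    bilinear_lmul[OF P.cptD(1)[OF P.weyl.Wf_cpt]] bilinear_rmul[OF P.cptD(1)[OF P.weyl.Wf_cpt]]
  have "al p \<psi> = (\<lambda>z v. nu p * P.chi \<psi> z v + 1 / (real n + 1) * P.weyl.Wf \<psi> z v)"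
    by (simp add: fun_eq_iff al_def P.chi_qK quat_weyl_form_eq)
  moreover have "bilinear \<dots>"
    unfolding bilinear_def P.chi_def
    by (auto intro!: linearI simp: l P.qs algebra_simps add_divide_distrib)
  ultimately show ?thesis by simp
qed

lemma al_linear:
  assumes "bilinear \<psi>" "bilinear \<phi>"
  shows "al p (\<lambda>u v. r * \<psi> u v + \<phi> u v) z v = r * al p \<psi> z v + al p \<phi> z v"
proof -
  interpret qk_at A g Q n p ..
  show ?thesis
    unfolding al_def quat_weyl_form_eq P.weyl.Wf_linear[OF assms] qK_def sum_1_3
    by (simp add: algebra_simps)
qed

lemma sharp_al:
  assumes "bilinear \<psi>" shows "g p (sharp (g p) (al p \<psi> z)) v = al p \<psi> z v"
  by (rule inner_form_sharp[OF inner_g]) (use bilinear_al[OF assms] in \<open>simp add: bilinear_def\<close>)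

lemma g_ext: "(\<And>z. g p v z = g p w z) \<Longrightarrow> v = w" by (rule inner_form_ext[OF inner_g])

lemmas g_lin = bilinear_ladd bilinear_radd bilinear_lmul bilinear_rmul bilinear_lneg bilinear_rneg bilinear_lsub bilinear_rsub
lemma bilinear_g: "bilinear (g p)" using inner_g unfolding inner_form_def by blast

lemma smooth_dual_basis:
  assumes "c \<in> A" "open U" shows "Cinf_on (cdom c U) (\<lambda>x. sharp (G c x) (\<lambda>z. a \<bullet> z))"
proof -
  interpret loc_riem "cdom c U" "G c" by (rule loc_riem_chart[OF assms])
  show ?thesis
    by (rule sharp_Cinf[OF open_S inner_G smooth_G])
       (auto simp: lin_field_def intro!: Cinf_on_const linearI inner_add_right)
qed

text \<open>Both frame traces in the scalar curvature become coordinate traces. This shows that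
  \<open>\<nu>\<close> is smooth, which is needed before it can be differentiated.\<close>

lemma nu_chart:
  assumes c: "c \<in> A" "p \<in> fst c"
  defines "x \<equiv> snd c p"
  shows "nu p = (\<Sum>a\<in>Basis. \<Sum>b\<in>Basis. G c x (crv (G c) x b a (sharp (G c x) (\<lambda>z. a \<bullet> z))) (sharp (G c x) (\<lambda>z. b \<bullet> z)))
      / (4 * real n * (real n + 2))"
proof -
  interpret qk_at A g Q n p ..
  note L = linear_add[OF curv_linear(1)] linear_add[OF curv_linear(2)] linear_add[OF curv_linear(3)]
    linear_cmul[OF curv_linear(1)] linear_cmul[OF curv_linear(2)] linear_cmul[OF curv_linear(3)] g_lin[OF bilinear_g]
  have r: "ricci A g p v w = (\<Sum>b\<in>Basis. g p (curv A g p (from_chart A c p b) v w) (from_chart A c p (sharp (G c x) (\<lambda>z. b \<bullet> z))))" for v w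
    unfolding ricci_def Let_def x_def
    by (rule trace_chart[OF c, of "\<lambda>y y'. g p (curv A g p y v w) y'"]) (auto simp: bilinear_def L intro!: linearI)
  have "scalar_curv A g p = (\<Sum>a\<in>Basis. ricci A g p (from_chart A c p a) (from_chart A c p (sharp (G c x) (\<lambda>z. a \<bullet> z))))"
    unfolding scalar_curv_def Let_def x_def
    by (rule trace_chart[OF c, of "ricci A g p"])
       (auto simp: bilinear_def ricci_def Let_def L sum.distrib sum_distrib_left intro!: linearI)
  also have "\<dots> = (\<Sum>a\<in>Basis. \<Sum>b\<in>Basis. G c x (crv (G c) x b a (sharp (G c x) (\<lambda>z. a \<bullet> z))) (sharp (G c x) (\<lambda>z. b \<bullet> z)))"
  proof -
    have "g p (curv A g p (from_chart A c p b) (from_chart A c p a) (from_chart A c p w)) (from_chart A c p v)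
       = G c x (crv (G c) x b a w) v" for a b v w
      using g_chart[OF c, of "curv A g p (from_chart A c p b) (from_chart A c p a) (from_chart A c p w)" "from_chart A c p v"]
      by (simp add: curv_chart[OF c] c x_def)
    then show ?thesis unfolding r by simp
  qed
  finally show ?thesis by (simp add: reduced_scalar_curv_def)
qed

lemma smooth_nu:
  assumes c: "c \<in> A" and U: "open U" shows "Cinf_on (cdom c U) (fun_rep c nu)"
proof -
  interpret loc_riem "cdom c U" "G c" by (rule loc_riem_chart[OF c U])
  let ?f = "\<lambda>x. (\<Sum>a\<in>Basis. \<Sum>b\<in>Basis. G c x (crv (G c) x b a (sharp (G c x) (\<lambda>z. a \<bullet> z))) (sharp (G c x) (\<lambda>z. b \<bullet> z)))
      / (4 * real n * (real n + 2))"
  have "Cinf_on (cdom c U) ?f"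
    using n_ge_2
    by (intro Cinf_on_divide[OF open_S] Cinf_on_const Cinf_on_sum[OF open_S] bil_field_Cinf[OF open_S bil_G]
       smooth_crv smooth_dual_basis[OF c U]) auto
  then show ?thesis
  proof (rule Cinf_on_cong[OF open_S, rotated])
    fix x assume "x \<in> cdom c U"
    then obtain p where p: "p \<in> fst c" "p \<in> U" "x = snd c p" by (rule cdomE)
    show "?f x = fun_rep c nu x" unfolding p(3) fun_rep_at[OF c p(1)] nu_chart[OF c p(1)] ..
  qed
qed

text \<open>An expression free of pointwise choices: the frame sum in \<open>quat_weyl_form\<close>
  becomes a coordinate trace, and the Weyl tensor is written with \<open>crv\<close> and
  \<open>qR\<close>. It serves to prove that the vector component of the connection is
  smooth.\<close>

lemma al_chart:
  assumes J: "local_basis V J" "p \<in> V" and c: "c \<in> A" "p \<in> fst c" and \<psi>: "bilinear (\<psi> p)"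
  defines "x \<equiv> snd c p"
  defines "JJ \<equiv> \<lambda>i. erep A c (J i) x"
  defines "S \<equiv> \<lambda>a. sharp (G c x) (frep A c \<psi> x (sharp (G c x) (\<lambda>z. a \<bullet> z)))"
  shows "al p (\<psi> p) (from_chart A c p u) (from_chart A c p v)
    = fun_rep c nu x * (3 / 4 * qK JJ (frep A c \<psi> x) u v - 5 / 4 * frep A c \<psi> x u v)
    + 1 / (real n + 1) * (1 / 2 * (\<Sum>a\<in>Basis. G c x (crv (G c) x a (S a) u) v
        + fun_rep c nu x / 4 * qR (G c x) JJ a (S a) u v))"
proof -
  interpret qk_at A g Q n p ..
  let ?F = "from_chart A c p"
  have W: "g p (quat_weyl A g Q n p X Y (?F u)) (?F v) = G c x (crv (G c) x (to_chart A c p X) (to_chart A c p Y) u) v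
      + nu p / 4 * qR (G c x) JJ (to_chart A c p X) (to_chart A c p Y) u v" for X Y
  proof -
    have "g p (curv A g p X Y (?F u)) (?F v) = G c x (crv (G c) x (to_chart A c p X) (to_chart A c p Y) u) v"
      using g_chart[OF c, of "curv A g p X Y (?F u)" "?F v"] by (simp add: curv_chart[OF c] c x_def)
    then show ?thesis
      by (simp add: quat_weyl_eq P.Wv_def P.h_lin P.rz_qR qR_chart[OF J c] nu_eq c x_def JJ_def)
  qed
  have "quat_weyl_form A g Q n p (\<psi> p) (?F u) (?F v)
     = 1 / 2 * (\<Sum>b\<in>Basis. (\<lambda>y y'. P.weyl.Wm y (sharp (g p) (\<psi> p y')) (?F u) (?F v)) (frame (g p) b) (frame (g p) b))"
    by (simp add: quat_weyl_form_def Let_def quat_weyl_eq P.weyl.Wm_def)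
  also have "\<dots> = 1 / 2 * (\<Sum>a\<in>Basis. P.weyl.Wm (?F a) (sharp (g p) (\<psi> p (?F (sharp (G c x) (\<lambda>z. a \<bullet> z))))) (?F u) (?F v))"
    unfolding x_def
    by (subst trace_chart[OF c])
       (auto simp: bilinear_def P.weyl.Wm_lin linear_add[OF P.weyl.Wm_lin(2)] linear_cmul[OF P.weyl.Wm_lin(2)]
          linear_add[OF P.weyl.linear_sharp[OF \<psi>]] linear_cmul[OF P.weyl.linear_sharp[OF \<psi>]] intro!: linearI)
  also have "\<dots> = 1 / 2 * (\<Sum>a\<in>Basis. G c x (crv (G c) x a (S a) u) v + nu p / 4 * qR (G c x) JJ a (S a) u v)"
  proof -
    have "to_chart A c p (sharp (g p) (\<psi> p (?F w))) = sharp (G c x) (frep A c \<psi> x w)" for w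
      using sharp_chart[OF c, of "\<psi> p (?F w)"] \<psi> unfolding bilinear_def x_def frep_at[OF c] by simp
    then show ?thesis unfolding P.weyl.Wm_def quat_weyl_eq[symmetric] W S_def by (simp add: c)
  qed
  finally have F: "quat_weyl_form A g Q n p (\<psi> p) (?F u) (?F v) = \<dots>" .
  show ?thesis
    unfolding al_def qK_chart[where \<psi> = \<psi>, OF J c \<psi>] F by (simp add: x_def JJ_def fun_rep_at frep_at c)
qed

end

context qk begin

lemma frep_qB:
  assumes "local_basis V J" "c \<in> A" "x \<in> cdom c V"
  shows "frep A c (\<lambda>q. qB (g q) (ad q) (X q) (Z q)) x u v
    = qB (G c x) (\<lambda>i. erep A c (J i) x) (vec_rep A c X x) (vec_rep A c Z x) u v"
proof -
  from assms(3) obtain p where p: "p \<in> fst c" "p \<in> V" "x = snd c p" by (rule cdomE)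
  show ?thesis unfolding p(3) vec_rep_at[OF assms(2) p(1)] frep_at[OF assms(2) p(1), of "\<lambda>q. qB (g q) (ad q) (X q) (Z q)"]
    using qB_chart[OF assms(1) p(2) assms(2) p(1)] by (simp add: assms(2) p(1))
qed

lemma smooth_qB_form:
  assumes "open U" "smooth_vec A U X" "smooth_vec A U Z"
  shows "smooth_form A U (\<lambda>q. qB (g q) (ad q) (X q) (Z q))"
proof (rule smooth_formI, rule Cinf_on_local)
  fix c x u v assume c: "c \<in> A" and "x \<in> cdom c U"
  then obtain p where p: "p \<in> fst c" "p \<in> U" "x = snd c p" by (metis cdomE)
  obtain V J where J: "local_basis V J" "p \<in> V" "V \<subseteq> U" by (rule local_basis_exists[OF assms(1) p(2)])
  interpret qk_chart "cdom c V" "G c" "\<lambda>i. erep A c (J i)" "qrep c" n by (rule qk_chart_local[OF c J(1)])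
  note X = smooth_vecD[OF smooth_subset(1)[OF assms(2) J(3)] c] and Z = smooth_vecD[OF smooth_subset(1)[OF assms(3) J(3)] c]
  have "Cinf_on (cdom c V) (\<lambda>x. frep A c (\<lambda>q. qB (g q) (ad q) (X q) (Z q)) x u v)"
    by (rule Cinf_on_cong[OF open_S _ smooth_qB[OF X Z Cinf_on_const Cinf_on_const]])
       (simp add: frep_qB[OF J(1) c])
  then show "\<exists>T. open T \<and> x \<in> T \<and> Cinf_on T (\<lambda>x. frep A c (\<lambda>q. qB (g q) (ad q) (X q) (Z q)) x u v)"
    using open_S cdomI[OF p(1) J(2)] p(3) by blast
qed

lemma smooth_form_nabla:
  assumes "open U" "smooth_form A U \<psi>" "\<And>q. q \<in> U \<Longrightarrow> bilinear (\<psi> q)" "smooth_vec A U Z"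
  shows "smooth_form A U (\<lambda>q. nabla_form A g q (Z q) \<psi>)"
proof (rule smooth_formI)
  fix c u v assume c: "c \<in> A"
  interpret loc_riem "cdom c U" "G c" by (rule loc_riem_chart[OF c assms(1)])
  note f = nabf_field[OF smooth_form_bil_field[OF assms(2,3) c] smooth_vecD[OF assms(4) c]]
  show "Cinf_on (cdom c U) (\<lambda>x. frep A c (\<lambda>q. nabla_form A g q (Z q) \<psi>) x u v)"
    by (rule Cinf_on_cong[OF open_S _ bil_field_Cinf[OF open_S f Cinf_on_const Cinf_on_const]])
       (simp add: frep_nabla[OF assms(1-3) c])
qed

lemma smooth_conn_form:
  assumes "open U" "smooth_form A U \<psi>" "\<And>q. q \<in> U \<Longrightarrow> bilinear (\<psi> q)" "smooth_vec A U Z" "smooth_vec A U X"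
  shows "smooth_form A U (qk_conn_form A g Q n Z \<psi> X)"
proof (rule smooth_formI)
  fix c u v assume c: "c \<in> A"
  interpret loc_riem "cdom c U" "G c" by (rule loc_riem_chart[OF c assms(1)])
  have e: "frep A c (qk_conn_form A g Q n Z \<psi> X) x u v
     = frep A c (\<lambda>q. nabla_form A g q (Z q) \<psi>) x u v - 1 / (4 * real n - 1) * frep A c (\<lambda>q. qB (g q) (ad q) (X q) (Z q)) x u v" for x
    by (simp add: frep_def form_rep_def Let_def conn_form_eq)
  have s: "Cinf_on (cdom c U) (\<lambda>x. frep A c \<phi> x u v)" if "smooth_form A U \<phi>" for \<phi>
    using that c unfolding smooth_form_def frep_def cdom_def by blast
  show "Cinf_on (cdom c U) (\<lambda>x. frep A c (qk_conn_form A g Q n Z \<psi> X) x u v)"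
    unfolding e
    by (intro Cinf_intros open_S s smooth_form_nabla smooth_qB_form assms)
qed

lemma nabla_form_compatible:
  assumes U: "open U" "p \<in> U" and \<psi>: "smooth_form A U \<psi>" "\<And>q. q \<in> U \<Longrightarrow> \<psi> q \<in> compatible (g q) (Q q)"
  shows "nabla_form A g p w \<psi> \<in> compatible (g p) (Q p)"
proof -
  obtain V J where J: "local_basis V J" "p \<in> V" "V \<subseteq> U" by (rule local_basis_exists[OF U])
  interpret qk_chart "cdom (bc p) V" "G (bc p)" "\<lambda>i. erep A (bc p) (J i)" "qrep (bc p)" n
    by (rule qk_chart_local[OF bc_in J(1)])
  have bil: "bil_field (cdom (bc p) V) (frep A (bc p) \<psi>)"
    by (rule smooth_form_bil_field[OF smooth_subset(2)[OF \<psi>(1) J(3)] _ bc_in]) (use \<psi>(2) J(3) compatible_bilinear in blast)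
  have "frep A (bc p) \<psi> y \<in> compatible (G (bc p) y) (qrep (bc p) y)" if y: "y \<in> cdom (bc p) V" for y
  proof -
    obtain q where q: "q \<in> fst (bc p)" "q \<in> V" "y = snd (bc p) q" using y by (rule cdomE)
    interpret T: quat_point "g q" "Q q" n "\<lambda>i. J i q" by (rule quat_point_local[OF J(1) q(2)])
    interpret Y: quat_point "G (bc p) y" "qrep (bc p) y" n "\<lambda>i. erep A (bc p) (J i) y" by (rule qp[OF y])
    obtain a b c where d: "T.cpt a b c (\<psi> q)" using \<psi>(2)[of q] q(2) J(3) unfolding T.compatible_iff by blast
    have "bilinear (frep A (bc p) \<psi> y)" using bil y unfolding bil_field_def by blast
    then have "Y.cpt a b c (frep A (bc p) \<psi> y)"
    proof (rule Y.cptI)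
      show "frep A (bc p) \<psi> y u v = - frep A (bc p) \<psi> y v u" for u v
        unfolding q(3) frep_at[OF bc_in q(1)] by (rule T.cptD(2)[OF d])
    qed (simp_all add: q(3) frep_at[OF bc_in q(1)] erep_at[OF bc_in q(1)] from_to[OF bc_in q(1)] T.cptD(3-5)[OF d])
    then show ?thesis unfolding Y.compatible_iff by blast
  qed
  from nabf_compatible[OF cdomI[OF bc_dom J(2)] bil this, of w]
  have "nabf (G (bc p)) (frep A (bc p) \<psi>) (snd (bc p) p) w \<in> compatible (g p) (Q p)"
    unfolding G_base qrep_base .
  moreover have "nabla_form A g p w \<psi> = nabf (G (bc p)) (frep A (bc p) \<psi>) (snd (bc p) p) w"
    by (simp add: fun_eq_iff nabla_form_base)
  ultimately show ?thesis by simp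
qed

lemma conn_form_compatible:
  assumes U: "open U" "p \<in> U" and \<psi>: "smooth_form A U \<psi>" "\<And>q. q \<in> U \<Longrightarrow> \<psi> q \<in> compatible (g q) (Q q)"
  shows "qk_conn_form A g Q n Z \<psi> X p \<in> compatible (g p) (Q p)"
proof -
  have e: "qk_conn_form A g Q n Z \<psi> X p
     = (\<lambda>u v. (- 1 / (4 * real n - 1)) * qB (g p) (ad p) (X p) (Z p) u v + nabla_form A g p (Z p) \<psi> u v)"
    by (simp add: conn_form_eq)
  show ?thesis unfolding e by (rule compatible_add[OF qB_compatible nabla_form_compatible[OF U \<psi>]])
qed

lemma smooth_al_vec:
  assumes U: "open U" and \<psi>: "smooth_form A U \<psi>" "\<And>q. q \<in> U \<Longrightarrow> bilinear (\<psi> q)" and Z: "smooth_vec A U Z"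
  shows "smooth_vec A U (\<lambda>q. sharp (g q) (al q (\<psi> q) (Z q)))"
  unfolding smooth_vec_iff
proof (intro ballI Cinf_on_local)
  fix c x assume c: "c \<in> A" and "x \<in> cdom c U"
  then obtain p where p: "p \<in> fst c" "p \<in> U" "x = snd c p" by (metis cdomE)
  obtain V J where J: "local_basis V J" "p \<in> V" "V \<subseteq> U" by (rule local_basis_exists[OF U p(2)])
  have V: "open V" using J(1) unfolding local_basis_def by blast
  interpret qk_chart "cdom c V" "G c" "\<lambda>i. erep A c (J i)" "qrep c" n by (rule qk_chart_local[OF c J(1)])
  note Zc = smooth_vecD[OF smooth_subset(1)[OF Z J(3)] c]
  have b: "bil_field (cdom c V) (frep A c \<psi>)"
    by (rule smooth_form_bil_field[OF smooth_subset(2)[OF \<psi>(1) J(3)] _ c]) (use \<psi>(2) J(3) in blast)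
  define S where "S a x = sharp (G c x) (frep A c \<psi> x (sharp (G c x) (\<lambda>z. a \<bullet> z)))" for a x
  have S: "Cinf_on (cdom c V) (S a)" for a
    unfolding S_def by (rule sharp_Cinf[OF open_S inner_G smooth_G bil_field_right_var[OF open_S b smooth_dual_basis[OF c V]]])
  \<comment> \<open>The formula of \<open>al_chart\<close> with \<open>Z\<close> inserted; its
    smoothness can be read off term by term.\<close>
  define \<alpha> where "\<alpha> x v = fun_rep c nu x * (3 / 4 * qK (\<lambda>i. erep A c (J i) x) (frep A c \<psi> x) (vec_rep A c Z x) v - 5 / 4 * frep A c \<psi> x (vec_rep A c Z x) v)
    + 1 / (real n + 1) * (1 / 2 * (\<Sum>a\<in>Basis. G c x (crv (G c) x a (S a x) (vec_rep A c Z x)) v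
        + fun_rep c nu x / 4 * qR (G c x) (\<lambda>i. erep A c (J i) x) a (S a x) (vec_rep A c Z x) v))" for x v
  have \<alpha>: "\<alpha> (snd c q) v = al q (\<psi> q) (Z q) (from_chart A c q v)" if "q \<in> V" "q \<in> fst c" for q v
    using al_chart[OF J(1) that(1) c that(2), where \<psi> = \<psi> and u = "to_chart A c q (Z q)" and v = v] \<psi>(2) J(3) that
    unfolding \<alpha>_def S_def vec_rep_at[OF c that(2)] by (auto simp: c)
  have lin: "linear (al q (\<psi> q) (Z q))" if "q \<in> V" for q
    using bilinear_al[of "\<psi> q" q] \<psi>(2) J(3) that unfolding bilinear_def by blast
  have "lin_field (cdom c V) \<alpha>"
    unfolding lin_field_def
  proof (intro conjI ballI allI)
    fix y assume "y \<in> cdom c V"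
    then obtain q where q: "q \<in> fst c" "q \<in> V" "y = snd c q" by (rule cdomE)
    have "\<alpha> y = (\<lambda>v. al q (\<psi> q) (Z q) (from_chart A c q v))" by (simp add: fun_eq_iff q(3) \<alpha> q(1,2))
    then show "linear (\<alpha> y)" using linear_compose[OF linear_from[OF c q(1)] lin[OF q(2)]] by (simp add: o_def)
  next
    show "Cinf_on (cdom c V) (\<lambda>x. \<alpha> x v)" for v
      unfolding \<alpha>_def
      by (intro Cinf_intros open_S smooth_nu[OF c V] bil_field_Cinf[OF open_S b] bil_field_Cinf[OF open_S bil_qK[OF b]]
         smooth_G_fields smooth_crv smooth_qR Cinf_on_divide S Zc) auto
  qed
  from sharp_Cinf[OF open_S inner_G smooth_G this]
  have "Cinf_on (cdom c V) (vec_rep A c (\<lambda>q. sharp (g q) (al q (\<psi> q) (Z q))))"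
  proof (rule Cinf_on_cong[OF open_S, rotated])
    fix y assume "y \<in> cdom c V"
    then obtain q where q: "q \<in> fst c" "q \<in> V" "y = snd c q" by (rule cdomE)
    show "sharp (G c y) (\<alpha> y) = vec_rep A c (\<lambda>q. sharp (g q) (al q (\<psi> q) (Z q))) y"
      unfolding q(3) vec_rep_at[OF c q(1)] sharp_chart[OF c q(1) lin[OF q(2)]] \<alpha>[OF q(2,1), symmetric] ..
  qed
  then show "\<exists>T. open T \<and> x \<in> T \<and> Cinf_on T (vec_rep A c (\<lambda>q. sharp (g q) (al q (\<psi> q) (Z q))))"
    using open_S cdomI[OF p(1) J(2)] p(3) by blast
qed

lemma smooth_vec_add:
  assumes "open U" "smooth_vec A U X" "smooth_vec A U Y" shows "smooth_vec A U (\<lambda>q. r *\<^sub>R X q + Y q)"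
  unfolding smooth_vec_iff
proof
  fix c assume c: "c \<in> A"
  show "Cinf_on (cdom c U) (vec_rep A c (\<lambda>q. r *\<^sub>R X q + Y q))"
  proof (rule Cinf_on_cong[OF open_cdom[OF c assms(1)]])
    show "Cinf_on (cdom c U) (\<lambda>x. r *\<^sub>R vec_rep A c X x + vec_rep A c Y x)"
      by (intro Cinf_intros open_cdom c assms smooth_vecD)
    fix x assume "x \<in> cdom c U"
    then obtain p where p: "p \<in> fst c" "p \<in> U" "x = snd c p" by (rule cdomE)
    show "r *\<^sub>R vec_rep A c X x + vec_rep A c Y x = vec_rep A c (\<lambda>q. r *\<^sub>R X q + Y q) x"
      unfolding p(3) vec_rep_at[OF c p(1)]
      by (simp add: linear_add[OF linear_to[OF c p(1)]] linear_cmul[OF linear_to[OF c p(1)]])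
  qed
qed

lemma smooth_vec_cong:
  assumes "open U" "smooth_vec A U X" "\<And>q. q \<in> U \<Longrightarrow> X q = Y q" shows "smooth_vec A U Y"
  unfolding smooth_vec_iff
proof
  fix c assume c: "c \<in> A"
  show "Cinf_on (cdom c U) (vec_rep A c Y)"
    by (rule Cinf_on_cong[OF open_cdom[OF c assms(1)] _ smooth_vecD[OF assms(2) c]])
       (use assms(3) cdom_iff[OF c] in \<open>auto simp: vec_rep_def Let_def\<close>)
qed

lemma smooth_conn_vec:
  assumes U: "open U" and \<psi>: "smooth_form A U \<psi>" "\<And>q. q \<in> U \<Longrightarrow> \<psi> q \<in> compatible (g q) (Q q)"
    and Z: "smooth_vec A U Z" and X: "smooth_vec A U X"
  shows "smooth_vec A U (qk_conn_vec A g Q n Z \<psi> X)"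
proof (rule smooth_vec_cong[OF U])
  show "smooth_vec A U (\<lambda>q. (- ((4 * real n - 1) / 4)) *\<^sub>R sharp (g q) (al q (\<psi> q) (Z q)) + nabla_vec A g q (Z q) X)"
    by (rule smooth_vec_add[OF U smooth_al_vec[OF U \<psi>(1) compatible_bilinear[OF \<psi>(2)] Z] smooth_nabla_vec[OF U X Z]])
  show "(- ((4 * real n - 1) / 4)) *\<^sub>R sharp (g q) (al q (\<psi> q) (Z q)) + nabla_vec A g q (Z q) X = qk_conn_vec A g Q n Z \<psi> X q"
    if "q \<in> U" for q
    using conn_vec_eq[of \<psi> q Z X, OF \<psi>(2)[OF that]] by simp
qed

end

context qk begin

section \<open>The connection property\<close>

lemma nabla_form_cong:
  assumes "open U" "p \<in> U" "\<And>q. q \<in> U \<Longrightarrow> \<psi> q = \<phi> q"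
  shows "nabla_form A g p w \<psi> u v = nabla_form A g p w \<phi> u v"
proof -
  interpret loc_riem "cdom (bc p) U" "G (bc p)" by (rule loc_riem_chart[OF bc_in assms(1)])
  show ?thesis unfolding nabla_form_base
    by (rule nabf_cong[OF cdomI[OF bc_dom assms(2)]])
       (use assms(3) cdom_iff[OF bc_in] in \<open>auto simp: frep_def form_rep_def Let_def\<close>)
qed

lemma nabla_vec_cong:
  assumes "open U" "p \<in> U" "\<And>q. q \<in> U \<Longrightarrow> X q = Y q"
  shows "nabla_vec A g p w X = nabla_vec A g p w Y"
proof -
  interpret loc_riem "cdom (bc p) U" "G (bc p)" by (rule loc_riem_chart[OF bc_in assms(1)])
  show ?thesis unfolding nabla_vec_base
    by (rule nab_cong[OF cdomI[OF bc_dom assms(2)]])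
       (use assms(3) cdom_iff[OF bc_in] in \<open>auto simp: vec_rep_def Let_def\<close>)
qed

text \<open>The combination \<open>f \<psi> + \<phi>\<close> covers sums (\<open>f = 1\<close>),
  multiples (\<open>\<phi> = 0\<close>) and the derivative of the zero form at once.\<close>

lemma nabla_form_leibniz:
  assumes U: "p \<in> U" "smooth_fun A U f" "smooth_form A U \<psi>" "smooth_form A U \<phi>"
  shows "nabla_form A g p w (\<lambda>q u v. f q * \<psi> q u v + \<phi> q u v) u v
    = f p * nabla_form A g p w \<psi> u v + d_fun A p w f * \<psi> p u v + nabla_form A g p w \<phi> u v"
proof -
  have x: "base_pt A p \<in> snd (bc p) ` (fst (bc p) \<inter> U)" using U(1) bc_dom unfolding base_pt_def by blast
  have D: "fun_rep (bc p) f differentiable at (base_pt A p)" "form_rep A (bc p) \<psi> u v differentiable at (base_pt A p)"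
    "form_rep A (bc p) \<phi> u v differentiable at (base_pt A p)"
    using U(2-4) bc_in Cinf_onD[OF _ x] unfolding smooth_fun_def smooth_form_def by blast+
  have at: "fun_rep (bc p) f (base_pt A p) = f p" "form_rep A (bc p) \<psi> u v (base_pt A p) = \<psi> p u v"
    by (simp_all add: base_pt_def fun_rep_at form_rep_def Let_def bc_in bc_dom)
  have "form_rep A (bc p) (\<lambda>q u v. f q * \<psi> q u v + \<phi> q u v) u v
     = (\<lambda>x. fun_rep (bc p) f x * form_rep A (bc p) \<psi> u v x + form_rep A (bc p) \<phi> u v x)"
    by (simp add: fun_eq_iff form_rep_def fun_rep_def Let_def)
  then have "d_form A p w (\<lambda>q u v. f q * \<psi> q u v + \<phi> q u v) u v
    = f p * d_form A p w \<psi> u v + d_fun A p w f * \<psi> p u v + d_form A p w \<phi> u v"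
    by (simp add: d_form_def d_fun_def DD_add[OF differentiable_mult[OF D(1,2)] D(3)] DD_mult[OF D(1,2)] at)
  then show ?thesis unfolding nabla_form_def by (simp add: algebra_simps)
qed

lemma nabla_vec_leibniz:
  assumes U: "open U" "p \<in> U" "smooth_fun A U f" "smooth_vec A U X" "smooth_vec A U Y"
  shows "nabla_vec A g p w (\<lambda>q. f q *\<^sub>R X q + Y q)
    = f p *\<^sub>R nabla_vec A g p w X + d_fun A p w f *\<^sub>R X p + nabla_vec A g p w Y"
proof -
  let ?b = "bc p"
  interpret loc_riem "cdom ?b U" "G ?b" by (rule loc_riem_chart[OF bc_in U(1)])
  note x = cdomI[OF bc_dom U(2)]
  have s: "Cinf_on (cdom ?b U) (fun_rep ?b f)" "Cinf_on (cdom ?b U) (vec_rep A ?b X)" "Cinf_on (cdom ?b U) (vec_rep A ?b Y)"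
    using U(3-5) bc_in unfolding smooth_fun_iff smooth_vec_iff by blast+
  have "nab (G ?b) (vec_rep A ?b (\<lambda>q. f q *\<^sub>R X q + Y q)) (snd ?b p) w
     = nab (G ?b) (\<lambda>y. fun_rep ?b f y *\<^sub>R vec_rep A ?b X y + vec_rep A ?b Y y) (snd ?b p) w"
  proof (rule nab_cong[OF x])
    fix y assume "y \<in> cdom ?b U"
    then obtain q where q: "q \<in> fst ?b" "q \<in> U" "y = snd ?b q" by (rule cdomE)
    show "vec_rep A ?b (\<lambda>q. f q *\<^sub>R X q + Y q) y = fun_rep ?b f y *\<^sub>R vec_rep A ?b X y + vec_rep A ?b Y y"
      unfolding q(3) by (simp add: vec_rep_at fun_rep_at bc_in q(1) linear_add[OF linear_to] linear_cmul[OF linear_to])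
  qed
  then show ?thesis
    unfolding nabla_vec_base nab_add[OF x Cinf_on_scaleR[OF open_S s(1,2)] s(3)] nab_scaleR[OF x s(1,2)]
    by (simp add: d_fun_def base_pt_def fun_rep_at vec_rep_at bc_in bc_dom)
qed

lemma qB_linear:
  "qB (g p) (ad p) (r *\<^sub>R X + Y) Z u v = r * qB (g p) (ad p) X Z u v + qB (g p) (ad p) Y Z u v"
  "qB (g p) (ad p) X (r *\<^sub>R Y + Z) u v = r * qB (g p) (ad p) X Y u v + qB (g p) (ad p) X Z u v"
proof -
  interpret qk_at A g Q n p ..
  show "qB (g p) (ad p) (r *\<^sub>R X + Y) Z u v = r * qB (g p) (ad p) X Z u v + qB (g p) (ad p) Y Z u v"
    "qB (g p) (ad p) X (r *\<^sub>R Y + Z) u v = r * qB (g p) (ad p) X Y u v + qB (g p) (ad p) X Z u v"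
    unfolding P.BB_qB[symmetric] by (simp_all add: P.BB_lin)
qed

lemma sharp_al_linear:
  assumes "bilinear \<psi>" "bilinear \<phi>"
  shows "sharp (g p) (al p (\<lambda>u v. r * \<psi> u v + \<phi> u v) z) = r *\<^sub>R sharp (g p) (al p \<psi> z) + sharp (g p) (al p \<phi> z)"
    "sharp (g p) (al p \<psi> (r *\<^sub>R z + y)) = r *\<^sub>R sharp (g p) (al p \<psi> z) + sharp (g p) (al p \<psi> y)"
proof -
  have b: "bilinear (\<lambda>u v. r * \<psi> u v + \<phi> u v)"
    unfolding bilinear_def
    by (auto intro!: linearI simp: g_lin[OF assms(1)] g_lin[OF assms(2)] algebra_simps)
  show "sharp (g p) (al p (\<lambda>u v. r * \<psi> u v + \<phi> u v) z) = r *\<^sub>R sharp (g p) (al p \<psi> z) + sharp (g p) (al p \<phi> z)"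
    by (rule g_ext[of p]) (simp add: g_lin[OF bilinear_g] sharp_al[OF b] sharp_al[OF assms(1)] sharp_al[OF assms(2)] al_linear[OF assms])
  show "sharp (g p) (al p \<psi> (r *\<^sub>R z + y)) = r *\<^sub>R sharp (g p) (al p \<psi> z) + sharp (g p) (al p \<psi> y)"
    by (rule g_ext[of p]) (simp add: g_lin[OF bilinear_g] sharp_al[OF assms(1)] g_lin[OF bilinear_al[OF assms(1)]])
qed

lemma nabla_linear:
  assumes U: "open U" "p \<in> U"
  shows "smooth_form A U \<psi> \<Longrightarrow> (\<And>q. q \<in> U \<Longrightarrow> bilinear (\<psi> q)) \<Longrightarrow> linear (\<lambda>w. nabla_form A g p w \<psi> u v)"
    "smooth_vec A U X \<Longrightarrow> linear (\<lambda>w. nabla_vec A g p w X)"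
proof -
  interpret loc_riem "cdom (bc p) U" "G (bc p)" by (rule loc_riem_chart[OF bc_in U(1)])
  note x = cdomI[OF bc_dom U(2)]
  show "linear (\<lambda>w. nabla_form A g p w \<psi> u v)" if "smooth_form A U \<psi>" "\<And>q. q \<in> U \<Longrightarrow> bilinear (\<psi> q)"
    unfolding nabla_form_base using nabf_lin(1)[OF smooth_form_bil_field[OF that bc_in]] x unfolding lin_field_def by blast
  show "linear (\<lambda>w. nabla_vec A g p w X)" if "smooth_vec A U X"
    unfolding nabla_vec_base using lin_nab[OF smooth_vecD[OF that bc_in]] x unfolding lin_field_def by blast
qed

lemma sections_iff: "(\<psi>, X) \<in> qk_sections A g Q U \<longleftrightarrow>
    smooth_form A U \<psi> \<and> (\<forall>p\<in>U. \<psi> p \<in> compatible (g p) (Q p)) \<and> smooth_vec A U X"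
  by (simp add: qk_sections_def)

lemma conn_leibniz:
  assumes U: "open U" "p \<in> U" and f: "smooth_fun A U f"
    and \<psi>: "smooth_form A U \<psi>" "\<And>q. q \<in> U \<Longrightarrow> \<psi> q \<in> compatible (g q) (Q q)" and X: "smooth_vec A U X"
    and \<phi>: "smooth_form A U \<phi>" "\<And>q. q \<in> U \<Longrightarrow> \<phi> q \<in> compatible (g q) (Q q)" and Y: "smooth_vec A U Y"
  shows "qk_conn_form A g Q n Z (\<lambda>q u v. f q * \<psi> q u v + \<phi> q u v) (\<lambda>q. f q *\<^sub>R X q + Y q) p u v
      = f p * qk_conn_form A g Q n Z \<psi> X p u v + d_fun A p (Z p) f * \<psi> p u v + qk_conn_form A g Q n Z \<phi> Y p u v"
    and "qk_conn_vec A g Q n Z (\<lambda>q u v. f q * \<psi> q u v + \<phi> q u v) (\<lambda>q. f q *\<^sub>R X q + Y q) p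
      = f p *\<^sub>R qk_conn_vec A g Q n Z \<psi> X p + d_fun A p (Z p) f *\<^sub>R X p + qk_conn_vec A g Q n Z \<phi> Y p"
proof -
  show "qk_conn_form A g Q n Z (\<lambda>q u v. f q * \<psi> q u v + \<phi> q u v) (\<lambda>q. f q *\<^sub>R X q + Y q) p u v
      = f p * qk_conn_form A g Q n Z \<psi> X p u v + d_fun A p (Z p) f * \<psi> p u v + qk_conn_form A g Q n Z \<phi> Y p u v"
    unfolding conn_form_eq nabla_form_leibniz[OF U(2) f \<psi>(1) \<phi>(1)] qB_linear
    by (simp add: algebra_simps add_divide_distrib)
  note c = \<psi>(2)[OF U(2)] \<phi>(2)[OF U(2)]
  show "qk_conn_vec A g Q n Z (\<lambda>q u v. f q * \<psi> q u v + \<phi> q u v) (\<lambda>q. f q *\<^sub>R X q + Y q) p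
      = f p *\<^sub>R qk_conn_vec A g Q n Z \<psi> X p + d_fun A p (Z p) f *\<^sub>R X p + qk_conn_vec A g Q n Z \<phi> Y p"
    unfolding conn_vec_eq[of \<psi>, OF c(1)] conn_vec_eq[of \<phi>, OF c(2)] nabla_vec_leibniz[OF U f X Y]
      conn_vec_eq[of "\<lambda>q u v. f q * \<psi> q u v + \<phi> q u v" p, OF compatible_add[OF c]]
      sharp_al_linear(1)[OF compatible_bilinear[OF c(1)] compatible_bilinear[OF c(2)]]
    by (simp add: algebra_simps)
qed

lemma conn_tensorial:
  assumes U: "open U" "p \<in> U"
    and \<psi>: "smooth_form A U \<psi>" "\<And>q. q \<in> U \<Longrightarrow> \<psi> q \<in> compatible (g q) (Q q)" and X: "smooth_vec A U X"
  shows "qk_conn_form A g Q n (\<lambda>q. f q *\<^sub>R Y q + Z q) \<psi> X p u v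
      = f p * qk_conn_form A g Q n Y \<psi> X p u v + qk_conn_form A g Q n Z \<psi> X p u v"
    and "qk_conn_vec A g Q n (\<lambda>q. f q *\<^sub>R Y q + Z q) \<psi> X p
      = f p *\<^sub>R qk_conn_vec A g Q n Y \<psi> X p + qk_conn_vec A g Q n Z \<psi> X p"
proof -
  have lf: "linear (\<lambda>w. nabla_form A g p w \<psi> u v)" by (rule nabla_linear(1)[OF U \<psi>(1) compatible_bilinear[OF \<psi>(2)]])
  note lv = nabla_linear(2)[OF U X]
  show "qk_conn_form A g Q n (\<lambda>q. f q *\<^sub>R Y q + Z q) \<psi> X p u v
      = f p * qk_conn_form A g Q n Y \<psi> X p u v + qk_conn_form A g Q n Z \<psi> X p u v"
    unfolding conn_form_eq qB_linear linear_add[OF lf] linear_cmul[OF lf]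
    by (simp add: algebra_simps add_divide_distrib)
  note c = \<psi>(2)[OF U(2)]
  show "qk_conn_vec A g Q n (\<lambda>q. f q *\<^sub>R Y q + Z q) \<psi> X p
      = f p *\<^sub>R qk_conn_vec A g Q n Y \<psi> X p + qk_conn_vec A g Q n Z \<psi> X p"
    unfolding conn_vec_eq[of \<psi>, OF c] linear_add[OF lv] linear_cmul[OF lv]
      sharp_al_linear(2)[OF compatible_bilinear[OF c] compatible_bilinear[OF c]]
    by (simp add: algebra_simps)
qed

lemma smooth_const: "open U \<Longrightarrow> smooth_fun A U (\<lambda>_. r)"
  unfolding smooth_fun_def fun_rep_def by (simp add: Cinf_on_const)

lemma d_fun_const: "d_fun A p w (\<lambda>_. r) = 0"
  unfolding d_fun_def fun_rep_def by simp

lemma zero_section: "open U \<Longrightarrow> ((\<lambda>p u v. 0), (\<lambda>p. 0)) \<in> qk_sections A g Q U"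
  unfolding sections_iff
proof (intro conjI ballI)
  assume U: "open U"
  show "smooth_form A U (\<lambda>p u v. 0)" unfolding smooth_form_def form_rep_def Let_def by (simp add: Cinf_on_const)
  show "(\<lambda>u v. 0) \<in> compatible (g p) (Q p)" for p
  proof -
    interpret qk_at A g Q n p ..
    have "P.cpt 0 0 0 (\<lambda>u v. 0)" by (rule P.cptI) (auto simp: bilinear_def intro!: linearI)
    then show ?thesis unfolding P.compatible_iff by blast
  qed
  show "smooth_vec A U (\<lambda>p. 0)" unfolding smooth_vec_iff
  proof
    fix c assume c: "c \<in> A"
    show "Cinf_on (cdom c U) (vec_rep A c (\<lambda>p. 0))"
    proof (rule Cinf_on_cong[OF open_cdom[OF c U] _ Cinf_on_const])
      fix x assume "x \<in> cdom c U"
      then obtain p where p: "p \<in> fst c" "p \<in> U" "x = snd c p" by (rule cdomE)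
      show "0 = vec_rep A c (\<lambda>p. 0) x" unfolding p(3) vec_rep_at[OF c p(1)] linear_0[OF linear_to[OF c p(1)]] ..
    qed
  qed
qed

lemma connection_qk: "connection A (qk_sections A g Q) (qk_connection A g Q n)"
  unfolding connection_def
proof (intro allI impI conjI ballI)
  fix U :: "'a set" and Y Z :: "'a \<Rightarrow> 'e" and s t
  assume U: "open U" and s: "s \<in> qk_sections A g Q U" "t \<in> qk_sections A g Q U"
    and YZ: "\<forall>p\<in>U. Y p = Z p" and st: "sec_eq_on U s t"
  obtain \<psi> X \<phi> V where e: "s = (\<psi>, X)" "t = (\<phi>, V)" by (metis surj_pair)
  have st': "\<psi> q = \<phi> q" "X q = V q" if "q \<in> U" for q using st that unfolding e sec_eq_on_def by auto
  show "sec_eq_on U (qk_connection A g Q n Y s) (qk_connection A g Q n Z t)"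
    unfolding sec_eq_on_def
  proof (intro ballI conjI)
    fix p assume p: "p \<in> U"
    have "qk_conn_form A g Q n Y \<psi> X p u v = qk_conn_form A g Q n Z \<phi> V p u v" for u v
      using nabla_form_cong[OF U p st'(1)] YZ p st'(2)[OF p] by (simp add: conn_form_eq)
    then show "fst (qk_connection A g Q n Y s) p = fst (qk_connection A g Q n Z t) p"
      by (simp add: e qk_connection_def fun_eq_iff)
    show "snd (qk_connection A g Q n Y s) p = snd (qk_connection A g Q n Z t) p"
      using nabla_vec_cong[OF U p st'(2)] YZ p st'(1)[OF p] by (simp add: e qk_connection_def qk_conn_vec_def)
  qed
next
  fix U :: "'a set" and Z :: "'a \<Rightarrow> 'e" and s
  assume U: "open U" and s: "s \<in> qk_sections A g Q U" and Z: "smooth_vec A U Z"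
  obtain \<psi> X where e: "s = (\<psi>, X)" by (metis surj_pair)
  have h: "smooth_form A U \<psi>" "\<And>q. q \<in> U \<Longrightarrow> \<psi> q \<in> compatible (g q) (Q q)" "smooth_vec A U X"
    using s unfolding e sections_iff by blast+
  show "qk_connection A g Q n Z s \<in> qk_sections A g Q U"
    unfolding e qk_connection_def prod.case sections_iff
    using smooth_conn_form[OF U h(1) compatible_bilinear[OF h(2)] Z h(3)] conn_form_compatible[OF U _ h(1,2)]
      smooth_conn_vec[OF U h(1,2) Z h(3)] by blast
next
  fix U :: "'a set" and Y Z :: "'a \<Rightarrow> 'e" and f s
  assume U: "open U" and s: "s \<in> qk_sections A g Q U"
  obtain \<psi> X where e: "s = (\<psi>, X)" by (metis surj_pair)
  have h: "smooth_form A U \<psi>" "\<And>q. q \<in> U \<Longrightarrow> \<psi> q \<in> compatible (g q) (Q q)" "smooth_vec A U X"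
    using s unfolding e sections_iff by blast+
  show "sec_eq_on U (qk_connection A g Q n (\<lambda>p. f p *\<^sub>R Y p + Z p) s)
      (sec_add (sec_scale f (qk_connection A g Q n Y s)) (qk_connection A g Q n Z s))"
    unfolding sec_eq_on_def e
    by (simp add: qk_connection_def sec_add_def sec_scale_def fun_eq_iff conn_tensorial[OF U _ h])
next
  fix U :: "'a set" and Z :: "'a \<Rightarrow> 'e" and s t
  assume U: "open U" and s: "s \<in> qk_sections A g Q U" "t \<in> qk_sections A g Q U"
  obtain \<psi> X \<phi> V where e: "s = (\<psi>, X)" "t = (\<phi>, V)" by (metis surj_pair)
  have h: "smooth_form A U \<psi>" "\<And>q. q \<in> U \<Longrightarrow> \<psi> q \<in> compatible (g q) (Q q)" "smooth_vec A U X"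
    and k: "smooth_form A U \<phi>" "\<And>q. q \<in> U \<Longrightarrow> \<phi> q \<in> compatible (g q) (Q q)" "smooth_vec A U V"
    using s unfolding e sections_iff by blast+
  note l = conn_leibniz[OF U _ smooth_const[OF U, of 1] h k]
  show "sec_eq_on U (qk_connection A g Q n Z (sec_add s t)) (sec_add (qk_connection A g Q n Z s) (qk_connection A g Q n Z t))"
    unfolding sec_eq_on_def e
    using l[of _ Z] by (simp add: qk_connection_def sec_add_def fun_eq_iff d_fun_const)
next
  fix U :: "'a set" and Z :: "'a \<Rightarrow> 'e" and f s
  assume U: "open U" and s: "s \<in> qk_sections A g Q U" and f: "smooth_fun A U f"
  obtain \<psi> X where e: "s = (\<psi>, X)" by (metis surj_pair)
  have h: "smooth_form A U \<psi>" "\<And>q. q \<in> U \<Longrightarrow> \<psi> q \<in> compatible (g q) (Q q)" "smooth_vec A U X"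
    and k: "smooth_form A U (\<lambda>p u v. 0)" "\<And>q. q \<in> U \<Longrightarrow> (\<lambda>u v. 0) \<in> compatible (g q) (Q q)" "smooth_vec A U (\<lambda>p. 0)"
    using s zero_section[OF U] unfolding e sections_iff by blast+
  note l = conn_leibniz[OF U _ f h k] conn_leibniz[OF U _ smooth_const[OF U, of 1] k k]
  \<comment> \<open>The Leibniz rule for \<open>1 * 0 + 0\<close> says that the derivative of the
    zero section equals its own double.\<close>
  have z: "qk_conn_form A g Q n Z (\<lambda>p u v. 0) (\<lambda>p. 0) p u v = 0" "qk_conn_vec A g Q n Z (\<lambda>p u v. 0) (\<lambda>p. 0) p = 0" if "p \<in> U" for p u v
    using l(3,4)[OF that, of Z] by (simp_all add: d_fun_const)
  show "sec_eq_on U (qk_connection A g Q n Z (sec_scale f s))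
      (sec_add (sec_scale f (qk_connection A g Q n Z s)) (sec_scale (\<lambda>p. d_fun A p (Z p) f) s))"
    unfolding sec_eq_on_def e
    using l(1,2)[of _ Z] by (simp add: qk_connection_def sec_add_def sec_scale_def fun_eq_iff z)
qed

end

context qk begin

section \<open>Exterior derivative and codifferential\<close>

lemma christoffel_sym: "christoffel A g p u v = christoffel A g p v u"
proof -
  interpret loc_riem "cdom (bc p) UNIV" "G (bc p)" by (rule loc_riem_chart[OF bc_in open_UNIV])
  show ?thesis unfolding christoffel_chr base_pt_def by (rule chr_sym[OF cdomI[OF bc_dom UNIV_I]])
qed

text \<open>The Christoffel symbols are symmetric, so for a skew form their contributions cancel in
  pairs.\<close>

lemma ext_deriv_nabla:
  assumes "\<And>u v. \<psi> p u v = - \<psi> p v u"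
  shows "ext_deriv A \<psi> p u v w = nabla_form A g p u \<psi> v w - nabla_form A g p v \<psi> u w + nabla_form A g p w \<psi> u v"
proof -
  have "\<psi> p (christoffel A g p w u) v = - \<psi> p v (christoffel A g p u w)"
    unfolding christoffel_sym[of p w u] by (rule assms)
  then show ?thesis
    unfolding ext_deriv_def nabla_form_def christoffel_sym[of p v u] christoffel_sym[of p w v] by simp
qed

lemma nabla_form_bilinear:
  assumes U: "open U" "p \<in> U" and \<psi>: "smooth_form A U \<psi>" "\<And>q. q \<in> U \<Longrightarrow> bilinear (\<psi> q)"
  shows "bilinear (nabla_form A g p w \<psi>)"
proof -
  interpret loc_riem "cdom (bc p) U" "G (bc p)" by (rule loc_riem_chart[OF bc_in U(1)])
  have "nabla_form A g p w \<psi> = (\<lambda>u v. nabf (G (bc p)) (frep A (bc p) \<psi>) (snd (bc p) p) w u v)"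
    by (simp add: fun_eq_iff nabla_form_base)
  then show ?thesis
    using nabf_lin(2)[OF smooth_form_bil_field[OF \<psi> bc_in]] cdomI[OF bc_dom U(2)] unfolding bil_field_def by metis
qed

text \<open>Needed for \<open>(\<psi>, codiff A g \<psi>)\<close> to be a smooth section. The frame
  sum is again replaced by a coordinate trace.\<close>

lemma smooth_codiff:
  assumes \<psi>: "smooth_form A UNIV \<psi>" "\<And>q. bilinear (\<psi> q)"
  shows "smooth_vec A UNIV (codiff A g \<psi>)"
  unfolding smooth_vec_iff
proof
  fix c assume c: "c \<in> A"
  interpret loc_riem "cdom c UNIV" "G c" by (rule loc_riem_chart[OF c open_UNIV])
  let ?a = "\<lambda>x a. sharp (G c x) (\<lambda>z. a \<bullet> z)"
  define \<alpha> where "\<alpha> x v = - (\<Sum>a\<in>Basis. nabf (G c) (frep A c \<psi>) x a (?a x a) v)" for x v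
  note bil = smooth_form_bil_field[OF \<psi> c]
  have N: "bilinear (nabla_form A g p w \<psi>)" for p w by (rule nabla_form_bilinear[OF open_UNIV UNIV_I \<psi>])
  have l: "linear (\<lambda>w. nabla_form A g p w \<psi> u v)" for p u v by (rule nabla_linear(1)[OF open_UNIV UNIV_I \<psi>])
  note l' = linear_add[OF l] linear_cmul[OF l] g_lin[OF N]
  have nb: "bil_field (cdom c UNIV) (\<lambda>x u v. nabf (G c) (frep A c \<psi>) x a u v)" for a by (rule nabf_lin(2)[OF bil])
  have lin: "lin_field (cdom c UNIV) \<alpha>"
    unfolding lin_field_def
  proof (intro conjI ballI allI)
    show "linear (\<alpha> x)" if x: "x \<in> cdom c UNIV" for x
    proof -
      have "linear (\<lambda>v. nabf (G c) (frep A c \<psi>) x a u v)" for a u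
        using nb[of a] x unfolding bil_field_def bilinear_def by blast
      from linear_add[OF this] linear_cmul[OF this] show ?thesis
        unfolding \<alpha>_def by (intro linearI) (simp_all add: sum.distrib sum_distrib_left)
    qed
    show "Cinf_on (cdom c UNIV) (\<lambda>x. \<alpha> x u)" for u
      unfolding \<alpha>_def
      by (intro Cinf_intros open_S bil_field_Cinf[OF open_S nb] smooth_dual_basis[OF c open_UNIV])
  qed
  from sharp_Cinf[OF open_S inner_G smooth_G this]
  show "Cinf_on (cdom c UNIV) (vec_rep A c (codiff A g \<psi>))"
  proof (rule Cinf_on_cong[OF open_S, rotated])
    fix x assume "x \<in> cdom c UNIV"
    then obtain p where p: "p \<in> fst c" "x = snd c p" using cdomE by metis
    let ?F = "from_chart A c p"
    have e: "codiff A g \<psi> p = sharp (g p) (\<lambda>v. - (\<Sum>a\<in>Basis. nabla_form A g p (?F a) \<psi> (?F (?a x a)) v))"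
    proof -
      have "(\<Sum>b\<in>Basis. nabla_form A g p (frame (g p) b) \<psi> (frame (g p) b) v)
        = (\<Sum>a\<in>Basis. nabla_form A g p (?F a) \<psi> (?F (?a x a)) v)" for v
        unfolding p(2)
        by (rule trace_chart[OF c p(1), of "\<lambda>y y'. nabla_form A g p y \<psi> y' v"]) (auto simp: bilinear_def l' intro!: linearI)
      then show ?thesis unfolding codiff_def Let_def by simp
    qed
    have "linear (\<lambda>v. - (\<Sum>a\<in>Basis. nabla_form A g p (?F a) \<psi> (?F (?a x a)) v))"
      by (intro linearI) (simp_all add: l' sum.distrib sum_distrib_left)
    from sharp_chart[OF c p(1) this] e
    have "vec_rep A c (codiff A g \<psi>) x = sharp (G c x) (\<lambda>v. - (\<Sum>a\<in>Basis. nabla_form A g p (?F a) \<psi> (?F (?a x a)) (?F v)))"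
      by (simp add: p(2) vec_rep_at[OF c p(1)])
    also have "(\<lambda>v. - (\<Sum>a\<in>Basis. nabla_form A g p (?F a) \<psi> (?F (?a x a)) (?F v))) = \<alpha> x"
      unfolding \<alpha>_def nabla_form_chart[OF open_UNIV UNIV_I \<psi> c p(1)] by (simp add: p c)
    finally show "sharp (G c x) (\<alpha> x) = vec_rep A c (codiff A g \<psi>) x" ..
  qed
qed

subsection \<open>Parallel sections\<close>

text \<open>Parallelism is split into its two components because the first alone describes
  conformal-Killing forms and the second is a consequence of it.\<close>

definition form_eq :: "('a \<Rightarrow> 'e \<Rightarrow> 'e \<Rightarrow> real) \<Rightarrow> ('a \<Rightarrow> 'e) \<Rightarrow> bool" where
  "form_eq \<psi> X \<longleftrightarrow> (\<forall>p w u v. nabla_form A g p w \<psi> u v = 1 / (4 * real n - 1) * qB (g p) (ad p) (X p) w u v)"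

definition vec_eq :: "('a \<Rightarrow> 'e \<Rightarrow> 'e \<Rightarrow> real) \<Rightarrow> ('a \<Rightarrow> 'e) \<Rightarrow> bool" where
  "vec_eq \<psi> X \<longleftrightarrow> (\<forall>p w. nabla_vec A g p w X = ((4 * real n - 1) / 4) *\<^sub>R sharp (g p) (al p (\<psi> p) w))"

text \<open>Every tangent vector is a value of a coordinate field, so the condition over all local
  fields is a pointwise one.\<close>

lemma parallel_iff:
  "(\<psi>, X) \<in> parallel_sections A (qk_sections A g Q) (qk_connection A g Q n)
    \<longleftrightarrow> (\<psi>, X) \<in> qk_sections A g Q UNIV \<and> form_eq \<psi> X \<and> vec_eq \<psi> X"
proof -
  have "(\<forall>U Z. open U \<longrightarrow> smooth_vec A U Z \<longrightarrow> sec_eq_on U (qk_connection A g Q n Z (\<psi>, X)) sec_zero) \<longleftrightarrow> form_eq \<psi> X \<and> vec_eq \<psi> X"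
    if c: "\<And>p. \<psi> p \<in> compatible (g p) (Q p)"
  proof -
    have z: "sec_eq_on U (qk_connection A g Q n Z (\<psi>, X)) sec_zero \<longleftrightarrow>
       (\<forall>p\<in>U. (\<forall>u v. nabla_form A g p (Z p) \<psi> u v = 1 / (4 * real n - 1) * qB (g p) (ad p) (X p) (Z p) u v)
         \<and> nabla_vec A g p (Z p) X = ((4 * real n - 1) / 4) *\<^sub>R sharp (g p) (al p (\<psi> p) (Z p)))" for U Z
      unfolding sec_eq_on_def qk_connection_def sec_zero_def
      by (simp add: conn_form_eq conn_vec_eq[OF c] fun_eq_iff)
    show ?thesis
    proof
      assume *: "\<forall>U Z. open U \<longrightarrow> smooth_vec A U Z \<longrightarrow> sec_eq_on U (qk_connection A g Q n Z (\<psi>, X)) sec_zero"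
      have "(\<forall>u v. nabla_form A g p w \<psi> u v = 1 / (4 * real n - 1) * qB (g p) (ad p) (X p) w u v)
         \<and> nabla_vec A g p w X = ((4 * real n - 1) / 4) *\<^sub>R sharp (g p) (al p (\<psi> p) w)" for p w
        using *[rule_format, OF open_chart[OF bc_in[of p]] smooth_coord_field, of w] bc_dom[of p] unfolding z
        by (metis coord_field_at)
      then show "form_eq \<psi> X \<and> vec_eq \<psi> X" unfolding form_eq_def vec_eq_def by blast
    next
      assume "form_eq \<psi> X \<and> vec_eq \<psi> X"
      then show "\<forall>U Z. open U \<longrightarrow> smooth_vec A U Z \<longrightarrow> sec_eq_on U (qk_connection A g Q n Z (\<psi>, X)) sec_zero"
        unfolding z form_eq_def vec_eq_def by blast
    qed
  qed
  moreover have "\<psi> p \<in> compatible (g p) (Q p)" if "(\<psi>, X) \<in> qk_sections A g Q UNIV" for p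
    using that unfolding sections_iff by simp
  ultimately show ?thesis unfolding parallel_sections_def mem_Collect_eq by (intro conj_cong refl) metis
qed

text \<open>The contraction of \<open>BB\<close> gives \<open>(1 - 4n) / (4n - 1) = - 1\<close>, and
  the codifferential changes the sign. So \<open>X\<close> is recovered from \<open>\<psi>\<close>,
  which makes the projection to the form injective on parallel sections.\<close>

lemma codiff_form_eq:
  assumes "form_eq \<psi> X" shows "codiff A g \<psi> = X"
proof
  fix p
  interpret qk_at A g Q n p ..
  have "(\<Sum>b\<in>Basis. nabla_form A g p (P.e b) \<psi> (P.e b) v) = - g p (X p) v" for v
  proof -
    have "nabla_form A g p (P.e b) \<psi> (P.e b) v = 1 / (4 * real n - 1) * P.BB (X p) (P.e b) (P.e b) v" for b
      using assms unfolding form_eq_def P.BB_qB by blast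
    then have "(\<Sum>b\<in>Basis. nabla_form A g p (P.e b) \<psi> (P.e b) v) = 1 / (4 * real n - 1) * ((1 - 4 * real n) * g p (X p) v)"
      by (simp only: sum_distrib_left[symmetric] P.BB_contract)
    also have "\<dots> = - g p (X p) v" using n_ge_2 by (simp add: field_simps)
    finally show ?thesis .
  qed
  then show "codiff A g \<psi> p = X p"
    unfolding codiff_def Let_def by (intro sharp_eqI[OF inner_g]) simp
qed

lemma dim_real: "real DIM('e) = 4 * real n"
  by (simp add: dim_n)

text \<open>In the exterior derivative the wedge part of \<open>BB\<close> drops out and the totally
  skew part is counted three times. Hence \<open>1 / 3\<close> of the exterior derivative is the
  skew part, and the codifferential term supplies the wedge part.\<close>

lemma form_eq_conformal_killing:
  assumes c: "\<And>p. \<psi> p \<in> compatible (g p) (Q p)" and f: "form_eq \<psi> X"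
  shows "conformal_killing A g \<psi>"
  unfolding conformal_killing_def
proof (intro allI)
  fix p Y u v
  interpret qk_at A g Q n p ..
  define k where "k = 1 / (4 * real n - 1)"
  have N: "nabla_form A g p w \<psi> a b = k * P.BB (X p) w a b" for w a b
    using f unfolding form_eq_def P.BB_qB k_def by blast
  have E: "ext_deriv A \<psi> p Y u v = k * (P.BB (X p) Y u v - P.BB (X p) u Y v + P.BB (X p) v Y u)"
    unfolding ext_deriv_nabla[of \<psi> p, OF compatible_skew[OF c]] N by (simp add: algebra_simps)
  have 1: "P.BB (X p) u Y v = - P.BB (X p) Y u v + 
      (g p (X p) u * g p Y v - g p Y u * g p (X p) v) + (g p (X p) Y * g p u v - g p u Y * g p (X p) v)"
    using P.BB_skew[of "X p" Y u v] by simp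
  have 2: "P.BB (X p) v Y u = P.BB (X p) Y u v
      + (g p (X p) v * g p Y u - g p Y v * g p (X p) u) + (g p (X p) Y * g p v u - g p v Y * g p (X p) u)"
    using P.BB_skew[of "X p" Y v u] P.cptD(2)[OF P.BB_cpt, of "X p" Y v u] by simp
  have s: "g p a b = g p b a" for a b using inner_g unfolding inner_form_def by blast
  have "ext_deriv A \<psi> p Y u v = 3 * k * P.BB (X p) Y u v - 3 * k * (g p (X p) u * g p Y v - g p Y u * g p (X p) v)"
    unfolding E 1 2 s[of u Y] s[of v u] s[of v Y] by (simp add: algebra_simps)
  then show "nabla_form A g p Y \<psi> u v = 1 / 3 * ext_deriv A \<psi> p Y u v
      - 1 / (real DIM('e) - 1) * wedge (g p) Y (codiff A g \<psi> p) u v"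
    unfolding N codiff_form_eq[OF f] dim_real k_def[symmetric] wedge_def wedge_end_def
    by (simp add: P.h_lin algebra_simps)
qed

text \<open>The difference \<open>\<sigma>\<close> is compatible in its last two slots, because the
  derivative of a compatible form is. It is skew in the first two, because the parts of the
  conformal-Killing equation and of \<open>BB\<close> that are not totally skew are the same wedge
  term. So \<open>three_form_zero\<close> applies.\<close>

lemma conformal_killing_form_eq:
  assumes s: "smooth_form A UNIV \<psi>" and c: "\<And>p. \<psi> p \<in> compatible (g p) (Q p)" and ck: "conformal_killing A g \<psi>"
  shows "form_eq \<psi> (codiff A g \<psi>)"
  unfolding form_eq_def
proof (intro allI)
  fix p w u v
  interpret qk_at A g Q n p ..
  define X where "X = codiff A g \<psi> p"
  define k where "k = 1 / (4 * real n - 1)"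
  define \<sigma> where "\<sigma> w u v = nabla_form A g p w \<psi> u v - k * P.BB X w u v" for w u v
  have Nc: "nabla_form A g p w \<psi> \<in> compatible (g p) (Q p)" for w
    by (rule nabla_form_compatible[OF open_UNIV UNIV_I s c])
  have e: "\<sigma> w = (\<lambda>u v. (- k) * P.BB X w u v + nabla_form A g p w \<psi> u v)" for w
    by (simp add: \<sigma>_def fun_eq_iff)
  have "\<sigma> w \<in> compatible (g p) (Q p)" for w
    unfolding e P.BB_qB by (rule compatible_add[OF qB_compatible Nc])
  then have "\<forall>w. \<exists>a b c. P.cpt a b c (\<sigma> w)" unfolding P.compatible_iff by blast
  then obtain a b d where cpt: "\<And>w. P.cpt (a w) (b w) (d w) (\<sigma> w)" by metis
  have sk: "\<sigma> w u v = - \<sigma> w v u" for w u v using P.cptD(2)[OF cpt] .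
  have l: "linear (\<lambda>w. nabla_form A g p w \<psi> u v)" for u v
    by (rule nabla_linear(1)[OF open_UNIV UNIV_I s compatible_bilinear[OF c]])
  have lin: "linear (\<lambda>w. \<sigma> w u v)" for u v
    by (intro linearI) (simp_all add: \<sigma>_def linear_add[OF l] linear_cmul[OF l] P.BB_lin algebra_simps)
  have "\<sigma> w u v = - \<sigma> u w v" for w u v
  proof -
    have e: "nabla_form A g p w \<psi> u v = 1 / 3 * ext_deriv A \<psi> p w u v - k * (g p w u * g p X v - g p X u * g p w v)" for w u v
      using ck unfolding conformal_killing_def dim_real wedge_def wedge_end_def X_def k_def
      by (simp add: P.h_lin)
    have "ext_deriv A \<psi> p w u v = - ext_deriv A \<psi> p u w v"
      unfolding ext_deriv_nabla[of \<psi> p, OF compatible_skew[OF c]]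
      using compatible_skew[OF Nc, of v w u] by simp
    then show ?thesis unfolding \<sigma>_def e using arg_cong[OF P.BB_skew[of X w u v], of "(*) k"] by (simp add: algebra_simps)
  qed
  from P.three_form_zero[OF lin sk this cpt, of w u v]
  show "nabla_form A g p w \<psi> u v = 1 / (4 * real n - 1) * qB (g p) (ad p) (codiff A g \<psi> p) w u v"
    by (simp add: \<sigma>_def P.BB_qB X_def k_def)
qed

end

context qk begin

subsection \<open>Second covariant derivatives\<close>

text \<open>The tensor \<open>qB\<close> is parallel, so only the two fields inserted into it are
  differentiated.\<close>

lemma nabla_qB:
  assumes U: "open U" "p \<in> U" and s: "smooth_vec A U X" "smooth_vec A U Z"
  shows "nabla_form A g p w (\<lambda>q. qB (g q) (ad q) (X q) (Z q)) u v
    = qB (g p) (ad p) (nabla_vec A g p w X) (Z p) u v + qB (g p) (ad p) (X p) (nabla_vec A g p w Z) u v"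
proof -
  let ?b = "bc p"
  obtain V J where J: "local_basis V J" "p \<in> V" "V \<subseteq> U" by (rule local_basis_exists[OF U])
  interpret qk_chart "cdom ?b V" "G ?b" "\<lambda>i. erep A ?b (J i)" "qrep ?b" n by (rule qk_chart_local[OF bc_in J(1)])
  note x = cdomI[OF bc_dom J(2)]
  note c = smooth_vecD[OF smooth_subset(1)[OF s(1) J(3)] bc_in] smooth_vecD[OF smooth_subset(1)[OF s(2) J(3)] bc_in]
  have "nabla_form A g p w (\<lambda>q. qB (g q) (ad q) (X q) (Z q)) u v
     = nabf (G ?b) (\<lambda>y. qB (G ?b y) (\<lambda>i. erep A ?b (J i) y) (vec_rep A ?b X y) (vec_rep A ?b Z y)) (snd ?b p) w u v"
    unfolding nabla_form_base by (rule nabf_cong[OF x]) (rule frep_qB[OF J(1) bc_in])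
  then show ?thesis
    unfolding nabf_qB[OF x c] qB_chart[OF J(1,2) bc_in bc_dom] by (simp add: nabla_vec_base vec_rep_at bc_in bc_dom)
qed

lemma ricci_identity:
  assumes U: "open U" "p \<in> U" and \<psi>: "smooth_form A U \<psi>" "\<And>q. q \<in> U \<Longrightarrow> bilinear (\<psi> q)"
    and s: "smooth_vec A U Y" "smooth_vec A U Z"
  shows "nabla_form A g p (Y p) (\<lambda>q. nabla_form A g q (Z q) \<psi>) u v - nabla_form A g p (Z p) (\<lambda>q. nabla_form A g q (Y q) \<psi>) u v
     - nabla_form A g p (lie_bracket A Y Z p) \<psi> u v
    = - \<psi> p (curv A g p (Y p) (Z p) u) v - \<psi> p u (curv A g p (Y p) (Z p) v)"
proof -
  let ?b = "bc p"
  interpret loc_riem "cdom ?b U" "G ?b" by (rule loc_riem_chart[OF bc_in U(1)])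
  note x = cdomI[OF bc_dom U(2)]
  note c = smooth_vecD[OF s(1) bc_in] smooth_vecD[OF s(2) bc_in]
  note bil = smooth_form_bil_field[OF \<psi> bc_in]
  let ?\<psi> = "frep A ?b \<psi>" and ?x = "snd ?b p"
  have at: "vec_rep A ?b W ?x = W p" for W by (simp add: vec_rep_at bc_in bc_dom)
  have N: "nabla_form A g p w (\<lambda>q. nabla_form A g q (W q) \<psi>) u v
     = nabf (G ?b) (\<lambda>y a b. nabf (G ?b) ?\<psi> y (W p) a b) ?x w u v + nabf (G ?b) ?\<psi> ?x (DD (vec_rep A ?b W) ?x w) u v"
    if W: "smooth_vec A U W" for W w
  proof -
    have "nabla_form A g p w (\<lambda>q. nabla_form A g q (W q) \<psi>) u v
       = nabf (G ?b) (\<lambda>y a b. nabf (G ?b) ?\<psi> y (vec_rep A ?b W y) a b) ?x w u v"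
      unfolding nabla_form_base[where \<psi> = "\<lambda>q. nabla_form A g q (W q) \<psi>"]
      by (rule nabf_cong[OF x]) (rule frep_nabla[OF U(1) \<psi> bc_in])
    then show ?thesis using nabf_var[OF x bil smooth_vecD[OF W bc_in], of w u v] by (simp add: at)
  qed
  have l: "linear (\<lambda>w. nabf (G ?b) ?\<psi> ?x w u v)" using nabf_lin(1)[OF bil] x unfolding lin_field_def by blast
  have br: "lie_bracket A Y Z p = DD (vec_rep A ?b Z) ?x (Y p) - DD (vec_rep A ?b Y) ?x (Z p)"
    using lie_bracket_chart[OF U(1) s bc_in bc_dom U(2)] by (simp add: at)
  have \<psi>p: "?\<psi> ?x = \<psi> p" by (simp add: fun_eq_iff frep_at bc_in bc_dom)
  show ?thesis
    unfolding N[OF s(1)] N[OF s(2)] br nabla_form_base[of p _ \<psi>] linear_diff[OF l] curv_base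
    using nabf_nabf[OF x bil, of "Z p" "Y p" u v] unfolding \<psi>p by simp
qed

lemma curv_op_curv:
  assumes U: "open U" "p \<in> U" and s: "smooth_vec A U Y" "smooth_vec A U Z" "smooth_vec A U X"
  shows "curv_op A g Y Z X p = curv A g p (Y p) (Z p) (X p)"
  using curv_op_chart[OF U(1) s bc_in bc_dom U(2)] unfolding curv_base by (simp add: vec_rep_at bc_in bc_dom)

section \<open>The prolongation\<close>

lemma form_eq_vec_eq:
  assumes s: "smooth_form A UNIV \<psi>" and c: "\<And>p. \<psi> p \<in> compatible (g p) (Q p)" and X: "smooth_vec A UNIV X"
    and f: "form_eq \<psi> X"
  shows "vec_eq \<psi> X"
  unfolding vec_eq_def
proof (intro allI)
  fix p w
  interpret qk_at A g Q n p ..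
  let ?U = "fst (bc p)"
  have U: "open ?U" "p \<in> ?U" using open_chart[OF bc_in] bc_dom by blast+
  define k where "k = 1 / (4 * real n - 1)"
  have k: "k * (4 * real n - 1) = 1" using n_ge_2 by (simp add: k_def)
  note sX = smooth_subset(1)[OF X subset_UNIV] and s\<psi> = smooth_subset(2)[OF s subset_UNIV]
  have N: "nabla_form A g q w \<psi> = (\<lambda>u v. k * qB (g q) (ad q) (X q) w u v)" for q w
    using f unfolding form_eq_def k_def by blast
  \<comment> \<open>The Ricci identity with the equation for \<open>\<psi>\<close> inserted: the
    derivatives of the coordinate fields cancel against the bracket term, and only those of
    \<open>X\<close> remain.\<close>
  have R: "- \<psi> p (curv A g p Y Z u) v - \<psi> p u (curv A g p Y Z v)
      = k * (P.BB (nabla_vec A g p Y X) Z u v - P.BB (nabla_vec A g p Z X) Y u v)" for Y Z u v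
  proof -
    let ?Y = "coord_field A p Y" and ?Z = "coord_field A p Z"
    have D: "nabla_form A g p w (\<lambda>q. nabla_form A g q (coord_field A p V q) \<psi>) u v
       = k * (P.BB (nabla_vec A g p w X) V u v + P.BB (X p) (nabla_vec A g p w (coord_field A p V)) u v)" for w V
    proof -
      have z: "smooth_form A ?U (\<lambda>p u v. 0)" using zero_section[OF U(1)] unfolding sections_iff by blast
      show ?thesis
        unfolding N
        using nabla_form_leibniz[OF U(2) smooth_const[OF U(1)] smooth_qB_form[OF U(1) sX smooth_coord_field] z, of w k V u v]
          nabla_form_leibniz[OF U(2) smooth_const[OF U(1)] z z, of w 1 u v] nabla_qB[OF U sX smooth_coord_field, of w V u v]
        by (simp add: d_fun_const P.BB_qB)
    qed
    have "- \<psi> p (curv A g p Y Z u) v - \<psi> p u (curv A g p Y Z v)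
      = k * (P.BB (nabla_vec A g p Y X) Z u v + P.BB (X p) (nabla_vec A g p Y ?Z) u v)
       - k * (P.BB (nabla_vec A g p Z X) Y u v + P.BB (X p) (nabla_vec A g p Z ?Y) u v)
       - k * P.BB (X p) (nabla_vec A g p Y ?Z - nabla_vec A g p Z ?Y) u v"
      using ricci_identity[OF U s\<psi> compatible_bilinear[OF c] smooth_coord_field smooth_coord_field, of Y Z u v]
      unfolding D unfolding coord_field_at lie_bracket_nabla N P.BB_qB by simp
    moreover have "P.BB (X p) (a - b) u v = P.BB (X p) a u v - P.BB (X p) b u v" for a b
      using P.BB_lin(3)[of "X p" a "-1 *\<^sub>R b" u v] P.BB_lin(4)[of "X p" "-1" b u v] by simp
    ultimately show ?thesis by (simp add: algebra_simps)
  qed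
  obtain a b d where cp: "P.cpt a b d (\<psi> p)" using c[of p] unfolding P.compatible_iff by blast
  note bil = P.cptD(1)[OF cp]
  note l = g_lin[OF bil] P.qs
  have bchi: "bilinear (P.chi (\<psi> p))"
    unfolding bilinear_def P.chi_def by (auto intro!: linearI simp: l algebra_simps add_divide_distrib)
  define S where "S x = sharp (g p) (P.chi (\<psi> p) x)" for x
  have S: "g p (S x) v = P.chi (\<psi> p) x v" for x v unfolding S_def by (rule P.weyl.sharp_eq[OF bchi])
  have linS: "linear S" unfolding S_def by (rule P.weyl.linear_sharp[OF bchi])
  \<comment> \<open>Chosen so that \<open>k * r = \<nu>/4\<close>, the coefficient of the model term
    in \<open>curvature_action\<close>. Subtracting \<open>r S\<close> therefore leaves for
    \<open>L\<close> the identity with the Weyl tensor alone.\<close>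
  define r where "r = P.nu * (4 * real n - 1) / 4"
  define L where "L w = nabla_vec A g p w X - r *\<^sub>R S w" for w
  have nX: "linear (\<lambda>w. nabla_vec A g p w X)" by (rule nabla_linear(2)[OF U sX])
  have linL: "linear L"
    unfolding L_def using linear_add[OF nX] linear_cmul[OF nX] linear_add[OF linS] linear_cmul[OF linS]
    by (intro linearI) (simp_all add: algebra_simps)
  have "- \<psi> p (P.Wv Y Z u) v - \<psi> p u (P.Wv Y Z v) = 1 / (4 * real n - 1) * (P.BB (L Y) Z u v - P.BB (L Z) Y u v)" for Y Z u v
  proof -
    have B: "P.BB (L w) z u v = P.BB (nabla_vec A g p w X) z u v - r * P.BB (S w) z u v" for w z
      unfolding L_def using P.BB_lin(1)[of "nabla_vec A g p w X" "- r *\<^sub>R S w" z u v] P.BB_lin(2)[of "- r" "S w" z u v] by simp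
    have kr: "k * r = P.nu / 4" using k by (simp add: r_def mult.commute)
    have "k * (P.BB (L Y) Z u v - P.BB (L Z) Y u v) = k * (P.BB (nabla_vec A g p Y X) Z u v - P.BB (nabla_vec A g p Z X) Y u v)
      - (k * r) * (P.BB (S Y) Z u v - P.BB (S Z) Y u v)" unfolding B by (simp add: algebra_simps)
    also have "\<dots> = - \<psi> p (P.Wv Y Z u) v - \<psi> p u (P.Wv Y Z v)"
      using R[of Y Z u v] P.curvature_action[OF cp S, of Y Z u v] unfolding kr by (simp add: algebra_simps)
    finally show ?thesis unfolding k_def by simp
  qed
  from P.weyl.weyl_determines[OF cp linL this]
  have "g p (L w) v = (4 * real n - 1) / (4 * (real n + 1)) * P.weyl.Wf (\<psi> p) w v" for v .
  moreover have "(4 * real n - 1) / (4 * (real n + 1)) = (4 * real n - 1) / 4 * (1 / (real n + 1))" by simp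
  ultimately have "g p (nabla_vec A g p w X) v = r * P.chi (\<psi> p) w v + (4 * real n - 1) / 4 * (1 / (real n + 1)) * P.weyl.Wf (\<psi> p) w v" for v
    unfolding L_def P.h_lin S by (simp only: diff_eq_eq add.commute real_scaleR_def)
  then have gN: "g p (nabla_vec A g p w X) v = r * P.chi (\<psi> p) w v + (4 * real n - 1) / 4 * (1 / (real n + 1)) * P.weyl.Wf (\<psi> p) w v" for v .
  have "g p (nabla_vec A g p w X) v = (4 * real n - 1) / 4 * al p (\<psi> p) w v" for v
  proof -
    define \<kappa> where "\<kappa> = (4 * real n - 1) / 4"
    have "r = \<kappa> * P.nu" by (simp add: r_def \<kappa>_def)
    then show ?thesis
      using gN unfolding al_def quat_weyl_form_eq nu_eq P.chi_qK[symmetric] \<kappa>_def[symmetric] by (simp add: distrib_left mult.assoc)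
  qed
  then show "nabla_vec A g p w X = ((4 * real n - 1) / 4) *\<^sub>R sharp (g p) (al p (\<psi> p) w)"
    by (intro g_ext[of p]) (simp add: P.h_lin sharp_al[OF bil])
qed

text \<open>The isomorphism is the projection to the form, with inverse
  \<open>\<psi> \<mapsto> (\<psi>, codiff A g \<psi>)\<close>.\<close>

lemma prolongation_qk:
  "prolongation A (qk_sections A g Q) (qk_connection A g Q n) (compatible_conformal_killing A g Q)"
proof -
  let ?P = "parallel_sections A (qk_sections A g Q) (qk_connection A g Q n)"
  have "bij_betw fst ?P (compatible_conformal_killing A g Q)"
  proof (rule bij_betwI')
    fix s t assume "s \<in> ?P" "t \<in> ?P"
    moreover obtain \<psi> X \<phi> Y where e: "s = (\<psi>, X)" "t = (\<phi>, Y)" by (metis surj_pair)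
    ultimately show "fst s = fst t \<longleftrightarrow> s = t"
      using codiff_form_eq[of \<psi> X] codiff_form_eq[of \<phi> Y] unfolding e parallel_iff by auto
  next
    fix s assume "s \<in> ?P"
    moreover obtain \<psi> X where e: "s = (\<psi>, X)" by (metis surj_pair)
    ultimately show "fst s \<in> compatible_conformal_killing A g Q"
      using form_eq_conformal_killing[of \<psi> X] unfolding e parallel_iff sections_iff compatible_conformal_killing_def by auto
  next
    fix \<psi> assume "\<psi> \<in> compatible_conformal_killing A g Q"
    then have h: "smooth_form A UNIV \<psi>" "\<And>p. \<psi> p \<in> compatible (g p) (Q p)" "conformal_killing A g \<psi>"
      unfolding compatible_conformal_killing_def by blast+
    note f = conformal_killing_form_eq[OF h] and sX = smooth_codiff[OF h(1) compatible_bilinear[OF h(2)]]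
    have "(\<psi>, codiff A g \<psi>) \<in> ?P"
      unfolding parallel_iff sections_iff using h(1,2) sX f form_eq_vec_eq[OF h(1,2) sX f] by simp
    then show "\<exists>s\<in>?P. \<psi> = fst s" by force
  qed
  moreover have "fst (sec_add (sec_scale (\<lambda>_. r) s) t) = (\<lambda>p u v. r * fst s p u v + fst t p u v)" for r and s t :: "('a, 'e) section_pair"
    by (simp add: sec_add_def sec_scale_def)
  ultimately show ?thesis unfolding prolongation_def using connection_qk by blast
qed

end

section \<open>The curvature of the connection\<close>

context loc_riem begin

lemma nabf_linear:
  assumes x: "x \<in> S" and b: "bil_field S \<psi>" "bil_field S \<phi>"
  shows "nabf G (\<lambda>y u v. r * \<psi> y u v + s * \<phi> y u v) x w u v = r * nabf G \<psi> x w u v + s * nabf G \<phi> x w u v"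
proof -
  have d: "(\<lambda>y. \<psi> y u v) differentiable at x" "(\<lambda>y. \<phi> y u v) differentiable at x"
    using b x Cinf_onD unfolding bil_field_def by blast+
  have c: "(\<lambda>y. r) differentiable at x" for r :: real by simp
  show ?thesis
    unfolding nabf_def DD_add[OF differentiable_mult[OF c d(1)] differentiable_mult[OF c d(2)]] DD_mult[OF c d(1)] DD_mult[OF c d(2)]
    by (simp add: algebra_simps)
qed

end

context qk begin

lemma nabla_conn_form:
  assumes U: "open U" "p \<in> U" and \<psi>: "smooth_form A U \<psi>" "\<And>q. q \<in> U \<Longrightarrow> \<psi> q \<in> compatible (g q) (Q q)"
    and X: "smooth_vec A U X" and Z: "smooth_vec A U Z"
  defines "k \<equiv> 1 / (4 * real n - 1)"
  shows "nabla_form A g p w (qk_conn_form A g Q n Z \<psi> X) u v = nabla_form A g p w (\<lambda>q. nabla_form A g q (Z q) \<psi>) u v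
    - k * (qB (g p) (ad p) (nabla_vec A g p w X) (Z p) u v + qB (g p) (ad p) (X p) (nabla_vec A g p w Z) u v)"
proof -
  have e: "qk_conn_form A g Q n Z \<psi> X = (\<lambda>q u v. (- k) * qB (g q) (ad q) (X q) (Z q) u v + nabla_form A g q (Z q) \<psi> u v)"
    by (simp add: fun_eq_iff conn_form_eq k_def)
  show ?thesis
    unfolding e using nabla_form_leibniz[OF U(2) smooth_const[OF U(1)] smooth_qB_form[OF U(1) X Z]
      smooth_form_nabla[OF U(1) \<psi>(1) compatible_bilinear[OF \<psi>(2)] Z], of w "- k" u v]
    by (simp add: d_fun_const nabla_qB[OF U X Z])
qed

text \<open>The derivatives of \<open>X\<close> occur symmetrically in \<open>Y\<close> and
  \<open>Z\<close>: once when \<open>qB\<close> is differentiated and once when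
  \<open>qk_conn_vec\<close> is inserted into it. The derivatives of \<open>Y\<close> and
  \<open>Z\<close> cancel against the bracket. The Ricci identity and the \<open>al\<close> terms
  remain, with coefficient \<open>1 / (4n - 1) * ((4n - 1) / 4) = 1 / 4\<close>.\<close>

lemma conn_curv_form:
  assumes U: "open U" "p \<in> U" and \<psi>: "smooth_form A U \<psi>" "\<And>q. q \<in> U \<Longrightarrow> \<psi> q \<in> compatible (g q) (Q q)"
    and X: "smooth_vec A U X" and Y: "smooth_vec A U Y" and Z: "smooth_vec A U Z"
  shows "fst (connection_curv A (qk_connection A g Q n) Y Z (\<psi>, X)) p u v
    = - \<psi> p (curv A g p (Y p) (Z p) u) v - \<psi> p u (curv A g p (Y p) (Z p) v)
    + 1 / 4 * (qB (g p) (ad p) (sharp (g p) (al p (\<psi> p) (Z p))) (Y p) u v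
        - qB (g p) (ad p) (sharp (g p) (al p (\<psi> p) (Y p))) (Z p) u v)"
proof -
  define k where "k = 1 / (4 * real n - 1)"
  define \<kappa> where "\<kappa> = (4 * real n - 1) / 4"
  have k: "k * \<kappa> = 1 / 4" using n_ge_2 by (simp add: k_def \<kappa>_def)
  let ?B = "qB (g p) (ad p)" and ?S = "\<lambda>W. sharp (g p) (al p (\<psi> p) (W p))"
  note c = \<psi>(2)[OF U(2)]
  have v: "?B (qk_conn_vec A g Q n W \<psi> X p) V u v = ?B (nabla_vec A g p (W p) X) V u v - \<kappa> * ?B (?S W) V u v" for W V
    unfolding conn_vec_eq[of \<psi>, OF c] \<kappa>_def[symmetric]
    using qB_linear(1)[of p "- \<kappa>" "?S W" "nabla_vec A g p (W p) X" V u v] by simp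
  have d: "?B (X p) (a - b) u v = ?B (X p) a u v - ?B (X p) b u v" for a b
    using qB_linear(2)[of p "X p" "-1" b a u v] by simp
  have R: "nabla_form A g p (Y p) (\<lambda>q. nabla_form A g q (Z q) \<psi>) u v - nabla_form A g p (Z p) (\<lambda>q. nabla_form A g q (Y q) \<psi>) u v
     - nabla_form A g p (lie_bracket A Y Z p) \<psi> u v = - \<psi> p (curv A g p (Y p) (Z p) u) v - \<psi> p u (curv A g p (Y p) (Z p) v)"
    by (rule ricci_identity[OF U \<psi>(1) compatible_bilinear[OF \<psi>(2)] Y Z])
  have N: "nabla_form A g p w (qk_conn_form A g Q n W \<psi> X) u v = nabla_form A g p w (\<lambda>q. nabla_form A g q (W q) \<psi>) u v
    - k * (?B (nabla_vec A g p w X) (W p) u v + ?B (X p) (nabla_vec A g p w W) u v)" if "smooth_vec A U W" for w W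
    unfolding k_def by (rule nabla_conn_form[OF U \<psi> X that])
  have "fst (connection_curv A (qk_connection A g Q n) Y Z (\<psi>, X)) p u v
    = qk_conn_form A g Q n Y (qk_conn_form A g Q n Z \<psi> X) (qk_conn_vec A g Q n Z \<psi> X) p u v
    - qk_conn_form A g Q n Z (qk_conn_form A g Q n Y \<psi> X) (qk_conn_vec A g Q n Y \<psi> X) p u v
    - qk_conn_form A g Q n (lie_bracket A Y Z) \<psi> X p u v"
    by (simp add: connection_curv_def qk_connection_def sec_add_def sec_scale_def)
  also have "\<dots> = (nabla_form A g p (Y p) (\<lambda>q. nabla_form A g q (Z q) \<psi>) u v - nabla_form A g p (Z p) (\<lambda>q. nabla_form A g q (Y q) \<psi>) u v
     - nabla_form A g p (lie_bracket A Y Z p) \<psi> u v)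
    + (k * \<kappa>) * (?B (?S Z) (Y p) u v - ?B (?S Y) (Z p) u v)"
    unfolding conn_form_eq[of _ "qk_conn_form A g Q n Z \<psi> X"] conn_form_eq[of _ "qk_conn_form A g Q n Y \<psi> X"]
      conn_form_eq[of "lie_bracket A Y Z"] k_def[symmetric] v
      N[OF Y] N[OF Z]
    by (simp add: lie_bracket_nabla d algebra_simps)
  finally show ?thesis unfolding R k .
qed

text \<open>The terms with \<open>X\<close> are those of \<open>curvature_vector\<close>. The terms
  with \<open>\<Phi>\<close> and \<open>\<Psi>\<close> depend on \<open>\<psi>\<close> only;
  together they are the skew-symmetrized covariant derivative of the tensor \<open>al\<close>,
  applied to \<open>\<psi>\<close>.\<close>

lemma conn_curv_vec:
  assumes U: "open U" "p \<in> U" and \<psi>: "smooth_form A U \<psi>" "\<And>q. q \<in> U \<Longrightarrow> \<psi> q \<in> compatible (g q) (Q q)"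
    and X: "smooth_vec A U X" and Y: "smooth_vec A U Y" and Z: "smooth_vec A U Z"
  defines "\<Phi> \<equiv> \<lambda>W q. sharp (g q) (al q (\<psi> q) (W q))"
    and "\<Psi> \<equiv> \<lambda>W V. sharp (g p) (al p (nabla_form A g p (W p) \<psi>) (V p))"
  shows "g p (snd (connection_curv A (qk_connection A g Q n) Y Z (\<psi>, X)) p) v
    = (real n + 2) / (real n + 1) * g p (quat_weyl A g Q n p (Y p) (Z p) (X p)) v
    - (4 * real n - 1) / 4 * g p (nabla_vec A g p (Y p) (\<Phi> Z) - nabla_vec A g p (Z p) (\<Phi> Y) - \<Phi> (lie_bracket A Y Z) p + \<Psi> Z Y - \<Psi> Y Z) v"
proof -
  interpret qk_at A g Q n p ..
  define k where "k = 1 / (4 * real n - 1)"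
  define \<kappa> where "\<kappa> = (4 * real n - 1) / 4"
  have k: "\<kappa> * k = 1 / 4" using n_ge_2 by (simp add: k_def \<kappa>_def)
  let ?B = "qB (g p) (ad p)"
  note c = \<psi>(2)[OF U(2)]
  let ?s = "\<lambda>W V. sharp (g p) (al p (?B (X p) (W p)) (V p))"
  have T: "qk_conn_vec A g Q n V (qk_conn_form A g Q n W \<psi> X) (qk_conn_vec A g Q n W \<psi> X) p
    = nabla_vec A g p (V p) (\<lambda>q. nabla_vec A g q (W q) X) - \<kappa> *\<^sub>R nabla_vec A g p (V p) (\<Phi> W) + (\<kappa> * k) *\<^sub>R ?s W V - \<kappa> *\<^sub>R \<Psi> W V"
    if W: "smooth_vec A U W" for W V
  proof -
    have "nabla_vec A g p (V p) (qk_conn_vec A g Q n W \<psi> X)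
      = nabla_vec A g p (V p) (\<lambda>q. (- \<kappa>) *\<^sub>R \<Phi> W q + nabla_vec A g q (W q) X)"
      by (rule nabla_vec_cong[OF U]) (simp add: conn_vec_eq[of \<psi>, OF \<psi>(2)] \<Phi>_def \<kappa>_def)
    also have "\<dots> = (- \<kappa>) *\<^sub>R nabla_vec A g p (V p) (\<Phi> W) + nabla_vec A g p (V p) (\<lambda>q. nabla_vec A g q (W q) X)"
      using nabla_vec_leibniz[OF U smooth_const[OF U(1)] smooth_al_vec[OF U(1) \<psi>(1) compatible_bilinear[OF \<psi>(2)] W]
        smooth_nabla_vec[OF U(1) X W], of "V p" "- \<kappa>"] by (simp add: d_fun_const \<Phi>_def)
    finally have 1: "nabla_vec A g p (V p) (qk_conn_vec A g Q n W \<psi> X) = \<dots>" .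
    have e: "qk_conn_form A g Q n W \<psi> X p = (\<lambda>u v. (- k) * ?B (X p) (W p) u v + nabla_form A g p (W p) \<psi> u v)"
      by (simp add: conn_form_eq k_def)
    have 2: "sharp (g p) (al p (qk_conn_form A g Q n W \<psi> X p) (V p)) = (- k) *\<^sub>R ?s W V + \<Psi> W V"
      unfolding e \<Psi>_def
      by (rule sharp_al_linear(1)[OF compatible_bilinear[OF qB_compatible] compatible_bilinear[OF nabla_form_compatible[OF U \<psi>]]])
    have 3: "qk_conn_form A g Q n W \<psi> X p \<in> compatible (g p) (Q p)" by (rule conn_form_compatible[OF U \<psi>])
    show ?thesis
      unfolding conn_vec_eq[of "qk_conn_form A g Q n W \<psi> X", OF 3] 1 2 \<kappa>_def[symmetric]
      by (simp add: algebra_simps)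
  qed
  have "snd (connection_curv A (qk_connection A g Q n) Y Z (\<psi>, X)) p
    = qk_conn_vec A g Q n Y (qk_conn_form A g Q n Z \<psi> X) (qk_conn_vec A g Q n Z \<psi> X) p
    - qk_conn_vec A g Q n Z (qk_conn_form A g Q n Y \<psi> X) (qk_conn_vec A g Q n Y \<psi> X) p
    - qk_conn_vec A g Q n (lie_bracket A Y Z) \<psi> X p"
    by (simp add: connection_curv_def qk_connection_def sec_add_def sec_scale_def)
  also have "\<dots> = curv A g p (Y p) (Z p) (X p) + (\<kappa> * k) *\<^sub>R (?s Z Y - ?s Y Z)
    - \<kappa> *\<^sub>R (nabla_vec A g p (Y p) (\<Phi> Z) - nabla_vec A g p (Z p) (\<Phi> Y) - \<Phi> (lie_bracket A Y Z) p + \<Psi> Z Y - \<Psi> Y Z)"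
    unfolding T[OF Y] T[OF Z] conn_vec_eq[of \<psi>, OF c] \<kappa>_def[symmetric] curv_op_curv[OF U Y Z X, symmetric] curv_op_def
    by (simp add: \<Phi>_def algebra_simps)
  finally have *: "g p (snd (connection_curv A (qk_connection A g Q n) Y Z (\<psi>, X)) p) v
    = g p (curv A g p (Y p) (Z p) (X p)) v + 1 / 4 * (al p (?B (X p) (Z p)) (Y p) v - al p (?B (X p) (Y p)) (Z p) v)
    - \<kappa> * g p (nabla_vec A g p (Y p) (\<Phi> Z) - nabla_vec A g p (Z p) (\<Phi> Y) - \<Phi> (lie_bracket A Y Z) p + \<Psi> Z Y - \<Psi> Y Z) v"
    by (simp only: k P.h_lin sharp_al[OF compatible_bilinear[OF qB_compatible]] real_scaleR_def)
  have BB: "?B W V = P.BB W V" for W V by (simp add: fun_eq_iff P.BB_qB)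
  have a: "al p (?B W V) a b = P.nu * P.chi (P.BB W V) a b + 1 / (real n + 1) * P.weyl.Wf (P.BB W V) a b" for W V a b
    unfolding BB al_def quat_weyl_form_eq nu_eq P.chi_qK ..
  show ?thesis unfolding * a \<kappa>_def[symmetric] P.curvature_vector quat_weyl_eq ..
qed

lemma al_zero: "al p (\<lambda>u v. 0) z v = 0"
proof -
  have b: "bilinear (\<lambda>u v :: 'e. 0 :: real)" by (auto simp: bilinear_def intro!: linearI)
  show ?thesis using al_linear[OF b b, of p 1 z v] by simp
qed

lemma flat_imp_weyl_zero:
  assumes flat: "flat_connection A (qk_sections A g Q) (qk_connection A g Q n)"
  shows "quat_weyl A g Q n p X Y Z = 0"
proof -
  let ?U = "fst (bc p)" and ?X = "coord_field A p X" and ?Y = "coord_field A p Y" and ?Z = "coord_field A p Z"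
  let ?o = "\<lambda>p u v. 0 :: real"
  have U: "open ?U" "p \<in> ?U" using open_chart[OF bc_in] bc_dom by blast+
  note s = smooth_coord_field
  have h: "smooth_form A ?U ?o" "\<And>q. q \<in> ?U \<Longrightarrow> (\<lambda>u v. 0) \<in> compatible (g q) (Q q)" "smooth_vec A ?U (\<lambda>p. 0)"
    using zero_section[OF U(1)] unfolding sections_iff by blast+
  have sz: "sharp (g q) (\<lambda>v. 0) = 0" for q by (rule sharp_eqI[OF inner_g]) (simp add: bilinear_lzero[OF bilinear_g])
  have al0: "al q (\<lambda>u v. 0) = (\<lambda>z v. 0)" for q by (simp add: fun_eq_iff al_zero)
  have nf: "nabla_form A g p w ?o = (\<lambda>u v. 0)" for w
    using nabla_form_leibniz[OF U(2) smooth_const[OF U(1)] h(1,1), of w 1] by (simp add: d_fun_const fun_eq_iff)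
  have nv: "nabla_vec A g p w (\<lambda>p. 0) = 0" for w
    using nabla_vec_leibniz[OF U smooth_const[OF U(1)] h(3,3), of w 1] by (simp add: d_fun_const)
  have "(?o, ?Z) \<in> qk_sections A g Q ?U" unfolding sections_iff using h(1,2) s by blast
  then have "snd (connection_curv A (qk_connection A g Q n) ?X ?Y (?o, ?Z)) p = 0"
    using flat U s unfolding flat_connection_def sec_eq_on_def sec_zero_def by (metis snd_conv)
  with conn_curv_vec[OF U h(1,2) s s s, of X Y Z]
  have "(real n + 2) / (real n + 1) * g p (quat_weyl A g Q n p X Y Z) v = 0" for v
    by (simp add: al0 sz nf nv bilinear_lzero[OF bilinear_g])
  moreover have "(real n + 2) / (real n + 1) \<noteq> 0" by (simp add: add_nonneg_eq_0_iff)
  ultimately show ?thesis by (intro g_ext[of p]) (simp add: bilinear_lzero[OF bilinear_g])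
qed

text \<open>Without the Weyl part, \<open>al\<close> is \<open>\<nu>\<close> times a combination of
  \<open>qK\<close> and the identity. The differential of \<open>\<nu>\<close> vanishes and
  \<open>qK\<close> is parallel, so the Leibniz rule has no term in which \<open>al\<close> itself
  is differentiated.\<close>

lemma nabla_al:
  assumes W0: "\<And>p X Y Z. quat_weyl A g Q n p X Y Z = 0" and U: "open U" "p \<in> U"
    and \<psi>: "smooth_form A U \<psi>" "\<And>q. q \<in> U \<Longrightarrow> bilinear (\<psi> q)" and Z: "smooth_vec A U Z"
  shows "nabla_vec A g p w (\<lambda>q. sharp (g q) (al q (\<psi> q) (Z q)))
    = sharp (g p) (al p (nabla_form A g p w \<psi>) (Z p)) + sharp (g p) (al p (\<psi> p) (nabla_vec A g p w Z))"
proof -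
  let ?b = "bc p" and ?\<Phi> = "\<lambda>q. sharp (g q) (al q (\<psi> q) (Z q))"
  obtain V J where J: "local_basis V J" "p \<in> V" "V \<subseteq> U" by (rule local_basis_exists[OF U])
  have V: "open V" using J(1) unfolding local_basis_def by blast
  interpret qk_chart "cdom ?b V" "G ?b" "\<lambda>i. erep A ?b (J i)" "qrep ?b" n by (rule qk_chart_local[OF bc_in J(1)])
  note x = cdomI[OF bc_dom J(2)]
  let ?x = "snd ?b p"
  define \<psi>c where "\<psi>c = frep A ?b \<psi>"
  define Zc where "Zc = vec_rep A ?b Z"
  define \<Phi>c where "\<Phi>c = vec_rep A ?b ?\<Phi>"
  define \<nu> where "\<nu> = fun_rep ?b nu"
  define H where "H y u v = 3 / 4 * qK (\<lambda>i. erep A ?b (J i) y) (\<psi>c y) u v + (- 5 / 4) * \<psi>c y u v" for y u v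
  have \<psi>b: "bilinear (\<psi> q)" if "q \<in> V" for q using \<psi>(2) J(3) that by blast
  have b\<psi>: "bil_field (cdom ?b V) \<psi>c"
    unfolding \<psi>c_def by (rule smooth_form_bil_field[OF smooth_subset(2)[OF \<psi>(1) J(3)] \<psi>b bc_in])
  have sZ: "Cinf_on (cdom ?b V) Zc" unfolding Zc_def by (rule smooth_vecD[OF smooth_subset(1)[OF Z J(3)] bc_in])
  have s\<Phi>: "Cinf_on (cdom ?b V) \<Phi>c"
    unfolding \<Phi>c_def by (rule smooth_vecD[OF smooth_subset(1)[OF smooth_al_vec[OF U(1) \<psi> Z] J(3)] bc_in])
  have s\<nu>: "Cinf_on (cdom ?b V) \<nu>" unfolding \<nu>_def by (rule smooth_nu[OF bc_in V])
  have bilH: "bil_field (cdom ?b V) H"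
    unfolding bil_field_def
  proof (intro conjI ballI allI)
    fix y assume "y \<in> cdom ?b V"
    then have b: "bilinear (\<psi>c y)" "bilinear (qK (\<lambda>i. erep A ?b (J i) y) (\<psi>c y))"
      using b\<psi> bil_qK[OF b\<psi>] unfolding bil_field_def by blast+
    show "bilinear (H y)"
      unfolding H_def bilinear_def by (auto intro!: linearI simp: g_lin[OF b(1)] g_lin[OF b(2)] field_simps)
  next
    have "Cinf_on (cdom ?b V) (\<lambda>y. \<psi>c y u v)" "Cinf_on (cdom ?b V) (\<lambda>y. qK (\<lambda>i. erep A ?b (J i) y) (\<psi>c y) u v)" for u v
      using b\<psi> bil_qK[OF b\<psi>] unfolding bil_field_def by blast+
    then show "Cinf_on (cdom ?b V) (\<lambda>y. H y u v)" for u v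
      unfolding H_def by (intro Cinf_intros open_S)
  qed
  have al0: "al q \<phi> z v = nu q * (3 / 4 * qK (ad q) \<phi> z v - 5 / 4 * \<phi> z v)" for q \<phi> z v
    by (simp add: al_def quat_weyl_form_def W0 bilinear_lzero[OF bilinear_g])
  have G\<Phi>: "G ?b y (\<Phi>c y) v = \<nu> y * H y (Zc y) v" if "y \<in> cdom ?b V" for y v
  proof -
    obtain q where q: "q \<in> fst ?b" "q \<in> V" "y = snd ?b q" using \<open>y \<in> cdom ?b V\<close> by (rule cdomE)
    have "G ?b y (\<Phi>c y) v = al q (\<psi> q) (Z q) (from_chart A ?b q v)"
      unfolding \<Phi>c_def q(3) vec_rep_at[OF bc_in q(1)] frep_at[OF bc_in q(1)] from_to[OF bc_in q(1)] by (rule sharp_al[OF \<psi>b[OF q(2)]])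
    also have "\<dots> = \<nu> y * H y (Zc y) v"
      unfolding al0 qK_chart[where \<psi> = \<psi>, OF J(1) q(2) bc_in q(1) \<psi>b[OF q(2)]] \<nu>_def H_def \<psi>c_def Zc_def q(3)
        vec_rep_at[OF bc_in q(1)] frep_at[OF bc_in q(1)] fun_rep_at[OF bc_in q(1)] to_from[OF bc_in q(1)] from_to[OF bc_in q(1)]
      by simp
    finally show ?thesis .
  qed
  have D\<nu>: "DD \<nu> ?x w = 0"
  proof (rule weyl_zero_DD_nu[OF x s\<nu>])
    fix y u v w z assume "y \<in> cdom ?b V"
    then obtain q where q: "q \<in> fst ?b" "q \<in> V" "y = snd ?b q" by (rule cdomE)
    interpret at: qk_at A g Q n q ..
    let ?F = "from_chart A ?b q"
    have "at.P.Wv (?F u) (?F v) (?F w) = 0" using W0[of q "?F u" "?F v" "?F w"] unfolding at.quat_weyl_eq .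
    then have R: "curv A g q (?F u) (?F v) (?F w) = (- (nu q / 4)) *\<^sub>R at.P.rz (?F u) (?F v) (?F w)"
      unfolding at.P.Wv_def at.nu_eq by (simp add: eq_neg_iff_add_eq_0)
    have "G ?b y (crv (G ?b) y u v w) z = g q (curv A g q (?F u) (?F v) (?F w)) (?F z)"
      using g_chart[OF bc_in q(1), of "curv A g q (?F u) (?F v) (?F w)" "?F z"]
      unfolding curv_chart[OF bc_in q(1)] to_from[OF bc_in q(1)] q(3) .
    also have "\<dots> = - (\<nu> y / 4) * qR (G ?b y) (\<lambda>i. erep A ?b (J i) y) u v w z"
      unfolding R at.P.h_lin at.P.rz_qR qR_chart[OF J(1) q(2) bc_in q(1)] to_from[OF bc_in q(1)] q(3) \<nu>_def fun_rep_at[OF bc_in q(1)] by simp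
    finally show "G ?b y (crv (G ?b) y u v w) z = - (\<nu> y / 4) * qR (G ?b y) (\<lambda>i. erep A ?b (J i) y) u v w z" .
  qed
  have main: "G ?b ?x (nab (G ?b) \<Phi>c ?x w) v
     = \<nu> ?x * (nabf (G ?b) H ?x w (Zc ?x) v + H ?x (nab (G ?b) Zc ?x w) v)" for v
  proof -
    have "DD (\<lambda>y. G ?b y (\<Phi>c y) v) ?x w = DD (\<lambda>y. \<nu> y * H y (Zc y) v) ?x w"
      by (rule fun_cong[OF frechet_derivative_cong_open[OF open_S x]]) (rule G\<Phi>)
    moreover have "(\<lambda>y. H y (Zc y) v) differentiable at ?x"
      by (rule Cinf_onD[OF bil_field_Cinf[OF open_S bilH sZ Cinf_on_const] x])
    ultimately show ?thesis
      using DD_G_fields[OF x s\<Phi> Cinf_on_const, of v w] DD_nabf[OF x bilH sZ Cinf_on_const, of v w]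
        DD_mult[OF Cinf_onD[OF s\<nu> x], of "\<lambda>y. H y (Zc y) v" w] D\<nu> G\<Phi>[OF x, of "nab (G ?b) (\<lambda>y. v) ?x w"]
      by (simp add: algebra_simps)
  qed
  have at: "Zc ?x = Z p" "\<psi>c ?x = \<psi> p" "\<nu> ?x = nu p"
    by (simp_all add: fun_eq_iff Zc_def \<psi>c_def \<nu>_def vec_rep_at frep_at fun_rep_at bc_in bc_dom)
  have qK: "qK (\<lambda>i. erep A ?b (J i) ?x) \<beta> u v = qK (ad p) \<beta> u v" if "bilinear \<beta>" for \<beta> u v
  proof -
    have "frep A ?b (\<lambda>_. \<beta>) ?x = \<beta>" by (simp add: fun_eq_iff frep_at bc_in bc_dom)
    then show ?thesis using qK_chart[where \<psi> = "\<lambda>_. \<beta>", OF J(1,2) bc_in bc_dom that, of u v] by simp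
  qed
  have N: "nabf (G ?b) \<psi>c ?x w = nabla_form A g p w \<psi>" by (simp add: fun_eq_iff nabla_form_base \<psi>c_def)
  have Nb: "bilinear (nabla_form A g p w \<psi>)" by (rule nabla_form_bilinear[OF U \<psi>])
  have e: "nabf (G ?b) H ?x w u v = 3 / 4 * qK (ad p) (nabla_form A g p w \<psi>) u v + (- 5 / 4) * nabla_form A g p w \<psi> u v" for u v
    unfolding H_def nabf_linear[OF x bil_qK[OF b\<psi>] b\<psi>] nabf_qK[OF x b\<psi>] N qK[OF Nb] ..
  have "g p (nabla_vec A g p w ?\<Phi>) v = al p (nabla_form A g p w \<psi>) (Z p) v + al p (\<psi> p) (nabla_vec A g p w Z) v" for v
    using main[of v] unfolding e H_def[of ?x] at qK[OF \<psi>b[OF J(2)]] G_base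
    unfolding \<Phi>c_def Zc_def nabla_vec_base[symmetric] al0[of p] by (simp add: distrib_left)
  then show ?thesis
    by (intro g_ext[of p]) (simp add: g_lin[OF bilinear_g] sharp_al[OF Nb] sharp_al[OF \<psi>b[OF J(2)]])
qed

text \<open>In the form component, \<open>curvature_action\<close> without its Weyl terms is what
  the \<open>BB\<close> terms cancel. In the vector component nothing is left because
  \<open>al\<close> is parallel by \<open>nabla_al\<close>.\<close>

lemma weyl_zero_imp_flat:
  assumes W0: "\<And>p X Y Z. quat_weyl A g Q n p X Y Z = 0"
  shows "flat_connection A (qk_sections A g Q) (qk_connection A g Q n)"
  unfolding flat_connection_def sec_eq_on_def
proof (intro allI ballI impI conjI)
  fix U Y Z s p
  assume s: "s \<in> qk_sections A g Q U" and U: "open U" "p \<in> U" and YZ: "smooth_vec A U Y" "smooth_vec A U Z"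
  obtain \<psi> X where e: "s = (\<psi>, X)" by (metis surj_pair)
  have h: "smooth_form A U \<psi>" "\<And>q. q \<in> U \<Longrightarrow> \<psi> q \<in> compatible (g q) (Q q)" "smooth_vec A U X"
    using s unfolding e sections_iff by blast+
  interpret qk_at A g Q n p ..
  have bil: "bilinear (\<psi> p)" by (rule compatible_bilinear[OF h(2)[OF U(2)]])
  have Wv: "P.Wv a b c = 0" for a b c using W0[of p a b c] unfolding quat_weyl_eq .
  obtain a b d where cp: "P.cpt a b d (\<psi> p)" using h(2)[OF U(2)] unfolding P.compatible_iff by blast
  have bchi: "bilinear (P.chi (\<psi> p))"
    unfolding bilinear_def P.chi_def by (auto intro!: linearI simp: g_lin[OF bil] P.qs algebra_simps add_divide_distrib)
  define S where "S x = sharp (g p) (P.chi (\<psi> p) x)" for x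
  have S: "g p (S x) v = P.chi (\<psi> p) x v" for x v unfolding S_def by (rule P.weyl.sharp_eq[OF bchi])
  have al: "sharp (g p) (al p (\<psi> p) z) = P.nu *\<^sub>R S z" for z
  proof (rule g_ext[of p])
    fix v
    have "al p (\<psi> p) z v = P.nu * P.chi (\<psi> p) z v"
      unfolding al_def P.chi_qK nu_eq quat_weyl_form_def by (simp add: W0 P.h_lin)
    then show "g p (sharp (g p) (al p (\<psi> p) z)) v = g p (P.nu *\<^sub>R S z) v" by (simp add: sharp_al[OF bil] P.h_lin S)
  qed
  have "fst (connection_curv A (qk_connection A g Q n) Y Z s) p u v = 0" for u v
  proof -
    have "fst (connection_curv A (qk_connection A g Q n) Y Z s) p u v
      = - \<psi> p (curv A g p (Y p) (Z p) u) v - \<psi> p u (curv A g p (Y p) (Z p) v)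
      + 1 / 4 * (P.BB (P.nu *\<^sub>R S (Z p)) (Y p) u v - P.BB (P.nu *\<^sub>R S (Y p)) (Z p) u v)"
      unfolding e al[symmetric] P.BB_qB by (rule conn_curv_form[OF U h YZ])
    then show ?thesis
      unfolding P.BB_lin P.curvature_action[OF cp S] Wv
      by (simp add: bilinear_lzero[OF bil] bilinear_rzero[OF bil] algebra_simps)
  qed
  then show "fst (connection_curv A (qk_connection A g Q n) Y Z s) p = fst sec_zero p"
    by (simp add: sec_zero_def fun_eq_iff)
  have br: "sharp (g p) (al p (\<psi> p) (lie_bracket A Y Z p))
     = sharp (g p) (al p (\<psi> p) (nabla_vec A g p (Y p) Z)) - sharp (g p) (al p (\<psi> p) (nabla_vec A g p (Z p) Y))"
    unfolding lie_bracket_nabla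
    using sharp_al_linear(2)[OF bil bil, of p "-1" "nabla_vec A g p (Z p) Y" "nabla_vec A g p (Y p) Z"] by simp
  have "g p (snd (connection_curv A (qk_connection A g Q n) Y Z s) p) v = 0" for v
  proof -
    have n: "nabla_vec A g p w (\<lambda>q. sharp (g q) (al q (\<psi> q) (V q)))
      = sharp (g p) (al p (nabla_form A g p w \<psi>) (V p)) + sharp (g p) (al p (\<psi> p) (nabla_vec A g p w V))"
      if "smooth_vec A U V" for V w
      by (rule nabla_al[OF W0 U h(1) compatible_bilinear[OF h(2)] that])
    show ?thesis
      using conn_curv_vec[OF U h YZ, of v] unfolding e W0 n[OF YZ(1)] n[OF YZ(2)] br by (simp add: P.h_lin)
  qed
  then show "snd (connection_curv A (qk_connection A g Q n) Y Z s) p = snd sec_zero p"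
    by (intro g_ext[of p]) (simp add: sec_zero_def P.h_lin)
qed

end

theorem theorem2:
  fixes A :: "('a::{t2_space,second_countable_topology}, 'e::euclidean_space) chart set"
    and g :: "'a \<Rightarrow> 'e \<Rightarrow> 'e \<Rightarrow> real"
    and Q :: "'a \<Rightarrow> ('e \<Rightarrow> 'e) set"
    and n :: nat
  assumes "quaternionic_kaehler A g Q n"
    and "connected (UNIV :: 'a set)"
  shows "prolongation A (qk_sections A g Q) (qk_connection A g Q n)
           (compatible_conformal_killing A g Q)
       \<and> (flat_connection A (qk_sections A g Q) (qk_connection A g Q n) \<longleftrightarrow>
           (\<forall>p X Y Z. quat_weyl A g Q n p X Y Z = 0))"
proof -
  interpret qk A g Q n
    using assms(1) by unfold_locales (auto simp: quaternionic_kaehler_def)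
  show ?thesis
    using prolongation_qk flat_imp_weyl_zero weyl_zero_imp_flat by blast
qed

end
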